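(* Let $3\le N\le 5$ and let $\{(v_{1,n},\dots,v_{N,n})^\tau\}_{n\in\mathbb{N}}\subset (W^{1,2}(\Omega))^N$ be a sequence such that, as $n\to+\infty$, $$I(v_{1,n},\dots,v_{N,n})\to a_0,\qquad \|I'(v_{1,n},\dots,v_{N,n})\|_*\to 0,$$ where $a_0$ is a constant and $\|\cdot\|_*$ denotes the norm of the dual space of $(W^{1,2}(\Omega))^N$. Then $(v_{1,n},\dots,v_{N,n})$ admits a strongly convergent subsequence in $(W^{1,2}(\Omega))^N$.
   Context: $\Omega$ is a doubly periodic domain in $\mathbb{R}^2$ (a flat 2-torus) of area $|\Omega|$, $W^{1,2}(\Omega)$ is the Sobolev space of doubly periodic functions, $(W^{1,2}(\Omega))^N$ carries the usual norm $\|\mathbf{w}\|^2=\sum_{i=1}^N\int_\Omega(w_i^2+|\nabla w_i|^2)dx$, and $\tau$ denotes transpose. $\lambda>0$ is a fixed parameter. For $i=1,\dots,N$, points $p_{i1},\dots,p_{in_i}\in\Omega$ (counted with multiplicity) are given, $n_i\in\mathbb{N}=\{1,2,\dots\}$. $K$ is the $N\times N$ Cartan matrix of $SU(N+1)$: $K_{ii}=2$, $K_{i,i\pm1}=-1$, all other entries $0$. $A=K^{-1}=(a_{ij})$. $r_j=\sum_{k=1}^N a_{jk}=\frac12 j(N+1-j)$, $R=\mathrm{diag}\{r_1,\dots,r_N\}$, $M=RKR$, $b_j=4\pi\sum_{k=1}^N a_{jk}n_k>0$, $\mathbf{b}=(b_1,\dots,b_N)^\tau$. $u_i^0$ is defined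 by $\Delta u_i^0=4\pi\sum_{s=1}^{n_i}\delta_{p_{is}}-\frac{4\pi n_i}{|\Omega|}$, $\int_\Omega u_i^0dx=0$ (so $e^{u_i^0}\in L^\infty(\Omega)$). For $\mathbf{v}=(v_1,\dots,v_N)^\tau\in(W^{1,2}(\Omega))^N$ put $\mathbf{U}=(e^{u_1^0+v_1},\dots,e^{u_N^0+v_N})^\tau$, $\mathbf{1}=(1,\dots,1)^\tau$, and $$I(\mathbf{v})=\frac12\sum_{i=1}^2\int_\Omega\partial_i\mathbf{v}^\tau A\,\partial_i\mathbf{v}\,dx+\frac\lambda2\int_\Omega(\mathbf{U}-\mathbf{1})^\tau M(\mathbf{U}-\mathbf{1})\,dx+\frac1{|\Omega|}\int_\Omega\mathbf{b}^\tau\mathbf{v}\,dx,$$ which is a $C^1$ functional on $(W^{1,2}(\Omega))^N$ with derivative $I'$. *)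

theory Defs
  imports "HOL-Analysis.Analysis"
begin

section \<open>The flat torus and its function spaces\<close>

text \<open>
  The torus is the plane modulo the lattice spanned by two linearly independent periods
  \<open>\<omega>1\<close>, \<open>\<omega>2\<close>. Functions on it are doubly periodic functions on the plane, and integrals
  are taken over a period cell. Elements of Lebesgue and Sobolev spaces are represented by
  functions rather than by classes modulo null sets, so the Sobolev norm below is
  a seminorm on representatives whose kernel consists of the functions vanishing almost everywhere.
\<close>

definition period_cell :: "real^2 \<Rightarrow> real^2 \<Rightarrow> (real^2) set" where
  "period_cell \<omega>1 \<omega>2 = {s *\<^sub>R \<omega>1 + t *\<^sub>R \<omega>2 | s t. 0 \<le> s \<and> s < 1 \<and> 0 \<le> t \<and> t < 1}"

definition cell_area :: "real^2 \<Rightarrow> real^2 \<Rightarrow> real" where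
  "cell_area \<omega>1 \<omega>2 = measure lebesgue (period_cell \<omega>1 \<omega>2)"

definition cell_integral :: "real^2 \<Rightarrow> real^2 \<Rightarrow> (real^2 \<Rightarrow> real) \<Rightarrow> real" where
  "cell_integral \<omega>1 \<omega>2 f = set_lebesgue_integral lebesgue (period_cell \<omega>1 \<omega>2) f"

definition doubly_periodic :: "real^2 \<Rightarrow> real^2 \<Rightarrow> (real^2 \<Rightarrow> real) \<Rightarrow> bool" where
  "doubly_periodic \<omega>1 \<omega>2 f \<longleftrightarrow> (\<forall>x. f (x + \<omega>1) = f x \<and> f (x + \<omega>2) = f x)"

definition partial_deriv :: "2 \<Rightarrow> (real^2 \<Rightarrow> real) \<Rightarrow> real^2 \<Rightarrow> real" where
  "partial_deriv k f x = frechet_derivative f (at x) (axis k 1)"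

primrec C_k :: "nat \<Rightarrow> (real^2 \<Rightarrow> real) \<Rightarrow> bool" where
  "C_k 0 f \<longleftrightarrow> continuous_on UNIV f"
| "C_k (Suc m) f \<longleftrightarrow> (\<forall>x. f differentiable (at x)) \<and> (\<forall>k. C_k m (partial_deriv k f))"

definition periodic_test_functions :: "real^2 \<Rightarrow> real^2 \<Rightarrow> (real^2 \<Rightarrow> real) set" where
  "periodic_test_functions \<omega>1 \<omega>2 = {\<phi>. doubly_periodic \<omega>1 \<omega>2 \<phi> \<and> (\<forall>m. C_k m \<phi>)}"

definition laplacian :: "(real^2 \<Rightarrow> real) \<Rightarrow> real^2 \<Rightarrow> real" where
  "laplacian f x = (\<Sum>k\<in>UNIV. partial_deriv k (partial_deriv k f) x)"

definition periodic_L1 :: "real^2 \<Rightarrow> real^2 \<Rightarrow> (real^2 \<Rightarrow> real) set" where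
  "periodic_L1 \<omega>1 \<omega>2 = {f. doubly_periodic \<omega>1 \<omega>2 f \<and> f \<in> borel_measurable lebesgue \<and>
     set_integrable lebesgue (period_cell \<omega>1 \<omega>2) f}"

definition periodic_L2 :: "real^2 \<Rightarrow> real^2 \<Rightarrow> (real^2 \<Rightarrow> real) set" where
  "periodic_L2 \<omega>1 \<omega>2 = {f. doubly_periodic \<omega>1 \<omega>2 f \<and> f \<in> borel_measurable lebesgue \<and>
     set_integrable lebesgue (period_cell \<omega>1 \<omega>2) (\<lambda>x. (f x)\<^sup>2)}"

definition is_weak_partial ::
  "real^2 \<Rightarrow> real^2 \<Rightarrow> 2 \<Rightarrow> (real^2 \<Rightarrow> real) \<Rightarrow> (real^2 \<Rightarrow> real) \<Rightarrow> bool" where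
  "is_weak_partial \<omega>1 \<omega>2 k f g \<longleftrightarrow> g \<in> periodic_L2 \<omega>1 \<omega>2 \<and>
     (\<forall>\<phi>\<in>periodic_test_functions \<omega>1 \<omega>2.
        cell_integral \<omega>1 \<omega>2 (\<lambda>x. f x * partial_deriv k \<phi> x) =
        - cell_integral \<omega>1 \<omega>2 (\<lambda>x. g x * \<phi> x))"

definition W12 :: "real^2 \<Rightarrow> real^2 \<Rightarrow> (real^2 \<Rightarrow> real) set" where
  "W12 \<omega>1 \<omega>2 = {f \<in> periodic_L2 \<omega>1 \<omega>2. \<forall>k. \<exists>g. is_weak_partial \<omega>1 \<omega>2 k f g}"

text \<open>The choice is only up to null sets, which does not affect any of the integrals below.\<close>

definition weak_partial :: "real^2 \<Rightarrow> real^2 \<Rightarrow> 2 \<Rightarrow> (real^2 \<Rightarrow> real) \<Rightarrow> real^2 \<Rightarrow> real" where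
  "weak_partial \<omega>1 \<omega>2 k f = (SOME g. is_weak_partial \<omega>1 \<omega>2 k f g)"

text \<open>
  Vectors and matrices of size \<open>N\<close> are functions on \<open>nat\<close> whose relevant indices are
  \<open>1, \<dots>, N\<close>; components with other indices are ignored.
\<close>

definition W12_vec :: "real^2 \<Rightarrow> real^2 \<Rightarrow> nat \<Rightarrow> (nat \<Rightarrow> real^2 \<Rightarrow> real) set" where
  "W12_vec \<omega>1 \<omega>2 N = {w. \<forall>i\<in>{1..N}. w i \<in> W12 \<omega>1 \<omega>2}"

definition W12_norm :: "real^2 \<Rightarrow> real^2 \<Rightarrow> nat \<Rightarrow> (nat \<Rightarrow> real^2 \<Rightarrow> real) \<Rightarrow> real" where
  "W12_norm \<omega>1 \<omega>2 N w = sqrt (\<Sum>i=1..N. cell_integral \<omega>1 \<omega>2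
     (\<lambda>x. (w i x)\<^sup>2 + (\<Sum>k\<in>UNIV. (weak_partial \<omega>1 \<omega>2 k (w i) x)\<^sup>2)))"


section \<open>Dual space and Frechet derivative\<close>

definition W12_dual ::
  "real^2 \<Rightarrow> real^2 \<Rightarrow> nat \<Rightarrow> ((nat \<Rightarrow> real^2 \<Rightarrow> real) \<Rightarrow> real) set" where
  "W12_dual \<omega>1 \<omega>2 N = {L.
     (\<forall>v\<in>W12_vec \<omega>1 \<omega>2 N. \<forall>w\<in>W12_vec \<omega>1 \<omega>2 N. L (\<lambda>i x. v i x + w i x) = L v + L w) \<and>
     (\<forall>c. \<forall>w\<in>W12_vec \<omega>1 \<omega>2 N. L (\<lambda>i x. c * w i x) = c * L w) \<and>
     (\<exists>C. \<forall>w\<in>W12_vec \<omega>1 \<omega>2 N. \<bar>L w\<bar> \<le> C * W12_norm \<omega>1 \<omega>2 N w)}"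

definition dual_norm ::
  "real^2 \<Rightarrow> real^2 \<Rightarrow> nat \<Rightarrow> ((nat \<Rightarrow> real^2 \<Rightarrow> real) \<Rightarrow> real) \<Rightarrow> real" where
  "dual_norm \<omega>1 \<omega>2 N L =
     Sup {\<bar>L w\<bar> | w. w \<in> W12_vec \<omega>1 \<omega>2 N \<and> W12_norm \<omega>1 \<omega>2 N w \<le> 1}"

definition has_W12_derivative ::
  "real^2 \<Rightarrow> real^2 \<Rightarrow> nat \<Rightarrow> ((nat \<Rightarrow> real^2 \<Rightarrow> real) \<Rightarrow> real) \<Rightarrow>
   ((nat \<Rightarrow> real^2 \<Rightarrow> real) \<Rightarrow> real) \<Rightarrow> (nat \<Rightarrow> real^2 \<Rightarrow> real) \<Rightarrow> bool" where
  "has_W12_derivative \<omega>1 \<omega>2 N F L v \<longleftrightarrow> L \<in> W12_dual \<omega>1 \<omega>2 N \<and>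
     (\<forall>\<epsilon>>0. \<exists>\<delta>>0. \<forall>h\<in>W12_vec \<omega>1 \<omega>2 N. W12_norm \<omega>1 \<omega>2 N h < \<delta> \<longrightarrow>
        \<bar>F (\<lambda>i x. v i x + h i x) - F v - L h\<bar> \<le> \<epsilon> * W12_norm \<omega>1 \<omega>2 N h)"

definition W12_derivative ::
  "real^2 \<Rightarrow> real^2 \<Rightarrow> nat \<Rightarrow> ((nat \<Rightarrow> real^2 \<Rightarrow> real) \<Rightarrow> real) \<Rightarrow>
   (nat \<Rightarrow> real^2 \<Rightarrow> real) \<Rightarrow> (nat \<Rightarrow> real^2 \<Rightarrow> real) \<Rightarrow> real" where
  "W12_derivative \<omega>1 \<omega>2 N F v = (SOME L. has_W12_derivative \<omega>1 \<omega>2 N F L v)"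


section \<open>The matrices\<close>

definition cartan :: "nat \<Rightarrow> nat \<Rightarrow> real" where
  "cartan i j = (if i = j then 2 else if i = Suc j \<or> j = Suc i then - 1 else 0)"

definition mat_mult ::
  "nat \<Rightarrow> (nat \<Rightarrow> nat \<Rightarrow> real) \<Rightarrow> (nat \<Rightarrow> nat \<Rightarrow> real) \<Rightarrow> nat \<Rightarrow> nat \<Rightarrow> real" where
  "mat_mult N A B i j = (\<Sum>k=1..N. A i k * B k j)"

definition diag :: "(nat \<Rightarrow> real) \<Rightarrow> nat \<Rightarrow> nat \<Rightarrow> real" where
  "diag d i j = (if i = j then d i else 0)"

text \<open>The entries outside the index range are set to zero to make the inverse unique.\<close>

definition mat_inverse :: "nat \<Rightarrow> (nat \<Rightarrow> nat \<Rightarrow> real) \<Rightarrow> nat \<Rightarrow> nat \<Rightarrow> real" where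
  "mat_inverse N A = (THE B.
     (\<forall>i\<in>{1..N}. \<forall>j\<in>{1..N}. mat_mult N A B i j = diag (\<lambda>_. 1) i j \<and>
                              mat_mult N B A i j = diag (\<lambda>_. 1) i j) \<and>
     (\<forall>i j. i \<notin> {1..N} \<or> j \<notin> {1..N} \<longrightarrow> B i j = 0))"

definition A_mat :: "nat \<Rightarrow> nat \<Rightarrow> nat \<Rightarrow> real" where
  "A_mat N = mat_inverse N cartan"

definition r_vec :: "nat \<Rightarrow> nat \<Rightarrow> real" where
  "r_vec N j = (\<Sum>k=1..N. A_mat N j k)"

definition M_mat :: "nat \<Rightarrow> nat \<Rightarrow> nat \<Rightarrow> real" where
  "M_mat N = mat_mult N (mat_mult N (diag (r_vec N)) cartan) (diag (r_vec N))"

definition b_vec :: "nat \<Rightarrow> (nat \<Rightarrow> nat) \<Rightarrow> nat \<Rightarrow> real" where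
  "b_vec N n j = 4 * pi * (\<Sum>k=1..N. A_mat N j k * real (n k))"


section \<open>The background functions and the functional\<close>

text \<open>
  The equation \<open>\<Delta>u = 4\<pi> \<Sum>\<^sub>s \<delta>(q s) - 4\<pi>m / |\<Omega>|\<close> is understood in the sense of
  distributions on the torus. Points may be repeated, according to their multiplicities.
\<close>

definition is_background ::
  "real^2 \<Rightarrow> real^2 \<Rightarrow> nat \<Rightarrow> (nat \<Rightarrow> real^2) \<Rightarrow> (real^2 \<Rightarrow> real) \<Rightarrow> bool" where
  "is_background \<omega>1 \<omega>2 m q u \<longleftrightarrow> u \<in> periodic_L1 \<omega>1 \<omega>2 \<and> cell_integral \<omega>1 \<omega>2 u = 0 \<and>
     (\<forall>\<phi>\<in>periodic_test_functions \<omega>1 \<omega>2.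
        cell_integral \<omega>1 \<omega>2 (\<lambda>x. u x * laplacian \<phi> x) =
        4 * pi * (\<Sum>s=1..m. \<phi> (q s)) -
        4 * pi * real m / cell_area \<omega>1 \<omega>2 * cell_integral \<omega>1 \<omega>2 \<phi>)"

definition energy ::
  "real^2 \<Rightarrow> real^2 \<Rightarrow> nat \<Rightarrow> real \<Rightarrow> (nat \<Rightarrow> nat) \<Rightarrow> (nat \<Rightarrow> real^2 \<Rightarrow> real) \<Rightarrow>
   (nat \<Rightarrow> real^2 \<Rightarrow> real) \<Rightarrow> real" where
  "energy \<omega>1 \<omega>2 N l n u0 v =
     1 / 2 * (\<Sum>k\<in>UNIV. cell_integral \<omega>1 \<omega>2 (\<lambda>x. \<Sum>i=1..N. \<Sum>j=1..N.
        weak_partial \<omega>1 \<omega>2 k (v i) x * A_mat N i j * weak_partial \<omega>1 \<omega>2 k (v j) x)) +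
     l / 2 * cell_integral \<omega>1 \<omega>2 (\<lambda>x. \<Sum>i=1..N. \<Sum>j=1..N.
        (exp (u0 i x + v i x) - 1) * M_mat N i j * (exp (u0 j x + v j x) - 1)) +
     1 / cell_area \<omega>1 \<omega>2 * cell_integral \<omega>1 \<omega>2 (\<lambda>x. \<Sum>i=1..N. b_vec N n i * v i x)"

end

theory Submission
 imports Defs "HOL-Library.Diagonal_Subsequence"
begin

text \<open>
Put \<open>z\<^sub>j = r\<^sub>j U\<^sub>j\<close>. Since \<open>K r = 1\<close>, the derivative of the functional at \<open>v\<close> is
\<open>\<psi> \<mapsto> \<integral> \<partial>v\<cdot>A \<partial>\<psi> + l \<integral> \<Sum>\<^sub>j z\<^sub>j ((K z)\<^sub>j - 1) \<psi>\<^sub>j + mean (b\<cdot>\<psi>)\<close>; that it is one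
(\<open>energy_has_derivative\<close>) rests on exponential integrability in two dimensions.

Let \<open>v\<close> be almost critical with bounded energy. As \<open>K\<close> is positive definite, the test function
\<open>\<psi> = 1\<close> bounds \<open>\<integral>|z|\<^sup>2\<close>, hence \<open>\<integral>v\<^sub>j\<^sup>+\<close>. The energy then ties the Dirichlet energy \<open>D\<close> to
\<open>-\<integral>b\<cdot>v\<close>, so that the norm of \<open>v\<close> is at most \<open>C (1 + D)\<close>. The test function \<open>\<psi> = v\<close> would bound
\<open>D\<close> if \<open>\<integral>|z|\<^sup>2 v\<^sup>+\<close> were a small multiple of \<open>D\<close>, up to a constant. The exponential bound for
\<open>v - mean v\<close> gives this as soon as \<open>|z|\<^sup>2\<close> has little mass where \<open>v\<close> is large.

This uniform integrability is the heart of the proof. Let \<open>t\<close> run through the finitely many points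
of a fine lattice with \<open>t \<ge> 0\<close> and \<open>K t \<le> 1\<close>, give \<open>t\<close> the softmax weight \<open>p\<^sub>t\<close> of \<open>4 q t\<cdot>v - L\<close>, and
test with \<open>\<psi> = \<Sum>\<^sub>t p\<^sub>t K t\<close>. Because of \<open>A K = 1\<close> the Dirichlet term is a variance, thus nonnegative,
and it even controls the gradient of \<open>\<psi>\<close>. If \<open>(K t)\<^sub>j\<close> is close to 1 for all \<open>j\<close>, the potential term
is almost \<open>p\<^sub>t z\<cdot>K z\<close>; otherwise \<open>t\<close> can be increased in direction \<open>j\<close>, which forces
\<open>p\<^sub>t e\<^bsup>4 v\<^sub>j\<^esup> \<le> 1\<close>, so the bad \<open>z\<^sub>j\<close> are harmless. The weights add up to at least 1/2 where some
\<open>4 v\<^sub>j \<ge> L\<close> and are small in the mean for large \<open>L\<close>.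

A bounded almost critical sequence has a subsequence that converges in \<open>L\<^sup>2\<close> (Rellich). The difference
of two derivatives, tested with the difference of two members, then shows that it is Cauchy.

The analysis on the torus is developed from convolution with trigonometric kernels. Exponential
integrability, and the fact that the background functions are bounded above, both come from one
estimate for level sets, a consequence of the embedding of \<open>W\<^sup>1\<^sup>,\<^sup>1\<close> into \<open>L\<^sup>2\<close>.
\<close>

lemmas sum_integrable = Bochner_Integration.integrable_sum and sum_integral = Bochner_Integration.integral_sum
 and add_integrable = Bochner_Integration.integrable_add and add_integral = Bochner_Integration.integral_add
 and diff_integrable = Bochner_Integration.integrable_diff and diff_integral = Bochner_Integration.integral_diff
 and bound_integrable = Bochner_Integration.integrable_bound and cong_integral = Bochner_Integration.integral_cong

notation (input) LIMSEQ (infixr "---->" 60)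

abbreviation BMeas :: "('a::topological_space => 'b::topological_space) set" where "BMeas \<equiv> borel_measurable borel"
abbreviation LMeas :: "('a::euclidean_space => 'b::topological_space) set" where "LMeas \<equiv> borel_measurable lebesgue"

abbreviation pd :: "2 => (real^2 => real) => real^2 => real" where "pd \<equiv> partial_deriv"

section \<open>The torus as a measure space\<close>

lemma lebesgue_translation:
 fixes f :: "'a::euclidean_space => 'b::topological_space"
 assumes "f : LMeas"
 shows "(%x. f (x + h)) : LMeas"
proof -
 have m: "(%x. h + x) : lebesgue \<rightarrow>\<^sub>M lebesgue"
	using lebesgue_affine_measurable[of "%_. 1" h] by (simp add: euclidean_representation)
 show ?thesis using measurable_comp[OF m assms] by (simp add: comp_def add.commute)
qed

lemma nn_integral_lebesgue_translation:
 fixes f :: "'a::euclidean_space => ennreal"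
 assumes "f : LMeas"
 shows "(\<integral>\<^sup>+x. f (x + h) \<partial>lebesgue) = (\<integral>\<^sup>+x. f x \<partial>lebesgue)"
proof -
 have m: "(%x. h + x) : lebesgue \<rightarrow>\<^sub>M lebesgue"
	using lebesgue_affine_measurable[of "%_. 1" h] by (simp add: euclidean_representation)
 have d: "distr lebesgue lebesgue (%x. h + x) = lebesgue"
	using lebesgue_affine_euclidean[of "%_. 1" h] by (simp add: euclidean_representation density_1)
 have "(\<integral>\<^sup>+x. f x \<partial>lebesgue) = (\<integral>\<^sup>+x. f x \<partial>distr lebesgue lebesgue (%x. h + x))"
	by (simp only: d)
 also have "... = (\<integral>\<^sup>+x. f (h + x) \<partial>lebesgue)"
	using assms m by (subst nn_integral_distr) auto
 finally show ?thesis by (simp add: add.commute)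
qed

text \<open>Both sides sum the function over the lattice translates of \<open>S\<close>, in a different order.\<close>

lemma fundamental_domain_translation:
 fixes f :: "'a::euclidean_space => ennreal" and L :: "int \<times> int => 'a"
 assumes f [measurable]: "f : LMeas" and S [measurable]: "S : sets lebesgue"
	and per: "!!x g. f (x + L g) = f x" and neg: "!!g. L (- g) = - L g"
	and part: "!!x. EX! g. x + L g : S"
 shows "(\<integral>\<^sup>+x. f (x + h) * indicator S x \<partial>lebesgue) = (\<integral>\<^sup>+x. f x * indicator S x \<partial>lebesgue)"
proof -
 have S1: "(%x. indicator S x :: ennreal) : LMeas" by measurable
 have [measurable]: "(%x. indicator S (x + h) :: ennreal) : LMeas"
	"(%x. indicator S (x - h) :: ennreal) : LMeas" for h
	using lebesgue_translation[OF S1, of h] lebesgue_translation[OF S1, of "- h"] by simp_all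
 have one: "(\<integral>\<^sup>+g. indicator S (x + L g) \<partial>count_space UNIV) = (1::ennreal)"
	"(\<integral>\<^sup>+g. indicator S (x - L g) \<partial>count_space UNIV) = (1::ennreal)" for x
 proof -
	obtain g0 where g0: "x + L g0 : S" "!!g. x + L g : S ==> g = g0"
	 using part[of x] by blast
	have "indicator S (x + L g) = (indicator {g0} g :: ennreal)" for g
	proof (cases "g = g0")
	 case False
	 hence "x + L g ~: S" using g0(2)[of g] by blast
	 thus ?thesis using False by simp
	qed (simp add: g0(1))
	thus "(\<integral>\<^sup>+g. indicator S (x + L g) \<partial>count_space UNIV) = (1::ennreal)"
	 by (simp add: one_ennreal_def[symmetric])
	have "indicator S (x - L g) = (indicator {- g0} g :: ennreal)" for g
	proof (cases "g = - g0")
	 case False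
	 hence "- g ~= g0" by auto
	 hence "x - L g ~: S" using g0(2)[of "- g"] by (auto simp: neg)
	 thus ?thesis using False by simp
	qed (simp add: g0(1) neg)
	thus "(\<integral>\<^sup>+g. indicator S (x - L g) \<partial>count_space UNIV) = (1::ennreal)"
	 by (simp add: one_ennreal_def[symmetric])
 qed
 have "(\<integral>\<^sup>+x. f (x + h) * indicator S x \<partial>lebesgue) = (\<integral>\<^sup>+x. f (x + h) * indicator S (x + h - h) \<partial>lebesgue)"
	by simp
 also have "... = (\<integral>\<^sup>+x. f x * indicator S (x - h) \<partial>lebesgue)"
	by (rule nn_integral_lebesgue_translation) measurable
 also have "... = (\<integral>\<^sup>+x. (\<integral>\<^sup>+g. f x * indicator S (x - h) * indicator S (x + L g) \<partial>count_space UNIV) \<partial>lebesgue)"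
	by (subst nn_integral_cmult) (simp_all add: one)
 also have "... = (\<integral>\<^sup>+g. (\<integral>\<^sup>+x. f x * indicator S (x - h) * indicator S (x + L g) \<partial>lebesgue) \<partial>count_space UNIV)"
	by (rule nn_integral_count_space_nn_integral) (simp, measurable)
 also have "... = (\<integral>\<^sup>+g. (\<integral>\<^sup>+x. f x * indicator S (x - h - L g) * indicator S x \<partial>lebesgue) \<partial>count_space UNIV)"
 proof (rule nn_integral_cong)
	fix g
	have "x + L g - h - L g = x - h" for x by simp
	hence "(\<integral>\<^sup>+x. f x * indicator S (x - h) * indicator S (x + L g) \<partial>lebesgue) =
	 (\<integral>\<^sup>+x. f (x + L g) * indicator S (x + L g - h - L g) * indicator S (x + L g) \<partial>lebesgue)"
	 by (simp add: per)
	also have "... = (\<integral>\<^sup>+x. f x * indicator S (x - h - L g) * indicator S x \<partial>lebesgue)"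
	 unfolding diff_diff_eq
	 by (rule nn_integral_lebesgue_translation) measurable
	finally show "(\<integral>\<^sup>+x. f x * indicator S (x - h) * indicator S (x + L g) \<partial>lebesgue) =
	 (\<integral>\<^sup>+x. f x * indicator S (x - h - L g) * indicator S x \<partial>lebesgue)" .
 qed
 also have "... = (\<integral>\<^sup>+x. (\<integral>\<^sup>+g. f x * indicator S (x - h - L g) * indicator S x \<partial>count_space UNIV) \<partial>lebesgue)"
	unfolding diff_diff_eq
	by (rule nn_integral_count_space_nn_integral[symmetric]) (simp, measurable)
 also have "... = (\<integral>\<^sup>+x. f x * indicator S x \<partial>lebesgue)"
	by (intro nn_integral_cong)
	 (simp add: nn_integral_cmult nn_integral_multc one mult.assoc)
 finally show ?thesis .
qed

locale flat_torus =
 fixes per1 per2 :: "real^2"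
 assumes distinct_periods: "per1 ~= per2" and independent_periods: "independent {per1, per2}"
begin

definition period_det :: real where
 "period_det = per1$1 * per2$2 - per1$2 * per2$1"

definition coord1 :: "real^2 => real" where
 "coord1 x = (x$1 * per2$2 - x$2 * per2$1) / period_det"

definition coord2 :: "real^2 => real" where
 "coord2 x = (per1$1 * x$2 - per1$2 * x$1) / period_det"

lemma period_det_nonzero: "period_det ~= 0"
proof
 assume D: "period_det = 0"
 have eq1: "per2$2 *\<^sub>R per1 + (- per1$2) *\<^sub>R per2 = 0" and eq2: "per2$1 *\<^sub>R per1 + (- per1$1) *\<^sub>R per2 = 0"
	using D by (auto simp: vec_eq_iff forall_2 period_det_def algebra_simps)
 have "per1 ~: span {per2}" and "per2 ~= 0"
	using independent_periods distinct_periods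
	by (auto simp: independent_insert dependent_single)
 have indep: "a = 0 & b = 0" if ab: "a *\<^sub>R per1 + b *\<^sub>R per2 = 0" for a b
 proof (cases "a = 0")
	case True
	thus ?thesis using ab \<open>per2 ~= 0\<close> by simp
 next
	case False
	have "a *\<^sub>R per1 = (- b) *\<^sub>R per2" using ab by (simp add: eq_neg_iff_add_eq_0)
	hence "(1/a) *\<^sub>R (a *\<^sub>R per1) = (1/a) *\<^sub>R ((- b) *\<^sub>R per2)" by (rule arg_cong)
	hence "per1 = (- b / a) *\<^sub>R per2" using False by simp
	hence "per1 : span {per2}" by (metis span_base span_scale singletonI)
	thus ?thesis using \<open>per1 ~: span {per2}\<close> by simp
 qed
 have "per1 = 0" using indep[OF eq1] indep[OF eq2] by (simp add: vec_eq_iff forall_2)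
 hence "dependent {per1, per2}" using dependent_zero[of "{per1,per2}"] by auto
 thus False using independent_periods by simp
qed

lemma coord_expansion: "x = coord1 x *\<^sub>R per1 + coord2 x *\<^sub>R per2"
proof -
 have D: "x$1 * period_det = (x$1 * per2$2 - x$2 * per2$1) * per1$1 + (per1$1 * x$2 - per1$2 * x$1) * per2$1"
	"x$2 * period_det = (x$1 * per2$2 - x$2 * per2$1) * per1$2 + (per1$1 * x$2 - per1$2 * x$1) * per2$2"
	by (simp_all add: period_det_def algebra_simps)
 have "x$1 = coord1 x * per1$1 + coord2 x * per2$1" "x$2 = coord1 x * per1$2 + coord2 x * per2$2"
	using D period_det_nonzero
	by (simp_all add: coord1_def coord2_def eq_divide_eq add_divide_distrib[symmetric])
 thus ?thesis by (simp add: vec_eq_iff forall_2)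
qed

lemma bounded_linear_coord1: "bounded_linear coord1"
 unfolding coord1_def[abs_def]
 by (intro bounded_linear_divide[THEN bounded_linear_compose] bounded_linear_sub
	bounded_linear_mult_left[THEN bounded_linear_compose] bounded_linear_vec_nth)

lemma bounded_linear_coord2: "bounded_linear coord2"
 unfolding coord2_def[abs_def]
 by (intro bounded_linear_divide[THEN bounded_linear_compose] bounded_linear_sub
	bounded_linear_mult_right[THEN bounded_linear_compose] bounded_linear_vec_nth)

lemma coord_periods [simp]:
 "coord1 per1 = 1" "coord1 per2 = 0" "coord2 per1 = 0" "coord2 per2 = 1"
 using period_det_nonzero by (auto simp: coord1_def coord2_def period_det_def)

lemma coord_linear:
 "coord1 (x + y) = coord1 x + coord1 y" "coord2 (x + y) = coord2 x + coord2 y"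
 "coord1 (x - y) = coord1 x - coord1 y" "coord2 (x - y) = coord2 x - coord2 y"
 "coord1 (c *\<^sub>R x) = c * coord1 x" "coord2 (c *\<^sub>R x) = c * coord2 x"
 "coord1 (- x) = - coord1 x" "coord2 (- x) = - coord2 x"
 "coord1 0 = 0" "coord2 0 = 0"
 by (simp_all add: coord1_def coord2_def algebra_simps diff_divide_distrib add_divide_distrib)

lemma continuous_coord [continuous_intros]:
 "continuous_on S coord1" "continuous_on S coord2"
 using linear_continuous_on bounded_linear_coord1 bounded_linear_coord2 by blast+

lemma coord_eqI: "coord1 x = coord1 y ==> coord2 x = coord2 y ==> x = y"
 using coord_expansion by metis

abbreviation Q :: "(real^2) set" where "Q \<equiv> period_cell per1 per2"

lemma cell_iff: "x : Q \<longleftrightarrow> 0 <= coord1 x & coord1 x < 1 & 0 <= coord2 x & coord2 x < 1"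
proof
 assume "x : Q"
 thus "0 <= coord1 x & coord1 x < 1 & 0 <= coord2 x & coord2 x < 1"
	by (auto simp: period_cell_def coord_linear)
next
 assume "0 <= coord1 x & coord1 x < 1 & 0 <= coord2 x & coord2 x < 1"
 thus "x : Q" unfolding period_cell_def using coord_expansion[of x] by blast
qed

lemma measurable_coord [measurable]: "coord1 : BMeas" "coord2 : BMeas"
 by (auto intro!: borel_measurable_continuous_onI continuous_intros)

lemma cell_borel [measurable]: "Q : sets borel"
proof -
 have "Q = {x : space borel. 0 <= coord1 x & coord1 x < 1 & 0 <= coord2 x & coord2 x < 1}"
	by (auto simp: cell_iff)
 also have "... : sets borel" by measurable
 finally show ?thesis .
qed

lemma cell_lebesgue [measurable]: "Q : sets lebesgue"
 using cell_borel by simp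

lemma norm_cell: "x : Q ==> norm x <= norm per1 + norm per2"
proof -
 assume x: "x : Q"
 have "norm x <= norm (coord1 x *\<^sub>R per1) + norm (coord2 x *\<^sub>R per2)"
	by (subst coord_expansion[of x]) (rule norm_triangle_ineq)
 also have "... <= 1 * norm per1 + 1 * norm per2"
	using x unfolding cell_iff norm_scaleR by (intro add_mono mult_right_mono) auto
 finally show ?thesis by simp
qed

lemma bounded_cell: "bounded Q"
 using norm_cell by (auto simp: bounded_iff)

definition M :: "(real^2) measure" where "M = restrict_space lebesgue Q"

abbreviation torus_integral :: "(real^2 => real) => real" (binder "\<oint>" 10) where
 "torus_integral f \<equiv> integral\<^sup>L M f"

abbreviation torus_nn_integral :: "(real^2 => ennreal) => ennreal" (binder "\<oint>+" 10) where
 "torus_nn_integral f \<equiv> integral\<^sup>N M f"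

abbreviation Integ :: "(real^2 => real) => bool" where "Integ \<equiv> Bochner_Integration.integrable M"
abbreviation Meas :: "(real^2 => 'b::topological_space) set" where "Meas \<equiv> borel_measurable M"
abbreviation L2 :: "(real^2 => real) set" where "L2 \<equiv> periodic_L2 per1 per2"
abbreviation Test :: "(real^2 => real) set" where "Test \<equiv> periodic_test_functions per1 per2"
abbreviation wkp :: "2 => (real^2 => real) => (real^2 => real) => bool" where "wkp \<equiv> is_weak_partial per1 per2"

lemma space_M [simp]: "space M = Q" by (simp add: M_def space_restrict_space)

lemma nn_integral_M: "(\<oint>+x. f x) = (\<integral>\<^sup>+x. f x * indicator Q x \<partial>lebesgue)"
 unfolding M_def by (rule nn_integral_restrict_space) simp

lemma cell_integral_M: "cell_integral per1 per2 f = integral\<^sup>L M f"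
 unfolding cell_integral_def M_def set_lebesgue_integral_def
 by (subst integral_restrict_space) auto

lemma set_integrable_M:
 fixes f :: "real^2 => real"
 shows "set_integrable lebesgue Q f \<longleftrightarrow> Integ f"
 unfolding M_def by (simp add: integrable_restrict_space set_integrable_def)

lemma emeasure_M: "A \<subseteq> Q ==> emeasure M A = emeasure lebesgue A"
 unfolding M_def by (rule emeasure_restrict_space) auto

lemma finite_measure_M: "finite_measure M"
proof
 have "emeasure lebesgue Q < \<infinity>"
	using emeasure_bounded_finite[OF bounded_cell] by simp
 thus "emeasure M (space M) ~= \<infinity>" by (simp add: emeasure_M)
qed

sublocale M: finite_measure M by (rule finite_measure_M)

lemma measurable_lebesgue_M: "f : measurable lebesgue N ==> f : measurable M N"
 unfolding M_def by (rule measurable_restrict_space1)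

lemma measurable_borel_M: "f : measurable borel N ==> f : measurable M N"
 by (intro measurable_lebesgue_M measurable_completion) simp

lemma AE_M: "(AE x in M. P x) \<longleftrightarrow> (AE x in lebesgue. x : Q --> P x)"
 unfolding M_def by (rule AE_restrict_space_iff) simp

definition area :: real where "area = measure M (space M)"

lemma cell_area_eq: "cell_area per1 per2 = area"
 by (simp add: cell_area_def area_def measure_def emeasure_M)

lemma open_subcell:
 assumes "0 <= a" "a < b" "b <= 1"
 defines "W \<equiv> {x. a < coord1 x & coord1 x < b & a < coord2 x & coord2 x < b}"
 shows "W \<subseteq> Q" "open W" "measure M W > 0"
proof -
 show sub: "W \<subseteq> Q" using assms by (auto simp: cell_iff)
 show op: "open W" unfolding W_def
	by (intro open_Collect_conj open_Collect_less continuous_intros)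
 define c where "c = (a + b)/2"
 have "c *\<^sub>R per1 + c *\<^sub>R per2 : W" using assms by (auto simp: W_def coord_linear c_def)
 hence ne: "W ~= {}" by auto
 have "emeasure lebesgue W ~= 0"
	using open_not_negligible[OF op ne] negligible_iff_emeasure0[of W] op by auto
 hence "emeasure M W ~= 0" using emeasure_M[OF sub] by simp
 thus "measure M W > 0" using M.emeasure_eq_measure[of W]
	by (metis ennreal_0 less_eq_real_def measure_nonneg)
qed

lemma area_pos: "area > 0"
proof -
 have "measure M {x. 0 < coord1 x & coord1 x < 1 & 0 < coord2 x & coord2 x < 1} <= area"
	unfolding area_def by (rule M.bounded_measure)
 thus ?thesis using open_subcell(3)[of 0 1] by simp
qed

definition lat :: "int \<times> int => real^2" where
 "lat g = of_int (fst g) *\<^sub>R per1 + of_int (snd g) *\<^sub>R per2"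

definition periodic :: "(real^2 => 'a) => bool" where
 "periodic f \<longleftrightarrow> (ALL x g. f (x + lat g) = f x)"

lemma doubly_periodic_iff: "doubly_periodic per1 per2 f \<longleftrightarrow> periodic f"
proof
 assume p: "periodic f"
 have "f (x + per1) = f x & f (x + per2) = f x" for x
	using p[unfolded periodic_def, rule_format, of x "(1,0)"]
	 p[unfolded periodic_def, rule_format, of x "(0,1)"]
	by (simp add: lat_def)
 thus "doubly_periodic per1 per2 f" by (simp add: doubly_periodic_def)
next
 assume d: "doubly_periodic per1 per2 f"
 have mult: "f (x + of_int k *\<^sub>R w) = f x" if w: "!!y. f (y + w) = f y" for k x w
 proof -
	have nat: "f (y + of_nat m *\<^sub>R w) = f y" for m y
	proof (induction m)
	 case (Suc m)
	 have "y + of_nat (Suc m) *\<^sub>R w = (y + of_nat m *\<^sub>R w) + w"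
		by (simp add: algebra_simps)
	 thus ?case using Suc w[of "y + of_nat m *\<^sub>R w"] by metis
	qed simp
	show ?thesis
	proof (cases "k >= 0")
	 case True
	 thus ?thesis using nat[of x "nat k"] by simp
	next
	 case False
	 hence eq: "x + of_int k *\<^sub>R w + of_nat (nat (-k)) *\<^sub>R w = x"
		by (simp add: scaleR_minus_left)
	 show ?thesis using nat[of "x + of_int k *\<^sub>R w" "nat (-k)"] unfolding eq by (rule sym)
	qed
 qed
 show "periodic f" unfolding periodic_def lat_def
	using mult[of per1] mult[of per2] d by (simp add: doubly_periodic_def add.assoc[symmetric])
qed

lemma lattice_partition: "EX! g. x + lat g : Q"
proof (rule ex1I)
 show "x + lat (- \<lfloor>coord1 x\<rfloor>, - \<lfloor>coord2 x\<rfloor>) : Q"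
	using floor_correct[of "coord1 x"] floor_correct[of "coord2 x"]
	by (auto simp: cell_iff lat_def coord_linear; linarith)
next
 fix g assume g: "x + lat g : Q"
 hence "0 <= coord1 x + of_int (fst g)" "coord1 x + of_int (fst g) < 1"
	"0 <= coord2 x + of_int (snd g)" "coord2 x + of_int (snd g) < 1"
	by (auto simp: cell_iff lat_def coord_linear)
 hence "fst g = - \<lfloor>coord1 x\<rfloor>" "snd g = - \<lfloor>coord2 x\<rfloor>" by linarith+
 thus "g = (- \<lfloor>coord1 x\<rfloor>, - \<lfloor>coord2 x\<rfloor>)" by (simp add: prod_eq_iff)
qed

lemma lattice_vec_uminus: "lat (- g) = - lat g"
 by (simp add: lat_def)

lemma nn_integral_M_translation:
 fixes f :: "real^2 => ennreal"
 assumes f: "f : LMeas" and per: "periodic f"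
 shows "(\<oint>+x. f (x + h)) = (\<oint>+x. f x)"
 unfolding nn_integral_M
 by (rule fundamental_domain_translation[where L = lat, OF f cell_lebesgue])
	(simp_all only: per[unfolded periodic_def, rule_format] lattice_vec_uminus lattice_partition)

lemma measurable_shift:
 assumes "f : measurable lebesgue N"
 shows "(%x. f (x + h)) : measurable lebesgue N"
proof -
 have "(%x. h + x) : lebesgue \<rightarrow>\<^sub>M lebesgue"
	using lebesgue_affine_measurable[of "%_. 1" h] by (simp add: euclidean_representation)
 from measurable_comp[OF this assms] show ?thesis by (simp add: comp_def add.commute)
qed

lemma integral_M_translation:
 fixes f :: "real^2 => real"
 assumes f [measurable]: "f : LMeas" and per: "periodic f"
 shows "Integ (%x. f (x + h)) \<longleftrightarrow> Integ f"
	and "(\<oint>x. f (x + h)) = (\<oint>x. f x)"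
proof -
 have [measurable]: "f : Meas" "(%x. f (x + h)) : Meas"
	using measurable_shift[OF f] f by (auto intro: measurable_lebesgue_M)
 have nn: "(\<oint>+x. ennreal (g (f (x + h)))) = (\<oint>+x. ennreal (g (f x)))"
	if [measurable]: "g : BMeas" for g :: "real => real"
	using per by (intro nn_integral_M_translation) (auto simp: periodic_def)
 show int: "Integ (%x. f (x + h)) \<longleftrightarrow> Integ f"
	using nn[of norm] by (simp add: integrable_iff_bounded)
 show "(\<oint>x. f (x + h)) = (\<oint>x. f x)"
 proof (cases "Integ f")
	case True
	thus ?thesis using int nn[of "%x. x"] nn[of uminus] by (simp add: real_lebesgue_integral_def)
 next
	case False
	thus ?thesis using int by (simp add: not_integrable_integral_eq)
 qed
qed

lemma AE_M_translation:
 assumes [measurable]: "Measurable.pred lebesgue P" and per: "periodic P" and ae: "AE x in M. P x"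
 shows "AE x in M. P (x + h)"
proof -
 have m: "Measurable.pred lebesgue (%x. P (x + h))" by (rule measurable_shift) measurable
 let ?f = "%x. indicator {x. \<not> P x} x :: ennreal"
 have [measurable]: "?f : LMeas" by measurable
 have p: "periodic ?f" using per by (simp add: periodic_def indicator_def)
 have "(\<oint>+x. ?f x) = 0"
	using ae by (subst nn_integral_0_iff_AE) (auto intro: measurable_lebesgue_M simp: indicator_def)
 hence "(\<oint>+x. ?f (x + h)) = 0"
	using nn_integral_M_translation[OF _ p, of h] by simp
 hence "AE x in M. ?f (x + h) = 0"
	by (subst (asm) nn_integral_0_iff_AE) (auto intro!: measurable_lebesgue_M measurable_shift)
 thus ?thesis by (rule AE_mp) (auto simp: indicator_def split: if_splits)
qed

definition reduce :: "real^2 => real^2" where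
 "reduce x = x - (of_int \<lfloor>coord1 x\<rfloor> *\<^sub>R per1 + of_int \<lfloor>coord2 x\<rfloor> *\<^sub>R per2)"

lemma reduce_in_cell: "reduce x : Q"
 using floor_correct[of "coord1 x"] floor_correct[of "coord2 x"]
 by (auto simp: cell_iff reduce_def coord_linear; linarith)

lemma reduce_cell: "x : Q ==> reduce x = x"
proof -
 assume "x : Q"
 hence "\<lfloor>coord1 x\<rfloor> = 0" "\<lfloor>coord2 x\<rfloor> = 0" by (auto simp: cell_iff floor_eq_iff)
 thus ?thesis by (simp add: reduce_def)
qed

lemma reduce_shift: "reduce (x + lat g) = reduce x"
 by (simp add: reduce_def lat_def coord_linear algebra_simps)

lemma reduce_lattice: "EX g. x = reduce x + lat g"
 by (rule exI[of _ "(\<lfloor>coord1 x\<rfloor>, \<lfloor>coord2 x\<rfloor>)"]) (simp add: reduce_def lat_def)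

lemma periodic_reduce: "periodic f ==> f (reduce x) = f x"
 using reduce_lattice[of x] by (metis periodic_def)

lemma measurable_reduce [measurable]: "reduce : BMeas"
 unfolding reduce_def[abs_def] by measurable

lemma borel_representative:
 fixes f :: "real^2 => real"
 assumes f: "f : LMeas" and per: "periodic f"
 obtains f' where "f' : BMeas" "periodic f'" "AE x in M. f x = f' x"
proof -
 obtain g where g: "g : borel_measurable lborel" "AE x in lborel. f x = g x"
	using completion_ex_borel_measurable_real[OF f] by auto
 have [measurable]: "g : BMeas" using g(1) by simp
 show thesis
 proof
	show "(%x. g (reduce x)) : BMeas" by measurable
	show "periodic (%x. g (reduce x))" by (simp add: periodic_def reduce_shift)
	have "AE x in lebesgue. f x = g x" using g(2) by (rule AE_completion)
	thus "AE x in M. f x = g (reduce x)"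
	 unfolding AE_M by (rule AE_mp) (auto simp: reduce_cell)
 qed
qed


definition C1p :: "(real^2 => real) => bool" where
 "C1p f \<longleftrightarrow> periodic f & (ALL x. f differentiable (at x)) &
	(ALL k. continuous_on UNIV (pd k f))"

lemma has_derivative_partial:
 fixes f :: "real^2 => real"
 assumes "f differentiable (at x)"
 shows "(f has_derivative (%h. SUM k:UNIV. pd k f x * h$k)) (at x)"
proof -
 let ?f' = "frechet_derivative f (at x)"
 have d: "(f has_derivative ?f') (at x)"
	using assms frechet_derivative_works by blast
 interpret l: linear ?f' using d has_derivative_linear by blast
 have "?f' h = (SUM k:UNIV. pd k f x * h$k)" for h
 proof -
	have "?f' h = ?f' (SUM k:UNIV. h$k *\<^sub>R axis k 1)"
	 using basis_expansion[of h] by (simp add: scalar_mult_eq_scaleR)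
	also have "... = (SUM k:UNIV. h$k * ?f' (axis k 1))" by (simp add: l.sum l.scale)
	finally show ?thesis by (simp add: partial_deriv_def mult.commute)
 qed
 hence "?f' = (%h. SUM k:UNIV. pd k f x * h$k)" by blast
 thus ?thesis using d by simp
qed

lemma partial_deriv_eqI:
 "(f has_derivative f') (at x) ==> pd k f x = f' (axis k 1)"
 unfolding partial_deriv_def using frechet_derivative_at by metis

lemma periodic_partial:
 assumes "periodic f" "!!x. f differentiable (at x)"
 shows "periodic (pd k f)"
 unfolding periodic_def
proof (intro allI)
 fix x g
 have "(f has_derivative frechet_derivative f (at (x + lat g))) (at (x + lat g))"
	using assms(2) frechet_derivative_works by blast
 moreover have "((%y. y + lat g) has_derivative (%h. h)) (at x)"
	by (auto intro!: derivative_eq_intros)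
 ultimately have "((%y. f (y + lat g)) has_derivative frechet_derivative f (at (x + lat g))) (at x)"
	using has_derivative_compose by blast
 moreover have "(%y. f (y + lat g)) = f" using assms(1) unfolding periodic_def by blast
 ultimately have "(f has_derivative frechet_derivative f (at (x + lat g))) (at x)" by simp
 from partial_deriv_eqI[OF this] show "pd k f (x + lat g) = pd k f x"
	by (simp add: partial_deriv_def)
qed

lemma periodic_continuous_bounded:
 fixes f :: "real^2 => real"
 assumes "periodic f" "continuous_on UNIV f"
 shows "EX B>0. ALL x. abs (f x) <= B"
proof -
 have "compact (closure Q)" using bounded_cell compact_closure by blast
 hence "compact (f ` closure Q)"
	using assms(2) by (intro compact_continuous_image) (auto intro: continuous_on_subset)
 then obtain B where B: "B > 0" "!!y. y : f ` closure Q ==> norm y <= B"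
	using compact_imp_bounded bounded_pos by metis
 have "abs (f x) <= B" for x
 proof -
	have "f (reduce x) : f ` closure Q" using reduce_in_cell[of x] closure_subset[of Q] by blast
	from B(2)[OF this] show ?thesis using periodic_reduce[OF assms(1), of x] by simp
 qed
 thus ?thesis using B(1) by blast
qed

lemma C1D:
 assumes "C1p f"
 shows "periodic f" "f differentiable (at x)" "continuous_on UNIV f"
	"continuous_on UNIV (pd k f)" "periodic (pd k f)"
	"f : BMeas" "pd k f : BMeas"
proof -
 show 1: "periodic f" and 2: "f differentiable (at x)"
	and 3: "continuous_on UNIV (pd k f)" for x
	using assms by (auto simp: C1p_def)
 show 4: "continuous_on UNIV f"
	using 2 by (simp add: continuous_on_eq_continuous_at differentiable_imp_continuous_within)
 show "periodic (pd k f)" using 1 2 by (rule periodic_partial)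
 show "f : BMeas" "pd k f : BMeas"
	using 3 4 by (auto intro: borel_measurable_continuous_onI)
qed

lemma C1_periodic_bounded: "C1p f ==> EX B>0. ALL x. abs (f x) <= B"
 using periodic_continuous_bounded C1D by blast

lemma C1_periodic_partial_bounded: "C1p f ==> EX B>0. ALL x. abs (pd k f x) <= B"
 using periodic_continuous_bounded C1D by blast

lemma integrable_M_bounded:
 fixes f :: "real^2 => real"
 assumes "f : Meas" "!!x. abs (f x) <= B"
 shows "Integ f"
 using assms by (intro M.integrable_const_bound[where B = B]) auto

lemma integrable_M_mult_bounded:
 fixes f g :: "real^2 => real"
 assumes f: "Integ f" and g [measurable]: "g : Meas" and b: "!!x. abs (g x) <= B"
 shows "Integ (%x. f x * g x)"
proof (rule bound_integrable)
 show "Integ (%x. B * f x)" using f by simp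
 show "(%x. f x * g x) : Meas" using f g by measurable
 have "abs (f x) * abs (g x) <= abs (f x) * abs B" for x using b[of x] by (intro mult_left_mono) auto
 thus "AE x in M. norm (f x * g x) <= norm (B * f x)"
	by (intro always_eventually allI) (simp add: abs_mult mult.commute)
qed

lemma C1_periodic_mult:
 assumes f: "C1p f" and g: "C1p g"
 shows "C1p (%x. f x * g x)"
	and "pd k (%x. f x * g x) x = f x * pd k g x + pd k f x * g x"
proof -
 have d: "((%x. f x * g x) has_derivative
	 (%h. f x * (SUM k:UNIV. pd k g x * h$k) + (SUM k:UNIV. pd k f x * h$k) * g x)) (at x)" for x
	using has_derivative_partial C1D(2)[OF f, of x] C1D(2)[OF g, of x]
	by (intro has_derivative_mult) auto
 show eq: "pd k (%x. f x * g x) x = f x * pd k g x + pd k f x * g x" for k x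
	by (subst partial_deriv_eqI[OF d]) (simp add: axis_def if_distrib cong: if_cong)
 have "continuous_on UNIV (pd k (%x. f x * g x))" for k
	unfolding eq[abs_def] using C1D[OF f] C1D[OF g]
	by (intro continuous_intros) auto
 moreover have "(%x. f x * g x) differentiable (at x)" for x
	using d differentiable_def by blast
 moreover have "periodic (%x. f x * g x)"
	using C1D(1)[OF f] C1D(1)[OF g] by (simp add: periodic_def)
 ultimately show "C1p (%x. f x * g x)" by (simp add: C1p_def)
qed

lemma integral_partial_zero:
 assumes f: "C1p f"
 shows "(\<oint>x. pd k f x) = 0"
proof -
 let ?e = "axis k 1 :: real^2"
 let ?D = "%n x. (f (x + (1 / real (Suc n)) *\<^sub>R ?e) - f x) * real (Suc n)"
 obtain B where B: "B > 0" "!!x. abs (pd k f x) <= B"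
	using C1_periodic_partial_bounded[OF f] by blast
 have [measurable]: "f : BMeas" "pd k f : BMeas"
	using C1D[OF f] by auto
 have der: "((%t. f (x + t *\<^sub>R ?e)) has_real_derivative pd k f (x + t *\<^sub>R ?e)) (at t)" for x t
 proof -
	have "((%t. f (x + t *\<^sub>R ?e)) has_derivative (%h. SUM j:UNIV. pd j f (x + t *\<^sub>R ?e) * (h *\<^sub>R ?e) $ j)) (at t)"
	 by (rule has_derivative_compose[OF _ has_derivative_partial[OF C1D(2)[OF f]]])
		(auto intro!: derivative_eq_intros)
	moreover have "(SUM j:UNIV. pd j f (x + t *\<^sub>R ?e) * (h *\<^sub>R ?e) $ j) = h * pd k f (x + t *\<^sub>R ?e)" for h
	 by (simp add: axis_def if_distrib cong: if_cong)
	ultimately show ?thesis by (simp add: has_field_derivative_def mult_commute_abs)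
 qed
 have bound: "abs (?D n x) <= B" for n x
 proof -
	let ?t = "1 / real (Suc n)"
	have t: "?t > 0" by simp
	have "EX z>0. z < ?t & f (x + ?t *\<^sub>R ?e) - f (x + 0 *\<^sub>R ?e) = (?t - 0) * pd k f (x + z *\<^sub>R ?e)"
	 by (rule MVT2[OF t]) (rule der)
	then obtain z where "f (x + ?t *\<^sub>R ?e) - f x = ?t * pd k f (x + z *\<^sub>R ?e)"
	 by auto
	hence "?D n x = (?t * pd k f (x + z *\<^sub>R ?e)) * real (Suc n)" by (simp only:)
	also have "... = pd k f (x + z *\<^sub>R ?e)" by simp
	finally show ?thesis using B(2) by (simp only:)
 qed
 have lim: "(%n. ?D n x) ----> pd k f x" for x
 proof -
	have "((%t. (f (x + t *\<^sub>R ?e) - f x) / t) \<longlongrightarrow> pd k f x) (at 0)"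
	 using der[of x 0] unfolding has_field_derivative_iff by simp
	moreover have "filterlim (%n. 1 / real (Suc n)) (at 0) sequentially"
	 using LIMSEQ_inverse_real_of_nat by (auto simp: filterlim_at inverse_eq_divide)
	ultimately have "(%n. (f (x + (1 / real (Suc n)) *\<^sub>R ?e) - f x) / (1 / real (Suc n))) ----> pd k f x"
	 by (rule filterlim_compose)
	thus ?thesis by (simp add: mult.commute)
 qed
 have "(%n. \<integral>x. ?D n x \<partial>M) ----> (\<oint>x. pd k f x)"
 proof (rule integral_dominated_convergence[where w = "%_. B"])
	show "(%x. ?D n x) : Meas" for n
	 by (rule measurable_borel_M) measurable
	show "AE x in M. norm (?D n x) <= B" for n
	 by (rule AE_I2) (simp only: real_norm_def bound)
 next
	show "AE x in M. (%n. ?D n x) ----> pd k f x" by (rule AE_I2) (rule lim)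
 qed (simp_all add: measurable_borel_M)
 moreover have "(\<oint>x. ?D n x) = 0" for n
 proof -
	obtain C where C: "!!x. abs (f x) <= C" using C1_periodic_bounded[OF f] by blast
	have i: "Integ f" by (rule integrable_M_bounded[of _ C]) (use C in \<open>auto intro: measurable_borel_M\<close>)
	have m: "f : LMeas"
	 using C1D(6)[OF f] by (intro measurable_completion) simp
	note t = integral_M_translation[OF m C1D(1)[OF f]]
	have "(\<oint>x. ?D n x) = ((\<oint>x. f (x + (1 / real (Suc n)) *\<^sub>R ?e)) - (\<oint>x. f x)) * real (Suc n)"
	 using i t(1) by (subst integral_mult_left_zero) (simp only: diff_integral)
	also have "... = 0" unfolding t(2) by simp
	finally show ?thesis .
 qed
 ultimately have "(%n::nat. 0) ----> (\<oint>x. pd k f x)" by (simp only:)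
 thus ?thesis by (simp add: LIMSEQ_const_iff)
qed

lemma integration_by_parts:
 assumes f: "C1p f" and g: "C1p g"
 shows "(\<oint>x. f x * pd k g x) = - (\<oint>x. pd k f x * g x)"
proof -
 have [measurable]: "f : BMeas" "pd k f : BMeas"
	"g : BMeas" "pd k g : BMeas"
	using C1D f g by auto
 obtain Bf Bg Bf' Bg' where B: "!!x. abs (f x) <= Bf" "!!x. abs (g x) <= Bg"
	"!!x. abs (pd k f x) <= Bf'" "!!x. abs (pd k g x) <= Bg'"
	using C1_periodic_bounded[OF f] C1_periodic_bounded[OF g]
	 C1_periodic_partial_bounded[OF f] C1_periodic_partial_bounded[OF g] by metis
 have "Integ (%x. f x * pd k g x)" "Integ (%x. pd k f x * g x)"
	by (rule integrable_M_mult_bounded, rule integrable_M_bounded; use B in \<open>auto intro!: measurable_borel_M\<close>)+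
 hence "(\<oint>x. f x * pd k g x) + (\<oint>x. pd k f x * g x) =
	(\<oint>x. pd k (%x. f x * g x) x)"
	by (simp add: C1_periodic_mult(2)[OF f g])
 thus ?thesis using integral_partial_zero[OF C1_periodic_mult(1)[OF f g], of k] by simp
qed

lemma test_function_C1:
 assumes "phi : Test"
 shows "C1p phi"
proof -
 have p: "periodic phi" and c: "!!m. C_k m phi"
	using assms by (auto simp: periodic_test_functions_def doubly_periodic_iff)
 have "C_k (Suc 0) phi" by (rule c)
 thus ?thesis using p unfolding C1p_def by (simp only: C_k.simps simp_thms)
qed

section \<open>Trigonometric polynomials\<close>

inductive_set trig :: "(real^2 => real) set" where
 const: "(%x. c) : trig"
| cos1: "(%x. cos (2 * pi * coord1 x)) : trig"
| sin1: "(%x. sin (2 * pi * coord1 x)) : trig"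
| cos2: "(%x. cos (2 * pi * coord2 x)) : trig"
| sin2: "(%x. sin (2 * pi * coord2 x)) : trig"
| add: "f : trig ==> g : trig ==> (%x. f x + g x) : trig"
| mult: "f : trig ==> g : trig ==> (%x. f x * g x) : trig"

lemma trig_cmult: "f : trig ==> (%x. c * f x) : trig"
 using trig.mult[OF trig.const] .

lemma trig_uminus: "f : trig ==> (%x. - f x) : trig"
 using trig_cmult[of f "-1"] by simp

lemma trig_power: "f : trig ==> (%x. f x ^ n) : trig"
 by (induction n) (simp_all add: trig.const trig.mult)

lemma has_derivative_coord:
 "(coord1 has_derivative coord1) F" "(coord2 has_derivative coord2) F"
 by (simp_all add: bounded_linear_coord1 bounded_linear_coord2 bounded_linear_imp_has_derivative)

lemma sum_axis: "(SUM j:UNIV. c j * axis k 1 $ j) = (c k :: real)" for k :: 2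
 by (simp add: axis_def if_distrib cong: if_cong)

lemma periodic_angle:
 "cos (2 * pi * (a + real_of_int k)) = cos (2 * pi * a)" "sin (2 * pi * (a + real_of_int k)) = sin (2 * pi * a)"
proof -
 have e: "2 * pi * (a + real_of_int k) = 2 * pi * a + 2 * pi * real_of_int k" by (simp add: algebra_simps)
 have z: "cos (2 * pi * real_of_int k) = 1" "sin (2 * pi * real_of_int k) = 0"
	using cos_int_2pin[of k] sin_int_2pin[of k] by (simp_all add: mult.commute)
 show "cos (2 * pi * (a + real_of_int k)) = cos (2 * pi * a)" "sin (2 * pi * (a + real_of_int k)) = sin (2 * pi * a)"
	unfolding e cos_add sin_add by (simp_all add: z)
qed

lemma trig_periodic: "f : trig ==> periodic f"
 by (induction rule: trig.induct)
	(simp_all add: periodic_def lat_def coord_linear periodic_angle del: split_paired_All)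

lemma trig_derivative:
 assumes "f : trig"
 shows "(ALL x. f differentiable (at x)) & (ALL k. pd k f : trig)"
proof -
 have *: "(ALL x. f differentiable (at x)) & (ALL k. pd k f : trig)"
	if d: "!!x. (f has_derivative f' x) (at x)" and t: "!!k. (%x. f' x (axis k 1)) : trig" for f f'
 proof -
	have "pd k f = (%x. f' x (axis k 1))" for k using partial_deriv_eqI[OF d] by blast
	thus ?thesis using d t by (auto simp: differentiable_def)
 qed
 show ?thesis using assms
 proof (induction rule: trig.induct)
	case (const c)
	have "((%x. c) has_derivative (%h. 0)) (at x)" for x :: "real^2" by simp
	thus ?case by (rule *) (rule trig.const)
 next
	case cos1
	have "((%x. cos (2 * pi * coord1 x)) has_derivative (%h. - (2 * pi * coord1 h) * sin (2 * pi * coord1 x))) (at x)" for x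
	 by (auto intro!: derivative_eq_intros has_derivative_coord)
	thus ?case
	 by (rule *) (rule trig_cmult, rule trig.sin1)
 next
	case sin1
	have "((%x. sin (2 * pi * coord1 x)) has_derivative (%h. (2 * pi * coord1 h) * cos (2 * pi * coord1 x))) (at x)" for x
	 by (auto intro!: derivative_eq_intros has_derivative_coord)
	thus ?case
	 by (rule *) (rule trig_cmult, rule trig.cos1)
 next
	case cos2
	have "((%x. cos (2 * pi * coord2 x)) has_derivative (%h. - (2 * pi * coord2 h) * sin (2 * pi * coord2 x))) (at x)" for x
	 by (auto intro!: derivative_eq_intros has_derivative_coord)
	thus ?case
	 by (rule *) (rule trig_cmult, rule trig.sin2)
 next
	case sin2
	have "((%x. sin (2 * pi * coord2 x)) has_derivative (%h. (2 * pi * coord2 h) * cos (2 * pi * coord2 x))) (at x)" for x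
	 by (auto intro!: derivative_eq_intros has_derivative_coord)
	thus ?case
	 by (rule *) (rule trig_cmult, rule trig.cos2)
 next
	case (add f g)
	show ?case
	proof (rule *)
	 show "((%x. f x + g x) has_derivative (%h. (SUM k:UNIV. pd k f x * h$k) + (SUM k:UNIV. pd k g x * h$k))) (at x)" for x
		using add by (intro has_derivative_add has_derivative_partial) auto
	 show "(%x. (SUM j:UNIV. pd j f x * axis k 1 $ j) + (SUM j:UNIV. pd j g x * axis k 1 $ j)) : trig" for k
		unfolding sum_axis using add by (intro trig.add) auto
	qed
 next
	case (mult f g)
	show ?case
	proof (rule *)
	 show "((%x. f x * g x) has_derivative (%h. f x * (SUM k:UNIV. pd k g x * h$k) + (SUM k:UNIV. pd k f x * h$k) * g x)) (at x)" for x
		using mult by (intro has_derivative_mult has_derivative_partial) auto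
	 show "(%x. f x * (SUM j:UNIV. pd j g x * axis k 1 $ j) + (SUM j:UNIV. pd j f x * axis k 1 $ j) * g x) : trig" for k
		unfolding sum_axis using mult by (intro trig.add trig.mult) auto
	qed
 qed
qed

lemma trig_C_k: "f : trig ==> C_k m f"
proof (induction m arbitrary: f)
 case 0
 thus ?case using trig_derivative[OF 0]
	by (simp add: continuous_on_eq_continuous_at differentiable_imp_continuous_within)
next
 case (Suc m)
 thus ?case using trig_derivative[OF Suc.prems] by simp
qed

lemma trig_test: "f : trig ==> f : Test"
 using trig_C_k trig_periodic by (simp add: periodic_test_functions_def doubly_periodic_iff)

lemma trig_C1: "f : trig ==> C1p f"
 by (intro test_function_C1 trig_test)


section \<open>Convolution\<close>

inductive separable :: "(real^2 => real^2 => real) => bool" where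
 tensor: "f : trig ==> g : trig ==> separable (%x y. f x * g y)"
| plus: "separable k ==> separable l ==> separable (%x y. k x y + l x y)"

lemma separable_mult_tensor:
 assumes "separable k" "f : trig" "g : trig"
 shows "separable (%x y. f x * g y * k x y)"
 using assms(1)
proof (induction rule: separable.induct)
 case (tensor f' g')
 have "separable (%x y. (f x * f' x) * (g y * g' y))"
	using tensor assms by (intro separable.tensor trig.mult)
 thus ?case by (simp add: mult_ac)
next
 case (plus k l)
 thus ?case using separable.plus[OF plus.IH] by (simp add: distrib_left)
qed

lemma separable_mult:
 assumes "separable k" "separable l"
 shows "separable (%x y. k x y * l x y)"
 using assms(1)
proof (induction rule: separable.induct)
 case (tensor f g)
 thus ?case using separable_mult_tensor[OF assms(2)] by simp
next
 case (plus k k')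
 thus ?case using separable.plus[OF plus.IH] by (simp add: distrib_right)
qed

lemma separable_uminus_tensor: "f : trig ==> g : trig ==> separable (%x y. - (f x * g y))"
 using separable.tensor[OF trig_uminus] by simp

lemma separable_difference: "K : trig ==> separable (%x y. K (x - y))"
proof (induction rule: trig.induct)
 case (const c)
 show ?case using separable.tensor[OF trig.const[of c] trig.const[of 1]] by simp
next
 case cos1
 show ?case unfolding coord_linear right_diff_distrib cos_diff
	by (intro separable.plus separable.tensor trig.cos1 trig.sin1)
next
 case sin1
 show ?case unfolding coord_linear right_diff_distrib sin_diff unfolding diff_conv_add_uminus
	by (intro separable.plus separable.tensor separable_uminus_tensor trig.cos1 trig.sin1)
next
 case cos2
 show ?case unfolding coord_linear right_diff_distrib cos_diff
	by (intro separable.plus separable.tensor trig.cos2 trig.sin2)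
next
 case sin2
 show ?case unfolding coord_linear right_diff_distrib sin_diff unfolding diff_conv_add_uminus
	by (intro separable.plus separable.tensor separable_uminus_tensor trig.cos2 trig.sin2)
next
 case (add f g)
 thus ?case by (intro separable.plus)
next
 case (mult f g)
 thus ?case by (intro separable_mult)
qed

lemma separable_sections:
 assumes "separable k"
 shows "(%x. k x y) : trig" "k x : trig"
 using assms
proof (induction rule: separable.induct)
 case (tensor f g)
 {
	case 1
	thus ?case using tensor trig.mult[OF _ trig.const] by blast
 next
	case 2
	thus ?case using tensor trig.mult[OF trig.const] by blast
 }
next
 case (plus k l)
 {
	case 1
	thus ?case using plus by (intro trig.add)
 next
	case 2
	thus ?case using plus by (intro trig.add)
 }
qed

lemma integrable_mult_trig:
 assumes u: "Integ u" and g: "g : trig"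
 shows "Integ (%y. u y * g y)"
proof -
 obtain B where "!!x. abs (g x) <= B" using C1_periodic_bounded[OF trig_C1[OF g]] by blast
 moreover have "g : Meas"
	using C1D(6)[OF trig_C1[OF g]] by (rule measurable_borel_M)
 ultimately show ?thesis by (intro integrable_M_mult_bounded[OF u])
qed

lemma partial_deriv_add:
 assumes "f differentiable (at x)" "g differentiable (at x)"
 shows "pd k (%x. f x + g x) x = pd k f x + pd k g x"
 using partial_deriv_eqI[OF has_derivative_add[OF has_derivative_partial[OF assms(1)] has_derivative_partial[OF assms(2)]]]
 by (simp add: sum_axis)

lemma partial_deriv_cmult_right:
 assumes "f differentiable (at x)"
 shows "pd k (%x. f x * c) x = pd k f x * c"
 using partial_deriv_eqI[OF has_derivative_mult_left[OF has_derivative_partial[OF assms]]]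
 by (simp add: sum_axis)

lemma trig_differentiable: "f : trig ==> f differentiable (at x)"
 using trig_derivative by blast

lemma trig_partial: "f : trig ==> pd k f : trig"
 using trig_derivative by blast

lemma separable_integral:
 assumes u: "Integ u" and k: "separable k"
 shows "(%x. \<integral>y. u y * k x y \<partial>M) : trig &
	(ALL j x. pd j (%x. \<integral>y. u y * k x y \<partial>M) x = (\<oint>y. u y * pd j (%x. k x y) x))"
 using k
proof (induction rule: separable.induct)
 case (tensor f g)
 have eq: "(\<oint>y. u y * (f x * g y)) = f x * (\<oint>y. u y * g y)" for f x
	by (subst integral_mult_right_zero[symmetric]) (simp add: mult_ac)
 show ?case unfolding eq
	using tensor by (auto simp: partial_deriv_cmult_right trig_differentiable eq
		intro!: trig.mult[OF _ trig.const])
next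
 case (plus k l)
 have i: "Integ (%y. u y * k x y)" "Integ (%y. u y * l x y)" for x
	using separable_sections(2)[OF plus.hyps(1)] separable_sections(2)[OF plus.hyps(2)] u
	by (auto intro: integrable_mult_trig)
 have d: "(%x. k x y) differentiable (at x)" "(%x. l x y) differentiable (at x)" for x y
	using plus.hyps separable_sections(1) trig_differentiable by blast+
 have eq: "(\<oint>y. u y * (k x y + l x y)) = (\<oint>y. u y * k x y) + (\<oint>y. u y * l x y)" for x
	using i by (simp add: distrib_left)
 have pi: "Integ (%y. u y * pd j (%x. m x y) x)" if m: "separable m" for m j x
	using m
 proof (induction rule: separable.induct)
	case (tensor f g)
	have "pd j f x * g y = pd j (%x. f x * g y) x" for y
	 using tensor by (simp add: partial_deriv_cmult_right trig_differentiable)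
	moreover have "(%y. pd j f x * g y) : trig" using tensor(2) by (rule trig_cmult)
	ultimately show ?case using integrable_mult_trig[OF u, of "%y. pd j f x * g y"] by simp
 next
	case (plus k l)
	hence "pd j (%x. k x y + l x y) x = pd j (%x. k x y) x + pd j (%x. l x y) x" for y
	 by (intro partial_deriv_add trig_differentiable separable_sections)
	thus ?case using plus by (simp add: distrib_left)
 qed
 have "(\<oint>y. u y * pd j (%x. k x y + l x y) x) =
	(\<oint>y. u y * pd j (%x. k x y) x) + (\<oint>y. u y * pd j (%x. l x y) x)" for j x
	using pi[OF plus.hyps(1)] pi[OF plus.hyps(2)] by (simp add: partial_deriv_add[OF d] distrib_left)
 moreover have "pd j (%x. (\<oint>y. u y * k x y) + (\<oint>y. u y * l x y)) x =
	pd j (%x. \<integral>y. u y * k x y \<partial>M) x + pd j (%x. \<integral>y. u y * l x y \<partial>M) x" for j x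
	using plus.IH by (intro partial_deriv_add trig_differentiable) auto
 ultimately show ?case unfolding eq using plus.IH by (auto intro: trig.add)
qed

definition conv :: "(real^2 => real) => (real^2 => real) => real^2 => real" where
 "conv u K x = (\<oint>y. u y * K (x - y))"

lemma partial_deriv_shift:
 assumes "K : trig"
 shows "pd j (%x. K (x - y)) x = pd j K (x - y)"
	and "pd j (%y. K (x - y)) y = - pd j K (x - y)"
proof -
 have K: "(K has_derivative (%h. SUM k:UNIV. pd k K (x - y) * h$k)) (at (x - y))"
	by (intro has_derivative_partial trig_differentiable assms)
 have "((%x. K (x - y)) has_derivative (%h. SUM k:UNIV. pd k K (x - y) * h$k)) (at x)"
	by (rule has_derivative_compose[of "%x. x - y" "%h. h", OF _ K]) (auto intro!: derivative_eq_intros)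
 from partial_deriv_eqI[OF this] show "pd j (%x. K (x - y)) x = pd j K (x - y)"
	by (simp add: sum_axis)
 have "((%y. K (x - y)) has_derivative (%h. SUM k:UNIV. pd k K (x - y) * (- h)$k)) (at y)"
	by (rule has_derivative_compose[of "%y. x - y" "%h. - h", OF _ K]) (auto intro!: derivative_eq_intros)
 from partial_deriv_eqI[OF this] show "pd j (%y. K (x - y)) y = - pd j K (x - y)"
	by (simp add: sum_axis sum_negf)
qed

lemma conv_trig:
 assumes u: "Integ u" and K: "K : trig"
 shows "conv u K : trig" and "pd j (conv u K) x = conv u (pd j K) x"
proof -
 note s = separable_integral[OF u separable_difference[OF K]]
 have c: "conv u K = (%x. \<integral>y. u y * K (x - y) \<partial>M)" for u K by (simp add: conv_def fun_eq_iff)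
 show "conv u K : trig" using s by (simp add: c)
 show "pd j (conv u K) x = conv u (pd j K) x"
	using s by (simp add: c partial_deriv_shift[OF K])
qed

lemma reflected_shift_trig: "K : trig ==> (%y. K (x - y)) : trig"
 using separable_sections(2)[OF separable_difference] .

lemma conv_weak_partial:
 assumes g: "wkp k u g" and u: "Integ u" and K: "K : trig"
 shows "pd k (conv u K) x = conv g K x"
proof -
 have "(%y. K (x - y)) : Test"
	using K by (intro trig_test reflected_shift_trig)
 hence "(\<oint>y. u y * pd k (%y. K (x - y)) y) = - (\<oint>y. g y * K (x - y))"
	using g unfolding is_weak_partial_def cell_integral_M by blast
 thus ?thesis by (simp add: conv_trig(2)[OF u K] partial_deriv_shift[OF K] conv_def)
qed

section \<open>An approximate identity\<close>

definition bump :: "real^2 => real" where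
 "bump x = (1 + cos (2 * pi * coord1 x)) / 2 * ((1 + cos (2 * pi * coord2 x)) / 2)"

lemma bump_trig: "bump : trig"
proof -
 have "(%x. ((1/2) * (1 + cos (2 * pi * coord1 x))) * ((1/2) * (1 + cos (2 * pi * coord2 x)))) : trig"
	by (intro trig.mult trig.const trig.add trig.cos1 trig.cos2)
 thus ?thesis by (simp add: bump_def[abs_def])
qed

lemma bump_continuous: "continuous_on UNIV bump"
 using C1D(3)[OF trig_C1[OF bump_trig]] .

lemma half_cos_bounds: "0 <= (1 + cos t) / 2" "(1 + cos t) / 2 <= 1" for t :: real
proof -
 have "(1::real) + - 1 <= 1 + cos t" by (rule add_left_mono) simp
 hence "0 <= 1 + cos t" by (simp only: add.right_inverse)
 thus "0 <= (1 + cos t) / 2" by (rule divide_nonneg_pos) simp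
 show "(1 + cos t) / 2 <= 1" using cos_le_one[of t] by simp
qed

lemma bump_bounds: "0 <= bump x" "bump x <= 1" "bump (- x) = bump x" "bump 0 = 1"
proof -
 note b = half_cos_bounds
 show "0 <= bump x" unfolding bump_def by (intro mult_nonneg_nonneg b)
 show "bump x <= 1" unfolding bump_def by (intro mult_le_one b)
qed (simp_all add: bump_def coord_linear)

lemma bump_near_lattice:
 assumes "rho > 0"
 shows "EX del'>0. del' < 1 & (ALL h. bump h > 1 - del' --> (EX g. norm (h - lat g) < rho))"
proof -
 define C where "C = {h. abs (coord1 h) <= 1/2 & abs (coord2 h) <= 1/2 & rho <= norm h}"
 have "closed C" unfolding C_def
	by (intro closed_Collect_conj closed_Collect_le continuous_intros)
 moreover have "bounded C"
 proof (rule boundedI)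
	fix h assume h: "h : C"
	have "norm h <= norm (coord1 h *\<^sub>R per1) + norm (coord2 h *\<^sub>R per2)"
	 by (subst coord_expansion[of h]) (rule norm_triangle_ineq)
	also have "... <= 1/2 * norm per1 + 1/2 * norm per2"
	 using h unfolding C_def norm_scaleR by (intro add_mono mult_right_mono) auto
	finally show "norm h <= 1/2 * norm per1 + 1/2 * norm per2" .
 qed
 ultimately have comp: "compact C" by (simp add: compact_eq_bounded_closed)
 have lt: "bump h < 1" if h: "h : C" for h
 proof (rule ccontr)
	assume "\<not> bump h < 1"
	hence one: "bump h = 1" using bump_bounds(2)[of h] by simp
	note b = half_cos_bounds
	have "bump h <= (1 + cos (2 * pi * coord1 h)) / 2" "bump h <= (1 + cos (2 * pi * coord2 h)) / 2"
	 unfolding bump_def using b by (intro mult_right_le_one_le mult_left_le_one_le; simp)+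
	hence "cos (2 * pi * coord1 h) = 1" "cos (2 * pi * coord2 h) = 1"
	 using one cos_le_one[of "2 * pi * coord1 h"] cos_le_one[of "2 * pi * coord2 h"] by auto
	then obtain i j where ij: "2 * pi * coord1 h = real_of_int i * 2 * pi" "2 * pi * coord2 h = real_of_int j * 2 * pi"
	 unfolding cos_one_2pi_int by blast
	hence "coord1 h = real_of_int i" "coord2 h = real_of_int j" by simp_all
	moreover from this have "abs (real_of_int i) <= 1/2" "abs (real_of_int j) <= 1/2" using h by (auto simp: C_def)
	hence "i = 0" "j = 0" by linarith+
	ultimately have "h = 0" using coord_eqI[of h 0] by (simp add: coord_linear)
	thus False using h assms by (simp add: C_def)
 qed
 obtain s where s: "s < 1" "!!h. h : C ==> bump h <= s"
 proof (cases "C = {}")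
	case True
	thus ?thesis using that[of 0] by simp
 next
	case False
	obtain h0 where "h0 : C" "ALL h:C. bump h <= bump h0"
	 using continuous_attains_sup[OF comp False] bump_continuous continuous_on_subset by blast
	thus ?thesis using that[of "bump h0"] lt by blast
 qed
 define del' where "del' = min (1/2) (1 - s)"
 have "EX g. norm (h - lat g) < rho" if h: "bump h > 1 - del'" for h
 proof -
	let ?g = "(round (coord1 h), round (coord2 h))"
	have "bump (h + lat (- ?g)) = bump h"
	 using trig_periodic[OF bump_trig] unfolding periodic_def by blast
	hence per: "bump (h - lat ?g) = bump h" by (simp only: lattice_vec_uminus) simp
	have "abs (coord1 (h - lat ?g)) <= 1/2" "abs (coord2 (h - lat ?g)) <= 1/2"
	 using of_int_round_abs_le[of "coord1 h"] of_int_round_abs_le[of "coord2 h"]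
	 by (auto simp: lat_def coord_linear abs_minus_commute)
	moreover have "h - lat ?g ~: C" using s(2)[of "h - lat ?g"] per h by (auto simp: del'_def)
	ultimately have "norm (h - lat ?g) < rho" by (auto simp: C_def)
	thus ?thesis by blast
 qed
 moreover have "del' > 0" "del' < 1" using s by (auto simp: del'_def)
 ultimately show ?thesis by blast
qed

definition bump_mass :: "nat => real" where
 "bump_mass m = (\<oint>x. bump x ^ m)"

definition kern :: "nat => real^2 => real" where
 "kern m x = bump x ^ m / bump_mass m"

lemma bump_measurable [measurable]: "bump : BMeas"
 using bump_continuous by (rule borel_measurable_continuous_onI)

lemma bump_power_integrable: "Integ (%x. bump x ^ m)"
 by (rule integrable_M_bounded[of _ 1]) (auto simp: bump_bounds power_le_one intro!: measurable_borel_M)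

lemma bump_mass_lower:
 assumes "0 < del'" "del' < 1"
 shows "EX c>0. ALL m. (1 - del') ^ m * c <= bump_mass m"
proof -
 have "isCont bump 0" using bump_continuous by (simp add: continuous_on_eq_continuous_at)
 then obtain r where r: "r > 0" "!!x. norm x < r ==> abs (bump x - 1) < del'"
	using assms(1) unfolding continuous_at_eps_delta by (metis bump_bounds(4) diff_zero dist_norm real_norm_def)
 define b where "b = min 1 (r / (norm per1 + norm per2 + 1))"
 have den: "norm per1 + norm per2 + 1 > 0" using norm_ge_zero[of per1] norm_ge_zero[of per2] by linarith
 have b: "0 < b" "b <= 1" using r den by (auto simp: b_def)
 define W where "W = {x. 0 < coord1 x & coord1 x < b & 0 < coord2 x & coord2 x < b}"
 note W = open_subcell[OF order_refl b, folded W_def]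
 have lower: "bump x >= 1 - del'" if x: "x : W" for x
 proof -
	have "norm x <= norm (coord1 x *\<^sub>R per1) + norm (coord2 x *\<^sub>R per2)"
	 by (subst coord_expansion[of x]) (rule norm_triangle_ineq)
	also have "... <= b * norm per1 + b * norm per2"
	 using x unfolding W_def norm_scaleR by (intro add_mono mult_right_mono) auto
	also have "... < b * (norm per1 + norm per2 + 1)" using b by (simp add: distrib_left)
	also have "... <= r"
	proof -
	 have "b <= r / (norm per1 + norm per2 + 1)" by (simp add: b_def)
	 thus ?thesis using den by (simp only: pos_le_divide_eq)
	qed
	finally show ?thesis using r(2)[of x] by simp
 qed
 have Wm: "W : sets M" using W(1,2) by (auto simp: M_def sets_restrict_space_iff)
 have "(1 - del') ^ m * measure M W <= bump_mass m" for m
 proof -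
	have "(1 - del') ^ m * measure M W = (\<oint>x. (1 - del') ^ m * indicator W x)"
	 using Wm W(1) by (simp add: Int_absorb2)
	also have "... <= (\<oint>x. bump x ^ m)"
	proof (rule integral_mono)
	 show "Integ (%x. (1 - del') ^ m * indicat_real W x)"
		using Wm by (intro integrable_mult_right integrable_real_indicator) (auto simp: M.emeasure_eq_measure)
	 show "(1 - del') ^ m * indicat_real W x <= bump x ^ m" for x
		using lower[of x] assms bump_bounds(1)[of x] by (auto simp: indicator_def intro: power_mono)
	qed (rule bump_power_integrable)
	finally show ?thesis by (simp add: bump_mass_def)
 qed
 thus ?thesis using W(3) by blast
qed

lemma bump_mass_pos: "bump_mass m > 0"
proof -
 obtain c where "c > 0" "(1 - 1/2) ^ m * c <= bump_mass m" using bump_mass_lower[of "1/2"] by auto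
 moreover have "0 < (1 - 1/2 :: real) ^ m * c" using \<open>c > 0\<close> by simp
 ultimately show ?thesis by linarith
qed

lemma kern_trig: "kern m : trig"
 using trig_cmult[OF trig_power[OF bump_trig, of m], of "1 / bump_mass m"]
 by (simp add: kern_def[abs_def])

lemma kern_nonneg: "0 <= kern m x"
 using bump_mass_pos[of m] bump_bounds(1) by (simp add: kern_def)

lemma kern_even: "kern m (- x) = kern m x"
 by (simp add: kern_def bump_bounds)

lemma kern_integral: "(\<oint>x. kern m x) = 1" "Integ (kern m)"
 using bump_mass_pos[of m] bump_power_integrable[of m]
 by (simp_all add: kern_def[abs_def] bump_mass_def)

lemma kern_measurable [measurable]: "kern m : BMeas"
 unfolding kern_def[abs_def] by measurable

text \<open>The powers of a bump that is maximal exactly on the lattice concentrate there after normalisation.\<close>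

lemma kern_average:
 assumes rho: "rho > 0" and eta: "eta > 0"
 shows "EX m0. ALL m>=m0. ALL W e B. W : Meas --> 0 <= e --> 0 <= B -->
	(ALL h g. norm (h - lat g) < rho --> W h <= ennreal e) --> (ALL h. W h <= ennreal B) -->
	(\<oint>+h. ennreal (kern m h) * W h) <= ennreal (e + B * eta)"
proof -
 obtain del' where del': "0 < del'" "del' < 1" "!!h. bump h > 1 - del' ==> EX g. norm (h - lat g) < rho"
	using bump_near_lattice[OF rho] by blast
 obtain c where c: "c > 0" "!!m. (1 - del'/2) ^ m * c <= bump_mass m"
	using bump_mass_lower[of "del'/2"] del' by auto
 define q where "q = (1 - del') / (1 - del'/2)"
 have q: "0 <= q" "q < 1" using del' by (auto simp: q_def field_simps)
 have "(%m. q ^ m * (area / c)) ----> 0 * (area / c)"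
	by (intro tendsto_mult LIMSEQ_power_zero tendsto_const) (use q in auto)
 hence "\<forall>\<^sub>F m in sequentially. q ^ m * (area / c) < eta"
	using eta by (simp add: order_tendsto_iff)
 then obtain m0 where m0: "!!m. m >= m0 ==> q ^ m * (area / c) < eta"
	by (auto simp: eventually_sequentially)
 show ?thesis
 proof (intro exI[of _ m0] allI impI)
	fix m :: nat and W :: "real^2 => ennreal" and e B :: real
	assume m: "m >= m0" and [measurable]: "W : Meas" and e: "0 <= e" and B: "0 <= B"
	 and near: "ALL h g. norm (h - lat g) < rho --> W h <= ennreal e" and all: "ALL h. W h <= ennreal B"
	have far: "kern m h <= eta / area" if h: "\<not> bump h > 1 - del'" for h
	proof -
	 have "kern m h <= (1 - del') ^ m / ((1 - del'/2) ^ m * c)"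
		unfolding kern_def using h bump_bounds(1)[of h] c(1) c(2)[of m] del' bump_mass_pos[of m]
		by (intro frac_le power_mono mult_pos_pos zero_less_power) auto
	 also have "... = q ^ m * (area / c) / area" using area_pos by (simp add: q_def power_divide)
	 also have "... <= eta / area" using m0[OF m] area_pos by (intro divide_right_mono) auto
	 finally show ?thesis .
	qed
	have pt: "ennreal (kern m h) * W h <= ennreal (kern m h * e + B * eta / area)" for h
	proof (cases "bump h > 1 - del'")
	 case True
	 hence "W h <= ennreal e" using del'(3) near by blast
	 hence "ennreal (kern m h) * W h <= ennreal (kern m h) * ennreal e" by (intro mult_left_mono) auto
	 also have "... = ennreal (kern m h * e)" using kern_nonneg e by (simp add: ennreal_mult)
	 also have "... <= ennreal (kern m h * e + B * eta / area)" using B eta area_pos by (intro ennreal_leI) auto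
	 finally show ?thesis .
	next
	 case False
	 have "ennreal (kern m h) * W h <= ennreal (eta / area) * ennreal B"
		using far[OF False] all by (intro mult_mono ennreal_leI) auto
	 also have "... = ennreal (B * eta / area)" using eta B area_pos by (simp add: ennreal_mult[symmetric] mult.commute)
	 also have "... <= ennreal (kern m h * e + B * eta / area)" using kern_nonneg[of m h] e by (intro ennreal_leI) auto
	 finally show ?thesis .
	qed
	have "(\<oint>+h. ennreal (kern m h) * W h) <= (\<oint>+h. ennreal (kern m h * e + B * eta / area))"
	 by (intro nn_integral_mono pt)
	also have "... = ennreal (\<oint>h. kern m h * e + B * eta / area)"
	 using kern_integral(2)[of m] kern_nonneg e B eta area_pos by (intro nn_integral_eq_integral) auto
	also have "(\<oint>h. kern m h * e + B * eta / area) = e + B * eta"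
	 using kern_integral[of m] area_pos by (simp add: area_def)
	finally show "(\<oint>+h. ennreal (kern m h) * W h) <= ennreal (e + B * eta)" .
 qed
qed

end

lemma sum3_power_le:
 fixes a b c :: real
 assumes "0 <= a" "0 <= b" "0 <= c"
 shows "(a + b + c) ^ p <= 3 ^ p * (a ^ p + b ^ p + c ^ p)"
proof -
 define m where "m = max a (max b c)"
 have "(a + b + c) ^ p <= (3 * m) ^ p" using assms by (intro power_mono) (auto simp: m_def)
 also have "... = 3 ^ p * m ^ p" by (simp add: power_mult_distrib)
 also have "m ^ p <= a ^ p + b ^ p + c ^ p"
	using zero_le_power[OF assms(1), of p] zero_le_power[OF assms(2), of p] zero_le_power[OF assms(3), of p]
	by (auto simp: m_def max_def)
 finally show ?thesis by simp
qed

lemma jensen_power: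
 fixes f K :: "'a => real"
 assumes p: "p = 1 \<or> p = 2" and [measurable]: "f : borel_measurable N"
	and K: "!!x. 0 <= K x" "integrable N K" "(\<integral>x. K x \<partial>N) = 1"
	and Kf: "integrable N (%x. K x * f x)"
 shows "ennreal (abs (\<integral>x. K x * f x \<partial>N) ^ p) <= (\<integral>\<^sup>+x. ennreal (K x) * ennreal (abs (f x) ^ p) \<partial>N)"
proof -
 have [measurable]: "K : borel_measurable N" using K(2) by auto
 have eq: "ennreal (K x) * ennreal (abs (f x) ^ p) = ennreal (K x * abs (f x) ^ p)" for x
	using K(1) by (simp add: ennreal_mult)
 show ?thesis
 proof (cases "p = 1")
	case True
	have "ennreal (abs (\<integral>x. K x * f x \<partial>N)) <= (\<integral>\<^sup>+x. ennreal (norm (K x * f x)) \<partial>N)"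
	 using integral_norm_bound_ennreal[OF Kf] by simp
	thus ?thesis unfolding eq using True K(1) by (simp add: abs_mult)
 next
	case False
	hence p2: "p = 2" using p by simp
	show ?thesis
	proof (cases "(\<integral>\<^sup>+x. ennreal (K x * abs (f x) ^ p) \<partial>N) = \<infinity>")
	 case True
	 thus ?thesis unfolding eq by simp
	next
	 case False
	 hence i: "integrable N (%x. K x * (f x)^2)"
		using K(1) by (intro integrableI_nonneg) (auto simp: p2 less_top)
	 define a where "a = (\<integral>x. K x * f x \<partial>N)"
	 have "0 <= (\<integral>x. K x * (f x - a)^2 \<partial>N)" using K(1) by (intro integral_nonneg_AE) auto
	 also have "... = (\<integral>x. K x * (f x)^2 - 2 * a * (K x * f x) + a^2 * K x \<partial>N)"
		by (intro cong_integral refl) (simp add: power2_eq_square algebra_simps)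
	 also have "... = (\<integral>x. K x * (f x)^2 \<partial>N) - 2 * a * a + a^2"
		using i Kf K(2,3) by (simp add: a_def)
	 finally have "a^2 <= (\<integral>x. K x * (f x)^2 \<partial>N)" by (simp add: power2_eq_square)
	 hence "ennreal (a^2) <= ennreal (\<integral>x. K x * (f x)^2 \<partial>N)" by (rule ennreal_leI)
	 also have "... = (\<integral>\<^sup>+x. ennreal (K x * (f x)^2) \<partial>N)"
		using i K(1) by (intro nn_integral_eq_integral[symmetric]) auto
	 finally show ?thesis unfolding eq by (simp add: p2 a_def)
	qed
 qed
qed

context flat_torus
begin

lemma LMeas_of_borel: "f : BMeas ==> f : LMeas"
 by (intro measurable_completion) simp

definition modulus :: "nat => (real^2 => real) => real^2 => ennreal" where
 "modulus p u h = (\<oint>+x. ennreal (abs (u (x + h) - u x) ^ p))"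

lemma measurable_translated_difference:
 fixes u :: "real^2 => real"
 assumes [measurable]: "u : BMeas"
 shows "(%(h, x). u (x + h) - u x) : borel_measurable (M \<Otimes>\<^sub>M M)"
	and "(%x. u (x + h) - u x) : Meas"
	and "(%h. u (x + h) - u x) : Meas"
proof -
 have id: "(%x. x) : M \<rightarrow>\<^sub>M borel" by (rule measurable_borel_M) simp
 have f: "(%z. fst z) : M \<Otimes>\<^sub>M M \<rightarrow>\<^sub>M borel" and g: "(%z. snd z) : M \<Otimes>\<^sub>M M \<rightarrow>\<^sub>M borel"
	using measurable_compose[OF measurable_fst id] measurable_compose[OF measurable_snd id] by auto
 note u = assms
 have c: "(%z. u (f z + g z) - u (g' z)) : borel_measurable N"
	if "f : N \<rightarrow>\<^sub>M borel" "g : N \<rightarrow>\<^sub>M borel" "g' : N \<rightarrow>\<^sub>M borel" for f g g' :: "'b => real^2" and N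
 proof -
	have "(%z. f z + g z) : N \<rightarrow>\<^sub>M borel" using that by measurable
	hence [measurable]: "(%z. u (f z + g z)) : borel_measurable N" "(%z. u (g' z)) : borel_measurable N"
	 using measurable_compose[OF _ u] that(3) by blast+
	show ?thesis by measurable
 qed
 show "(%(h, x). u (x + h) - u x) : borel_measurable (M \<Otimes>\<^sub>M M)"
	unfolding case_prod_beta by (rule c[OF g f g])
 show "(%x. u (x + h) - u x) : Meas"
	by (rule c[OF id _ id]) simp
 show "(%h. u (x + h) - u x) : Meas"
	by (rule c[OF _ id]) simp_all
qed

lemma modulus_measurable [measurable]:
 assumes [measurable]: "u : BMeas"
 shows "modulus p u : Meas"
proof -
 note [measurable] = measurable_translated_difference[OF assms]
 have "(%(h, x). ennreal (abs (u (x + h) - u x) ^ p)) : borel_measurable (M \<Otimes>\<^sub>M M)"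
	using measurable_translated_difference(1)[OF assms] unfolding case_prod_beta by measurable
 thus ?thesis unfolding modulus_def[abs_def] by (rule M.borel_measurable_nn_integral)
qed

lemma conv_as_average:
 assumes u [measurable]: "u : BMeas" and per: "periodic u"
	and K: "K : trig" "!!h. K (- h) = K h"
 shows "conv u K x = (\<oint>h. K h * u (x + h))"
proof -
 have [measurable]: "K : BMeas" using C1D(6)[OF trig_C1[OF K(1)]] .
 let ?f = "%y. u y * K (x - y)"
 have "?f : LMeas" by (rule LMeas_of_borel) measurable
 moreover have "periodic ?f"
	using per trig_periodic[OF reflected_shift_trig[OF K(1)], of x] by (simp add: periodic_def)
 ultimately have "(\<oint>y. ?f (y + x)) = conv u K x"
	unfolding conv_def by (rule integral_M_translation)
 moreover have "?f (y + x) = K y * u (x + y)" for y using K(2)[of y] by (simp add: add.commute)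
 ultimately show ?thesis by simp
qed

lemma conv_error:
 assumes p: "p = 1 \<or> p = 2" and u [measurable]: "u : BMeas" and per: "periodic u"
	and ui: "Integ u"
	and K: "K : trig" "!!h. K (- h) = K h" "!!h. 0 <= K h" "(\<oint>h. K h) = 1"
 shows "(\<oint>+x. ennreal (abs (conv u K x - u x) ^ p)) <= (\<oint>+h. ennreal (K h) * modulus p u h)"
proof -
 interpret MM: pair_sigma_finite M M ..
 have [measurable]: "K : BMeas" using C1D(6)[OF trig_C1[OF K(1)]] .
 have [measurable]: "K : Meas" by (rule measurable_borel_M) measurable
 have Ki: "Integ K"
	using integrable_mult_trig[OF _ K(1), of "%_. 1"] by simp
 note md = measurable_translated_difference[OF u]
 have pt: "ennreal (abs (conv u K x - u x) ^ p) <= (\<oint>+h. ennreal (K h) * ennreal (abs (u (x + h) - u x) ^ p))" for x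
 proof -
	have "Integ (%h. u (h + x))"
	 using integral_M_translation(1)[OF LMeas_of_borel[OF u] per] ui by blast
	hence i1: "Integ (%h. u (x + h) * K h)"
	 using integrable_mult_trig[OF _ K(1)] by (simp add: add.commute)
	have i: "Integ (%h. K h * (u (x + h) - u x))"
	 using i1 Ki by (simp add: right_diff_distrib mult.commute)
	have "conv u K x - u x = (\<oint>h. K h * (u (x + h) - u x))"
	 using i1 Ki K(4) by (simp add: conv_as_average[OF u per K(1,2)] right_diff_distrib mult.commute)
	thus ?thesis
	 using jensen_power[OF p md(3) K(3) Ki K(4) i] by simp
 qed
 have m2: "(%(h, x). ennreal (K h) * ennreal (abs (u (x + h) - u x) ^ p)) : borel_measurable (M \<Otimes>\<^sub>M M)"
	using md(1) unfolding case_prod_beta by measurable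
 have "(\<oint>+x. ennreal (abs (conv u K x - u x) ^ p))
	 <= (\<oint>+x. (\<oint>+h. ennreal (K h) * ennreal (abs (u (x + h) - u x) ^ p)))"
	by (intro nn_integral_mono pt)
 also have "... = (\<oint>+h. (\<oint>+x. ennreal (K h) * ennreal (abs (u (x + h) - u x) ^ p)))"
	using MM.Fubini'[OF m2] by simp
 also have "... = (\<oint>+h. ennreal (K h) * modulus p u h)"
 proof (unfold modulus_def, intro nn_integral_cong nn_integral_cmult)
	fix h
	show "(%x. ennreal (abs (u (x + h) - u x) ^ p)) : Meas"
	 by (intro measurable_compose[OF _ measurable_ennreal] borel_measurable_power borel_measurable_abs md(2))
 qed
 finally show ?thesis .
qed

lemma modulus_lattice:
 assumes "periodic u"
 shows "modulus p u (h - lat g) = modulus p u h"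
proof -
 have "u (x + (h - lat g)) = u (x + h)" for x
 proof -
	have "u ((x + h) + lat (- g)) = u (x + h)" using assms unfolding periodic_def by blast
	thus ?thesis by (simp add: lattice_vec_uminus algebra_simps)
 qed
 thus ?thesis by (simp add: modulus_def)
qed

text \<open>Continuous functions approximate \<open>u\<close> in the mean and are uniformly continuous on bounded sets.\<close>

lemma modulus_continuous_bounded:
 assumes u: "u : LMeas" and R: "!!x. abs (u x) <= R" and eta: "eta > 0" and p: "p > 0"
 shows "EX rho>0. ALL h. norm h < rho --> modulus p u h <= ennreal eta"
proof -
 define r where "r = norm per1 + norm per2 + 1"
 define S where "S = (cball 0 r :: (real^2) set)"
 have S: "S : sets lebesgue" "S : lmeasurable" by (auto simp: S_def)
 have QS: "x + h : S" if "x : Q" "norm h <= 1" for x h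
	using norm_cell[OF that(1)] that(2) norm_triangle_ineq[of x h] by (simp add: S_def r_def)
 have R0: "0 <= R" using R[of 0] by linarith
 interpret L: finite_measure "lebesgue_on S" by (rule finite_measure_lebesgue_on[OF S(2)])
 obtain Z g where Z: "negligible Z" and g: "!!n. continuous_on UNIV (g n)"
	"!!x. x ~: Z ==> (%n. g n x) ----> u x"
	using lebesgue_measurable_imp_measurable_on_real[OF u, of UNIV] unfolding measurable_on_def by auto
 define G where "G n x = max (- R) (min R (g n x))" for n :: nat and x
 have Gc: "continuous_on UNIV (G n)" for n unfolding G_def by (intro continuous_intros g)
 have Gb: "abs (G n x) <= R" for n x using R0 by (auto simp: G_def)
 have Gl: "(%n. G n x) ----> u x" if "x ~: Z" for x
 proof -
	have "(%n. G n x) ----> max (- R) (min R (u x))"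
	 unfolding G_def by (intro tendsto_max tendsto_min tendsto_const g(2) that)
	moreover have "max (- R) (min R (u x)) = u x" using R[of x] by auto
	ultimately show ?thesis by simp
 qed
 have um: "u : borel_measurable (lebesgue_on S)" using u by (rule measurable_restrict_space1)
 have Gm: "G n : LMeas" for n
	using borel_measurable_continuous_onI[OF Gc] by (rule LMeas_of_borel)
 have Gm': "G n : borel_measurable (lebesgue_on S)" for n by (rule measurable_restrict_space1[OF Gm])
 have "AE x in lebesgue_on S. x ~: Z"
	using Z by (intro AE_I'[of "Z \<inter> S"]) (auto simp: S negligible_iff_null_sets null_sets_restrict_space
		space_restrict_space intro!: null_set_Int2)
 have "(%n. \<integral>x. abs (u x - G n x) ^ p \<partial>lebesgue_on S) ----> (\<integral>x. 0 \<partial>lebesgue_on S)"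
 proof (rule integral_dominated_convergence[where w = "%_. (2 * R) ^ p"])
	show "AE x in lebesgue_on S. (%n. abs (u x - G n x) ^ p) ----> 0"
	 using \<open>AE x in lebesgue_on S. x ~: Z\<close>
	proof (rule AE_mp, intro AE_I2 impI)
	 fix x assume "x ~: Z"
	 have "(%n. abs (u x - G n x) ^ p) ----> abs (u x - u x) ^ p"
		by (intro tendsto_intros Gl \<open>x ~: Z\<close>)
	 moreover have "abs (u x - u x) ^ p = 0" using p by simp
	 ultimately show "(%n. abs (u x - G n x) ^ p) ----> 0" by (simp only:)
	qed
	show "AE x in lebesgue_on S. norm (abs (u x - G n x) ^ p) <= (2 * R) ^ p" for n
	proof (rule AE_I2)
	 fix x
	 have "abs (u x - G n x) <= 2 * R" using R[of x] Gb[of n x] by linarith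
	 hence "abs (u x - G n x) ^ p <= (2 * R) ^ p" by (intro power_mono) auto
	 thus "norm (abs (u x - G n x) ^ p) <= (2 * R) ^ p" by (simp only: real_norm_def power_abs abs_abs)
	qed
 qed (use um Gm' in \<open>auto intro!: borel_measurable_power borel_measurable_diff borel_measurable_abs\<close>)
 moreover define kappa where "kappa = eta / (3 ^ p * (2 + area))"
 have kappa: "kappa > 0" using eta area_pos by (simp add: kappa_def)
 ultimately have "\<forall>\<^sub>F n in sequentially. (\<integral>x. abs (u x - G n x) ^ p \<partial>lebesgue_on S) < kappa"
	by (simp add: order_tendsto_iff)
 then obtain n where n: "(\<integral>x. abs (u x - G n x) ^ p \<partial>lebesgue_on S) < kappa"
	using eventually_happens trivial_limit_sequentially by blast
 define e where "e x = abs (u x - G n x) ^ p" for x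
 have em: "e : LMeas" unfolding e_def[abs_def] using u Gm[of n] by measurable
 have "integrable (lebesgue_on S) e"
 proof (rule L.integrable_const_bound[where B = "(2 * R) ^ p"])
	show "AE x in lebesgue_on S. norm (e x) <= (2 * R) ^ p"
	proof (rule AE_I2)
	 fix x
	 have "abs (u x - G n x) <= 2 * R" using R[of x] Gb[of n x] by linarith
	 hence "abs (u x - G n x) ^ p <= (2 * R) ^ p" by (intro power_mono) auto
	 thus "norm (e x) <= (2 * R) ^ p" by (simp only: e_def real_norm_def power_abs abs_abs)
	qed
 qed (rule measurable_restrict_space1[OF em])
 hence "(\<integral>\<^sup>+x. ennreal (e x) \<partial>lebesgue_on S) = ennreal (\<integral>x. e x \<partial>lebesgue_on S)"
	by (rule nn_integral_eq_integral) (simp add: e_def)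
 also have "... <= ennreal kappa" using n unfolding e_def by (intro ennreal_leI less_imp_le)
 finally have eS: "(\<integral>\<^sup>+x. ennreal (e x) * indicator S x \<partial>lebesgue) <= ennreal kappa"
	using S(1) by (simp add: nn_integral_restrict_space)
 have eQ: "(\<oint>+x. ennreal (e (x + h))) <= ennreal kappa" if h: "norm h <= 1" for h
 proof -
	have sm: "(%x. ennreal (e x) * indicator S x) : LMeas"
	 using em S by measurable
	have "(\<oint>+x. ennreal (e (x + h))) <= (\<integral>\<^sup>+x. ennreal (e (x + h)) * indicator S (x + h) \<partial>lebesgue)"
	 unfolding nn_integral_M using QS[OF _ h] by (intro nn_integral_mono) (auto simp: indicator_def)
	also have "... = (\<integral>\<^sup>+x. ennreal (e x) * indicator S x \<partial>lebesgue)"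
	 by (rule nn_integral_lebesgue_translation[OF sm])
	finally show ?thesis using eS by simp
 qed
 define kappa' where "kappa' = root p kappa"
 have kappa': "kappa' > 0" "kappa' ^ p = kappa" using kappa p by (auto simp: kappa'_def)
 have "uniformly_continuous_on S (G n)"
	unfolding S_def using Gc by (intro compact_uniformly_continuous) (auto intro: continuous_on_subset)
 then obtain d where d: "d > 0" "!!x y. x : S ==> y : S ==> dist y x < d ==> dist (G n y) (G n x) < kappa'"
	unfolding uniformly_continuous_on_def using kappa'(1) by metis
 show ?thesis
 proof (intro exI[of _ "min d 1"] conjI allI impI)
	show "0 < min d 1" using d(1) by simp
	fix h :: "real^2" assume h: "norm h < min d 1"
	have pt: "ennreal (abs (u (x + h) - u x) ^ p) <= ennreal (3 ^ p) * (ennreal (e (x + h)) + ennreal kappa + ennreal (e (x + 0)))"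
	 if x: "x : Q" for x
	proof -
	 have "dist (G n (x + h)) (G n x) < kappa'"
		using QS[OF x, of 0] QS[OF x, of h] h by (intro d(2)) (auto simp: dist_norm)
	 hence "abs (G n (x + h) - G n x) ^ p <= kappa"
		unfolding kappa'(2)[symmetric] by (intro power_mono) (auto simp: dist_real_def)
	 have "abs (u (x + h) - u x) ^ p <= (abs (u (x + h) - G n (x + h)) + abs (G n (x + h) - G n x) + abs (u x - G n x)) ^ p"
		by (intro power_mono) auto
	 also have "... <= 3 ^ p * (e (x + h) + abs (G n (x + h) - G n x) ^ p + e x)"
		unfolding e_def by (rule sum3_power_le) auto
	 also have "... <= 3 ^ p * (e (x + h) + kappa + e x)"
		using \<open>\<bar>G n (x + h) - G n x\<bar> ^ p <= kappa\<close> by simp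
	 finally have "ennreal (abs (u (x + h) - u x) ^ p) <= ennreal (3 ^ p * (e (x + h) + kappa + e x))" by (rule ennreal_leI)
	 also have "... = ennreal (3 ^ p) * (ennreal (e (x + h)) + ennreal kappa + ennreal (e (x + 0)))"
		using kappa by (simp add: ennreal_mult ennreal_plus[symmetric] e_def del: ennreal_plus)
	 finally show ?thesis .
	qed
	have me: "(%x. ennreal (e (x + h))) : Meas" for h
	 using measurable_shift[OF em, of h] by (intro measurable_lebesgue_M measurable_compose[OF _ measurable_ennreal])
	have "modulus p u h <= (\<oint>+x. ennreal (3 ^ p) * (ennreal (e (x + h)) + ennreal kappa + ennreal (e (x + 0))))"
	 unfolding modulus_def by (intro nn_integral_mono pt) simp
	also have "... = ennreal (3 ^ p) * ((\<oint>+x. ennreal (e (x + h))) + ennreal kappa * emeasure M Q + (\<oint>+x. ennreal (e (x + 0))))"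
	 using me[of h] me[of 0] by (simp add: nn_integral_cmult nn_integral_add)
	also have "... <= ennreal (3 ^ p) * (ennreal kappa + ennreal kappa * ennreal area + ennreal kappa)"
	 using h by (intro mult_left_mono add_mono eQ) (auto simp: M.emeasure_eq_measure area_def)
	also have "... = ennreal (3 ^ p * (kappa + kappa * area + kappa))"
	 using kappa area_pos by (simp add: ennreal_mult[symmetric] ennreal_plus[symmetric] del: ennreal_plus)
	also have "3 ^ p * (kappa + kappa * area + kappa) = 3 ^ p * (2 + area) * kappa" by (simp add: algebra_simps)
	also have "... = eta" using area_pos by (simp add: kappa_def)
	finally show "modulus p u h <= ennreal eta" .
 qed
qed

end

lemma ennreal_double: "2 * ennreal x = ennreal (2 * x)" if "0 <= x"
 using that by (simp add: ennreal_mult)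

lemma ennreal_mult_double:
 assumes "0 <= c" "0 <= x"
 shows "ennreal c * (2 * ennreal x) = ennreal (c * (2 * x))"
 unfolding ennreal_double[OF assms(2)] using assms by (intro ennreal_mult[symmetric]) simp_all

lemma ennreal_mult_triple:
 assumes "0 <= c" "0 <= x"
 shows "ennreal c * (2 * ennreal x + ennreal x) = ennreal (c * (2 * x + x))"
proof -
 have "2 * ennreal x + ennreal x = ennreal (2 * x + x)"
	unfolding ennreal_double[OF assms(2)] using assms(2) by (intro ennreal_plus[symmetric]) simp_all
 thus ?thesis using assms by (simp only: ennreal_mult[symmetric] add_nonneg_nonneg mult_nonneg_nonneg)
qed

context flat_torus
begin

section \<open>Square integrable functions\<close>

lemma L2_iff: "u : L2 \<longleftrightarrow>
	periodic u & u : LMeas & Integ (%x. (u x)^2)"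
 by (simp add: periodic_L2_def doubly_periodic_iff set_integrable_M)

lemma L1_iff: "u : periodic_L1 per1 per2 \<longleftrightarrow>
	periodic u & u : LMeas & Integ u"
 by (simp add: periodic_L1_def doubly_periodic_iff set_integrable_M)

lemma L2D:
 assumes "u : L2"
 shows "periodic u" "u : LMeas" "u : Meas"
	"Integ (%x. (u x)^2)" "Integ u"
proof -
 show 1: "periodic u" "u : LMeas" "Integ (%x. (u x)^2)"
	using assms by (auto simp: L2_iff)
 show 2: "u : Meas" by (rule measurable_lebesgue_M[OF 1(2)])
 show "Integ u" by (rule M.square_integrable_imp_integrable[OF 2 1(3)])
qed

lemma L2_product_integrable:
 fixes u v :: "real^2 => real"
 assumes [measurable]: "u : Meas" "v : Meas"
	and "Integ (%x. (u x)^2)" "Integ (%x. (v x)^2)"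
 shows "Integ (%x. u x * v x)"
proof (rule bound_integrable)
 show "Integ (%x. (u x)^2 + (v x)^2)" using assms by simp
 have "abs (u x * v x) <= (u x)^2 + (v x)^2" for x
 proof -
	have "2 * (abs (u x) * abs (v x)) <= (u x)^2 + (v x)^2"
	 using sum_squares_bound[of "abs (u x)" "abs (v x)"] by (simp add: mult.assoc)
	moreover have "0 <= abs (u x) * abs (v x)" by simp
	ultimately show ?thesis unfolding abs_mult by linarith
 qed
 thus "AE x in M. norm (u x * v x) <= norm ((u x)^2 + (v x)^2)"
	by (intro AE_I2) (simp add: order_trans[OF _ abs_ge_self])
qed measurable

lemma L2_add:
 assumes u: "u : L2" and v: "v : L2"
 shows "(%x. u x + v x) : L2"
proof -
 have "Integ (%x. (u x)^2 + 2 * (u x * v x) + (v x)^2)"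
	using L2D[OF u] L2D[OF v]
	by (intro add_integrable integrable_mult_right L2_product_integrable)
 thus ?thesis using L2D[OF u] L2D[OF v]
	by (auto simp: L2_iff periodic_def power2_sum algebra_simps)
qed

lemma L2_cmult: "u : L2 ==> (%x. c * u x) : L2"
 by (auto simp: L2_iff periodic_def power_mult_distrib)

lemma L2_diff:
 assumes u: "u : L2" and v: "v : L2"
 shows "(%x. u x - v x) : L2"
 using L2_add[OF u L2_cmult[OF v, of "-1"]] by simp

lemma continuous_periodic_L2:
 fixes f :: "real^2 => real"
 assumes "periodic f" "continuous_on UNIV f"
 shows "f : L2"
proof -
 obtain B where B: "!!x. abs (f x) <= B" using periodic_continuous_bounded[OF assms] by blast
 have m: "f : BMeas" using assms(2) by (rule borel_measurable_continuous_onI)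
 have "Integ (%x. f x * f x)"
	by (rule integrable_M_mult_bounded, rule integrable_M_bounded)
	 (use B m in \<open>auto intro!: measurable_borel_M\<close>)
 thus ?thesis using assms(1) LMeas_of_borel[OF m] by (simp add: L2_iff power2_eq_square)
qed

lemma C1_periodic_L2: "C1p f ==> f : L2"
 "C1p f ==> pd k f : L2"
proof -
 show "C1p f ==> f : L2"
	by (rule continuous_periodic_L2[OF C1D(1) C1D(3)])
 show "C1p f ==> pd k f : L2"
	by (rule continuous_periodic_L2[OF C1D(5) C1D(4)])
qed

lemma nn_integral_abs_power2:
 "(\<oint>+x. ennreal (abs (u x) ^ 2)) = ennreal (\<oint>x. (u x)^2)" if "Integ (%x. (u x)^2)"
 using nn_integral_eq_integral[OF that] by simp

section \<open>Mollification\<close>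

lemma modulus_perturb:
 assumes u: "u : LMeas" "periodic u" and w: "w : LMeas" "periodic w"
 shows "modulus p u h <= ennreal (3 ^ p) * (2 * (\<oint>+x. ennreal (abs (u x - w x) ^ p)) + modulus p w h)"
proof -
 let ?e = "%x. ennreal (abs (u x - w x) ^ p)"
 have em: "?e : LMeas"
	using u w by measurable
 have ep: "periodic ?e" using u w by (simp add: periodic_def)
 have sh: "(%x. w (x + h)) : LMeas" "(%x. ?e (x + h)) : LMeas"
	by (rule measurable_shift[OF w(1)], rule measurable_shift[OF em])
 have me: "?e : Meas" "(%x. ?e (x + h)) : Meas"
	"(%x. ennreal (abs (w (x + h) - w x) ^ p)) : Meas"
	using em sh w(1) by (intro measurable_lebesgue_M; measurable)+
 have pt: "ennreal (abs (u (x + h) - u x) ^ p) <= ennreal (3 ^ p) * (?e (x + h) + ?e x + ennreal (abs (w (x + h) - w x) ^ p))" for x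
 proof -
	have "abs (u (x + h) - u x) ^ p <= (abs (u (x + h) - w (x + h)) + abs (u x - w x) + abs (w (x + h) - w x)) ^ p"
	 by (intro power_mono) auto
	also have "... <= 3 ^ p * (abs (u (x + h) - w (x + h)) ^ p + abs (u x - w x) ^ p + abs (w (x + h) - w x) ^ p)"
	 by (rule sum3_power_le) auto
	finally have "ennreal (abs (u (x + h) - u x) ^ p) <= ennreal (3 ^ p * (abs (u (x + h) - w (x + h)) ^ p + abs (u x - w x) ^ p + abs (w (x + h) - w x) ^ p))"
	 by (rule ennreal_leI)
	thus ?thesis by (simp add: ennreal_mult ennreal_plus[symmetric] del: ennreal_plus)
 qed
 have "modulus p u h <= (\<oint>+x. ennreal (3 ^ p) * (?e (x + h) + ?e x + ennreal (abs (w (x + h) - w x) ^ p)))"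
	unfolding modulus_def by (intro nn_integral_mono pt)
 also have "... = ennreal (3 ^ p) * ((\<oint>+x. ?e (x + h)) + (\<oint>+x. ?e x) + modulus p w h)"
	using me by (simp add: nn_integral_cmult nn_integral_add modulus_def)
 also have "(\<oint>+x. ?e (x + h)) = (\<oint>+x. ?e x)"
	by (rule nn_integral_M_translation[OF em ep])
 finally show ?thesis by (simp add: mult_2)
qed

lemma modulus_bound:
 assumes u: "u : LMeas" "periodic u" and p: "p > 0"
 shows "modulus p u h <= ennreal (3 ^ p) * (2 * (\<oint>+x. ennreal (abs (u x) ^ p)))"
proof -
 have "modulus p (%_. 0) h = 0" using p by (simp add: modulus_def)
 thus ?thesis using modulus_perturb[OF u, of "%_. 0" p h] by (simp add: periodic_def)
qed

lemma modulus_continuous: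
 assumes u: "u : LMeas" "periodic u" and p: "p > 0"
	and i: "Integ (%x. abs (u x) ^ p)" and eta: "eta > 0"
 shows "EX rho>0. ALL h. norm h < rho --> modulus p u h <= ennreal eta"
proof -
 define t where "t R x = max (- real R) (min (real R) (u x))" for R :: nat and x
 have tm: "t R : LMeas" for R unfolding t_def[abs_def] using u(1) by measurable
 have tp: "periodic (t R)" for R using u(2) by (simp add: periodic_def t_def)
 define kappa where "kappa = eta / (3 ^ p * 3)"
 have kappa: "kappa > 0" using eta by (simp add: kappa_def)
 have [measurable]: "u : Meas" "t R : Meas" for R
	using u tm by (auto intro: measurable_lebesgue_M)
 have bd: "abs (u x - t R x) <= abs (u x)" for R x by (auto simp: t_def)
 have "(%R. \<integral>x. abs (u x - t R x) ^ p \<partial>M) ----> (\<oint>x. 0)"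
 proof (rule integral_dominated_convergence[where w = "%x. abs (u x) ^ p"])
	show "AE x in M. norm (abs (u x - t R x) ^ p) <= abs (u x) ^ p" for R
	proof (rule AE_I2)
	 fix x
	 have "abs (u x - t R x) ^ p <= abs (u x) ^ p" using bd by (intro power_mono) simp_all
	 thus "norm (abs (u x - t R x) ^ p) <= abs (u x) ^ p"
		by (simp only: real_norm_def power_abs abs_abs)
	qed
	show "AE x in M. (%R. abs (u x - t R x) ^ p) ----> 0"
	proof (rule AE_I2)
	 fix x
	 obtain N :: nat where "abs (u x) <= real N" using real_arch_simple by blast
	 hence "t R x = u x" if "R >= N" for R using that by (auto simp: t_def)
	 hence "\<forall>\<^sub>F R in sequentially. abs (u x - t R x) ^ p = 0"
		using p by (intro eventually_sequentiallyI[of N]) simp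
	 thus "(%R. abs (u x - t R x) ^ p) ----> 0" by (rule tendsto_eventually)
	qed
 qed (use i in auto)
 hence "\<forall>\<^sub>F R in sequentially. (\<oint>x. abs (u x - t R x) ^ p) < kappa"
	using kappa by (simp add: order_tendsto_iff)
 then obtain R where R: "(\<oint>x. abs (u x - t R x) ^ p) < kappa"
	using eventually_happens trivial_limit_sequentially by blast
 have "Integ (%x. abs (u x - t R x) ^ p)"
 proof (rule bound_integrable[OF i])
	show "AE x in M. norm (abs (u x - t R x) ^ p) <= norm (abs (u x) ^ p)"
	proof (rule AE_I2)
	 fix x
	 have "abs (u x - t R x) ^ p <= abs (u x) ^ p" using bd by (intro power_mono) simp_all
	 thus "norm (abs (u x - t R x) ^ p) <= norm (abs (u x) ^ p)"
		by (simp only: real_norm_def power_abs abs_abs)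
	qed
 qed measurable
 hence "(\<oint>+x. ennreal (abs (u x - t R x) ^ p)) = ennreal (\<oint>x. abs (u x - t R x) ^ p)"
	by (rule nn_integral_eq_integral) simp
 also have "... <= ennreal kappa" using R by (intro ennreal_leI less_imp_le)
 finally have e: "(\<oint>+x. ennreal (abs (u x - t R x) ^ p)) <= ennreal kappa" .
 have "abs (t R x) <= real R" for x by (auto simp: t_def)
 from modulus_continuous_bounded[OF tm this kappa p]
 obtain rho where rho: "rho > 0" "!!h. norm h < rho ==> modulus p (t R) h <= ennreal kappa" by blast
 show ?thesis
 proof (intro exI[of _ rho] conjI allI impI)
	fix h :: "real^2" assume h: "norm h < rho"
	have "2 * (\<oint>+x. ennreal (abs (u x - t R x) ^ p)) <= 2 * ennreal kappa"
	 by (rule mult_left_mono[OF e]) simp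
	from mult_left_mono[OF add_mono[OF this rho(2)[OF h]] zero_le, of "ennreal (3 ^ p)"]
	have "modulus p u h <= ennreal (3 ^ p) * (2 * ennreal kappa + ennreal kappa)"
	 by (intro order_trans[OF modulus_perturb[OF u tm[of R] tp[of R], of p h]]) blast
	also have "... = ennreal (3 ^ p * (2 * kappa + kappa))"
	 using kappa by (intro ennreal_mult_triple) simp_all
	also have "3 ^ p * (2 * kappa + kappa) = eta" by (simp add: kappa_def)
	finally show "modulus p u h <= ennreal eta" .
 qed (rule rho(1))
qed

lemma conv_cong_AE:
 assumes "AE x in M. u x = u' x" "u : Meas" "u' : Meas" "K : trig"
 shows "conv u K = conv u' K"
proof
 fix x
 have [measurable]: "(%y. K (x - y)) : Meas"
	using C1D(6)[OF trig_C1[OF reflected_shift_trig[OF assms(4)]]] by (rule measurable_borel_M)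
 note [measurable] = assms(2,3)
 show "conv u K x = conv u' K x"
	unfolding conv_def using assms(1) by (intro integral_cong_AE) auto
qed

lemma mollification_converges:
 assumes p: "p = 1 \<or> p = 2" and u: "u : LMeas" "periodic u"
	and i: "Integ (%x. abs (u x) ^ p)" and eta: "eta > 0"
 shows "EX m0. ALL m>=m0. (\<oint>+x. ennreal (abs (conv u (kern m) x - u x) ^ p)) <= ennreal eta"
proof -
 obtain u' where u': "u' : BMeas" "periodic u'" "AE x in M. u x = u' x"
	using borel_representative[OF u] .
 have um [measurable]: "u : Meas" "u' : Meas"
	using u(1) u'(1) by (auto intro: measurable_lebesgue_M measurable_borel_M)
 have i': "Integ (%x. abs (u' x) ^ p)"
 proof -
	have "AE x in M. abs (u x) ^ p = abs (u' x) ^ p" using u'(3) by (rule AE_mp) (intro AE_I2 impI, simp)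
	hence "Integ (%x. abs (u x) ^ p) \<longleftrightarrow> Integ (%x. abs (u' x) ^ p)"
	 by (intro integrable_cong_AE borel_measurable_power borel_measurable_abs um)
	thus ?thesis using i by blast
 qed
 have "Integ u'"
 proof (cases "p = 1")
	case True
	thus ?thesis using i' integrable_abs_iff[OF um(2)] by simp
 next
	case False
	hence "p = 2" using p by simp
	hence "Integ (%x. (u' x)^2)" using i' by simp
	thus ?thesis by (rule M.square_integrable_imp_integrable[OF um(2)])
 qed
 define B where "B = 3 ^ p * (2 * (\<oint>x. abs (u' x) ^ p))"
 have B: "B >= 0" by (simp add: B_def)
 have u'l: "u' : LMeas" using u'(1) by (rule LMeas_of_borel)
 have p0: "p > 0" using p by auto
 have mb: "modulus p u' h <= ennreal B" for h
 proof -
	have "modulus p u' h <= ennreal (3 ^ p) * (2 * ennreal (\<oint>x. abs (u' x) ^ p))"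
	 using modulus_bound[OF u'l u'(2) p0, of h] unfolding nn_integral_eq_integral[OF i' AE_I2[OF zero_le_power[OF abs_ge_zero]]] .
	also have "... = ennreal B" unfolding B_def by (intro ennreal_mult_double) simp_all
	finally show ?thesis .
 qed
 have eta2: "eta / 2 > 0" using eta by simp
 obtain rho where rho: "rho > 0" "!!h. norm h < rho ==> modulus p u' h <= ennreal (eta/2)"
	using modulus_continuous[OF u'l u'(2) p0 i' eta2] by blast
 have near: "modulus p u' h <= ennreal (eta/2)" if "norm (h - lat g) < rho" for h g
	using rho(2)[OF that] unfolding modulus_lattice[OF u'(2)] .
 define kappa where "kappa = eta / (2 * (B + 1))"
 have kappa: "kappa > 0" "B * kappa <= eta / 2" using eta B by (auto simp: kappa_def field_simps)
 obtain m0 where m0: "ALL m>=m0. ALL W e B. W : Meas --> 0 <= e --> 0 <= B -->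
	(ALL h g. norm (h - lat g) < rho --> W h <= ennreal e) --> (ALL h. W h <= ennreal B) -->
	(\<oint>+h. ennreal (kern m h) * W h) <= ennreal (e + B * kappa)"
	using kern_average[OF rho(1) kappa(1)] by (elim exE)
 show ?thesis
 proof (intro exI[of _ m0] allI impI)
	fix m assume m: "m >= m0"
	have "AE x in M. ennreal (abs (conv u' (kern m) x - u x) ^ p) = ennreal (abs (conv u' (kern m) x - u' x) ^ p)"
	 using u'(3) by (rule AE_mp) (intro AE_I2 impI, simp)
	hence "(\<oint>+x. ennreal (abs (conv u (kern m) x - u x) ^ p)) = (\<oint>+x. ennreal (abs (conv u' (kern m) x - u' x) ^ p))"
	 unfolding conv_cong_AE[OF u'(3) um kern_trig] by (rule nn_integral_cong_AE)
	also have "... <= (\<oint>+h. ennreal (kern m h) * modulus p u' h)"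
	 by (rule conv_error[OF p u'(1,2) \<open>Integ u'\<close> kern_trig kern_even kern_nonneg kern_integral(1)])
	also have "... <= ennreal (eta/2 + B * kappa)"
	proof (rule m0[rule_format, OF m])
	 show "modulus p u' : Meas" by (rule modulus_measurable[OF u'(1)])
	 show "0 <= eta/2" using eta by simp
	qed (rule B, erule near, rule mb)
	also have "... <= ennreal eta" using kappa(2) by (intro ennreal_leI) simp
	finally show "(\<oint>+x. ennreal (abs (conv u (kern m) x - u x) ^ p)) <= ennreal eta" .
 qed
qed


section \<open>Translation estimate\<close>

lemma norm_sq_vec2: "(norm h)^2 = (SUM k:UNIV. (h$k)^2)" for h :: "real^2"
 unfolding power2_norm_eq_inner inner_vec_def by (simp add: power2_eq_square)

definition grad_sq :: "(real^2 => real) => real^2 => real" where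
 "grad_sq v x = (SUM k:UNIV. (pd k v x)^2)"

lemma grad_sq_facts:
 assumes "C1p v"
 shows "continuous_on UNIV (grad_sq v)" "periodic (grad_sq v)" "0 <= grad_sq v x"
	"grad_sq v : BMeas" "Integ (grad_sq v)"
proof -
 show c: "continuous_on UNIV (grad_sq v)" unfolding grad_sq_def[abs_def]
	by (intro continuous_intros C1D(4)[OF assms])
 show "periodic (grad_sq v)"
	using C1D(5)[OF assms] by (simp add: periodic_def grad_sq_def)
 show "0 <= grad_sq v x" by (simp add: grad_sq_def sum_nonneg)
 show "grad_sq v : BMeas" using c by (rule borel_measurable_continuous_onI)
 show "Integ (grad_sq v)" unfolding grad_sq_def[abs_def]
	by (intro sum_integrable L2D(4) C1_periodic_L2(2) assms)
qed

lemma C1_line_derivative: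
 assumes v: "C1p v"
 shows "((%t. v (x + t *\<^sub>R h)) has_real_derivative (SUM k:UNIV. pd k v (x + t *\<^sub>R h) * h$k)) (at t)"
	and "continuous_on UNIV (%t::real. SUM k:UNIV. pd k v (x + t *\<^sub>R h) * h$k)"
proof -
 have "((%t. v (x + t *\<^sub>R h)) has_derivative (%s. SUM k:UNIV. pd k v (x + t *\<^sub>R h) * (s *\<^sub>R h)$k)) (at t)"
	by (rule has_derivative_compose[OF _ has_derivative_partial[OF C1D(2)[OF v]]])
	 (auto intro!: derivative_eq_intros)
 moreover have "(SUM k:UNIV. pd k v (x + t *\<^sub>R h) * (s *\<^sub>R h)$k) = (SUM k:UNIV. pd k v (x + t *\<^sub>R h) * h$k) * s" for s
	unfolding sum_distrib_right by (rule sum.cong) (simp_all add: mult_ac)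
 ultimately show "((%t. v (x + t *\<^sub>R h)) has_real_derivative (SUM k:UNIV. pd k v (x + t *\<^sub>R h) * h$k)) (at t)"
	by (simp only: has_field_derivative_def)
 show "continuous_on UNIV (%t::real. SUM k:UNIV. pd k v (x + t *\<^sub>R h) * h$k)"
	by (intro continuous_intros continuous_on_compose2[OF C1D(4)[OF v]]) auto
qed

lemma translation_estimate_C1:
 assumes v: "C1p v"
 shows "modulus 2 v h <= ennreal ((norm h)^2 * (\<oint>x. grad_sq v x))"
proof -
 interpret MT: pair_sigma_finite M "lborel :: real measure" ..
 let ?I = "indicator {0..1::real} :: real => real"
 define f where "f x t = (SUM k:UNIV. pd k v (x + t *\<^sub>R h) * h$k)" for x and t :: real
 have fc: "continuous_on UNIV (f x)" for x
	using C1_line_derivative(2)[OF v] unfolding f_def[abs_def] .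
 have der: "((%t. v (x + t *\<^sub>R h)) has_real_derivative f x t) (at t)" for x t
	unfolding f_def by (rule C1_line_derivative(1)[OF v])
 have FTC: "(\<integral>t. f x t * ?I t \<partial>lborel) = v (x + 1 *\<^sub>R h) - v (x + 0 *\<^sub>R h)"
	"integrable lborel (%t. f x t * ?I t)" for x
 proof -
	have "has_bochner_integral lborel (%t. f x t * ?I t) (v (x + 1 *\<^sub>R h) - v (x + 0 *\<^sub>R h))"
	proof (rule has_bochner_integral_FTC_Icc_real)
	 show "isCont (f x) t" for t using fc[of x] by (simp add: continuous_on_eq_continuous_at)
	qed (simp, rule der)
	thus "(\<integral>t. f x t * ?I t \<partial>lborel) = v (x + 1 *\<^sub>R h) - v (x + 0 *\<^sub>R h)"
	 "integrable lborel (%t. f x t * ?I t)" unfolding has_bochner_integral_iff by blast+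
 qed
 have fm: "f x : borel_measurable lborel" for x
	using borel_measurable_continuous_onI[OF fc] by simp
 have Iint: "integrable lborel ?I" "(\<integral>t. ?I t \<partial>lborel) = 1" by simp_all
 have pt: "ennreal (abs (v (x + h) - v x) ^ 2) <= (\<integral>\<^sup>+t. ennreal (?I t) * ennreal ((norm h)^2 * grad_sq v (x + t *\<^sub>R h)) \<partial>lborel)" for x
 proof -
	have "ennreal (abs (\<integral>t. ?I t * f x t \<partial>lborel) ^ 2) <= (\<integral>\<^sup>+t. ennreal (?I t) * ennreal (abs (f x t) ^ 2) \<partial>lborel)"
	 using FTC(2)[of x] by (intro jensen_power fm Iint) (simp_all add: mult.commute)
	also have "... <= (\<integral>\<^sup>+t. ennreal (?I t) * ennreal ((norm h)^2 * grad_sq v (x + t *\<^sub>R h)) \<partial>lborel)"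
	proof (intro nn_integral_mono mult_left_mono ennreal_leI)
	 fix t
	 have "(f x t)^2 <= (SUM k:UNIV. (pd k v (x + t *\<^sub>R h))^2) * (SUM k:UNIV. (h$k)^2)"
		unfolding f_def by (rule Cauchy_Schwarz_ineq_sum)
	 thus "abs (f x t) ^ 2 <= (norm h)^2 * grad_sq v (x + t *\<^sub>R h)"
		unfolding norm_sq_vec2 grad_sq_def power2_abs by (simp only: mult.commute)
	qed simp
	finally show ?thesis using FTC(1)[of x] by (simp add: mult.commute)
 qed
 have gm: "grad_sq v : BMeas" and gp: "periodic (grad_sq v)" and g0: "0 <= grad_sq v x"
	and gi: "Integ (grad_sq v)" for x
	using grad_sq_facts[OF v] by auto
 have id: "(%x. x) : M \<rightarrow>\<^sub>M borel" by (rule measurable_borel_M) simp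
 have f1: "(%z. fst z) : M \<Otimes>\<^sub>M (lborel :: real measure) \<rightarrow>\<^sub>M borel"
	by (rule measurable_compose[OF measurable_fst id])
 have "(%z. fst z + snd z *\<^sub>R h) : M \<Otimes>\<^sub>M lborel \<rightarrow>\<^sub>M borel"
	by (rule borel_measurable_add[OF f1]) measurable
 from measurable_compose[OF this gm]
 have m2: "(%(x, t). ennreal (?I t) * ennreal ((norm h)^2 * grad_sq v (x + t *\<^sub>R h))) : borel_measurable (M \<Otimes>\<^sub>M lborel)"
	unfolding case_prod_beta by measurable
 have sec: "(\<oint>+x. ennreal (grad_sq v (x + t *\<^sub>R h))) = ennreal (\<oint>x. grad_sq v x)" for t
 proof -
	have "(\<oint>+x. ennreal (grad_sq v (x + t *\<^sub>R h))) = (\<oint>+x. ennreal (grad_sq v x))"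
	proof (rule nn_integral_M_translation)
	 show "(%x. ennreal (grad_sq v x)) : LMeas"
		by (rule measurable_compose[OF LMeas_of_borel[OF gm] measurable_ennreal])
	 show "periodic (%x. ennreal (grad_sq v x))" using gp by (simp add: periodic_def)
	qed
	also have "... = ennreal (\<oint>x. grad_sq v x)" using gi g0 by (intro nn_integral_eq_integral) auto
	finally show ?thesis .
 qed
 have secm: "(%x. ennreal (grad_sq v (x + t *\<^sub>R h))) : Meas" for t
	using measurable_shift[OF LMeas_of_borel[OF gm], of "t *\<^sub>R h"]
	by (intro measurable_lebesgue_M measurable_compose[OF _ measurable_ennreal])
 define G where "G = (\<oint>x. grad_sq v x)"
 have G0: "0 <= G" unfolding G_def by (rule integral_nonneg_AE) (simp add: g0)
 have "modulus 2 v h <= (\<oint>+x. (\<integral>\<^sup>+t. ennreal (?I t) * ennreal ((norm h)^2 * grad_sq v (x + t *\<^sub>R h)) \<partial>lborel))"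
	unfolding modulus_def by (intro nn_integral_mono pt)
 also have "... = (\<integral>\<^sup>+t. (\<oint>+x. ennreal (?I t) * ennreal ((norm h)^2 * grad_sq v (x + t *\<^sub>R h))) \<partial>lborel)"
	using MT.Fubini'[OF m2] by simp
 also have "... = (\<integral>\<^sup>+t. ennreal ((norm h)^2 * G) * indicator {0..1::real} t \<partial>lborel)"
 proof (rule nn_integral_cong)
	fix t :: real
	have "ennreal (?I t) * ennreal ((norm h)^2 * grad_sq v (x + t *\<^sub>R h)) =
	 ennreal (?I t * (norm h)^2) * ennreal (grad_sq v (x + t *\<^sub>R h))" for x
	proof -
	 have "ennreal (?I t) * ennreal ((norm h)^2 * grad_sq v (x + t *\<^sub>R h)) = ennreal (?I t * ((norm h)^2 * grad_sq v (x + t *\<^sub>R h)))"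
		using g0 by (intro ennreal_mult[symmetric]) simp_all
	 also have "... = ennreal (?I t * (norm h)^2) * ennreal (grad_sq v (x + t *\<^sub>R h))"
		unfolding mult.assoc[symmetric] using g0 by (intro ennreal_mult) simp_all
	 finally show ?thesis .
	qed
	hence "(\<oint>+x. ennreal (?I t) * ennreal ((norm h)^2 * grad_sq v (x + t *\<^sub>R h))) =
	 (\<oint>+x. ennreal (?I t * (norm h)^2) * ennreal (grad_sq v (x + t *\<^sub>R h)))"
	 by (simp only:)
	also have "... = ennreal (?I t * (norm h)^2) * ennreal G"
	 unfolding nn_integral_cmult[OF secm] sec G_def ..
	also have "... = ennreal ((norm h)^2 * G) * indicator {0..1} t"
	 using G0 by (cases "t : {0..1}") (simp_all add: ennreal_mult[symmetric])
	finally show "(\<oint>+x. ennreal (?I t) * ennreal ((norm h)^2 * grad_sq v (x + t *\<^sub>R h))) =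
	 ennreal ((norm h)^2 * G) * indicator {0..1} t" .
 qed
 also have "... = ennreal ((norm h)^2 * G)"
	by (subst nn_integral_cmult_indicator) simp_all
 finally show ?thesis unfolding G_def .
qed

section \<open>Density of trigonometric polynomials\<close>

abbreviation wp :: "2 => (real^2 => real) => real^2 => real" where
 "wp \<equiv> weak_partial per1 per2"

abbreviation W :: "(real^2 => real) set" where "W \<equiv> W12 per1 per2"

lemma weak_partial_spec: "u : W ==> wkp k u (wp k u)"
 unfolding weak_partial_def
 by (rule someI_ex[of "%g. wkp k u g"]) (simp add: W12_def)

lemma W_L2: "u : W ==> u : L2"
 by (simp add: W12_def)

lemma wp_L2: "u : W ==> wp k u : L2"
 using weak_partial_spec[of u k] by (simp add: is_weak_partial_def)

definition dir :: "(real^2 => real) => real" where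
 "dir u = (SUM k:UNIV. \<integral>x. (wp k u x)^2 \<partial>M)"

lemma dirichlet_nonneg: "0 <= dir u"
 by (auto simp: dir_def intro!: sum_nonneg integral_nonneg_AE)

lemma nn_square_bound:
 assumes f [measurable]: "f : Meas" and b: "(\<oint>+x. ennreal (abs (f x) ^ 2)) <= ennreal c" and c: "0 <= c"
 shows "Integ (%x. (f x)^2)" "(\<oint>x. (f x)^2) <= c"
proof -
 have b': "(\<oint>+x. ennreal ((f x)^2)) <= ennreal c" using b by simp
 show i: "Integ (%x. (f x)^2)"
	using le_less_trans[OF b' ennreal_less_top] by (intro integrableI_nonneg) simp_all
 have "ennreal (\<oint>x. (f x)^2) <= ennreal c"
	using b' nn_integral_eq_integral[OF i] by simp
 thus "(\<oint>x. (f x)^2) <= c" using c by simp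
qed

lemma AE_tendsto_zero_of_L2:
 fixes f :: "nat => real^2 => real"
 assumes f [measurable]: "!!m. f m : Meas" and i: "!!m. Integ (%x. (f m x)^2)"
	and b: "!!m. (\<oint>x. (f m x)^2) <= (1/2)^m"
 shows "AE x in M. (%m. f m x) ----> 0"
proof -
 have "(\<oint>+x. (\<Sum>m. ennreal ((f m x)^2))) = (\<Sum>m. \<integral>\<^sup>+x. ennreal ((f m x)^2) \<partial>M)"
	by (rule nn_integral_suminf) measurable
 also have "... <= (\<Sum>m. ennreal ((1/2)^m))"
 proof (rule suminf_le)
	show "(\<oint>+x. ennreal ((f m x)^2)) <= ennreal ((1/2)^m)" for m
	 using b[of m] nn_integral_eq_integral[OF i[of m]] by (simp add: ennreal_leI)
 qed simp_all
 also have "... = ennreal (\<Sum>m. (1/2)^m)"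
	by (rule suminf_ennreal2) (simp_all add: summable_geometric)
 also have "... < \<infinity>" by simp
 finally have "(\<oint>+x. (\<Sum>m. ennreal ((f m x)^2))) ~= \<infinity>" by simp
 hence "AE x in M. (\<Sum>m. ennreal ((f m x)^2)) ~= \<infinity>"
	by (intro nn_integral_PInf_AE) measurable
 thus ?thesis
 proof (rule AE_mp, intro AE_I2 impI)
	fix x assume "(\<Sum>m. ennreal ((f m x)^2)) ~= \<infinity>"
	hence "summable (%m. (f m x)^2)" by (intro summable_suminf_not_top) simp_all
	hence "(%m. (f m x)^2) ----> 0" by (rule summable_LIMSEQ_zero)
	hence "(%m. sqrt ((f m x)^2)) ----> sqrt 0" by (rule tendsto_real_sqrt)
	hence "(%m. abs (f m x)) ----> 0" by simp
	thus "(%m. f m x) ----> 0" by (simp only: tendsto_rabs_zero_iff)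
 qed
qed

lemma trig_L2: "f : trig ==> f : L2"
 by (intro C1_periodic_L2(1) trig_C1)

text \<open>Convolution with a trigonometric kernel commutes with weak derivatives. The geometric rate yields convergence almost everywhere without passing to a subsequence.\<close>

theorem W12_approximation:
 assumes u: "u : W"
 obtains w where "!!m. w m : trig"
	"!!m. (\<oint>x. (w m x - u x)^2) <= (1/2)^m"
	"!!m k. (\<oint>x. (pd k (w m) x - wp k u x)^2) <= (1/2)^m"
	"AE x in M. (%m. w m x) ----> u x"
proof -
 have conv: "EX m0. ALL m>=m0. (\<oint>+x. ennreal (abs (conv f (kern m) x - f x) ^ 2)) <= ennreal ((1/2)^n)"
	if f: "f : L2" for f and n :: nat
	using L2D[OF f] by (intro mollification_converges) simp_all
 have ui: "Integ u" using L2D(5)[OF W_L2[OF u]] .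
 have "EX j. (\<oint>+x. ennreal (abs (conv u (kern j) x - u x) ^ 2)) <= ennreal ((1/2)^n) &
	(ALL k. (\<oint>+x. ennreal (abs (conv (wp k u) (kern j) x - wp k u x) ^ 2)) <= ennreal ((1/2)^n))" for n
 proof -
	obtain a where a: "ALL m>=a. (\<oint>+x. ennreal (abs (conv u (kern m) x - u x) ^ 2)) <= ennreal ((1/2)^n)"
	 using conv[OF W_L2[OF u]] by blast
	obtain b where b: "ALL m>=b. (\<oint>+x. ennreal (abs (conv (wp 1 u) (kern m) x - wp 1 u x) ^ 2)) <= ennreal ((1/2)^n)"
	 using conv[OF wp_L2[OF u]] by blast
	obtain c where c: "ALL m>=c. (\<oint>+x. ennreal (abs (conv (wp 2 u) (kern m) x - wp 2 u x) ^ 2)) <= ennreal ((1/2)^n)"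
	 using conv[OF wp_L2[OF u]] by blast
	show ?thesis
	 unfolding forall_2
	 by (intro exI[of _ "a + b + c"] conjI a[rule_format] b[rule_format] c[rule_format]) simp_all
 qed
 then obtain j where j: "ALL n. (\<oint>+x. ennreal (abs (conv u (kern (j n)) x - u x) ^ 2)) <= ennreal ((1/2)^n) &
	(ALL k. (\<oint>+x. ennreal (abs (conv (wp k u) (kern (j n)) x - wp k u x) ^ 2)) <= ennreal ((1/2)^n))"
	by (rule choice[OF allI, THEN exE])
 define w where "w n = conv u (kern (j n))" for n
 have wt: "w n : trig" for n unfolding w_def by (rule conv_trig(1)[OF ui kern_trig])
 have wd: "pd k (w n) x = conv (wp k u) (kern (j n)) x" for k n x
	unfolding w_def by (rule conv_weak_partial[OF weak_partial_spec[OF u] ui kern_trig])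
 have m1: "(%x. w n x - u x) : Meas" for n
	by (rule L2D(3)[OF L2_diff[OF trig_L2[OF wt] W_L2[OF u]]])
 have m2: "(%x. pd k (w n) x - wp k u x) : Meas" for k n
	by (rule L2D(3)[OF L2_diff[OF trig_L2[OF trig_partial[OF wt]] wp_L2[OF u]]])
 have b1: "Integ (%x. (w m x - u x)^2)" "(\<oint>x. (w m x - u x)^2) <= (1/2)^m" for m
	using j[rule_format, of m, THEN conjunct1] unfolding w_def[symmetric]
	by (rule nn_square_bound[OF m1], simp)+
 have b2: "(\<oint>x. (pd k (w m) x - wp k u x)^2) <= (1/2)^m" for k m
	using j[rule_format, of m, THEN conjunct2, rule_format, of k] unfolding wd[symmetric]
	by (rule nn_square_bound(2)[OF m2]) simp
 have "AE x in M. (%m. w m x - u x) ----> 0"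
	by (rule AE_tendsto_zero_of_L2[OF m1 b1])
 hence "AE x in M. (%m. w m x) ----> u x" by (simp only: LIM_zero_iff)
 thus thesis by (rule that[OF wt b1(2) b2])
qed

end

lemma sq_sum3: "(a + b + c)^2 <= 3 * (a^2 + b^2 + c^2)" for a b c :: real
proof -
 have "0 <= (a - b)^2 + (b - c)^2 + (a - c)^2" by simp
 thus ?thesis by (simp add: power2_eq_square algebra_simps)
qed

lemma sq_triangle3: "(a - b)^2 <= 3 * ((p - a)^2 + (p - q)^2 + (q - b)^2)" for a b p q :: real
 using sq_sum3[of "a - p" "p - q" "q - b"] by (simp add: power2_commute)

lemma ennreal_mult_2plus:
 assumes "0 <= c" "0 <= x" "0 <= y"
 shows "ennreal c * (2 * ennreal x + ennreal y) = ennreal (c * (2 * x + y))"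
proof -
 have "2 * ennreal x + ennreal y = ennreal (2 * x + y)"
	unfolding ennreal_double[OF assms(2)] using assms by (intro ennreal_plus[symmetric]) simp_all
 thus ?thesis using assms by (simp only: ennreal_mult[symmetric] add_nonneg_nonneg mult_nonneg_nonneg zero_le_numeral)
qed

context flat_torus
begin

section \<open>Poincare inequality and Rellich compactness\<close>

lemma modulus_cong_AE:
 fixes u u' :: "real^2 => real"
 assumes u: "u : LMeas" "periodic u" and u': "u' : LMeas" "periodic u'"
	and ae: "AE x in M. u x = u' x"
 shows "modulus p u h = modulus p u' h"
proof -
 have "Measurable.pred lebesgue (%x. u x = u' x)" using u(1) u'(1) by measurable
 moreover have "periodic (%x. u x = u' x)" using u(2) u'(2) by (simp add: periodic_def)
 ultimately have "AE x in M. u (x + h) = u' (x + h)" using ae by (rule AE_M_translation)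
 hence "AE x in M. ennreal (abs (u (x + h) - u x) ^ p) = ennreal (abs (u' (x + h) - u' x) ^ p)"
	using ae by eventually_elim simp
 thus ?thesis unfolding modulus_def by (rule nn_integral_cong_AE)
qed

lemma conv_error_L2:
 assumes u: "u : L2"
	and K: "K : trig" "!!h. K (- h) = K h" "!!h. 0 <= K h" "(\<oint>h. K h) = 1"
 shows "(\<oint>+x. ennreal (abs (conv u K x - u x) ^ 2)) <= (\<oint>+h. ennreal (K h) * modulus 2 u h)"
	and "modulus 2 u : Meas"
proof -
 note uD = L2D[OF u]
 obtain u' where u': "u' : BMeas" "periodic u'" "AE x in M. u x = u' x"
	using borel_representative[OF uD(2,1)] .
 have um': "u' : Meas" using u'(1) by (rule measurable_borel_M)
 have ul': "u' : LMeas" using u'(1) by (rule LMeas_of_borel)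
 have mod: "modulus 2 u = modulus 2 u'"
	using modulus_cong_AE[OF uD(2,1) ul' u'(2,3)] by (simp add: fun_eq_iff)
 have ui': "Integ u'"
	using integrable_cong_AE[OF uD(3) um' u'(3)] uD(5) by blast
 show "modulus 2 u : Meas" unfolding mod by (rule modulus_measurable[OF u'(1)])
 have "AE x in M. ennreal (abs (conv u' K x - u x) ^ 2) = ennreal (abs (conv u' K x - u' x) ^ 2)"
	using u'(3) by eventually_elim simp
 hence "(\<oint>+x. ennreal (abs (conv u K x - u x) ^ 2)) = (\<oint>+x. ennreal (abs (conv u' K x - u' x) ^ 2))"
	unfolding conv_cong_AE[OF u'(3) uD(3) um' K(1)] by (rule nn_integral_cong_AE)
 also have "... <= (\<oint>+h. ennreal (K h) * modulus 2 u' h)"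
	by (rule conv_error[OF _ u'(1,2) ui' K]) simp
 finally show "(\<oint>+x. ennreal (abs (conv u K x - u x) ^ 2)) <= (\<oint>+h. ennreal (K h) * modulus 2 u h)"
	unfolding mod .
qed

lemma sq_le_double: "a^2 <= 2 * b^2 + 2 * (a - b)^2" for a b :: real
proof -
 have "0 <= (a - 2 * b)^2" by simp
 thus ?thesis by (simp add: power2_eq_square algebra_simps)
qed

lemma integral_sq_le_double:
 assumes a: "a : L2" and b: "b : L2"
 shows "(\<oint>x. (a x)^2) <= 2 * (\<oint>x. (b x)^2) + 2 * (\<oint>x. (a x - b x)^2)"
proof -
 note i = L2D(4)[OF a] L2D(4)[OF b] L2D(4)[OF L2_diff[OF a b]]
 have "(\<oint>x. (a x)^2) <= (\<oint>x. 2 * (b x)^2 + 2 * (a x - b x)^2)"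
	by (intro integral_mono i add_integrable integrable_mult_right sq_le_double)
 also have "... = 2 * (\<oint>x. (b x)^2) + 2 * (\<oint>x. (a x - b x)^2)"
	using i by simp
 finally show ?thesis .
qed

lemma translation_estimate:
 assumes u: "u : W"
 shows "modulus 2 u h <= ennreal (18 * (norm h)^2 * dir u)"
proof -
 obtain w where w: "!!m. w m : trig" "!!m. (\<oint>x. (w m x - u x)^2) <= (1/2)^m"
	"!!m k. (\<oint>x. (pd k (w m) x - wp k u x)^2) <= (1/2)^m"
	"AE x in M. (%m. w m x) ----> u x"
	by (rule W12_approximation[OF u], rule that)
 note uD = L2D[OF W_L2[OF u]]
 define a where "a m = 3 ^ 2 * (2 * (1/2)^m + (norm h)^2 * (2 * dir u + 4 * (1/2)^m))" for m :: nat
 have le: "modulus 2 u h <= ennreal (a m)" for m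
 proof -
	note wD = L2D[OF trig_L2[OF w(1)[of m]]]
	have "(\<oint>+x. ennreal (abs (u x - w m x) ^ 2)) = ennreal (\<oint>x. (u x - w m x)^2)"
	 by (rule nn_integral_abs_power2[OF L2D(4)[OF L2_diff[OF W_L2[OF u] trig_L2[OF w(1)[of m]]]]])
	also have "(\<oint>x. (u x - w m x)^2) = (\<oint>x. (w m x - u x)^2)"
	 by (intro cong_integral refl power2_commute)
	also have "ennreal ... <= ennreal ((1/2)^m)" by (intro ennreal_leI w(2))
	finally have e: "(\<oint>+x. ennreal (abs (u x - w m x) ^ 2)) <= ennreal ((1/2)^m)" .
	have "(\<oint>x. grad_sq (w m) x) = (SUM k:UNIV. \<integral>x. (pd k (w m) x)^2 \<partial>M)"
	 unfolding grad_sq_def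
	 by (intro sum_integral L2D(4) trig_L2 trig_partial w(1))
	also have "... <= (SUM k:UNIV. 2 * (\<oint>x. (wp k u x)^2) + 2 * (1/2)^m)"
	proof (rule sum_mono)
	 fix k
	 show "(\<oint>x. (pd k (w m) x)^2) <= 2 * (\<oint>x. (wp k u x)^2) + 2 * (1/2)^m"
		using integral_sq_le_double[OF trig_L2[OF trig_partial[OF w(1)]] wp_L2[OF u], of k m k] w(3)[of k m]
		by linarith
	qed
	also have "... = 2 * dir u + 4 * (1/2)^m"
	 unfolding dir_def sum.distrib sum_distrib_left[symmetric] by simp
	finally have g: "(\<oint>x. grad_sq (w m) x) <= 2 * dir u + 4 * (1/2)^m" .
	have t: "modulus 2 (w m) h <= ennreal ((norm h)^2 * (2 * dir u + 4 * (1/2)^m))"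
	 using translation_estimate_C1[OF trig_C1[OF w(1)[of m]], of h]
	 by (rule order_trans) (intro ennreal_leI mult_left_mono g, simp)
	have p0: "0 <= (norm h)^2 * (2 * dir u + 4 * (1/2)^m)"
	 using dirichlet_nonneg[of u] by (intro mult_nonneg_nonneg add_nonneg_nonneg) simp_all
	have "modulus 2 u h <= ennreal (3 ^ 2) * (2 * (\<oint>+x. ennreal (abs (u x - w m x) ^ 2)) + modulus 2 (w m) h)"
	 by (rule modulus_perturb[OF uD(2,1) wD(2,1)])
	also have "... <= ennreal (3 ^ 2) * (2 * ennreal ((1/2)^m) + ennreal ((norm h)^2 * (2 * dir u + 4 * (1/2)^m)))"
	 by (rule mult_left_mono[OF add_mono[OF mult_left_mono[OF e zero_le] t] zero_le])
	also have "... = ennreal (a m)"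
	 unfolding a_def by (rule ennreal_mult_2plus[OF _ _ p0]) simp_all
	finally show ?thesis .
 qed
 have "(%m. ennreal (a m)) ----> ennreal (3 ^ 2 * (2 * 0 + (norm h)^2 * (2 * dir u + 4 * 0)))"
	unfolding a_def by (intro tendsto_ennrealI tendsto_intros LIMSEQ_power_zero) simp_all
 hence "modulus 2 u h <= ennreal (3 ^ 2 * (2 * 0 + (norm h)^2 * (2 * dir u + 4 * 0)))"
	by (rule LIMSEQ_le_const) (rule exI[of _ 0], simp only: le simp_thms)
 moreover have "3 ^ 2 * (2 * 0 + (norm h)^2 * (2 * dir u + 4 * 0)) = 18 * (norm h)^2 * dir u" by algebra
 ultimately show ?thesis by (simp only:)
qed

definition mean :: "(real^2 => real) => real" where
 "mean u = (\<oint>x. u x) / area"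

definition poincare_const :: real where
 "poincare_const = 18 * (norm per1 + norm per2)^2"

text \<open>The mean is the convolution with a constant kernel, so translations by vectors of the cell suffice.\<close>

theorem poincare:
 assumes u: "u : W"
 shows "(\<oint>x. (u x - mean u)^2) <= poincare_const * dir u"
proof -
 have c: "conv u (%_. 1 / area) x = mean u" for x by (simp add: conv_def mean_def)
 define b where "b = poincare_const * dir u"
 have b: "0 <= b" unfolding b_def poincare_const_def using dirichlet_nonneg[of u] by simp
 have bound: "modulus 2 u h <= ennreal b" if h: "h : space M" for h
 proof -
	have "(norm h)^2 <= (norm per1 + norm per2)^2"
	 using norm_cell[of h] h by (intro power_mono) auto
	hence "18 * (norm h)^2 * dir u <= b"
	 unfolding b_def poincare_const_def using dirichlet_nonneg[of u] by (intro mult_right_mono) simp_all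
	thus ?thesis using translation_estimate[OF u, of h] by (rule order_trans[OF _ ennreal_leI, rotated])
 qed
 have cm: "(%_. mean u) : L2" by (rule trig_L2[OF trig.const])
 have "(\<oint>+x. ennreal (abs (conv u (%_. 1 / area) x - u x) ^ 2)) <= (\<oint>+h. ennreal (1 / area) * modulus 2 u h)"
	using area_pos by (intro conv_error_L2(1) W_L2 u trig.const) (simp_all add: area_def)
 also have "... <= (\<oint>+h. ennreal (1 / area) * ennreal b)"
	by (intro nn_integral_mono mult_left_mono bound) simp_all
 also have "... = ennreal (1 / area) * ennreal b * ennreal area"
	by (simp add: M.emeasure_eq_measure area_def)
 also have "... = ennreal (1 / area * b * area)"
	using b area_pos by (simp only: ennreal_mult[symmetric] divide_nonneg_pos zero_le_one mult_nonneg_nonneg less_imp_le)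
 also have "1 / area * b * area = b" using area_pos by simp
 finally have e: "(\<oint>+x. ennreal (abs (mean u - u x) ^ 2)) <= ennreal b" unfolding c .
 have "(\<oint>x. (mean u - u x)^2) <= b"
	by (rule nn_square_bound(2)[OF L2D(3)[OF L2_diff[OF cm W_L2[OF u]]] e b])
 thus ?thesis unfolding b_def by (simp only: power2_commute[of "mean u"])
qed

lemma separable_compact:
 assumes k: "separable k" and ui: "!!n. Integ (u n)" and B: "!!n. (\<oint>x. abs (u n x)) <= B"
 shows "EX s. strict_mono (s::nat => nat) & (ALL e>0. EX N. ALL i>=N. ALL j>=N. ALL x.
	abs ((\<oint>y. u (r (s i)) y * k x y) - (\<oint>y. u (r (s j)) y * k x y)) <= e)"
 using k
proof (induction arbitrary: r rule: separable.induct)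
 case (tensor f g)
 define c where "c n = (\<oint>y. u (r n) y * g y)" for n
 obtain F where F: "F > 0" "!!x. abs (f x) <= F" using C1_periodic_bounded[OF trig_C1[OF tensor(1)]] by blast
 obtain G where G: "G > 0" "!!x. abs (g x) <= G" using C1_periodic_bounded[OF trig_C1[OF tensor(2)]] by blast
 have eq: "(\<oint>y. u (r n) y * (f x * g y)) = f x * c n" for n x
	unfolding c_def by (subst integral_mult_right_zero[symmetric]) (simp add: mult_ac)
 have "abs (c n) <= B * G" for n
 proof -
	have "abs (c n) <= (\<oint>y. abs (u (r n) y * g y))" unfolding c_def by (rule integral_abs_bound)
	also have "... <= (\<oint>y. abs (u (r n) y) * G)"
	proof (rule integral_mono)
	 show "Integ (%y. abs (u (r n) y * g y))" by (intro integrable_abs integrable_mult_trig ui tensor(2))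
	 show "Integ (%y. abs (u (r n) y) * G)" by (intro integrable_mult_left integrable_abs ui)
	 show "abs (u (r n) y * g y) <= abs (u (r n) y) * G" for y
		unfolding abs_mult by (intro mult_left_mono G(2)) simp
	qed
	also have "... = (\<oint>y. abs (u (r n) y)) * G" by (rule integral_mult_left_zero)
	also have "... <= B * G" using B[of "r n"] G(1) by (intro mult_right_mono) simp_all
	finally show ?thesis .
 qed
 hence "bounded (range c)" by (auto simp: bounded_iff)
 then obtain l s where s: "strict_mono (s :: nat => nat)" "(c \<circ> s) ----> l"
	using bounded_imp_convergent_subsequence by blast
 have cau: "Cauchy (c \<circ> s)" using s(2) by (rule LIMSEQ_imp_Cauchy)
 show ?case
 proof (intro exI[of _ s] conjI s(1) allI impI)
	fix e :: real assume e: "e > 0"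
	hence "e / F > 0" using F(1) by simp
	from cau[unfolded Cauchy_def, rule_format, OF this]
	obtain N where N: "!!i j. i >= N ==> j >= N ==> abs (c (s i) - c (s j)) < e / F"
	 unfolding dist_real_def comp_def by blast
	show "EX N. ALL i>=N. ALL j>=N. ALL x. abs ((\<oint>y. u (r (s i)) y * (f x * g y)) - (\<oint>y. u (r (s j)) y * (f x * g y))) <= e"
	proof (intro exI[of _ N] allI impI)
	 fix i j x assume ij: "i >= N" "j >= N"
	 have "abs (f x * c (s i) - f x * c (s j)) = abs (f x) * abs (c (s i) - c (s j))"
		by (simp add: abs_mult[symmetric] right_diff_distrib)
	 also have "... <= F * (e / F)" using F N[OF ij] by (intro mult_mono) simp_all
	 also have "... = e" using F(1) by simp
	 finally show "abs ((\<oint>y. u (r (s i)) y * (f x * g y)) - (\<oint>y. u (r (s j)) y * (f x * g y))) <= e"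
		unfolding eq .
	qed
 qed
next
 case (plus k l)
 obtain s where s: "strict_mono (s :: nat => nat)" "ALL e>0. EX N. ALL i>=N. ALL j>=N. ALL x.
	abs ((\<oint>y. u (r (s i)) y * k x y) - (\<oint>y. u (r (s j)) y * k x y)) <= e"
	using plus.IH(1)[of r] by blast
 obtain t where t: "strict_mono (t :: nat => nat)" "ALL e>0. EX N. ALL i>=N. ALL j>=N. ALL x.
	abs ((\<oint>y. u (r (s (t i))) y * l x y) - (\<oint>y. u (r (s (t j))) y * l x y)) <= e"
	using plus.IH(2)[of "%n. r (s n)"] by blast
 have eq: "(\<oint>y. u n y * (k x y + l x y)) = (\<oint>y. u n y * k x y) + (\<oint>y. u n y * l x y)" for n x
	using integrable_mult_trig[OF ui separable_sections(2)[OF plus.hyps(1)], of n x]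
	 integrable_mult_trig[OF ui separable_sections(2)[OF plus.hyps(2)], of n x]
	by (simp add: distrib_left)
 show ?case
 proof (intro exI[of _ "%n. s (t n)"] conjI allI impI)
	show "strict_mono (%n. s (t n))" using s(1) t(1) by (simp add: strict_mono_def)
	fix e :: real assume "e > 0"
	hence e2: "e / 2 > 0" by simp
	obtain N where N: "ALL i>=N. ALL j>=N. ALL x. abs ((\<oint>y. u (r (s i)) y * k x y) - (\<oint>y. u (r (s j)) y * k x y)) <= e / 2"
	 using s(2) e2 by blast
	obtain N' where N': "ALL i>=N'. ALL j>=N'. ALL x. abs ((\<oint>y. u (r (s (t i))) y * l x y) - (\<oint>y. u (r (s (t j))) y * l x y)) <= e / 2"
	 using t(2) e2 by blast
	show "EX N. ALL i>=N. ALL j>=N. ALL x. abs ((\<oint>y. u (r (s (t i))) y * (k x y + l x y)) - (\<oint>y. u (r (s (t j))) y * (k x y + l x y))) <= e"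
	proof (intro exI[of _ "max N N'"] allI impI)
	 fix i j x assume ij: "i >= max N N'" "j >= max N N'"
	 have "t i >= N" "t j >= N" using ij strict_mono_imp_increasing[OF t(1), of i] strict_mono_imp_increasing[OF t(1), of j] by simp_all
	 hence "abs ((\<oint>y. u (r (s (t i))) y * k x y) - (\<oint>y. u (r (s (t j))) y * k x y)) <= e / 2"
		using N by blast
	 moreover have "abs ((\<oint>y. u (r (s (t i))) y * l x y) - (\<oint>y. u (r (s (t j))) y * l x y)) <= e / 2"
		using N' ij by simp
	 ultimately show "abs ((\<oint>y. u (r (s (t i))) y * (k x y + l x y)) - (\<oint>y. u (r (s (t j))) y * (k x y + l x y))) <= e"
		unfolding eq by linarith
	qed
 qed
qed

lemma uniform_mollification:
 assumes B: "0 <= B" and eta: "eta > 0"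
 shows "EX m. ALL v:W. (\<oint>x. (v x)^2) <= B --> dir v <= B -->
	(\<oint>x. (conv v (kern m) x - v x)^2) <= eta"
proof -
 define D where "D = B + 1"
 have D: "D > 0" "B <= D" using B by (simp_all add: D_def)
 define rho where "rho = sqrt (eta / (36 * D))"
 have rho: "rho > 0" using eta D by (simp add: rho_def)
 have rho2: "18 * rho^2 * B <= eta / 2"
 proof -
	have "rho^2 = eta / (36 * D)" using eta D by (simp add: rho_def)
	hence "18 * rho^2 * D = eta / 2" using D by (simp add: field_simps)
	moreover have "18 * rho^2 * B <= 18 * rho^2 * D" using D by (intro mult_left_mono) simp_all
	ultimately show ?thesis by linarith
 qed
 define C where "C = 3 ^ 2 * (2 * B)"
 have C: "0 <= C" using B by (simp add: C_def)
 define E where "E = C + 1"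
 have E: "E > 0" "C <= E" using C by (simp_all add: E_def)
 define kappa where "kappa = eta / (2 * E)"
 have kappa: "kappa > 0" using eta E by (simp add: kappa_def)
 have Ckappa: "C * kappa <= eta / 2"
 proof -
	have "E * kappa = eta / 2" using E by (simp add: kappa_def)
	moreover have "C * kappa <= E * kappa" using E kappa by (intro mult_right_mono) simp_all
	ultimately show ?thesis by linarith
 qed
 obtain m where m: "ALL n>=m. ALL W e B. W : Meas --> 0 <= e --> 0 <= B -->
	(ALL h g. norm (h - lat g) < rho --> W h <= ennreal e) --> (ALL h. W h <= ennreal B) -->
	(\<oint>+h. ennreal (kern n h) * W h) <= ennreal (e + B * kappa)"
	using kern_average[OF rho kappa] by (elim exE)
 show ?thesis
 proof (intro exI[of _ m] ballI impI)
	fix v assume v: "v : W" and vB: "(\<oint>x. (v x)^2) <= B" and dB: "dir v <= B"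
	note vD = L2D[OF W_L2[OF v]]
	have near: "modulus 2 v h <= ennreal (eta / 2)" if h: "norm (h - lat g) < rho" for h g
	proof -
	 have "(norm (h - lat g))^2 <= rho^2" using h by (intro power_mono) simp_all
	 hence "18 * (norm (h - lat g))^2 * dir v <= 18 * rho^2 * B"
		using dB dirichlet_nonneg[of v] by (intro mult_mono) simp_all
	 hence "18 * (norm (h - lat g))^2 * dir v <= eta / 2" using rho2 by linarith
	 from order_trans[OF translation_estimate[OF v] ennreal_leI[OF this]]
	 show ?thesis unfolding modulus_lattice[OF vD(1)] .
	qed
	have all: "modulus 2 v h <= ennreal C" for h
	proof -
	 have "modulus 2 v h <= ennreal (3 ^ 2) * (2 * (\<oint>+x. ennreal (abs (v x) ^ 2)))"
		by (rule modulus_bound[OF vD(2,1)]) simp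
	 also have "... <= ennreal (3 ^ 2) * (2 * ennreal B)"
		unfolding nn_integral_abs_power2[OF vD(4)] using vB by (intro mult_left_mono ennreal_leI zero_le)
	 also have "... = ennreal C" unfolding C_def using B by (intro ennreal_mult_double) simp_all
	 finally show ?thesis .
	qed
	have "(\<oint>+x. ennreal (abs (conv v (kern m) x - v x) ^ 2)) <= (\<oint>+h. ennreal (kern m h) * modulus 2 v h)"
	 by (rule conv_error_L2(1)[OF W_L2[OF v] kern_trig kern_even kern_nonneg kern_integral(1)])
	also have "... <= ennreal (eta / 2 + C * kappa)"
	proof (rule m[rule_format, OF order_refl])
	 show "modulus 2 v : Meas"
		by (rule conv_error_L2(2)[OF W_L2[OF v] kern_trig[of 0] kern_even kern_nonneg kern_integral(1)])
	 show "0 <= eta / 2" using eta by simp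
	qed (rule C, erule near, rule all)
	also have "... <= ennreal eta" using Ckappa by (intro ennreal_leI) simp
	finally have e: "(\<oint>+x. ennreal (abs (conv v (kern m) x - v x) ^ 2)) <= ennreal eta" .
	show "(\<oint>x. (conv v (kern m) x - v x)^2) <= eta"
	 using eta by (intro nn_square_bound(2)[OF _ e] L2D(3) L2_diff trig_L2 conv_trig(1) vD(5) kern_trig W_L2 v) simp
 qed
qed

lemma L1_bound_of_L2:
 assumes "u : L2"
 shows "(\<oint>x. abs (u x)) <= area + (\<oint>x. (u x)^2)"
proof -
 note uD = L2D[OF assms]
 have "abs (u x) <= 1 + (u x)^2" for x
 proof -
	have "0 <= (abs (u x) - 1)^2" by simp
	hence "2 * abs (u x) <= 1 + (u x)^2" by (simp add: power2_diff)
	thus ?thesis using abs_ge_zero[of "u x"] by linarith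
 qed
 hence "(\<oint>x. abs (u x)) <= (\<oint>x. 1 + (u x)^2)"
	using uD by (intro integral_mono) simp_all
 also have "... = area + (\<oint>x. (u x)^2)" using uD by (simp add: area_def)
 finally show ?thesis .
qed

text \<open>Convolution operators with trigonometric kernels have finite rank and, by the translation estimate, approximate the identity uniformly on bounded sets of the Sobolev space.\<close>

theorem rellich:
 assumes v: "!!n. v n : W" and vB: "!!n. (\<oint>x. (v n x)^2) <= B" and dB: "!!n. dir (v n) <= B"
 shows "EX r. strict_mono (r :: nat => nat) &
	(ALL e>0. EX N. ALL i>=N. ALL j>=N. (\<oint>x. (v (r i) x - v (r j) x)^2) <= e)"
proof -
 have B: "0 <= B" using dB[of 0] dirichlet_nonneg[of "v 0"] by linarith
 note vD = L2D[OF W_L2[OF v]]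
 define P where "P n s \<longleftrightarrow> (EX N. ALL i>=N. ALL j>=N. (\<oint>x. (v (s i) x - v (s j) x)^2) <= 1 / real (Suc n))"
	for n :: nat and s :: "nat => nat"
 have ex: "EX r'. strict_mono r' & P n (s \<circ> r')" if "strict_mono s" for n and s :: "nat => nat"
 proof -
	define eta where "eta = 1 / (9 * real (Suc n))"
	have eta: "eta > 0" by (simp add: eta_def)
	obtain m where m: "!!u. u : W ==> (\<oint>x. (u x)^2) <= B ==> dir u <= B ==>
	 (\<oint>x. (conv u (kern m) x - u x)^2) <= eta"
	 using uniform_mollification[OF B eta] by (elim exE) (rule that, blast)
	define c where "c i = conv (v i) (kern m)" for i
	have cm: "(\<oint>x. (c i x - v i x)^2) <= eta" for i unfolding c_def by (rule m[OF v vB dB])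
	have cL: "c i : L2" for i
	 unfolding c_def by (rule trig_L2[OF conv_trig(1)[OF vD(5) kern_trig]])
	have L1: "(\<oint>x. abs (v n x)) <= area + B" for n
	 using L1_bound_of_L2[OF W_L2[OF v], of n] vB[of n] by linarith
	obtain r' where r': "strict_mono (r' :: nat => nat)" "ALL e>0. EX N. ALL i>=N. ALL j>=N. ALL x. abs (c (s (r' i)) x - c (s (r' j)) x) <= e"
	 using separable_compact[where u = v and r = s, OF separable_difference[OF kern_trig[of m]] vD(5) L1]
	 unfolding c_def conv_def by (elim exE conjE)
	have "sqrt (eta / area) > 0" using eta area_pos by simp
	then obtain N where N: "ALL i>=N. ALL j>=N. ALL x. abs (c (s (r' i)) x - c (s (r' j)) x) <= sqrt (eta / area)"
	 using r'(2) by blast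
	have "(\<oint>x. (v (s (r' i)) x - v (s (r' j)) x)^2) <= 1 / real (Suc n)" if ij: "i >= N" "j >= N" for i j
	proof -
	 let ?a = "s (r' i)" and ?b = "s (r' j)"
	 have cc: "(\<oint>x. (c ?a x - c ?b x)^2) <= eta"
	 proof -
		have "(c ?a x - c ?b x)^2 <= eta / area" for x
		proof -
		have "abs (c ?a x - c ?b x)^2 <= (sqrt (eta / area))^2" using N ij by (intro power_mono) simp_all
		thus ?thesis using eta area_pos by simp
		qed
		hence "(\<oint>x. (c ?a x - c ?b x)^2) <= (\<oint>x. eta / area)"
		by (intro integral_mono L2D(4) L2_diff cL) simp_all
		also have "... = eta" using area_pos by (simp add: area_def)
		finally show ?thesis .
	 qed
	 note i1 = L2D(4)[OF L2_diff[OF cL[of ?a] W_L2[OF v[of ?a]]]] L2D(4)[OF L2_diff[OF cL[of ?a] cL[of ?b]]]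
		L2D(4)[OF L2_diff[OF cL[of ?b] W_L2[OF v[of ?b]]]]
	 have "(\<oint>x. (v ?a x - v ?b x)^2) <= (\<oint>x. 3 * ((c ?a x - v ?a x)^2 + (c ?a x - c ?b x)^2 + (c ?b x - v ?b x)^2))"
	 proof (rule integral_mono)
		show "Integ (%x. (v ?a x - v ?b x)^2)" by (intro L2D(4) L2_diff W_L2 v)
		show "Integ (%x. 3 * ((c ?a x - v ?a x)^2 + (c ?a x - c ?b x)^2 + (c ?b x - v ?b x)^2))"
		by (intro integrable_mult_right add_integrable i1)
		show "(v ?a x - v ?b x)^2 <= 3 * ((c ?a x - v ?a x)^2 + (c ?a x - c ?b x)^2 + (c ?b x - v ?b x)^2)" for x
		by (rule sq_triangle3)
	 qed
	 also have "... = 3 * ((\<oint>x. (c ?a x - v ?a x)^2) + (\<oint>x. (c ?a x - c ?b x)^2) + (\<oint>x. (c ?b x - v ?b x)^2))"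
		using i1 by simp
	 also have "... <= 3 * (eta + eta + eta)" by (intro mult_left_mono add_mono cm cc) simp
	 also have "... = 9 * eta" by simp
	 also have "... = 1 / real (Suc n)" unfolding eta_def by (simp del: of_nat_Suc)
	 finally show ?thesis .
	qed
	hence "P n (s \<circ> r')" unfolding P_def comp_def by (intro exI[of _ N]) simp
	thus ?thesis by (intro exI[of _ r'] conjI r'(1))
 qed
 interpret S: subseqs P by (unfold_locales) (rule ex)
 have stable: "P n (s \<circ> r)" if r: "strict_mono r" and Ps: "P n s" for r s :: "nat => nat" and n
 proof -
	obtain N where N: "ALL i>=N. ALL j>=N. (\<oint>x. (v (s i) x - v (s j) x)^2) <= 1 / real (Suc n)"
	 using Ps unfolding P_def by (elim exE)
	show ?thesis unfolding P_def comp_def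
	proof (intro exI[of _ N] allI impI)
	 fix i j assume "i >= N" "j >= N"
	 hence "r i >= N" "r j >= N"
		using strict_mono_imp_increasing[OF r, of i] strict_mono_imp_increasing[OF r, of j] by simp_all
	 thus "(\<oint>x. (v (s (r i)) x - v (s (r j)) x)^2) <= 1 / real (Suc n)" by (rule N[rule_format])
	qed
 qed
 show ?thesis
 proof (intro exI[of _ S.diagseq] conjI S.subseq_diagseq allI impI)
	fix e :: real assume e: "e > 0"
	obtain n where n: "1 / real (Suc n) < e" by (rule nat_approx_posE[OF e])
	have "P n (S.diagseq \<circ> ((+) (Suc n)))"
	proof (rule S.diagseq_holds)
	 fix r s :: "nat => nat" and n
	 assume "strict_mono r" "P n s"
	 thus "P n (s \<circ> r)" by (rule stable)
	qed
	hence "EX N. ALL i>=N. ALL j>=N. (\<oint>x. (v (S.diagseq (Suc n + i)) x - v (S.diagseq (Suc n + j)) x)^2) <= 1 / real (Suc n)"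
	 unfolding P_def comp_def .
	then obtain N where N: "ALL i>=N. ALL j>=N. (\<oint>x. (v (S.diagseq (Suc n + i)) x - v (S.diagseq (Suc n + j)) x)^2) <= 1 / real (Suc n)"
	 by (rule exE)
	show "EX N. ALL i>=N. ALL j>=N. (\<oint>x. (v (S.diagseq i) x - v (S.diagseq j) x)^2) <= e"
	proof (intro exI[of _ "Suc n + N"] allI impI)
	 fix i j assume ij: "i >= Suc n + N" "j >= Suc n + N"
	 have "i = Suc n + (i - Suc n)" "j = Suc n + (j - Suc n)" "i - Suc n >= N" "j - Suc n >= N" using ij by simp_all
	 from N[rule_format, OF this(3,4)] this(1,2) n
	 show "(\<oint>x. (v (S.diagseq i) x - v (S.diagseq j) x)^2) <= e" by simp
	qed
 qed
qed

end

definition smoothstep :: "real => real" where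
 "smoothstep x = (if x <= 0 then 0 else if x >= 1 then 1 else 3 * x^2 - 2 * x ^ 3)"

definition smoothstep' :: "real => real" where
 "smoothstep' x = (if 0 < x & x < 1 then 6 * x - 6 * x^2 else 0)"

lemma smoothstep_bounds: "0 <= smoothstep x" "smoothstep x <= 1"
 "x <= 0 ==> smoothstep x = 0" "1 <= x ==> smoothstep x = 1"
proof -
 have "0 <= 3 * x^2 - 2 * x ^ 3 & 3 * x^2 - 2 * x ^ 3 <= 1" if x: "0 < x" "x < 1"
 proof
	have "0 <= x^2 * (3 - 2 * x)" using x by (intro mult_nonneg_nonneg) simp_all
	thus "0 <= 3 * x^2 - 2 * x ^ 3" by (simp add: algebra_simps power2_eq_square power3_eq_cube)
	have "0 <= (1 - x)^2 * (1 + 2 * x)" using x by (intro mult_nonneg_nonneg) simp_all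
	thus "3 * x^2 - 2 * x ^ 3 <= 1" by (simp add: algebra_simps power2_eq_square power3_eq_cube)
 qed
 thus "0 <= smoothstep x" "smoothstep x <= 1" by (simp_all add: smoothstep_def)
qed (simp_all add: smoothstep_def)

lemma smoothstep'_bounds: "0 <= smoothstep' x" "smoothstep' x <= 3/2"
proof -
 show "0 <= smoothstep' x"
 proof (cases "0 < x & x < 1")
	case True
	hence "0 <= 6 * x * (1 - x)" by (intro mult_nonneg_nonneg) simp_all
	thus ?thesis using True by (simp add: smoothstep'_def algebra_simps power2_eq_square)
 next
	case False
	show ?thesis by (simp only: smoothstep'_def False if_False order.refl)
 qed
 have "0 <= 6 * (x - 1/2)^2" by simp
 hence "6 * x - 6 * x^2 <= 3/2" by (simp add: power2_eq_square algebra_simps)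
 thus "smoothstep' x <= 3/2" by (simp add: smoothstep'_def)
qed

lemma derivative_zero_of_quadratic:
 fixes f :: "real => real"
 assumes r: "r > 0" and b: "!!y. abs (y - x) < r ==> abs (f y - f x) <= C * (y - x)^2"
 shows "(f has_real_derivative 0) (at x)"
 unfolding has_field_derivative_iff
proof (rule Lim_null_comparison)
 show "\<forall>\<^sub>F y in at x. norm ((f y - f x) / (y - x)) <= C * abs (y - x)"
	unfolding eventually_at
 proof (intro exI[of _ r] conjI r ballI impI)
	fix y assume y: "y ~= x & dist y x < r"
	hence "abs (f y - f x) <= C * (y - x)^2" by (intro b) (simp add: dist_real_def)
	hence "abs (f y - f x) <= C * abs (y - x) * abs (y - x)" by (simp add: power2_eq_square mult.assoc flip: abs_mult)
	thus "norm ((f y - f x) / (y - x)) <= C * abs (y - x)"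
	 using y by (simp add: abs_divide pos_divide_le_eq)
 qed
 have "((%y. C * abs (y - x)) \<longlongrightarrow> C * abs (x - x)) (at x)" by (intro tendsto_intros)
 thus "((%y. C * abs (y - x)) \<longlongrightarrow> 0) (at x)" by simp
qed

lemma smoothstep_derivative: "(smoothstep has_real_derivative smoothstep' x) (at x)"
proof -
 consider "x < 0" | "x = 0" | "0 < x" "x < 1" | "x = 1" | "1 < x" by linarith
 thus ?thesis
 proof cases
	case 1
	have "((%_. 0) has_real_derivative 0) (at x)" by simp
	hence "(smoothstep has_real_derivative 0) (at x)"
	 by (rule has_field_derivative_transform_within_open[of _ _ _ "{..<0}"]) (use 1 in \<open>auto simp: smoothstep_def\<close>)
	thus ?thesis using 1 by (simp add: smoothstep'_def)
 next
	case 2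
	have "(smoothstep has_real_derivative 0) (at 0)"
	proof (rule derivative_zero_of_quadratic[of 1 _ _ 3])
	 fix y :: real assume "abs (y - 0) < 1"
	 show "abs (smoothstep y - smoothstep 0) <= 3 * (y - 0)^2"
	 proof (cases "0 < y & y < 1")
		case True
		hence "smoothstep y <= 3 * y^2" by (simp add: smoothstep_def)
		thus ?thesis using smoothstep_bounds(1)[of y] smoothstep_bounds(3)[of 0] by simp
	 next
		case False
		hence "smoothstep y = 0" using \<open>\<bar>y - 0\<bar> < 1\<close> by (intro smoothstep_bounds) auto
		thus ?thesis by (simp add: smoothstep_bounds)
	 qed
	qed simp
	thus ?thesis using 2 by (simp add: smoothstep'_def)
 next
	case 3
	have "((%x. 3 * x^2 - 2 * x ^ 3) has_real_derivative 6 * x - 6 * x^2) (at x)"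
	 by (auto intro!: derivative_eq_intros)
	hence "(smoothstep has_real_derivative 6 * x - 6 * x^2) (at x)"
	 by (rule has_field_derivative_transform_within_open[of _ _ _ "{0<..<1}"]) (use 3 in \<open>auto simp: smoothstep_def\<close>)
	thus ?thesis using 3 by (simp add: smoothstep'_def)
 next
	case 4
	have "(smoothstep has_real_derivative 0) (at 1)"
	proof (rule derivative_zero_of_quadratic[of 1 _ _ 3])
	 fix y :: real assume y: "abs (y - 1) < 1"
	 show "abs (smoothstep y - smoothstep 1) <= 3 * (y - 1)^2"
	 proof (cases "y < 1")
		case True
		hence "smoothstep 1 - smoothstep y = (1 - y)^2 * (1 + 2 * y)" using y
		by (simp add: smoothstep_def power2_eq_square power3_eq_cube algebra_simps)
		also have "... <= (1 - y)^2 * 3" using True by (intro mult_left_mono) simp_all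
		also have "... = 3 * (y - 1)^2" by (simp add: power2_commute)
		finally show ?thesis using smoothstep_bounds(2)[of y] smoothstep_bounds(4)[of 1] by simp
	 next
		case False
		hence "smoothstep y = 1" by (intro smoothstep_bounds) auto
		thus ?thesis by (simp add: smoothstep_bounds)
	 qed
	qed simp
	thus ?thesis using 4 by (simp add: smoothstep'_def)
 next
	case 5
	have "((%_. 1) has_real_derivative 0) (at x)" by simp
	hence "(smoothstep has_real_derivative 0) (at x)"
	 by (rule has_field_derivative_transform_within_open[of _ _ _ "{1<..}"]) (use 5 in \<open>auto simp: smoothstep_def\<close>)
	thus ?thesis using 5 by (simp add: smoothstep'_def)
 qed
qed

lemma smoothstep'_continuous: "continuous_on UNIV smoothstep'"
proof -
 have eq: "smoothstep' = (%x. 6 * max 0 (min 1 x) - 6 * (max 0 (min 1 x))^2)"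
	by (auto simp: smoothstep'_def fun_eq_iff max_def min_def)
 show ?thesis by (subst eq) (intro continuous_intros)
qed

context flat_torus
begin

section \<open>The Sobolev inequality\<close>

definition grid :: "real \<times> real => real^2" where
 "grid z = fst z *\<^sub>R per1 + snd z *\<^sub>R per2"

abbreviation unit_square :: "(real \<times> real) set" where
 "unit_square \<equiv> {0..<1} \<times> {0..<1}"

lemma grid_coord: "grid (coord1 x, coord2 x) = x"
 using coord_expansion[of x] by (simp add: grid_def)

lemma grid_measurable [measurable]: "grid : BMeas"
 unfolding grid_def[abs_def]
 by (intro borel_measurable_continuous_onI continuous_intros)

lemma unit_square_borel: "unit_square : sets borel"
 by (intro borel_Times) simp_all

lemma unit_square_partition: "EX! g. z + (%g. (real_of_int (fst g), real_of_int (snd g))) g : unit_square"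
proof (rule ex1I[of _ "(- \<lfloor>fst z\<rfloor>, - \<lfloor>snd z\<rfloor>)"])
 show "z + (%g. (real_of_int (fst g), real_of_int (snd g))) (- \<lfloor>fst z\<rfloor>, - \<lfloor>snd z\<rfloor>) : unit_square"
	using floor_correct[of "fst z"] floor_correct[of "snd z"] by (cases z) (simp, linarith)
next
 fix g :: "int \<times> int"
 assume g: "z + (%g. (real_of_int (fst g), real_of_int (snd g))) g : unit_square"
 hence "0 <= fst z + of_int (fst g)" "fst z + of_int (fst g) < 1"
	"0 <= snd z + of_int (snd g)" "snd z + of_int (snd g) < 1"
	by (cases z, simp)+
 hence "fst g = - \<lfloor>fst z\<rfloor>" "snd g = - \<lfloor>snd z\<rfloor>" by linarith+
 thus "g = (- \<lfloor>fst z\<rfloor>, - \<lfloor>snd z\<rfloor>)" by (simp add: prod_eq_iff)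
qed

lemma cell_average:
 fixes f :: "real^2 => ennreal"
 assumes f [measurable]: "f : BMeas" and per: "periodic f"
 shows "(\<oint>+x. f x) = ennreal area * (\<integral>\<^sup>+z. f (grid z) * indicator unit_square z \<partial>lborel)"
proof -
 interpret MT: pair_sigma_finite M "lborel :: (real \<times> real) measure" ..
 define J where "J = (\<integral>\<^sup>+z. f (grid z) * indicator unit_square z \<partial>lborel)"
 note [measurable] = unit_square_borel
 have Jx: "(\<integral>\<^sup>+z. f (x + grid z) * indicator unit_square z \<partial>lborel) = J" for x
 proof -
	let ?G = "%z. f (grid z)"
	have G: "?G : BMeas" by measurable
	have Gl: "?G : LMeas" by (rule measurable_completion) (simp add: G)
	have perG: "?G (z + (%g. (real_of_int (fst g), real_of_int (snd g))) g) = ?G z" for z g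
	proof -
	 have "grid (z + (real_of_int (fst g), real_of_int (snd g))) = grid z + lat g"
		by (simp add: grid_def lat_def algebra_simps)
	 thus ?thesis by (simp only: per[unfolded periodic_def, rule_format])
	qed
	have shift: "f (x + grid z) = ?G (z + (coord1 x, coord2 x))" for z
	proof -
	 have "grid (z + (coord1 x, coord2 x)) = grid (coord1 x, coord2 x) + grid z"
		by (simp add: grid_def algebra_simps)
	 thus ?thesis unfolding grid_coord by simp
	qed
	have "(\<integral>\<^sup>+z. f (x + grid z) * indicator unit_square z \<partial>lborel) = (\<integral>\<^sup>+z. f (x + grid z) * indicator unit_square z \<partial>lebesgue)"
	 by (rule nn_integral_completion[symmetric])
	also have "... = (\<integral>\<^sup>+z. ?G (z + (coord1 x, coord2 x)) * indicator unit_square z \<partial>lebesgue)"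
	 by (simp only: shift)
	also have "... = (\<integral>\<^sup>+z. ?G z * indicator unit_square z \<partial>lebesgue)"
	proof (rule fundamental_domain_translation[where L = "%g. (real_of_int (fst g), real_of_int (snd g))"])
	 show "unit_square : sets lebesgue" using unit_square_borel by simp
	qed (rule Gl, rule perG, simp, rule unit_square_partition)
	also have "... = J" unfolding J_def by (rule nn_integral_completion)
	finally show ?thesis .
 qed
 have id: "(%x. x) : M \<rightarrow>\<^sub>M borel" by (rule measurable_borel_M) simp
 have f1: "(%z. fst z) : M \<Otimes>\<^sub>M (lborel :: (real \<times> real) measure) \<rightarrow>\<^sub>M borel"
	by (rule measurable_compose[OF measurable_fst id])
 have "(%z. fst z + grid (snd z)) : M \<Otimes>\<^sub>M (lborel :: (real \<times> real) measure) \<rightarrow>\<^sub>M borel"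
	by (rule borel_measurable_add[OF f1]) measurable
 from measurable_compose[OF this f]
 have m2: "(%(x, z). f (x + grid z) * indicator unit_square z) : borel_measurable (M \<Otimes>\<^sub>M (lborel :: (real \<times> real) measure))"
	unfolding case_prod_beta by measurable
 have fl: "f : LMeas" by (rule measurable_completion) simp
 have fM: "(%x. f (x + grid z)) : Meas" for z
	by (rule measurable_borel_M) measurable
 have "emeasure (lborel :: (real \<times> real) measure) unit_square = 1"
	unfolding lborel_prod[symmetric] by (subst lborel.emeasure_pair_measure_Times) simp_all
 hence one: "(\<integral>\<^sup>+z. indicator unit_square z \<partial>(lborel :: (real \<times> real) measure)) = 1"
	using unit_square_borel by simp
 have "J * ennreal area = (\<oint>+x. J)" by (simp add: M.emeasure_eq_measure area_def)
 also have "... = (\<oint>+x. (\<integral>\<^sup>+z. f (x + grid z) * indicator unit_square z \<partial>lborel))"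
	by (simp only: Jx)
 also have "... = (\<integral>\<^sup>+z. (\<oint>+x. f (x + grid z) * indicator unit_square z) \<partial>lborel)"
	using MT.Fubini'[OF m2] by simp
 also have "... = (\<integral>\<^sup>+z. (\<oint>+x. f x) * indicator unit_square z \<partial>lborel)"
 proof (rule nn_integral_cong)
	fix z
	show "(\<oint>+x. f (x + grid z) * indicator unit_square z) = (\<oint>+x. f x) * indicator unit_square z"
	 unfolding nn_integral_multc[OF fM] nn_integral_M_translation[OF fl per] ..
 qed
 also have "... = (\<oint>+x. f x)"
	by (subst nn_integral_cmult) (use unit_square_borel one in simp_all)
 finally show ?thesis unfolding J_def by (simp only: mult.commute)
qed

definition sobolev_weight :: real where
 "sobolev_weight = norm per1 + norm per2"

definition sdens :: "(real^2 => real) => real^2 => real" where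
 "sdens u x = abs (u x) + sobolev_weight * (SUM k:UNIV. abs (pd k u x))"

lemma sobolev_density_facts:
 assumes "C1p u"
 shows "continuous_on UNIV (sdens u)" "periodic (sdens u)" "0 <= sdens u x"
	"sdens u : BMeas"
proof -
 show c: "continuous_on UNIV (sdens u)" unfolding sdens_def[abs_def]
	by (intro continuous_intros C1D(3,4)[OF assms])
 show "periodic (sdens u)"
	using C1D(1,5)[OF assms] by (simp add: periodic_def sdens_def)
 show "0 <= sdens u x" by (simp add: sdens_def sum_nonneg sobolev_weight_def)
 show "sdens u : BMeas" using c by (rule borel_measurable_continuous_onI)
qed

lemma line_bound:
 assumes u: "C1p u" and w: "norm w <= sobolev_weight" and s: "s : {0..1}"
 shows "ennreal (abs (u (x + s *\<^sub>R w))) <= (\<integral>\<^sup>+t. ennreal (sdens u (x + t *\<^sub>R w)) * indicator {0..<1::real} t \<partial>lborel)"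
proof -
 define f where "f t = (SUM k:UNIV. pd k u (x + t *\<^sub>R w) * w$k)" for t :: real
 define p where "p t = u (x + t *\<^sub>R w)" for t :: real
 have der: "(p has_real_derivative f t) (at t)" for t
	unfolding f_def p_def by (rule C1_line_derivative(1)[OF u])
 have fc: "continuous_on UNIV f" unfolding f_def[abs_def] by (rule C1_line_derivative(2)[OF u])
 have pc: "continuous_on UNIV p" unfolding p_def[abs_def]
	by (intro continuous_on_compose2[OF C1D(3)[OF u]] continuous_intros) auto
 have dc: "continuous_on UNIV (%t. sdens u (x + t *\<^sub>R w))"
	by (intro continuous_on_compose2[OF sobolev_density_facts(1)[OF u]] continuous_intros) auto
 have ci: "integrable lborel (%t. g t * indicator {a..b} t)" if "continuous_on UNIV g" for g :: "real => real" and a b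
 proof -
	have "integrable lborel (%t. indicator {a..b} t *\<^sub>R g t)"
	 by (rule borel_integrable_compact) (auto intro: continuous_on_subset[OF that])
	thus ?thesis by (simp add: mult.commute)
 qed
 define B where "B = (\<integral>t. abs (f t) * indicator {0..1} t \<partial>lborel)"
 have fac: "continuous_on UNIV (%t. abs (f t))" by (intro continuous_intros fc)
 have diff: "abs (p b - p a) <= B" if ab: "0 <= a" "a <= b" "b <= 1" for a b
 proof -
	have "has_bochner_integral lborel (%t. f t * indicator {a..b} t) (p b - p a)"
	proof (rule has_bochner_integral_FTC_Icc_real)
	 show "isCont f t" for t using fc by (simp add: continuous_on_eq_continuous_at)
	qed (rule ab(2), rule der)
	hence "p b - p a = (\<integral>t. f t * indicator {a..b} t \<partial>lborel)"
	 by (simp add: has_bochner_integral_integral_eq)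
	hence "abs (p b - p a) <= (\<integral>t. abs (f t * indicator {a..b} t) \<partial>lborel)"
	 by (simp only: integral_abs_bound)
	also have "... <= B" unfolding B_def
	proof (rule integral_mono)
	 show "integrable lborel (%t. abs (f t * indicator {a..b} t))" by (intro integrable_abs ci fc)
	 show "integrable lborel (%t. abs (f t) * indicator {0..1} t)" by (rule ci[OF fac])
	 show "abs (f t * indicator {a..b} t) <= abs (f t) * indicator {0..1} t" for t
		using ab by (auto simp: indicator_def)
	qed
	finally show ?thesis .
 qed
 have diff': "abs (p s) <= abs (p t) + B" if t: "t : {0..1}" for t
 proof (cases "s <= t")
	case True
	hence "abs (p t - p s) <= B" using s t by (intro diff) simp_all
	thus ?thesis by linarith
 next
	case False
	hence "abs (p s - p t) <= B" using s t by (intro diff) simp_all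
	thus ?thesis by linarith
 qed
 have I: "integrable lborel (indicator {0..1::real} :: real => real)" "(\<integral>t. indicator {0..1::real} t \<partial>lborel) = (1::real)" by simp_all
 have pac: "continuous_on UNIV (%t. abs (p t))" by (intro continuous_intros pc)
 have "abs (p s) = (\<integral>t. abs (p s) * indicator {0..1::real} t \<partial>lborel)" by simp
 also have "... <= (\<integral>t. abs (p t) * indicator {0..1} t + B * indicator {0..1::real} t \<partial>lborel)"
 proof (rule integral_mono)
	show "integrable lborel (%t. abs (p t) * indicator {0..1} t + B * indicator {0..1::real} t)"
	 by (intro add_integrable ci pac integrable_mult_right I)
	show "abs (p s) * indicator {0..1} t <= abs (p t) * indicator {0..1} t + B * indicator {0..1} t" for t
	 using diff'[of t] by (simp add: indicator_def)
 qed simp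
 also have "... = (\<integral>t. abs (p t) * indicator {0..1} t \<partial>lborel) + B"
	using ci[OF pac] I by simp
 also have "... = (\<integral>t. abs (p t) * indicator {0..1} t + abs (f t) * indicator {0..1} t \<partial>lborel)"
	unfolding B_def by (rule add_integral[OF ci[OF pac] ci[OF fac], symmetric])
 also have "... <= (\<integral>t. sdens u (x + t *\<^sub>R w) * indicator {0..1} t \<partial>lborel)"
 proof (rule integral_mono)
	show "integrable lborel (%t. abs (p t) * indicator {0..1} t + abs (f t) * indicator {0..1} t)"
	 by (intro add_integrable ci pac fac)
	show "integrable lborel (%t. sdens u (x + t *\<^sub>R w) * indicator {0..1} t)" by (rule ci[OF dc])
	fix t :: real
	have "abs (f t) <= (SUM k:UNIV. abs (pd k u (x + t *\<^sub>R w) * w$k))" unfolding f_def by (rule sum_abs)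
	also have "... <= (SUM k:UNIV. abs (pd k u (x + t *\<^sub>R w)) * sobolev_weight)"
	 unfolding abs_mult by (intro sum_mono mult_left_mono order_trans[OF component_le_norm_cart w]) simp
	finally have "abs (f t) <= sobolev_weight * (SUM k:UNIV. abs (pd k u (x + t *\<^sub>R w)))"
	 by (simp add: sum_distrib_left mult.commute)
	hence "abs (p t) + abs (f t) <= sdens u (x + t *\<^sub>R w)" by (simp add: sdens_def p_def)
	thus "abs (p t) * indicator {0..1} t + abs (f t) * indicator {0..1} t <= sdens u (x + t *\<^sub>R w) * indicator {0..1} t"
	 by (simp add: indicator_def)
 qed
 finally have "ennreal (abs (p s)) <= ennreal (\<integral>t. sdens u (x + t *\<^sub>R w) * indicator {0..1} t \<partial>lborel)" by (rule ennreal_leI)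
 also have "... = (\<integral>\<^sup>+t. ennreal (sdens u (x + t *\<^sub>R w) * indicator {0..1} t) \<partial>lborel)"
	by (rule nn_integral_eq_integral[OF ci[OF dc], symmetric]) (simp add: sobolev_density_facts(3)[OF u])
 also have "... = (\<integral>\<^sup>+t. ennreal (sdens u (x + t *\<^sub>R w)) * indicator {0..<1::real} t \<partial>lborel)"
 proof (rule nn_integral_cong_AE)
	have "AE t in lborel. t ~= (1::real)" by (rule AE_lborel_singleton)
	thus "AE t in lborel. ennreal (sdens u (x + t *\<^sub>R w) * indicator {0..1} t) = ennreal (sdens u (x + t *\<^sub>R w)) * indicator {0..<1::real} t"
	 by (rule AE_mp) (intro AE_I2 impI, simp add: indicator_def)
 qed
 finally show ?thesis unfolding p_def .
qed

text \<open>Gagliardo's argument: \<open>u\<^sup>2\<close> is bounded by a product of two functions of one lattice coordinate each.\<close>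

theorem sobolev_W11_L2:
 assumes u: "C1p u"
 shows "area * (\<oint>x. (u x)^2) <= (\<oint>x. sdens u x)^2"
proof -
 let ?g = "%x. ennreal (sdens u x)"
 let ?I = "%t. indicator {0..<1::real} t :: ennreal"
 have gm [measurable]: "?g : BMeas"
	using sobolev_density_facts(4)[OF u] by measurable
 have gp: "periodic ?g" using sobolev_density_facts(2)[OF u] by (simp add: periodic_def)
 have um [measurable]: "u : BMeas" by (rule C1D(6)[OF u])
 define A1 where "A1 t = (\<integral>\<^sup>+s. ?g (grid (s, t)) * ?I s \<partial>lborel)" for t
 define A2 where "A2 s = (\<integral>\<^sup>+t. ?g (grid (s, t)) * ?I t \<partial>lborel)" for s
 have ind: "indicator unit_square (s, t) = ?I s * ?I t" for s t by (simp add: indicator_def)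
 have pm: "(%z. ?g (grid z) * indicator unit_square z) : borel_measurable (lborel \<Otimes>\<^sub>M lborel)"
	unfolding lborel_prod using unit_square_borel by measurable
 have sw: "(%z. grid (snd z, fst z)) : BMeas"
	unfolding grid_def by (intro borel_measurable_continuous_onI continuous_intros)
 have snd_m: "(%z. snd z) : borel_measurable (borel :: (real \<times> real) measure)"
	by (intro borel_measurable_continuous_onI continuous_intros)
 have im: "?I : borel_measurable (borel :: real measure)" by (rule borel_measurable_indicator) simp
 have sn: "(%z. ?I (snd z)) : borel_measurable (borel :: (real \<times> real) measure)"
	by (rule measurable_compose[OF snd_m im])
 have "(%z. ?g (grid z) * ?I (snd z)) : BMeas"
	"(%z. ?g (grid (snd z, fst z)) * ?I (snd z)) : BMeas"
	by (rule borel_measurable_times_ennreal[OF measurable_compose[OF grid_measurable gm] sn],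
		rule borel_measurable_times_ennreal[OF measurable_compose[OF sw gm] sn])
 hence gm2: "(%(s, t). ?g (grid (s, t)) * ?I t) : borel_measurable (lborel \<Otimes>\<^sub>M lborel)"
	"(%(t, s). ?g (grid (s, t)) * ?I s) : borel_measurable (lborel \<Otimes>\<^sub>M lborel)"
	unfolding lborel_prod case_prod_beta prod.collapse by simp_all
 have A1m [measurable]: "A1 : borel_measurable lborel" unfolding A1_def[abs_def]
	by (rule lborel.borel_measurable_nn_integral[OF gm2(2)])
 have A2m [measurable]: "A2 : borel_measurable lborel" unfolding A2_def[abs_def]
	by (rule lborel.borel_measurable_nn_integral[OF gm2(1)])
 define J where "J = (\<integral>\<^sup>+z. ?g (grid z) * indicator unit_square z \<partial>lborel)"
 have J2: "J = (\<integral>\<^sup>+s. A2 s * ?I s \<partial>lborel)"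
 proof -
	have "J = (\<integral>\<^sup>+s. (\<integral>\<^sup>+t. ?g (grid (s, t)) * indicator unit_square (s, t) \<partial>lborel) \<partial>lborel)"
	 unfolding J_def lborel_prod[symmetric] by (rule lborel.nn_integral_fst[OF pm, symmetric])
	also have "... = (\<integral>\<^sup>+s. A2 s * ?I s \<partial>lborel)"
	proof (rule nn_integral_cong)
	 fix s
	 have "(\<integral>\<^sup>+t. ?g (grid (s, t)) * indicator unit_square (s, t) \<partial>lborel) = (\<integral>\<^sup>+t. (?g (grid (s, t)) * ?I t) * ?I s \<partial>lborel)"
		by (simp only: ind mult_ac)
	 also have "... = A2 s * ?I s" unfolding A2_def by (rule nn_integral_multc) measurable
	 finally show "(\<integral>\<^sup>+t. ?g (grid (s, t)) * indicator unit_square (s, t) \<partial>lborel) = A2 s * ?I s" .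
	qed
	finally show ?thesis .
 qed
 have J1: "J = (\<integral>\<^sup>+t. A1 t * ?I t \<partial>lborel)"
 proof -
	have "J = (\<integral>\<^sup>+t. (\<integral>\<^sup>+s. ?g (grid (s, t)) * indicator unit_square (s, t) \<partial>lborel) \<partial>lborel)"
	 unfolding J_def lborel_prod[symmetric] by (rule lborel_pair.nn_integral_snd[OF pm, symmetric])
	also have "... = (\<integral>\<^sup>+t. A1 t * ?I t \<partial>lborel)"
	proof (rule nn_integral_cong)
	 fix t
	 have "(\<integral>\<^sup>+s. ?g (grid (s, t)) * indicator unit_square (s, t) \<partial>lborel) = (\<integral>\<^sup>+s. (?g (grid (s, t)) * ?I s) * ?I t \<partial>lborel)"
		by (simp only: ind mult_ac)
	 also have "... = A1 t * ?I t" unfolding A1_def by (rule nn_integral_multc) measurable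
	 finally show "(\<integral>\<^sup>+s. ?g (grid (s, t)) * indicator unit_square (s, t) \<partial>lborel) = A1 t * ?I t" .
	qed
	finally show ?thesis .
 qed
 have w: "norm per1 <= sobolev_weight" "norm per2 <= sobolev_weight" by (simp_all add: sobolev_weight_def)
 have pt: "ennreal ((u (grid (s, t)))^2) <= A1 t * A2 s" if st: "s : {0..<1}" "t : {0..<1}" for s t
 proof -
	have "ennreal (abs (u (t *\<^sub>R per2 + s *\<^sub>R per1))) <= (\<integral>\<^sup>+\<tau>. ?g (t *\<^sub>R per2 + \<tau> *\<^sub>R per1) * ?I \<tau> \<partial>lborel)"
	 by (rule line_bound[OF u w(1)]) (use st in simp)
	hence a: "ennreal (abs (u (grid (s, t)))) <= A1 t" unfolding A1_def grid_def by (simp add: add.commute)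
	have "ennreal (abs (u (s *\<^sub>R per1 + t *\<^sub>R per2))) <= (\<integral>\<^sup>+\<tau>. ?g (s *\<^sub>R per1 + \<tau> *\<^sub>R per2) * ?I \<tau> \<partial>lborel)"
	 by (rule line_bound[OF u w(2)]) (use st in simp)
	hence b: "ennreal (abs (u (grid (s, t)))) <= A2 s" unfolding A2_def grid_def by simp
	have "ennreal ((u (grid (s, t)))^2) = ennreal (abs (u (grid (s, t)))) * ennreal (abs (u (grid (s, t))))"
	 by (subst ennreal_mult[symmetric]) (simp_all add: power2_eq_square)
	also have "... <= A1 t * A2 s" by (intro mult_mono a b) simp_all
	finally show ?thesis .
 qed
 have um2: "(%x. ennreal ((u x)^2)) : BMeas" by measurable
 have "periodic (%x. ennreal ((u x)^2))" using C1D(1)[OF u] by (simp add: periodic_def)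
 note ca = cell_average[OF um2 this] cell_average[OF gm gp, folded J_def]
 have pm2: "(%z. A1 (snd z) * A2 (fst z) * indicator unit_square z) : borel_measurable (lborel \<Otimes>\<^sub>M lborel)"
 proof -
	have "unit_square : sets (lborel \<Otimes>\<^sub>M lborel)" unfolding lborel_prod using unit_square_borel by simp
	thus ?thesis by measurable
 qed
 have "(\<integral>\<^sup>+z. ennreal ((u (grid z))^2) * indicator unit_square z \<partial>lborel) <=
	 (\<integral>\<^sup>+z. A1 (snd z) * A2 (fst z) * indicator unit_square z \<partial>lborel)"
 proof (rule nn_integral_mono)
	fix z :: "real \<times> real"
	show "ennreal ((u (grid z))^2) * indicator unit_square z <= A1 (snd z) * A2 (fst z) * indicator unit_square z"
	proof (cases "z : unit_square")
	 case True
	 hence "fst z : {0..<1}" "snd z : {0..<1}" by auto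
	 from pt[OF this] show ?thesis using True by simp
	qed simp
 qed
 also have "... = (\<integral>\<^sup>+s. (\<integral>\<^sup>+t. A1 t * A2 s * indicator unit_square (s, t) \<partial>lborel) \<partial>lborel)"
	unfolding lborel_prod[symmetric] using lborel.nn_integral_fst[OF pm2] by simp
 also have "... = (\<integral>\<^sup>+s. J * (A2 s * ?I s) \<partial>lborel)"
 proof (rule nn_integral_cong)
	fix s
	have "(\<integral>\<^sup>+t. A1 t * A2 s * indicator unit_square (s, t) \<partial>lborel) = (\<integral>\<^sup>+t. (A1 t * ?I t) * (A2 s * ?I s) \<partial>lborel)"
	 by (simp only: ind mult_ac)
	also have "... = J * (A2 s * ?I s)" unfolding J1 by (rule nn_integral_multc) measurable
	finally show "(\<integral>\<^sup>+t. A1 t * A2 s * indicator unit_square (s, t) \<partial>lborel) = J * (A2 s * ?I s)" .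
 qed
 also have "... = J * J"
	by (subst nn_integral_cmult) (measurable, simp only: J2[symmetric])
 finally have main: "(\<integral>\<^sup>+z. ennreal ((u (grid z))^2) * indicator unit_square z \<partial>lborel) <= J * J" .
 have ui: "Integ (%x. (u x)^2)" by (rule L2D(4)[OF C1_periodic_L2(1)[OF u]])
 have gi: "Integ (sdens u)"
	by (rule L2D(5)[OF continuous_periodic_L2[OF sobolev_density_facts(2,1)[OF u]]])
 define X where "X = (\<oint>x. (u x)^2)"
 define Y where "Y = (\<oint>x. sdens u x)"
 have X0: "0 <= X" unfolding X_def by (rule integral_nonneg_AE) simp
 have Y0: "0 <= Y" unfolding Y_def by (rule integral_nonneg_AE) (simp add: sobolev_density_facts(3)[OF u])
 have "ennreal (area * X) = ennreal area * ennreal X" using X0 area_pos by (intro ennreal_mult) simp_all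
 also have "ennreal X = (\<oint>+x. ennreal ((u x)^2))"
	unfolding X_def by (rule nn_integral_eq_integral[OF ui, symmetric]) simp
 also have "ennreal area * (\<oint>+x. ennreal ((u x)^2)) <= ennreal area * (ennreal area * (J * J))"
	unfolding ca(1) by (intro mult_left_mono main) simp_all
 also have "... = (ennreal area * J) * (ennreal area * J)" by (simp only: mult_ac)
 also have "ennreal area * J = ennreal Y"
	unfolding ca(2)[symmetric] Y_def by (rule nn_integral_eq_integral[OF gi]) (simp add: sobolev_density_facts(3)[OF u])
 also have "ennreal Y * ennreal Y = ennreal (Y^2)"
	using Y0 by (subst ennreal_mult[symmetric]) (simp_all add: power2_eq_square)
 finally show ?thesis unfolding X_def[symmetric] Y_def[symmetric] by simp
qed


section \<open>Level set estimates\<close>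

lemma C1_periodic_compose:
 assumes u: "C1p u" and f: "!!y. (f has_real_derivative f' y) (at y)" and c: "continuous_on UNIV f'"
 shows "C1p (%x. f (u x))"
	and "pd k (%x. f (u x)) x = f' (u x) * pd k u x"
proof -
 have d: "((%x. f (u x)) has_derivative (%h. f' (u x) * (SUM k:UNIV. pd k u x * h$k))) (at x)" for x
 proof -
	have "(f has_derivative (%h. f' (u x) * h)) (at (u x))"
	 using f[of "u x"] by (simp only: has_field_derivative_def)
	from has_derivative_compose[OF has_derivative_partial[OF C1D(2)[OF u]] this]
	show ?thesis .
 qed
 show eq: "pd k (%x. f (u x)) x = f' (u x) * pd k u x" for k x
	using partial_deriv_eqI[OF d, of k x] by (simp add: sum_axis)
 have "continuous_on UNIV (%x. f' (u x) * pd k u x)" for k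
	by (intro continuous_on_mult continuous_on_compose2[OF c C1D(3)[OF u]] C1D(4)[OF u]) simp
 moreover have "periodic (%x. f (u x))"
	using C1D(1)[OF u] by (simp add: periodic_def)
 moreover have "(%x. f (u x)) differentiable (at x)" for x using d differentiable_def by blast
 ultimately show "C1p (%x. f (u x))" unfolding C1p_def eq[abs_def] by blast
qed

definition cutoff :: "real => real => real => real" where
 "cutoff a d y = d * smoothstep ((y - a) / d)"

definition cutoff' :: "real => real => real => real" where
 "cutoff' a d y = smoothstep' ((y - a) / d)"

lemma cutoff_derivative: "d > 0 ==> (cutoff a d has_real_derivative cutoff' a d y) (at y)"
proof -
 assume d: "d > 0"
 have "((%y. (y - a) / d) has_real_derivative 1 / d) (at y)"
	using d by (auto intro!: derivative_eq_intros)
 from DERIV_cmult[OF DERIV_chain2[OF smoothstep_derivative this], of d]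
 show ?thesis using d by (simp add: cutoff_def[abs_def] cutoff'_def)
qed

lemma cutoff'_continuous: "continuous_on UNIV (cutoff' a d)"
 unfolding cutoff'_def[abs_def]
 by (rule continuous_on_compose2[OF smoothstep'_continuous]) (auto simp: divide_inverse intro!: continuous_intros)

lemma cutoff_bounds:
 assumes "d > 0"
 shows "0 <= cutoff a d y" "cutoff a d y <= d * indicator {a<..} y" "d * indicator {a + d<..} y <= cutoff a d y"
	"0 <= cutoff' a d y" "cutoff' a d y <= 3/2 * indicator {a<..<a + d} y"
proof -
 show "0 <= cutoff a d y" using assms smoothstep_bounds(1) by (simp add: cutoff_def)
 show "cutoff a d y <= d * indicator {a<..} y"
 proof (cases "a < y")
	case True
	thus ?thesis using assms smoothstep_bounds(2)[of "(y - a) / d"] by (simp add: cutoff_def)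
 next
	case False
	hence "smoothstep ((y - a) / d) = 0" using assms by (intro smoothstep_bounds) (simp add: divide_nonpos_pos)
	thus ?thesis by (simp add: cutoff_def assms less_imp_le)
 qed
 show "d * indicator {a + d<..} y <= cutoff a d y"
 proof (cases "a + d < y")
	case True
	hence "smoothstep ((y - a) / d) = 1" using assms by (intro smoothstep_bounds) simp
	thus ?thesis using True by (simp add: cutoff_def indicator_def)
 next
	case False
	thus ?thesis using \<open>0 <= cutoff a d y\<close> by (simp add: indicator_def)
 qed
 show "0 <= cutoff' a d y" by (simp add: cutoff'_def smoothstep'_bounds)
 show "cutoff' a d y <= 3/2 * indicator {a<..<a + d} y"
 proof (cases "a < y & y < a + d")
	case True
	thus ?thesis using smoothstep'_bounds(2)[of "(y - a) / d"] by (simp add: cutoff'_def)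
 next
	case False
	hence "\<not> (0 < (y - a) / d & (y - a) / d < 1)" using assms by (simp add: field_simps) linarith?
	hence "smoothstep' ((y - a) / d) = 0" unfolding smoothstep'_def by (simp only: if_False)
	thus ?thesis by (simp add: cutoff'_def)
 qed
qed

definition level :: "(real^2 => real) => real => real" where
 "level u a = (\<oint>x. indicator {a<..} (u x))"

definition level_const :: real where
 "level_const = (2 + 6 * sobolev_weight^2) / area"

lemma level_const_pos: "level_const > 0"
proof -
 have "2 + 6 * sobolev_weight^2 > 0" using zero_le_power2[of sobolev_weight] by linarith
 thus ?thesis unfolding level_const_def using area_pos by simp
qed

lemma indicator_integrable:
 assumes [measurable]: "u : Meas" "B : sets borel"
 shows "Integ (%x. indicator B (u x) :: real)"
 by (rule M.integrable_const_bound[where B = 1]) (simp_all add: indicator_def)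

lemma level_nonneg: "0 <= level u a"
 unfolding level_def by (rule integral_nonneg_AE) simp

lemma cauchy_schwarz_M:
 fixes f g :: "real^2 => real"
 assumes [measurable]: "f : Meas" "g : Meas"
	and i: "Integ (%x. (f x)^2)" "Integ (%x. (g x)^2)"
 shows "(\<oint>x. f x * g x)^2 <= (\<oint>x. (f x)^2) * (\<oint>x. (g x)^2)"
proof -
 define F where "F = (\<oint>x. (f x)^2)"
 define G where "G = (\<oint>x. (g x)^2)"
 define H where "H = (\<oint>x. f x * g x)"
 have fg: "Integ (%x. f x * g x)" by (rule L2_product_integrable[OF assms])
 have q: "0 <= s^2 * F - 2 * s * t * H + t^2 * G" for s t
 proof -
	have "0 <= (\<oint>x. (s * f x - t * g x)^2)" by (rule integral_nonneg_AE) simp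
	also have "... = (\<oint>x. s^2 * (f x)^2 - 2 * s * t * (f x * g x) + t^2 * (g x)^2)"
	 by (intro cong_integral refl) (simp add: power2_eq_square algebra_simps)
	also have "... = s^2 * F - 2 * s * t * H + t^2 * G"
	 using i fg by (simp add: F_def G_def H_def)
	finally show ?thesis .
 qed
 have F0: "0 <= F" and G0: "0 <= G" unfolding F_def G_def by (rule integral_nonneg_AE, simp)+
 have "H^2 <= F * G"
 proof (cases "G = 0")
	case True
	have "H = 0"
	proof (rule ccontr)
	 assume "H ~= 0"
	 have "0 <= 1^2 * F - 2 * 1 * ((F + 1) / (2 * H)) * H + ((F + 1) / (2 * H))^2 * G" by (rule q)
	 also have "... = F - (F + 1)" using \<open>H ~= 0\<close> True by (simp add: field_simps)
	 finally show False by simp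
	qed
	thus ?thesis using True by simp
 next
	case False
	hence G: "G > 0" using G0 by simp
	have "0 <= G^2 * F - 2 * G * H * H + H^2 * G" by (rule q)
	also have "... = G * (F * G - H^2)" by (simp add: power2_eq_square algebra_simps)
	finally have "0 <= F * G - H^2" using G by (simp add: zero_le_mult_iff)
	thus ?thesis by simp
 qed
 thus ?thesis by (simp only: F_def G_def H_def)
qed

text \<open>The Sobolev inequality for a truncation of \<open>u\<close>; its derivative lives between the two levels.\<close>

lemma level_estimate:
 assumes u: "C1p u" and d: "d > 0"
 shows "d^2 * level u (a + d) <= level_const * level u a * (d^2 * level u a + (\<oint>x. cutoff' a d (u x) * grad_sq u x))"
proof -
 let ?T = "%x. cutoff a d (u x)" and ?T' = "%x. cutoff' a d (u x)"
 let ?L = "level u a" and ?c = "sobolev_weight"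
 define e where "e = (\<oint>x. ?T' x * grad_sq u x)"
 define S where "S x = (SUM k:UNIV. abs (pd k u x))" for x
 note T = C1_periodic_compose[OF u, of "cutoff a d" "cutoff' a d", OF cutoff_derivative[OF d] cutoff'_continuous]
 note bd = cutoff_bounds[OF d]
 have um: "u : Meas" by (rule measurable_borel_M[OF C1D(6)[OF u]])
 have iL: "Integ (%x. indicator {a<..} (u x) :: real)" "Integ (%x. indicator {a + d<..} (u x) :: real)"
	"Integ (%x. indicator {a<..<a + d} (u x) :: real)"
	by (rule indicator_integrable[OF um], simp)+
 have Tc: "continuous_on UNIV ?T'" by (rule continuous_on_compose2[OF cutoff'_continuous C1D(3)[OF u]]) simp
 have Tp: "periodic ?T'" using C1D(1)[OF u] by (simp add: periodic_def)
 have Sc: "continuous_on UNIV S" unfolding S_def[abs_def] by (intro continuous_intros C1D(4)[OF u])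
 have Sp: "periodic S" unfolding S_def[abs_def] using C1D(5)[OF u] by (simp add: periodic_def)
 have S0: "0 <= S x" for x unfolding S_def by (simp add: sum_nonneg)
 have cpL: "Integ f" if "continuous_on UNIV f" "periodic f" for f :: "real^2 => real"
	by (rule L2D(5)[OF continuous_periodic_L2[OF that(2,1)]])
 have iTS: "Integ (%x. ?T' x * S x)"
	by (rule cpL) (use Tc Sc Tp Sp in \<open>auto intro!: continuous_intros simp: periodic_def\<close>)
 have iT: "Integ ?T" by (rule L2D(5)[OF C1_periodic_L2(1)[OF T(1)]])
 have iT2: "Integ (%x. (?T x)^2)" by (rule L2D(4)[OF C1_periodic_L2(1)[OF T(1)]])
 have iTg: "Integ (%x. ?T' x * grad_sq u x)"
	by (rule cpL) (use Tc Tp grad_sq_facts(1,2)[OF u] in \<open>auto intro!: continuous_intros simp: periodic_def\<close>)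
 have e0: "0 <= e" unfolding e_def by (rule integral_nonneg_AE) (simp add: bd(4) grad_sq_facts(3)[OF u])
 have L0: "0 <= ?L" by (rule level_nonneg)
 have dens: "sdens ?T x = ?T x + ?c * (?T' x * S x)" for x
	unfolding sdens_def T(2) S_def
	using bd(1)[of a "u x"] bd(4)[of a "u x"] by (simp add: abs_mult sum_distrib_left)
 have TL: "(\<oint>x. ?T x) <= d * ?L"
 proof -
	have "(\<oint>x. ?T x) <= (\<oint>x. d * indicator {a<..} (u x))"
	 by (intro integral_mono iT integrable_mult_right iL bd(2))
	thus ?thesis by (simp add: level_def)
 qed
 have T0: "0 <= (\<oint>x. ?T x)" by (rule integral_nonneg_AE) (simp add: bd(1))
 have TS: "(\<oint>x. ?T' x * S x)^2 <= 3 * ?L * e"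
 proof -
	have m1: "(%x. sqrt (?T' x)) : Meas"
	 by (intro measurable_borel_M borel_measurable_continuous_onI continuous_intros Tc)
	have m2: "(%x. sqrt (?T' x) * S x) : Meas"
	 by (intro measurable_borel_M borel_measurable_continuous_onI continuous_intros Tc Sc)
	have e1: "(sqrt (?T' x))^2 = ?T' x" for x using bd(4) by simp
	have e2: "(sqrt (?T' x) * S x)^2 = ?T' x * (S x)^2" for x using bd(4) by (simp add: power_mult_distrib)
	have e3: "sqrt (?T' x) * (sqrt (?T' x) * S x) = ?T' x * S x" for x
	 using bd(4) by (simp add: mult.assoc[symmetric])
	have i1: "Integ ?T'" by (rule cpL[OF Tc Tp])
	have i2: "Integ (%x. ?T' x * (S x)^2)"
	 by (rule cpL) (use Tc Sc Tp Sp in \<open>auto intro!: continuous_intros simp: periodic_def\<close>)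
	have cs: "(\<oint>x. ?T' x * S x)^2 <= (\<oint>x. ?T' x) * (\<oint>x. ?T' x * (S x)^2)"
	 using cauchy_schwarz_M[OF m1 m2] i1 i2 unfolding e1 e2 e3 by blast
	have a1: "(\<oint>x. ?T' x) <= 3/2 * ?L"
	proof -
	 have "(\<oint>x. ?T' x) <= (\<oint>x. 3/2 * indicator {a<..} (u x))"
	 proof (intro integral_mono i1 integrable_mult_right iL)
		fix x
		have "indicator {a<..<a + d} (u x) <= (indicator {a<..} (u x) :: real)" by (simp add: indicator_def)
		thus "?T' x <= 3/2 * indicator {a<..} (u x)" using bd(5)[of a "u x"] by linarith
	 qed
	 thus ?thesis by (simp add: level_def)
	qed
	have a2: "(\<oint>x. ?T' x * (S x)^2) <= 2 * e"
	proof -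
	 have "(\<oint>x. ?T' x * (S x)^2) <= (\<oint>x. 2 * (?T' x * grad_sq u x))"
	 proof (intro integral_mono i2 integrable_mult_right iTg)
		fix x
		have "(S x)^2 <= 2 * grad_sq u x"
		proof -
		have "(abs p + abs q)^2 <= 2 * (p^2 + q^2)" for p q :: real
		proof -
		have "0 <= (abs p - abs q)^2" by simp
		thus ?thesis by (simp add: power2_eq_square algebra_simps)
		qed
		thus ?thesis unfolding S_def grad_sq_def sum_2 .
		qed
		hence "?T' x * (S x)^2 <= ?T' x * (2 * grad_sq u x)" by (intro mult_left_mono bd(4))
		thus "?T' x * (S x)^2 <= 2 * (?T' x * grad_sq u x)" by simp
	 qed
	 thus ?thesis by (simp add: e_def)
	qed
	have "(\<oint>x. ?T' x) * (\<oint>x. ?T' x * (S x)^2) <= (3/2 * ?L) * (2 * e)"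
	 using L0 by (intro mult_mono a1 a2 integral_nonneg_AE) (simp_all add: bd(4))
	moreover have "(3/2 * ?L) * (2 * e) = 3 * ?L * e" by simp
	ultimately show ?thesis using cs by linarith
 qed
 have low: "d^2 * level u (a + d) <= (\<oint>x. (?T x)^2)"
 proof -
	have "(\<oint>x. d^2 * indicator {a + d<..} (u x)) <= (\<oint>x. (?T x)^2)"
	proof (intro integral_mono iT2 integrable_mult_right iL)
	 fix x
	 have "d^2 * indicator {a + d<..} (u x) = (d * indicator {a + d<..} (u x))^2" by (simp add: indicator_def)
	 also have "... <= (?T x)^2" using d by (intro power_mono bd(3)) simp
	 finally show "d^2 * indicator {a + d<..} (u x) <= (?T x)^2" .
	qed
	thus ?thesis by (simp add: level_def)
 qed
 have "area * (d^2 * level u (a + d)) <= area * (\<oint>x. (?T x)^2)"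
	using low area_pos by (intro mult_left_mono) simp_all
 also have "... <= (\<oint>x. sdens ?T x)^2" by (rule sobolev_W11_L2[OF T(1)])
 also have "(\<oint>x. sdens ?T x) = (\<oint>x. ?T x) + ?c * (\<oint>x. ?T' x * S x)"
	unfolding dens using iT iTS by simp
 also have "((\<oint>x. ?T x) + ?c * (\<oint>x. ?T' x * S x))^2 <= 2 * (\<oint>x. ?T x)^2 + 2 * (?c^2 * (\<oint>x. ?T' x * S x)^2)"
 proof -
	have "(p + q)^2 <= 2 * p^2 + 2 * q^2" for p q :: real
	proof -
	 have "0 <= (p - q)^2" by simp
	 thus ?thesis by (simp add: power2_eq_square algebra_simps)
	qed
	thus ?thesis by (simp only: power_mult_distrib[symmetric])
 qed
 also have "... <= 2 * (d * ?L)^2 + 2 * (?c^2 * (3 * ?L * e))"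
	using TL T0 TS by (intro add_mono mult_left_mono power_mono) simp_all
 also have "... <= (2 + 6 * ?c^2) * ?L * (d^2 * ?L + e)"
 proof -
	have "0 <= 6 * ?c^2 * ?L * (d^2 * ?L) + 2 * ?L * e" using L0 e0 by simp
	thus ?thesis by (simp add: power_mult_distrib power2_eq_square algebra_simps)
 qed
 finally have "area * (d^2 * level u (a + d)) <= (2 + 6 * ?c^2) * ?L * (d^2 * ?L + e)" .
 hence "d^2 * level u (a + d) <= (2 + 6 * ?c^2) * ?L * (d^2 * ?L + e) / area"
	using area_pos by (simp add: pos_le_divide_eq mult.commute)
 thus ?thesis unfolding level_const_def e_def[symmetric] by simp
qed

end

lemma sum_band_indicators: "(SUM k<K. indicator {real k<..<real k + 1} y) <= (indicator {..<real K} y :: real)"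
proof (induction K)
 case (Suc K)
 have "indicator {..<real K} y + indicator {real K<..<real K + 1} y <= (indicator {..<real (Suc K)} y :: real)"
	by (auto simp: indicator_def)
 thus ?case using Suc by simp
qed simp

lemma sum_tail_indicators: "(SUM k<K. indicator {real k<..} y) <= max 0 (min (real K) (y + 1))" for y :: real
proof (induction K)
 case (Suc K)
 have "max 0 (min (real K) (y + 1)) + indicator {real K<..} y <= max 0 (min (real (Suc K)) (y + 1))"
	by (auto simp: indicator_def max_def min_def)
 thus ?case using Suc by simp
qed simp

lemma exp_le_layers:
 assumes s: "0 <= (s::real)"
 shows "y <= real n ==> exp (s * y) <= 1 + (SUM k<n. exp (s * (real k + 1)) * indicator {real k<..} y)"
proof (induction n)
 case 0
 hence "s * y <= 0" using s by (simp add: mult_nonneg_nonpos)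
 thus ?case by simp
next
 case (Suc n)
 show ?case
 proof (cases "y <= real n")
	case True
	thus ?thesis using Suc.IH by (simp add: add_increasing2)
 next
	case False
	hence "exp (s * y) <= exp (s * (real n + 1)) * indicator {real n<..} y"
	 using Suc.prems s by (simp add: mult_left_mono)
	moreover have "0 <= (SUM k<n. exp (s * (real k + 1)) * indicator {real k<..} y)" by (intro sum_nonneg) simp
	ultimately show ?thesis by simp
 qed
qed

context flat_torus
begin

section \<open>Exponential integrability\<close>

text \<open>The level estimate makes the measures of successive level sets decay by a factor \<open>e\<^sup>-\<^sup>s / 2\<close>, apart from factors whose product is at most exponential in the square of the norm.\<close>

lemma exp_bound_C1:
 assumes s: "0 <= s"
 shows "EX c beta. 0 <= c & 0 <= beta & (ALL u. C1p u -->
	(\<oint>x. exp (s * u x)) <= c * exp (beta * ((\<oint>x. (u x)^2) + (\<oint>x. grad_sq u x))))"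
proof -
 define beta where "beta = 2 * level_const * exp s"
 have beta: "beta > 0" using level_const_pos by (simp add: beta_def)
 define c where "c = area * (1 + 2 * exp s) * exp (2 * beta * area)"
 have c: "c >= 0" using area_pos by (simp add: c_def)
 have "(\<oint>x. exp (s * u x)) <= c * exp (2 * beta * ((\<oint>x. (u x)^2) + (\<oint>x. grad_sq u x)))"
	if u: "C1p u" for u
 proof -
	define X where "X = (\<oint>x. (u x)^2) + (\<oint>x. grad_sq u x)"
	define a where "a k = level u (real k)" for k :: nat
	define e where "e k = (\<oint>x. cutoff' (real k) 1 (u x) * grad_sq u x)" for k :: nat
	note uL = L2D[OF C1_periodic_L2(1)[OF u]] and g = grad_sq_facts[OF u]
	have um: "u : Meas" by (rule uL(3))
	have a0: "0 <= a k" for k unfolding a_def by (rule level_nonneg)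
	have e0: "0 <= e k" for k unfolding e_def
	 by (rule integral_nonneg_AE) (simp add: cutoff_bounds(4) g(3))
	have ie: "Integ (%x. cutoff' (real k) 1 (u x) * grad_sq u x)" for k
	proof -
	 have "continuous_on UNIV (%x. cutoff' (real k) 1 (u x) * grad_sq u x)"
		by (intro continuous_on_mult continuous_on_compose2[OF cutoff'_continuous C1D(3)[OF u]] g(1)) simp
	 moreover have "periodic (%x. cutoff' (real k) 1 (u x) * grad_sq u x)"
		using uL(1) g(2) by (simp add: periodic_def)
	 ultimately show ?thesis by (rule L2D(5)[OF continuous_periodic_L2, rotated])
	qed
	have ia: "Integ (%x. indicator {real k<..} (u x) :: real)" for k
	 by (rule indicator_integrable[OF um]) simp
	have step: "a (Suc k) <= (1/2) * exp (- s) * a k * exp (beta * (a k + e k))" for k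
	proof -
	 have "1^2 * level u (real k + 1) <= level_const * level u (real k) * (1^2 * level u (real k) + e k)"
		unfolding e_def by (rule level_estimate[OF u]) simp
	 hence "a (Suc k) <= level_const * a k * (a k + e k)" by (simp add: a_def add.commute)
	 also have "a k + e k <= exp (beta * (a k + e k)) / beta"
	 proof -
		have "beta * (a k + e k) <= exp (beta * (a k + e k))" using exp_ge_add_one_self[of "beta * (a k + e k)"] by linarith
		thus ?thesis using beta by (simp add: pos_le_divide_eq mult.commute)
	 qed
	 also have "level_const * a k * (exp (beta * (a k + e k)) / beta) = (1/2) * exp (- s) * a k * exp (beta * (a k + e k))"
		using level_const_pos by (simp add: beta_def exp_minus field_simps)
	 finally show ?thesis using level_const_pos a0[of k] by (simp add: mult_left_mono)
	qed
	have main: "a K <= area * ((1/2) * exp (- s)) ^ K * exp (beta * (SUM k<K. a k + e k))" for K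
	proof (induction K)
	 case 0
	 have "a 0 <= (\<oint>x. 1)" unfolding a_def level_def
		by (intro integral_mono indicator_integrable um) (simp_all add: indicator_def)
	 thus ?case by (simp add: area_def)
	next
	 case (Suc K)
	 have "a (Suc K) <= (1/2) * exp (- s) * a K * exp (beta * (a K + e K))" by (rule step)
	 also have "... <= (1/2) * exp (- s) * (area * ((1/2) * exp (- s)) ^ K * exp (beta * (SUM k<K. a k + e k))) * exp (beta * (a K + e K))"
		by (intro mult_right_mono mult_left_mono Suc) simp_all
	 also have "... = area * ((1/2) * exp (- s)) ^ Suc K * (exp (beta * (SUM k<K. a k + e k)) * exp (beta * (a K + e K)))"
		by simp
	 also have "exp (beta * (SUM k<K. a k + e k)) * exp (beta * (a K + e K)) = exp (beta * (SUM k<Suc K. a k + e k))"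
		by (simp add: exp_add[symmetric] distrib_left)
	 finally show ?case .
	qed
	have suma: "(SUM k<K. a k) <= 2 * area + (\<oint>x. (u x)^2)" for K
	proof -
	 have "(SUM k<K. a k) = (\<oint>x. (SUM k<K. indicator {real k<..} (u x)))"
		unfolding a_def level_def by (rule sum_integral[symmetric]) (rule ia)
	 also have "... <= (\<oint>x. 1 + abs (u x))"
	 proof (intro integral_mono sum_integrable ia add_integrable integrable_abs uL(5))
		fix x
		have "max 0 (min (real K) (u x + 1)) <= 1 + abs (u x)" by (auto simp: max_def min_def abs_if)
		thus "(SUM k<K. indicator {real k<..} (u x)) <= 1 + abs (u x)"
		using sum_tail_indicators[where K = K and y = "u x"] by linarith
	 qed simp
	 also have "... = area + (\<oint>x. abs (u x))" using uL(5) by (simp add: area_def)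
	 finally show ?thesis using L1_bound_of_L2[OF C1_periodic_L2(1)[OF u]] by linarith
	qed
	have sume: "(SUM k<K. e k) <= 3/2 * (\<oint>x. grad_sq u x)" for K
	proof -
	 have "(SUM k<K. e k) = (\<oint>x. (SUM k<K. cutoff' (real k) 1 (u x) * grad_sq u x))"
		unfolding e_def by (rule sum_integral[symmetric]) (rule ie)
	 also have "... <= (\<oint>x. 3/2 * grad_sq u x)"
	 proof (intro integral_mono sum_integrable ie integrable_mult_right g(5))
		fix x
		have "(SUM k<K. cutoff' (real k) 1 (u x)) <= (SUM k<K. 3/2 * indicator {real k<..<real k + 1} (u x))"
		by (intro sum_mono cutoff_bounds(5)) simp
		also have "... = 3/2 * (SUM k<K. indicator {real k<..<real k + 1} (u x))" by (rule sum_distrib_left[symmetric])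
		also have "... <= 3/2 * indicator {..<real K} (u x)" by (intro mult_left_mono sum_band_indicators) simp
		also have "... <= 3/2" by (simp add: indicator_def)
		finally have "(SUM k<K. cutoff' (real k) 1 (u x)) * grad_sq u x <= 3/2 * grad_sq u x"
		by (intro mult_right_mono g(3))
		thus "(SUM k<K. cutoff' (real k) 1 (u x) * grad_sq u x) <= 3/2 * grad_sq u x"
		by (simp only: sum_distrib_right)
	 qed
	 finally show ?thesis by simp
	qed
	have G0: "0 <= (\<oint>x. grad_sq u x)" by (rule integral_nonneg_AE) (simp add: g(3))
	have U0: "0 <= (\<oint>x. (u x)^2)" by (rule integral_nonneg_AE) simp
	have sumx: "(SUM k<K. a k + e k) <= 2 * area + 2 * X" for K
	proof -
	 have arith: "p + q <= 2 * r + 2 * (U + G)" if "p <= 2 * r + U" "q <= 3/2 * G" "0 <= G" "0 <= U" for p q r U G :: real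
		unfolding distrib_left using that by linarith
	 show ?thesis unfolding X_def sum.distrib by (rule arith[OF suma sume G0 U0])
	qed
	define E where "E = exp (beta * (2 * area + 2 * X))"
	have E1: "1 <= E" unfolding E_def X_def using beta area_pos G0 U0 by simp
	have aK: "exp (s * (real K + 1)) * a K <= area * exp s * E * (1/2) ^ K" for K
	proof -
	 have ek: "exp (s * (real K + 1)) = exp s * exp s ^ K"
		using exp_of_nat_mult[of K s] by (simp add: distrib_left exp_add mult.commute)
	 have "a K <= area * ((1/2) * exp (- s)) ^ K * E"
	 proof -
		have "exp (beta * (SUM k<K. a k + e k)) <= E" unfolding E_def using beta sumx[of K] by simp
		hence "area * ((1/2) * exp (- s)) ^ K * exp (beta * (SUM k<K. a k + e k)) <= area * ((1/2) * exp (- s)) ^ K * E"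
		using area_pos by (intro mult_left_mono) simp_all
		thus ?thesis using main[of K] by linarith
	 qed
	 hence "exp (s * (real K + 1)) * a K <= exp (s * (real K + 1)) * (area * ((1/2) * exp (- s)) ^ K * E)"
		by (intro mult_left_mono) simp_all
	 also have "... = area * exp s * E * (1/2) ^ K * (exp s ^ K * exp (- s) ^ K)"
		unfolding ek power_mult_distrib by (simp only: mult_ac)
	 also have "exp s ^ K * exp (- s) ^ K = 1" by (simp add: power_mult_distrib[symmetric] exp_add[symmetric])
	 finally show ?thesis by simp
	qed
	obtain B where B: "!!x. abs (u x) <= B" using C1_periodic_bounded[OF u] by blast
	obtain n :: nat where n: "B <= real n" using real_arch_simple by blast
	have un: "u x <= real n" for x using B[of x] n by linarith
	have iexp: "Integ (%x. exp (s * u x))"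
	 by (rule L2D(5)[OF continuous_periodic_L2])
		(use uL(1) C1D(3)[OF u] in \<open>auto intro!: continuous_intros simp: periodic_def\<close>)
	have "(\<oint>x. exp (s * u x)) <= (\<oint>x. 1 + (SUM k<n. exp (s * (real k + 1)) * indicator {real k<..} (u x)))"
	 by (intro integral_mono iexp add_integrable sum_integrable
		integrable_mult_right ia exp_le_layers s un) simp
	also have "... = (\<oint>x. 1) + (\<oint>x. (SUM k<n. exp (s * (real k + 1)) * indicator {real k<..} (u x)))"
	 by (intro add_integral sum_integrable integrable_mult_right ia) simp
	also have "(\<oint>x. (SUM k<n. exp (s * (real k + 1)) * indicator {real k<..} (u x))) =
		(SUM k<n. \<integral>x. exp (s * (real k + 1)) * indicator {real k<..} (u x) \<partial>M)"
	 by (intro sum_integral integrable_mult_right ia)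
	also have "... = (SUM k<n. exp (s * (real k + 1)) * a k)"
	 unfolding a_def level_def by (intro sum.cong refl integral_mult_right_zero)
	also have "(\<oint>x. 1) = area" by (simp add: area_def)
	also have "area + (SUM k<n. exp (s * (real k + 1)) * a k) <= area + (SUM k<n. area * exp s * E * (1/2) ^ k)"
	 by (intro add_left_mono sum_mono aK)
	also have "(SUM k<n. area * exp s * E * (1/2) ^ k) = area * exp s * E * (SUM k<n. (1/2) ^ k)"
	 by (rule sum_distrib_left[symmetric])
	also have "(SUM k<n. (1/2::real) ^ k) <= 2" by (simp add: geometric_sum)
	also have "area + area * exp s * E * 2 <= area * E + area * exp s * E * 2"
	 using E1 area_pos by simp
	also have "... = c * exp (2 * beta * X)"
	 unfolding c_def E_def by (simp add: distrib_left distrib_right exp_add mult_ac)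
	finally show ?thesis unfolding X_def using area_pos E1 by (simp add: mult_left_mono)
 qed
 thus ?thesis using c beta by (intro exI[of _ c] exI[of _ "2 * beta"]) simp
qed

theorem exp_bound_W12:
 assumes s: "0 <= s"
 shows "EX c beta. 0 <= c & 0 <= beta & (ALL u:W. Integ (%x. exp (s * abs (u x))) &
	(\<oint>x. exp (s * abs (u x))) <= c * exp (beta * ((\<oint>x. (u x)^2) + dir u)))"
proof -
 obtain c beta where c: "0 <= c" "0 <= beta" and cb: "ALL u. C1p u -->
	(\<oint>x. exp (s * u x)) <= c * exp (beta * ((\<oint>x. (u x)^2) + (\<oint>x. grad_sq u x)))"
	using exp_bound_C1[OF s] by (elim exE conjE)
 have "Integ (%x. exp (s * abs (u x))) &
	(\<oint>x. exp (s * abs (u x))) <= 2 * c * exp (6 * beta) * exp (2 * beta * ((\<oint>x. (u x)^2) + dir u))"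
	if u: "u : W" for u
 proof -
	define X where "X = (\<oint>x. (u x)^2) + dir u"
	define D where "D = 2 * c * exp (6 * beta) * exp (2 * beta * X)"
	have D0: "0 <= D" using c by (simp add: D_def)
	obtain w where w: "!!m. w m : trig"
	 "!!m. (\<oint>x. (w m x - u x)^2) <= (1/2)^m"
	 "!!m k. (\<oint>x. (pd k (w m) x - wp k u x)^2) <= (1/2)^m"
	 "AE x in M. (%m. w m x) ----> u x"
	 by (rule W12_approximation[OF u], rule that)
	have um: "u : Meas" by (rule L2D(3)[OF W_L2[OF u]])
	have wm: "w m : Meas" for m by (rule L2D(3)[OF trig_L2[OF w(1)]])
	have bound: "(\<oint>+x. ennreal (exp (s * abs (w m x)))) <= ennreal D" for m
	proof -
	 have half: "(1/2::real)^m <= 1" by (simp add: power_le_one)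
	 note w1 = trig_C1[OF w(1)[of m]] and w2 = trig_C1[OF trig_uminus[OF w(1)[of m]]]
	 have grad: "(\<oint>x. grad_sq (w m) x) <= 2 * dir u + 4"
	 proof -
		have "(\<oint>x. grad_sq (w m) x) = (SUM k:UNIV. \<integral>x. (pd k (w m) x)^2 \<partial>M)"
		unfolding grad_sq_def
		by (intro sum_integral L2D(4) trig_L2 trig_partial w(1))
		also have "... <= (SUM k:UNIV. 2 * (\<oint>x. (wp k u x)^2) + 2)"
		proof (rule sum_mono)
		fix k
		show "(\<oint>x. (pd k (w m) x)^2) <= 2 * (\<oint>x. (wp k u x)^2) + 2"
		using integral_sq_le_double[OF trig_L2[OF trig_partial[OF w(1)]] wp_L2[OF u], of k m k] w(3)[of k m] half
		by linarith
		qed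
		also have "... = 2 * dir u + 4"
		unfolding dir_def sum.distrib sum_distrib_left[symmetric] by simp
		finally show ?thesis .
	 qed
	 have sq: "(\<oint>x. (w m x)^2) <= 2 * (\<oint>x. (u x)^2) + 2"
		using integral_sq_le_double[OF trig_L2[OF w(1)[of m]] W_L2[OF u]] w(2)[of m] half by linarith
	 define Y where "Y = (\<oint>x. (w m x)^2) + (\<oint>x. grad_sq (w m) x)"
	 have arith: "p + q <= 2 * (U + D) + 6" if "q <= 2 * D + 4" "p <= 2 * U + 2" for p q U D :: real
		unfolding distrib_left using that by linarith
	 have Y: "Y <= 2 * X + 6" unfolding X_def Y_def by (rule arith[OF grad sq])
	 have neg: "grad_sq (%x. - w m x) x = grad_sq (w m) x" for x
	 proof -
		have "pd k (%x. - w m x) x = - pd k (w m) x" for k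
		using partial_deriv_cmult_right[OF trig_differentiable[OF w(1)[of m]], of k "-1" x] by simp
		thus ?thesis by (simp add: grad_sq_def)
	 qed
	 have e1: "(\<oint>x. exp (s * w m x)) <= c * exp (beta * Y)"
		unfolding Y_def by (rule cb[rule_format, OF w1])
	 have e2: "(\<oint>x. exp (s * (- w m x))) <= c * exp (beta * Y)"
		using cb[rule_format, OF w2] unfolding neg power2_minus Y_def .
	 have cont: "continuous_on UNIV (w m)" by (rule C1D(3)[OF w1])
	 have i1: "Integ (%x. exp (s * w m x))" "Integ (%x. exp (s * (- w m x)))"
		by (rule L2D(5)[OF continuous_periodic_L2];
		use trig_periodic[OF w(1)[of m]] cont in \<open>auto intro!: continuous_intros simp: periodic_def\<close>)+
	 have "(\<oint>+x. ennreal (exp (s * abs (w m x)))) <= (\<oint>+x. ennreal (exp (s * w m x) + exp (s * (- w m x))))"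
		by (intro nn_integral_mono ennreal_leI) (auto simp: abs_if)
	 also have "... = ennreal (\<oint>x. exp (s * w m x) + exp (s * (- w m x)))"
		using i1 by (intro nn_integral_eq_integral add_integrable) simp_all
	 also have "(\<oint>x. exp (s * w m x) + exp (s * (- w m x))) <= 2 * c * exp (beta * Y)"
		unfolding add_integral[OF i1] using e1 e2 by linarith
	 also have "2 * c * exp (beta * Y) <= 2 * c * exp (beta * (2 * X + 6))"
		using c Y by (intro mult_left_mono) (simp_all add: mult_left_mono)
	 also have "... = D" unfolding D_def by (simp add: exp_add[symmetric] distrib_left mult_ac)
	 finally show ?thesis by (simp add: ennreal_leI)
	qed
	have "(\<oint>+x. ennreal (exp (s * abs (u x)))) = (\<oint>+x. liminf (%m. ennreal (exp (s * abs (w m x)))))"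
	proof (rule nn_integral_cong_AE, use w(4) in eventually_elim)
	 fix x assume "(%m. w m x) ----> u x"
	 hence "(%m. ennreal (exp (s * abs (w m x)))) ----> ennreal (exp (s * abs (u x)))"
		by (intro tendsto_ennrealI tendsto_intros)
	 thus "ennreal (exp (s * abs (u x))) = liminf (%m. ennreal (exp (s * abs (w m x))))"
		by (intro lim_imp_Liminf[symmetric]) simp_all
	qed
	also have "... <= liminf (%m. \<integral>\<^sup>+x. ennreal (exp (s * abs (w m x))) \<partial>M)"
	 by (rule nn_integral_liminf) (use wm in measurable)
	also have "... <= limsup (%m. \<integral>\<^sup>+x. ennreal (exp (s * abs (w m x))) \<partial>M)"
	 by (rule Liminf_le_Limsup) simp
	also have "... <= ennreal D" by (rule Limsup_bounded) (simp add: bound)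
	finally have fin: "(\<oint>+x. ennreal (exp (s * abs (u x)))) <= ennreal D" .
	have i: "Integ (%x. exp (s * abs (u x)))"
	 using le_less_trans[OF fin ennreal_less_top] um by (intro integrableI_nonneg) simp_all
	have "ennreal (\<oint>x. exp (s * abs (u x))) <= ennreal D"
	 using fin nn_integral_eq_integral[OF i] by simp
	thus ?thesis using i D0 by (simp add: D_def X_def)
 qed
 thus ?thesis using c by (intro exI[of _ "2 * c * exp (6 * beta)"] exI[of _ "2 * beta"]) simp
qed

section \<open>Boundedness from above of the background functions\<close>

lemma level_antimono:
 assumes um: "u : Meas" and "a <= b"
 shows "level u b <= level u a"
 unfolding level_def using assms(2)
 by (intro integral_mono indicator_integrable um) (simp_all add: indicator_def)

lemma level_markov:
 assumes i: "Integ u" and a: "a > 0"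
 shows "level u a <= (\<oint>x. abs (u x)) / a"
proof -
 have um: "u : Meas" using i by auto
 have "level u a <= (\<oint>x. abs (u x) / a)" unfolding level_def
 proof (intro integral_mono indicator_integrable um)
	show "indicator {a<..} (u x) <= abs (u x) / a" for x
	 using a by (simp add: indicator_def pos_le_divide_eq)
 qed (use i in simp_all)
 thus ?thesis by simp
qed

lemma subsolution_energy:
 assumes u: "u : trig" and c: "0 <= c" and lap: "!!x. - c <= laplacian u x" and d: "d > 0"
 shows "(\<oint>x. cutoff' a d (u x) * grad_sq u x) <= c * d * level u a"
proof -
 let ?T = "%x. cutoff a d (u x)"
 note T = C1_periodic_compose[OF trig_C1[OF u], of "cutoff a d" "cutoff' a d", OF cutoff_derivative[OF d] cutoff'_continuous]
 have um: "u : Meas" by (rule L2D(3)[OF trig_L2[OF u]])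
 have TL: "?T : L2" by (rule C1_periodic_L2(1)[OF T(1)])
 have pk: "pd k u : trig" "pd k (pd k u) : trig" for k
	using u by (auto intro: trig_partial)
 have i1: "Integ (%x. pd k ?T x * pd k u x)" for k
	by (rule integrable_mult_trig[OF L2D(5)[OF C1_periodic_L2(2)[OF T(1)]] pk(1)])
 have i2: "Integ (%x. ?T x * pd k (pd k u) x)" for k
	by (rule integrable_mult_trig[OF L2D(5)[OF TL] pk(2)])
 have "(\<oint>x. cutoff' a d (u x) * grad_sq u x) = (\<oint>x. (SUM k:UNIV. pd k ?T x * pd k u x))"
	by (simp only: grad_sq_def T(2) sum_distrib_left power2_eq_square mult.assoc)
 also have "... = (SUM k:UNIV. \<integral>x. pd k ?T x * pd k u x \<partial>M)"
	by (rule sum_integral) (rule i1)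
 also have "... = (SUM k:UNIV. - (\<oint>x. ?T x * pd k (pd k u) x))"
	by (intro sum.cong refl) (simp only: integration_by_parts[OF T(1) trig_C1[OF pk(1)]] minus_minus)
 also have "... = - (\<oint>x. ?T x * laplacian u x)"
	unfolding laplacian_def sum_distrib_left sum_negf using i2 by (simp add: sum_integral)
 also have "... = (\<oint>x. ?T x * (- laplacian u x))" by simp
 also have "... <= (\<oint>x. c * (d * indicator {a<..} (u x)))"
 proof (rule integral_mono)
	have "Integ (%x. SUM k:UNIV. - (?T x * pd k (pd k u) x))"
	 by (intro sum_integrable integrable_minus i2)
	thus "Integ (%x. ?T x * (- laplacian u x))"
	 by (simp only: laplacian_def sum_distrib_left sum_negf mult_minus_right)
	show "Integ (%x. c * (d * indicator {a<..} (u x)))"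
	 by (intro integrable_mult_right indicator_integrable um) simp
	fix x
	have "?T x * (- laplacian u x) <= ?T x * c"
	 using lap[of x] cutoff_bounds(1)[OF d] by (intro mult_left_mono) simp_all
	also have "... <= (d * indicator {a<..} (u x)) * c" by (intro mult_right_mono cutoff_bounds(2)[OF d] c)
	finally show "?T x * (- laplacian u x) <= c * (d * indicator {a<..} (u x))" by (simp only: mult.commute)
 qed
 also have "... = c * d * level u a" by (simp add: level_def)
 finally show ?thesis .
qed

lemma subsolution_bound:
 assumes c: "0 <= c" and I: "0 <= I"
 shows "EX C. ALL u:trig. (ALL x. - c <= laplacian u x) --> (\<oint>x. abs (u x)) <= I --> level u C = 0"
proof -
 define D where "D = level_const * (1 + c)"
 have D: "D > 0" using level_const_pos c by (simp add: D_def)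
 define del' where "del' = 1 / (8 * D)"
 have del': "del' > 0" using D by (simp add: del'_def)
 define k0 where "k0 = (I + 1) / del'"
 have k0: "k0 > 0" using I del' by (simp add: k0_def)
 have "level u (k0 + 1) = 0" if u: "u : trig" and lap: "!!x. - c <= laplacian u x" and uI: "(\<oint>x. abs (u x)) <= I" for u
 proof -
	have um: "u : Meas" by (rule L2D(3)[OF trig_L2[OF u]])
	define al where "al j = k0 + 1 - (1/2)^j" for j :: nat
	have step: "level u (a + d) <= D * (level u a)^2 / d" if d: "0 < d" "d <= 1" for a d
	proof -
	 let ?L = "level u a"
	 have L0: "0 <= ?L" by (rule level_nonneg)
	 have "d^2 * level u (a + d) <= level_const * ?L * (d^2 * ?L + (\<oint>x. cutoff' a d (u x) * grad_sq u x))"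
		by (rule level_estimate[OF trig_C1[OF u] d(1)])
	 also have "... <= level_const * ?L * (d^2 * ?L + c * d * ?L)"
		using level_const_pos L0 by (intro mult_left_mono add_left_mono subsolution_energy[OF u c lap d(1)]) simp_all
	 also have "... = level_const * ?L^2 * (d * (d + c))" by (simp add: power2_eq_square algebra_simps)
	 also have "... <= level_const * ?L^2 * (d * (1 + c))"
		using level_const_pos d by (intro mult_left_mono) simp_all
	 also have "... = d^2 * (D * ?L^2 / d)" using d by (simp add: D_def power2_eq_square)
	 finally show ?thesis by (rule mult_left_le_imp_le) (use d in simp)
	qed
	have claim: "level u (al j) <= del' * (1/4)^j" for j
	proof (induction j)
	 case 0
	 have "level u k0 <= (\<oint>x. abs (u x)) / k0" by (rule level_markov[OF L2D(5)[OF trig_L2[OF u]] k0])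
	 also have "... <= (I + 1) / k0" using uI k0 by (intro divide_right_mono) simp_all
	 also have "... = del'" using I del' by (simp add: k0_def)
	 finally show ?case by (simp add: al_def)
	next
	 case (Suc j)
	 define d where "d = (1/2::real)^Suc j"
	 have d: "0 < d" "d <= 1" by (simp_all add: d_def power_le_one del: power_Suc)
	 have "al (Suc j) = al j + d" by (simp add: al_def d_def)
	 hence "level u (al (Suc j)) <= D * (level u (al j))^2 / d" using step[OF d] by simp
	 also have "... <= D * (del' * (1/4)^j)^2 / d"
		using D d level_nonneg Suc by (intro divide_right_mono mult_left_mono power_mono) simp_all
	 also have "... = (8 * D * del') * (1/2)^j * (del' * (1/4)^Suc j)"
	 proof -
		define h where "h = (1/2::real)^j"
		have h: "h > 0" by (simp add: h_def)
		have q: "(1/4::real)^j = h^2" unfolding h_def power2_eq_square by (simp add: power_mult_distrib[symmetric])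
		have "d = h / 2" "(1/4::real)^Suc j = h^2 / 4" using q by (simp_all add: d_def h_def)
		thus ?thesis unfolding q h_def[symmetric] using h by (simp add: power2_eq_square field_simps)
	 qed
	 also have "8 * D * del' = 1" using D by (simp add: del'_def)
	 also have "1 * (1/2)^j * (del' * (1/4)^Suc j) <= 1 * 1 * (del' * (1/4)^Suc j)"
		using del' by (intro mult_right_mono mult_left_mono) (simp_all add: power_le_one)
	 finally show ?case by simp
	qed
	have le: "level u (k0 + 1) <= del' * (1/4)^j" for j
	 using level_antimono[OF um, of "al j" "k0 + 1"] claim[of j] by (simp add: al_def)
	have "(%j. del' * (1/4::real)^j) ----> del' * 0" by (intro tendsto_intros LIMSEQ_power_zero) simp
	hence "level u (k0 + 1) <= del' * 0" by (rule LIMSEQ_le_const) (simp add: le)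
	thus ?thesis using level_nonneg[of u "k0 + 1"] by simp
 qed
 thus ?thesis by (intro exI[of _ "k0 + 1"]) simp
qed

lemma laplacian_conv:
 assumes u: "Integ u" and K: "K : trig"
 shows "laplacian (conv u K) x = (\<oint>y. u y * laplacian (%y. K (x - y)) y)"
proof -
 have c2: "pd k (pd k (conv u K)) x = conv u (pd k (pd k K)) x" for k
 proof -
	have "pd k (conv u K) = conv u (pd k K)" using conv_trig(2)[OF u K] by (simp add: fun_eq_iff)
	thus ?thesis by (simp only: conv_trig(2)[OF u trig_partial[OF K]])
 qed
 have r2: "pd k (pd k (%y. K (x - y))) y = pd k (pd k K) (x - y)" for k y
 proof -
	have "pd k (%y. K (x - y)) = (%y. (- 1) * pd k K (x - y))"
	 using partial_deriv_shift(2)[OF K, of k x] by (simp add: fun_eq_iff)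
	moreover have "(%x. (-1) * pd k K x) : trig" by (rule trig_cmult[OF trig_partial[OF K]])
	ultimately have "pd k (pd k (%y. K (x - y))) y = - pd k (%x. (-1) * pd k K x) (x - y)"
	 using partial_deriv_shift(2)[of "%x. (-1) * pd k K x" k x y] by simp
	also have "pd k (%x. (-1) * pd k K x) (x - y) = pd k (%x. pd k K x * (-1)) (x - y)"
	 by simp
	also have "... = pd k (pd k K) (x - y) * (-1)"
	 by (rule partial_deriv_cmult_right[OF trig_differentiable[OF trig_partial[OF K]]])
	finally show ?thesis by simp
 qed
 have i: "Integ (%y. u y * pd k (pd k K) (x - y))" for k
	by (rule integrable_mult_trig[OF u reflected_shift_trig[OF trig_partial[OF trig_partial[OF K]]]])
 show ?thesis unfolding laplacian_def c2 r2 conv_def sum_distrib_left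
	using i by (simp add: sum_integral)
qed

text \<open>The mollified background functions have Laplacian bounded from below, so De Giorgi's iteration over level sets bounds them from above uniformly.\<close>

theorem background_bounded_above:
 assumes bg: "is_background per1 per2 m q u"
 shows "EX C. AE x in M. u x <= C"
proof -
 have uD: "periodic u" "u : LMeas" "Integ u"
	using bg by (auto simp: is_background_def L1_iff)
 have um: "u : Meas" using uD(3) by auto
 define c where "c = 4 * pi * real m / area"
 have c: "0 <= c" using area_pos by (simp add: c_def)
 have eqn: "(\<oint>x. u x * laplacian phi x) = 4 * pi * (SUM s=1..m. phi (q s)) - c * (\<oint>x. phi x)"
	if "phi : trig" for phi
	using bg trig_test[OF that] unfolding is_background_def cell_integral_M cell_area_eq c_def by simp
 define w where "w j = conv u (kern j)" for j
 have wt: "w j : trig" for j unfolding w_def by (rule conv_trig(1)[OF uD(3) kern_trig])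
 have lap: "- c <= laplacian (w j) x" for j x
 proof -
	have phi: "(%y. kern j (x - y)) : trig" by (rule reflected_shift_trig[OF kern_trig])
	have one: "(\<oint>y. kern j (x - y)) = 1"
	proof -
	 have "(\<oint>y. kern j (x - (y + x))) = (\<oint>y. kern j (x - y))"
		by (rule integral_M_translation(2)[OF L2D(2)[OF trig_L2[OF phi]] trig_periodic[OF phi]])
	 moreover have "kern j (x - (y + x)) = kern j y" for y using kern_even[of j y] by simp
	 ultimately show ?thesis by (simp add: kern_integral)
	qed
	have "laplacian (w j) x = 4 * pi * (SUM s=1..m. kern j (x - q s)) - c * 1"
	 unfolding w_def laplacian_conv[OF uD(3) kern_trig] eqn[OF phi] one ..
	moreover have "0 <= 4 * pi * (SUM s=1..m. kern j (x - q s))"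
	 by (intro mult_nonneg_nonneg sum_nonneg kern_nonneg) simp_all
	ultimately show ?thesis by simp
 qed
 have moll: "EX j0. ALL j>=j0. (\<oint>+x. ennreal (abs (w j x - u x) ^ 1)) <= ennreal eta" if "eta > 0" for eta
	unfolding w_def using uD by (intro mollification_converges that) simp_all
 have wi: "Integ (%x. w j x - u x)" for j
	by (intro diff_integrable L2D(5)[OF trig_L2[OF wt]] uD(3))
 have conv: "EX j0. ALL j>=j0. (\<oint>x. abs (w j x - u x)) <= eta" if eta: "eta > 0" for eta
 proof -
	obtain j0 where j0: "ALL j>=j0. (\<oint>+x. ennreal (abs (w j x - u x) ^ 1)) <= ennreal eta"
	 using moll[OF eta] by (elim exE)
	have "(\<oint>x. abs (w j x - u x)) <= eta" if "j >= j0" for j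
	proof -
	 have "ennreal (\<oint>x. abs (w j x - u x)) = (\<oint>+x. ennreal (abs (w j x - u x)))"
		by (rule nn_integral_eq_integral[symmetric, OF integrable_abs[OF wi]]) simp
	 also have "... <= ennreal eta" using j0[rule_format, OF that] by simp
	 finally show ?thesis using eta by simp
	qed
	thus ?thesis by (intro exI[of _ j0]) simp
 qed
 define I where "I = (\<oint>x. abs (u x)) + 1"
 have I: "0 <= I" unfolding I_def by (intro add_nonneg_nonneg integral_nonneg_AE) simp_all
 obtain C where C: "ALL v:trig. (ALL x. - c <= laplacian v x) --> (\<oint>x. abs (v x)) <= I --> level v C = 0"
	using subsolution_bound[OF c I] by (elim exE)
 obtain j1 where j1: "ALL j>=j1. (\<oint>x. abs (w j x - u x)) <= 1" using conv[of 1] by auto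
 have lev: "level (w j) C = 0" if j: "j >= j1" for j
 proof -
	have "(\<oint>x. abs (w j x)) <= (\<oint>x. abs (w j x - u x) + abs (u x))"
	 by (intro integral_mono add_integrable integrable_abs wi uD(3) L2D(5)[OF trig_L2[OF wt]]) simp
	also have "... <= I" unfolding I_def using j1[rule_format, OF j] wi uD(3) by simp
	finally show ?thesis using C wt lap by blast
 qed
 have wle: "AE x in M. w j x <= C" if j: "j >= j1" for j
 proof -
	have wm: "w j : Meas" by (rule L2D(3)[OF trig_L2[OF wt]])
	have "AE x in M. (indicator {C<..} (w j x) :: real) = 0"
	 using lev[OF j] unfolding level_def
	 by (subst (asm) integral_nonneg_eq_0_iff_AE) (auto intro!: indicator_integrable wm)
	thus ?thesis by eventually_elim (simp add: indicator_def split: if_splits)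
 qed
 have "u x <= C + abs (w j x - u x)" if "w j x <= C" for j x using that by linarith
 have small: "(\<oint>x. max 0 (u x - C)) <= eta" if eta: "eta > 0" for eta
 proof -
	obtain j0 where j0: "ALL j>=j0. (\<oint>x. abs (w j x - u x)) <= eta" using conv[OF eta] by (elim exE)
	define j where "j = max j0 j1"
	have "(\<oint>x. max 0 (u x - C)) <= (\<oint>x. abs (w j x - u x))"
	proof (rule integral_mono_AE)
	 show "Integ (%x. max 0 (u x - C))"
		by (intro integrable_max) (simp_all add: uD(3))
	 show "Integ (%x. abs (w j x - u x))" by (rule integrable_abs[OF wi])
	 have "AE x in M. w j x <= C" by (rule wle) (simp add: j_def)
	 thus "AE x in M. max 0 (u x - C) <= abs (w j x - u x)" by eventually_elim simp
	qed
	also have "... <= eta" by (rule j0[rule_format]) (simp add: j_def)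
	finally show ?thesis .
 qed
 have "(\<oint>x. max 0 (u x - C)) <= 0" by (rule field_le_epsilon) (simp add: small)
 moreover have "0 <= (\<oint>x. max 0 (u x - C))" by (rule integral_nonneg_AE) simp
 moreover have "Integ (%x. max 0 (u x - C))" by (intro integrable_max) (simp_all add: uD(3))
 ultimately have "AE x in M. max 0 (u x - C) = 0"
	by (subst integral_nonneg_eq_0_iff_AE[symmetric]) simp_all
 hence "AE x in M. u x <= C" by eventually_elim (simp add: max_def split: if_splits)
 thus ?thesis by (intro exI[of _ C])
qed

end

section \<open>Algebra and a chain rule for weak derivatives\<close>

definition softmax :: "'i set => ('i => real) => 'i => real" where
 "softmax S y t = exp (y t) / (1 + (SUM s:S. exp (y s)))"

lemma softmax_denominator: "0 < 1 + (SUM s:S. exp (y s :: real))"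
 by (intro add_pos_nonneg sum_nonneg) simp_all

lemma softmax_pos: "0 < softmax S y t"
 unfolding softmax_def using softmax_denominator[where S = S and y = y] by (intro divide_pos_pos) simp_all

lemma softmax_sum: "(SUM t:S. softmax S y t) <= 1"
proof -
 have "(SUM t:S. softmax S y t) = (SUM s:S. exp (y s)) / (1 + (SUM s:S. exp (y s)))"
	unfolding softmax_def sum_divide_distrib ..
 also have "... <= 1" using softmax_denominator[where S = S and y = y] by (subst divide_le_eq_1_pos) simp_all
 finally show ?thesis .
qed

lemma softmax_le_1: "finite S ==> t : S ==> softmax S y t <= 1"
 using member_le_sum[of t S "softmax S y"] softmax_sum[of S y] softmax_pos[of S y]
 by (smt (verit) less_imp_le)

lemma softmax_le_exp: "finite S ==> softmax S y t <= exp (y t)"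
 unfolding softmax_def using softmax_denominator[where S = S and y = y] sum_nonneg[of S "%s. exp (y s)"]
 by (simp add: divide_le_eq mult_le_cancel_left1)

context flat_torus
begin

lemma periodicD: "periodic f ==> f (x + lat g) = f x"
 by (simp only: periodic_def)

lemma L1_norm_le_L2: "(\<oint>x. abs (f x))^2 <= area * (\<oint>x. (f x)^2)"
 if f: "f : Meas" "Integ (%x. (f x)^2)" for f :: "real^2 => real"
proof -
 have "(\<oint>x. 1 * abs (f x))^2 <= (\<oint>x. 1^2) * (\<oint>x. abs (f x)^2)"
	by (rule cauchy_schwarz_M) (use f in simp_all)
 thus ?thesis by (simp add: area_def)
qed

lemma L1_limit_of_L2:
 fixes f :: "nat => real^2 => real"
 assumes f: "!!m. f m : Meas" "!!m. Integ (%x. (f m x)^2)"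
	and lim: "(%m. \<integral>x. (f m x)^2 \<partial>M) ----> 0"
 shows "(%m. \<integral>x. abs (f m x) \<partial>M) ----> 0"
proof -
 have "(%m. (\<oint>x. abs (f m x))^2) ----> 0"
 proof (rule tendsto_sandwich[OF _ _ tendsto_const])
	show "\<forall>\<^sub>F m in sequentially. (\<oint>x. abs (f m x))^2 <= area * (\<oint>x. (f m x)^2)"
	 by (intro always_eventually allI L1_norm_le_L2 f)
	show "(%m. area * (\<oint>x. (f m x)^2)) ----> 0" using tendsto_mult_right_zero[OF lim] .
 qed simp
 hence "(%m. sqrt ((\<oint>x. abs (f m x))^2)) ----> sqrt 0" by (intro tendsto_real_sqrt)
 moreover have "sqrt ((\<oint>x. abs (f m x))^2) = (\<oint>x. abs (f m x))" for m
	by (simp add: integral_nonneg_AE)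
 ultimately show ?thesis by simp
qed

lemma bounded_L1_pairing:
 fixes q g :: "nat => real^2 => real"
 assumes qm [measurable]: "!!m. q m : Meas" "q' : Meas"
	and qb: "!!m x. abs (q m x) <= B" and ql: "AE x in M. (%m. q m x) ----> q' x"
	and gi: "!!m. Integ (g m)" "Integ g'"
	and gl: "(%m. \<integral>x. abs (g m x - g' x) \<partial>M) ----> 0"
 shows "(%m. \<integral>x. g m x * q m x \<partial>M) ----> (\<oint>x. g' x * q' x)"
proof -
 have gm [measurable]: "g' : Meas" using gi(2) by simp
 have d: "Integ (%x. g m x - g' x)" for m using gi by simp
 have B: "0 <= B" using order_trans[OF abs_ge_zero qb] .
 have i1: "Integ (%x. (g m x - g' x) * q m x)" "Integ (%x. g' x * q m x)" for m
	using integrable_M_mult_bounded[OF d qm(1) qb] integrable_M_mult_bounded[OF gi(2) qm(1) qb] by auto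
 have "(%m. \<integral>x. (g m x - g' x) * q m x \<partial>M) ----> 0"
 proof (rule Lim_null_comparison[OF _ tendsto_mult_right_zero[OF gl, of B]], intro always_eventually allI)
	fix m
	have "abs (\<integral>x. (g m x - g' x) * q m x \<partial>M) <= (\<oint>x. abs ((g m x - g' x) * q m x))" by (rule integral_abs_bound)
	also have "... <= (\<oint>x. B * abs (g m x - g' x))"
	proof (rule integral_mono)
	 fix x
	 show "abs ((g m x - g' x) * q m x) <= B * abs (g m x - g' x)"
		unfolding abs_mult using mult_left_mono[OF qb[of m x] abs_ge_zero[of "g m x - g' x"]] by (simp only: mult.commute)
	qed (intro integrable_abs integrable_mult_right i1 d)+
	finally show "norm (\<oint>x. (g m x - g' x) * q m x) <= B * (\<oint>x. abs (g m x - g' x))" by simp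
 qed
 moreover have "(%m. \<integral>x. g' x * q m x \<partial>M) ----> (\<oint>x. g' x * q' x)"
 proof (rule integral_dominated_convergence[where w = "%x. abs (g' x) * B"])
	show "AE x in M. (%m. g' x * q m x) ----> g' x * q' x" using ql by eventually_elim (rule tendsto_mult_left)
	show "AE x in M. norm (g' x * q m x) <= abs (g' x) * B" for m
	 by (rule AE_I2) (simp add: abs_mult mult_left_mono qb)
 qed (use gi in simp_all)
 ultimately have "(%m. (\<oint>x. (g m x - g' x) * q m x) + (\<oint>x. g' x * q m x)) ----> 0 + (\<oint>x. g' x * q' x)"
	by (rule tendsto_add)
 moreover have "(\<oint>x. (g m x - g' x) * q m x) + (\<oint>x. g' x * q m x) = (\<oint>x. g m x * q m x)" for m
	unfolding add_integral[OF i1, symmetric]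
	by (rule cong_integral) (simp_all add: left_diff_distrib)
 ultimately show ?thesis by simp
qed

lemma weak_partial_unique:
 assumes u: "Integ u" and g: "wkp k u g" and h: "wkp k u h"
 shows "AE x in M. g x = h x"
proof -
 have gL: "g : L2" and hL: "h : L2"
	using g h by (simp_all add: is_weak_partial_def)
 define d where "d x = g x - h x" for x
 have dL: "d : L2" unfolding d_def[abs_def] by (rule L2_diff[OF gL hL])
 have c0: "conv d (kern m) x = 0" for m x
 proof -
	have "conv d (kern m) x = conv g (kern m) x - conv h (kern m) x"
	 unfolding conv_def d_def left_diff_distrib
	 by (intro diff_integral integrable_mult_trig L2D(5) gL hL reflected_shift_trig kern_trig)
	thus ?thesis
	 using conv_weak_partial[OF g u kern_trig, of m x] conv_weak_partial[OF h u kern_trig, of m x] by simp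
 qed
 have small: "(\<oint>x. (d x)^2) <= e" if e: "e > 0" for e
 proof -
	have "Integ (%x. abs (d x) ^ 2)" using L2D(4)[OF dL] by simp
	from mollification_converges[OF disjI2[OF refl] L2D(2)[OF dL] L2D(1)[OF dL] this e]
	obtain m0 where "ALL m>=m0. (\<oint>+x. ennreal (abs (conv d (kern m) x - d x) ^ 2)) <= ennreal e"
	 by (elim exE)
	from this[rule_format, OF order_refl] have "(\<oint>+x. ennreal (abs (d x) ^ 2)) <= ennreal e"
	 unfolding c0 diff_0 abs_minus_cancel .
	hence "ennreal (\<oint>x. (d x)^2) <= ennreal e"
	 unfolding nn_integral_abs_power2[OF L2D(4)[OF dL]] .
	thus ?thesis using e by (simp add: ennreal_le_iff)
 qed
 have "(\<oint>x. (d x)^2) <= 0" by (rule field_le_epsilon) (simp add: small)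
 moreover have "0 <= (\<oint>x. (d x)^2)" by (rule integral_nonneg_AE) simp
 ultimately have "AE x in M. (d x)^2 = 0"
	using L2D(4)[OF dL] by (subst integral_nonneg_eq_0_iff_AE[symmetric]) simp_all
 thus ?thesis by eventually_elim (simp add: d_def)
qed

lemma W_I:
 assumes u: "u : L2" and g: "!!k. wkp k u (g k)"
 shows "u : W" "AE x in M. wp k u x = g k x"
proof -
 show W: "u : W" using u g unfolding W12_def by (intro CollectI conjI allI exI)
 show "AE x in M. wp k u x = g k x"
	by (rule weak_partial_unique[OF L2D(5)[OF u] weak_partial_spec[OF W] g])
qed

lemma test_bounded:
 assumes "phi : Test"
 obtains B where "!!x. abs (phi x) <= B" "!!x. abs (pd k phi x) <= B"
	"phi : Meas" "pd k phi : Meas"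
proof -
 have c: "C1p phi" by (rule test_function_C1[OF assms])
 obtain B1 where B1: "ALL x. abs (phi x) <= B1" using C1_periodic_bounded[OF c] by (elim exE conjE)
 obtain B2 where B2: "ALL x. abs (pd k phi x) <= B2" using C1_periodic_partial_bounded[OF c, of k] by (elim exE conjE)
 show thesis
 proof (rule that[of "max B1 B2"])
	show "abs (phi x) <= max B1 B2" "abs (pd k phi x) <= max B1 B2" for x
	 using B1[rule_format, of x] B2[rule_format, of x] by linarith+
 qed (intro measurable_borel_M C1D[OF c])+
qed

lemma test_integrable:
 assumes "phi : Test" and f: "Integ f"
 shows "Integ (%x. f x * phi x)" "Integ (%x. f x * pd k phi x)"
proof -
 obtain B where B: "!!x. abs (phi x) <= B" "!!x. abs (pd k phi x) <= B"
	"phi : Meas" "pd k phi : Meas"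
	by (rule test_bounded[OF assms(1), of k], rule that)
 show "Integ (%x. f x * phi x)" by (rule integrable_M_mult_bounded[OF f B(3,1)])
 show "Integ (%x. f x * pd k phi x)" by (rule integrable_M_mult_bounded[OF f B(4,2)])
qed

lemma weak_partial_C1:
 assumes "C1p f"
 shows "wkp k f (pd k f)"
 unfolding is_weak_partial_def cell_integral_M
 by (intro conjI ballI C1_periodic_L2(2)[OF assms] integration_by_parts[OF assms] test_function_C1)

lemma W_const: "(%x. c) : W" "AE x in M. wp k (%x. c) x = 0"
proof -
 note c = trig_C1[OF trig.const[of c]]
 show "(%x. c) : W" by (rule W_I(1)[OF C1_periodic_L2(1)[OF c] weak_partial_C1[OF c]])
 have "pd k (%x. c) x = 0" for x by (subst partial_deriv_eqI[of _ "%h. 0"]) simp_all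
 thus "AE x in M. wp k (%x. c) x = 0"
	using W_I(2)[OF C1_periodic_L2(1)[OF c] weak_partial_C1[OF c], of k] by simp
qed

lemma weak_partial_lincomb:
 assumes u: "Integ u" "wkp k u g" and v: "Integ v" "wkp k v h"
 shows "wkp k (%x. a * u x + b * v x) (%x. a * g x + b * h x)"
 unfolding is_weak_partial_def cell_integral_M
proof (intro conjI ballI)
 have gL: "g : L2" and hL: "h : L2"
	using u v by (simp_all add: is_weak_partial_def)
 show "(%x. a * g x + b * h x) : L2" by (intro L2_add L2_cmult gL hL)
 fix phi assume phi: "phi : Test"
 note i = test_integrable[OF phi]
 have s: "(\<oint>x. (a * p x + b * q x) * r x) = a * (\<oint>x. p x * r x) + b * (\<oint>x. q x * r x)"
	if "Integ (%x. p x * r x)" "Integ (%x. q x * r x)" for p q r :: "real^2 => real"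
	using that by (simp add: distrib_right mult.assoc)
 have "(\<oint>x. u x * pd k phi x) = - (\<oint>x. g x * phi x)"
	"(\<oint>x. v x * pd k phi x) = - (\<oint>x. h x * phi x)"
	using u v phi by (simp_all add: is_weak_partial_def cell_integral_M)
 thus "(\<oint>x. (a * u x + b * v x) * pd k phi x) = - (\<oint>x. (a * g x + b * h x) * phi x)"
	unfolding s[OF i(2)[OF u(1)] i(2)[OF v(1)]] s[OF i(1)[OF L2D(5)[OF gL]] i(1)[OF L2D(5)[OF hL]]] by simp
qed

lemma W_lincomb:
 assumes u: "u : W" and v: "v : W"
 shows "(%x. a * u x + b * v x) : W"
	and "AE x in M. wp k (%x. a * u x + b * v x) x = a * wp k u x + b * wp k v x"
proof -
 note L = L2_add[OF L2_cmult[OF W_L2[OF u]] L2_cmult[OF W_L2[OF v]]]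
 have w: "wkp k (%x. a * u x + b * v x) (%x. a * wp k u x + b * wp k v x)" for k
	by (intro weak_partial_lincomb L2D(5) W_L2 weak_partial_spec u v)
 show "(%x. a * u x + b * v x) : W" by (rule W_I(1)[OF L w])
 show "AE x in M. wp k (%x. a * u x + b * v x) x = a * wp k u x + b * wp k v x"
	by (rule W_I(2)[OF L w])
qed

lemma W_add: "u : W ==> v : W ==> (%x. u x + v x) : W"
 "u : W ==> v : W ==> AE x in M. wp k (%x. u x + v x) x = wp k u x + wp k v x"
 using W_lincomb[where a = 1 and b = 1 and u = u and v = v] by simp_all

lemma W_diff: "u : W ==> v : W ==> (%x. u x - v x) : W"
 "u : W ==> v : W ==> AE x in M. wp k (%x. u x - v x) x = wp k u x - wp k v x"
 using W_lincomb[where a = 1 and b = "-1" and u = u and v = v] by simp_all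

lemma W_cmult: "u : W ==> (%x. c * u x) : W"
 "u : W ==> AE x in M. wp k (%x. c * u x) x = c * wp k u x"
 using W_lincomb[where a = c and b = 0 and u = u and v = u] by simp_all

lemma W_sum:
 assumes "finite S" "!!s. s : S ==> w s : W"
 shows "(%x. SUM s:S. c s * w s x) : W & (ALL k. AE x in M. wp k (%x. SUM s:S. c s * w s x) x = (SUM s:S. c s * wp k (w s) x))"
 using assms
proof (induction S rule: finite_induct)
 case empty
 thus ?case using W_const(1)[where c = 0] W_const(2)[where c = 0] by simp
next
 case (insert a S)
 have w: "w a : W" and S: "(%x. SUM s:S. c s * w s x) : W"
	"!!k. AE x in M. wp k (%x. SUM s:S. c s * w s x) x = (SUM s:S. c s * wp k (w s) x)"
	using insert by simp_all
 have "AE x in M. wp k (%x. c a * w a x + 1 * (SUM s:S. c s * w s x)) x = c a * wp k (w a) x + (SUM s:S. c s * wp k (w s) x)" for k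
	using W_lincomb(2)[OF w S(1), of k "c a" 1] S(2)[of k] by eventually_elim simp
 thus ?case using W_lincomb(1)[OF w S(1), of "c a" 1] insert.hyps by simp
qed

lemma weak_partial_limit:
 assumes f: "!!m. wkp k (f m) (g m)" and g': "g' : L2"
	and fl: "!!phi. phi : Test ==>
	 (%m. \<integral>x. f m x * pd k phi x \<partial>M) ----> (\<oint>x. f' x * pd k phi x)"
	and gl: "!!phi. phi : Test ==>
	 (%m. \<integral>x. g m x * phi x \<partial>M) ----> (\<oint>x. g' x * phi x)"
 shows "wkp k f' g'"
 unfolding is_weak_partial_def cell_integral_M
proof (intro conjI ballI g')
 fix phi assume phi: "phi : Test"
 have "(\<oint>x. f m x * pd k phi x) = - (\<oint>x. g m x * phi x)" for m
	using f[of m] phi by (simp add: is_weak_partial_def cell_integral_M)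
 hence "(%m. - (\<oint>x. g m x * phi x)) ----> (\<oint>x. f' x * pd k phi x)"
	using fl[OF phi] by simp
 thus "(\<oint>x. f' x * pd k phi x) = - (\<oint>x. g' x * phi x)"
	using tendsto_minus[OF gl[OF phi]] by (rule LIMSEQ_unique)
qed

lemma softmax_C1:
 assumes S: "finite S" and a: "!!s. s : S ==> C1p (a s)" and t: "t : S"
 shows "C1p (%x. softmax S (%s. a s x) t)"
	and "pd k (%x. softmax S (%s. a s x) t) x =
	 softmax S (%s. a s x) t * (pd k (a t) x - (SUM s:S. softmax S (%s. a s x) s * pd k (a s) x))"
proof -
 let ?p = "%x. softmax S (%s. a s x)"
 let ?Z = "%x. 1 + (SUM s:S. exp (a s x))"
 let ?A = "%s x h. SUM k:UNIV. pd k (a s) x * h$k"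
 have Z: "?Z x ~= 0" for x using softmax_denominator[where S = S and y = "%s. a s x"] by linarith
 have D: "((%x. ?p x t) has_derivative (%h. (?A t x h * exp (a t x) * ?Z x - exp (a t x) * (0 + (SUM s:S. ?A s x h * exp (a s x)))) / (?Z x * ?Z x))) (at x)" for x
	unfolding softmax_def
	by (intro has_derivative_divide' has_derivative_exp has_derivative_add has_derivative_const has_derivative_sum
		has_derivative_partial C1D(2) a t Z)
 have pd: "pd k (%x. ?p x t) x = ?p x t * (pd k (a t) x - (SUM s:S. ?p x s * pd k (a s) x))" for k x
 proof -
	have m1: "(SUM s:S. ?p x s * pd k (a s) x) = (SUM s:S. pd k (a s) x * exp (a s x)) / ?Z x"
	 unfolding softmax_def sum_divide_distrib by (intro sum.cong refl) simp
	have m2: "pd k (%x. ?p x t) x = (pd k (a t) x * exp (a t x) * ?Z x - exp (a t x) * (SUM s:S. pd k (a s) x * exp (a s x))) / (?Z x * ?Z x)"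
	 unfolding partial_deriv_eqI[OF D] by (simp only: sum_axis add_0)
	have frac: "(d * e * z - e * y) / (z * z) = e / z * (d - y / z)" if "z ~= 0" for d e y z :: real
	 using that by (simp add: field_simps)
	show ?thesis unfolding m1 m2 frac[OF Z] by (simp only: softmax_def)
 qed
 thus "pd k (%x. ?p x t) x = ?p x t * (pd k (a t) x - (SUM s:S. ?p x s * pd k (a s) x))" .
 have c: "continuous_on UNIV (%x. ?p x s)" if "s : S" for s
	unfolding softmax_def by (intro continuous_intros C1D(3) a that ballI Z)
 show "C1p (%x. ?p x t)"
	unfolding C1p_def
 proof (intro conjI allI)
	have "a s (x + lat g) = a s x" if "s : S" for s x g
	 by (rule periodicD[OF C1D(1)[OF a[OF that]]])
	thus "periodic (%x. ?p x t)" unfolding periodic_def softmax_def using t by (simp cong: sum.cong)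
	show "(%x. ?p x t) differentiable at x" for x using D by (rule differentiableI)
	show "continuous_on UNIV (pd k (%x. ?p x t))" for k
	 unfolding pd[abs_def] by (intro continuous_intros c C1D(4) a t)
 qed
qed

text \<open>The identity holds for trigonometric polynomials and passes to the limit, because the softmax factors are bounded and converge almost everywhere.\<close>

theorem softmax_chain_rule:
 assumes S: "finite S" and w: "!!s. s : S ==> w s : W" and t: "t : S"
 shows "(%x. softmax S (%s. w s x) t) : W"
	and "AE x in M. wp k (%x. softmax S (%s. w s x) t) x =
	 softmax S (%s. w s x) t * (wp k (w t) x - (SUM s:S. softmax S (%s. w s x) s * wp k (w s) x))"
proof -
 let ?p = "%w x. softmax S (%s. w s x)"
 let ?g = "%k x. ?p w x t * (wp k (w t) x - (SUM s:S. ?p w x s * wp k (w s) x))"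
 let ?good = "%s a. (ALL m. a m : trig) & (ALL m k. (\<oint>x. (pd k (a m) x - wp k (w s) x)^2) <= (1/2)^m)
	& (AE x in M. (%m. a m x) ----> w s x)"
 have ex: "EX a. ?good s a" if s: "s : S" for s
 proof -
	obtain a where a: "!!m. a m : trig"
	 "!!m. (\<oint>x. (a m x - w s x)^2) <= (1/2)^m"
	 "!!m k. (\<oint>x. (pd k (a m) x - wp k (w s) x)^2) <= (1/2)^m"
	 "AE x in M. (%m. a m x) ----> w s x"
	 by (rule W12_approximation[OF w[OF s]], rule that)
	show ?thesis by (intro exI[of _ a] conjI allI a)
 qed
 define a where "a s = (SOME a. ?good s a)" for s
 have good: "?good s (a s)" if "s : S" for s unfolding a_def by (rule someI_ex[OF ex[OF that]])
 have atrig: "a s m : trig" if "s : S" for s m by (rule good[OF that, THEN conjunct1, rule_format])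
 have aL: "(\<oint>x. (pd k (a s m) x - wp k (w s) x)^2) <= (1/2)^m" if "s : S" for s m k
	by (rule good[OF that, THEN conjunct2, THEN conjunct1, rule_format])
 have alim: "AE x in M. (%m. a s m x) ----> w s x" if "s : S" for s by (rule good[OF that, THEN conjunct2, THEN conjunct2])
 let ?q = "%m x. softmax S (%s. a s m x)"
 have b1: "abs (softmax S y s) <= 1" if "s : S" for y s
	using softmax_pos[of S y s] softmax_le_1[OF S that, of y] by linarith
 have wm: "w s : LMeas" "periodic (w s)" if "s : S" for s
	using L2D(1,2)[OF W_L2[OF w[OF that]]] by auto
 have pm: "(%x. ?p w x s) : LMeas" if "s : S" for s
	unfolding softmax_def using that by (intro borel_measurable_divide borel_measurable_add borel_measurable_const
		borel_measurable_sum measurable_compose[OF wm(1) borel_measurable_exp])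
 have pmM: "(%x. ?p w x s) : Meas" if "s : S" for s by (rule measurable_lebesgue_M[OF pm[OF that]])
 have pper: "periodic (%x. ?p w x s)" if "s : S" for s
	unfolding periodic_def softmax_def using that by (simp add: periodicD[OF wm(2)] cong: sum.cong)
 have pL: "(%x. ?p w x s) : L2" if "s : S" for s
 proof -
	have "(softmax S y s)^2 <= 1" for y using power_mono[OF b1[OF that, of y] abs_ge_zero, of 2] by simp
	hence "Integ (%x. (?p w x s)^2)"
	 by (intro integrable_M_bounded[where B = 1]) (use pmM[OF that] in simp_all)
	thus ?thesis unfolding L2_iff using pm pper that by simp
 qed
 have C1: "C1p (%x. ?q m x s)" if "s : S" for m s
	by (rule softmax_C1(1)[OF S trig_C1[OF atrig] that])
 have qm: "(%x. ?q m x s) : Meas" if "s : S" for m s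
	by (rule measurable_borel_M[OF C1D(6)[OF C1[OF that]]])
 have lim: "AE x in M. ALL s:S. (%m. a s m x) ----> w s x"
	by (rule AE_finite_allI[OF S alim])
 have qlim: "AE x in M. ALL s:S. (%m. ?q m x s) ----> ?p w x s"
	using lim
 proof eventually_elim
	fix x assume x: "ALL s:S. (%m. a s m x) ----> w s x"
	have nz: "1 + (SUM s:S. exp (w s x)) ~= 0" using softmax_denominator[where S = S and y = "%s. w s x"] by linarith
	show "ALL s:S. (%m. ?q m x s) ----> ?p w x s"
	 unfolding softmax_def by (intro ballI tendsto_divide tendsto_add tendsto_const tendsto_sum tendsto_exp nz) (simp_all add: x)
 qed
 have wL: "wp k (w s) : L2" if "s : S" for k s by (rule wp_L2[OF w[OF that]])
 have gL1: "(%m. \<integral>x. abs (pd k (a s m) x - wp k (w s) x) \<partial>M) ----> 0" if s: "s : S" for s k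
 proof (rule L1_limit_of_L2)
	note L = L2_diff[OF trig_L2[OF trig_partial[OF atrig[OF s]]] wL[OF s]]
	show "(%x. pd k (a s m) x - wp k (w s) x) : Meas"
	 "Integ (%x. (pd k (a s m) x - wp k (w s) x)^2)" for m
	 by (rule L2D(3)[OF L], rule L2D(4)[OF L])
	show "(%m. \<integral>x. (pd k (a s m) x - wp k (w s) x)^2 \<partial>M) ----> 0"
	proof (rule tendsto_sandwich[OF _ _ tendsto_const])
	 show "(%m. (1/2::real)^m) ----> 0" by (rule LIMSEQ_realpow_zero) simp_all
	qed (simp_all add: aL[OF s] integral_nonneg_AE)
 qed
 \<comment> \<open>all terms of the derivative have the form (bounded factor) times (partial derivative)\<close>
 have pair: "(%m. \<integral>x. pd k (a s m) x * (Q m x * phi x) \<partial>M) ----> (\<oint>x. wp k (w s) x * (Q' x * phi x))"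
	if s: "s : S" and Q: "!!m. Q m : Meas" "Q' : Meas" "!!m x. abs (Q m x) <= 1"
	 "AE x in M. (%m. Q m x) ----> Q' x" and phi: "phi : Meas" "!!x. abs (phi x) <= B" for s k Q Q' phi B
 proof (rule bounded_L1_pairing[where B = B])
	show "(%x. Q m x * phi x) : Meas" "(%x. Q' x * phi x) : Meas" for m using Q phi by simp_all
	show "abs (Q m x * phi x) <= B" for m x
	 using mult_mono[OF Q(3)[of m x] phi(2)[of x]] by (simp add: abs_mult)
	show "AE x in M. (%m. Q m x * phi x) ----> Q' x * phi x" using Q(4) by eventually_elim (rule tendsto_mult_right)
 qed (intro L2D(5) trig_L2 trig_partial atrig wL s gL1)+
 have gL: "?g k : L2" for k
 proof -
	let ?b = "%x. abs (wp k (w t) x) + (SUM s:S. abs (wp k (w s) x))"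
	have meas: "?g k : LMeas"
	 by (intro borel_measurable_times borel_measurable_diff borel_measurable_sum pm t L2D(2)[OF wL])
	have per: "periodic (?g k)"
	 unfolding periodic_def using t by (simp add: periodicD[OF pper] periodicD[OF L2D(1)[OF wL]] cong: sum.cong)
	have bd: "(?g k x)^2 <= 2 * (wp k (w t) x)^2 + 2 * ((SUM s:S. (wp k (w s) x)^2) * real (card S))" for x
	proof -
	 have "abs (?g k x) <= abs (wp k (w t) x - (SUM s:S. ?p w x s * wp k (w s) x))"
		unfolding abs_mult using b1[OF t, of "%s. w s x"] by (intro mult_left_le_one_le) simp_all
	 also have "... <= abs (wp k (w t) x) + abs (SUM s:S. ?p w x s * wp k (w s) x)" by (rule abs_triangle_ineq4)
	 also have "... <= abs (wp k (w t) x) + (SUM s:S. abs (?p w x s * wp k (w s) x))" by (intro add_left_mono sum_abs)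
	 also have "... <= ?b x"
		unfolding abs_mult by (intro add_left_mono sum_mono mult_left_le_one_le b1) simp_all
	 finally have 1: "(?g k x)^2 <= (?b x)^2" by (intro abs_le_square_iff[THEN iffD1]) simp
	 have 2: "(a + b)^2 <= 2 * a^2 + 2 * b^2" for a b :: real
		using zero_le_power2[of "a - b"] by (simp add: power2_eq_square algebra_simps)
	 have "(?b x)^2 <= 2 * abs (wp k (w t) x)^2 + 2 * (SUM s:S. abs (wp k (w s) x))^2" by (rule 2)
	 also have "... <= 2 * abs (wp k (w t) x)^2 + 2 * ((SUM s:S. abs (wp k (w s) x)^2) * real (card S))"
		by (intro add_left_mono mult_left_mono sum_squared_le_sum_of_squares) simp
	 finally show ?thesis using 1 unfolding power2_abs by linarith
	qed
	have "Integ (%x. (?g k x)^2)"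
	proof (rule bound_integrable)
	 show "Integ (%x. 2 * (wp k (w t) x)^2 + 2 * ((SUM s:S. (wp k (w s) x)^2) * real (card S)))"
		by (intro integrable_mult_right integrable_mult_left add_integrable sum_integrable L2D(4) wL t)
	 show "(%x. (?g k x)^2) : Meas" by (intro borel_measurable_power measurable_lebesgue_M[OF meas])
	 show "AE x in M. norm ((?g k x)^2) <= norm (2 * (wp k (w t) x)^2 + 2 * ((SUM s:S. (wp k (w s) x)^2) * real (card S)))"
		using order_trans[OF bd abs_ge_self] by (intro AE_I2) simp
	qed
	thus ?thesis unfolding L2_iff using meas per by simp
 qed
 have wpart: "wkp k (%x. ?p w x t) (?g k)" for k
 proof (rule weak_partial_limit[OF weak_partial_C1[OF C1[OF t]] gL])
	fix phi assume phi: "phi : Test"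
	obtain B where B: "!!x. abs (phi x) <= B" "!!x. abs (pd k phi x) <= B"
	 "phi : Meas" "pd k phi : Meas"
	 by (rule test_bounded[OF phi, of k], rule that)
	have B0: "0 <= B" using order_trans[OF abs_ge_zero B(1)] .
	show "(%m. \<integral>x. ?q m x t * pd k phi x \<partial>M) ----> (\<oint>x. ?p w x t * pd k phi x)"
	proof (rule integral_dominated_convergence[where w = "%x. B"])
	 show "AE x in M. (%m. ?q m x t * pd k phi x) ----> ?p w x t * pd k phi x"
		using qlim by eventually_elim (rule tendsto_mult_right, use t in simp)
	 show "AE x in M. norm (?q m x t * pd k phi x) <= B" for m
		using mult_mono[OF b1[OF t] B(2)] by (intro AE_I2) (simp add: abs_mult)
	 show "(%x. ?p w x t * pd k phi x) : Meas"
		by (rule borel_measurable_times[OF pmM[OF t] B(4)])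
	 show "(%x. ?q m x t * pd k phi x) : Meas" for m
		by (rule borel_measurable_times[OF qm[OF t] B(4)])
	qed simp
	have bb: "abs (softmax S y t * softmax S y s) <= 1" if "s : S" for y s
	 using mult_mono[OF b1[OF t, of y] b1[OF that, of y]] by (simp add: abs_mult)
	have T1: "(%m. \<integral>x. pd k (a t m) x * (?q m x t * phi x) \<partial>M) ----> (\<oint>x. wp k (w t) x * (?p w x t * phi x))"
	 using qlim t by (intro pair[OF t qm[OF t] pmM[OF t] b1[OF t] _ B(3,1)]) (auto elim!: eventually_mono)
	have T2: "(%m. \<integral>x. pd k (a s m) x * (?q m x t * ?q m x s * phi x) \<partial>M) ----> (\<oint>x. wp k (w s) x * (?p w x t * ?p w x s * phi x))"
	 if s: "s : S" for s
	proof (rule pair[OF s borel_measurable_times[OF qm[OF t] qm[OF s]] borel_measurable_times[OF pmM[OF t] pmM[OF s]] bb[OF s] _ B(3,1)])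
	 show "AE x in M. (%m. ?q m x t * ?q m x s) ----> ?p w x t * ?p w x s"
		using qlim by eventually_elim (rule tendsto_mult, use t s in simp_all)
	qed
	have expand: "!!(Y :: real^2 => _ => real) G. (!!s. s : S ==> (%x. Y x s) : Meas) ==>
		(!!x s. s : S ==> abs (Y x s) <= 1) ==> (!!s. s : S ==> Integ (G s)) ==>
		(\<oint>x. Y x t * (G t x - (SUM s:S. Y x s * G s x)) * phi x) =
		(\<oint>x. G t x * (Y x t * phi x)) - (SUM s:S. \<integral>x. G s x * (Y x t * Y x s * phi x) \<partial>M)"
	proof -
	 fix Y :: "real^2 => _ => real" and G :: "_ => real^2 => real"
	 assume Y: "!!s. s : S ==> (%x. Y x s) : Meas"
		"!!x s. s : S ==> abs (Y x s) <= 1" "!!s. s : S ==> Integ (G s)"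
	 have y2: "abs (Y x t * Y x s * phi x) <= B" "abs (Y x t * phi x) <= B" if "s : S" for x s
		using mult_mono[OF mult_mono[OF Y(2)[OF t, of x] Y(2)[OF that, of x]] B(1)[of x]] mult_mono[OF Y(2)[OF t, of x] B(1)[of x]]
		by (simp_all add: abs_mult)
	 have i1: "Integ (%x. G t x * (Y x t * phi x))"
		by (rule integrable_M_mult_bounded[OF Y(3)[OF t] borel_measurable_times[OF Y(1)[OF t] B(3)] y2(2)[OF t]])
	 have i2: "Integ (%x. G s x * (Y x t * Y x s * phi x))" if "s : S" for s
		by (rule integrable_M_mult_bounded[OF Y(3)[OF that] borel_measurable_times[OF borel_measurable_times[OF Y(1)[OF t] Y(1)[OF that]] B(3)] y2(1)[OF that]])
	 have "(\<oint>x. Y x t * (G t x - (SUM s:S. Y x s * G s x)) * phi x) =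
		(\<oint>x. G t x * (Y x t * phi x) - (SUM s:S. G s x * (Y x t * Y x s * phi x)))"
		by (rule cong_integral[OF refl])
		(simp add: right_diff_distrib left_diff_distrib sum_distrib_left sum_distrib_right mult_ac)
	 also have "... = (\<oint>x. G t x * (Y x t * phi x)) - (SUM s:S. \<integral>x. G s x * (Y x t * Y x s * phi x) \<partial>M)"
		by (simp add: diff_integral[OF i1 sum_integrable[OF i2]] sum_integral[OF i2])
	 finally show "(\<oint>x. Y x t * (G t x - (SUM s:S. Y x s * G s x)) * phi x) =
		(\<oint>x. G t x * (Y x t * phi x)) - (SUM s:S. \<integral>x. G s x * (Y x t * Y x s * phi x) \<partial>M)" .
	qed
	have pdq: "pd k (%x. ?q m x t) x = ?q m x t * (pd k (a t m) x - (SUM s:S. ?q m x s * pd k (a s m) x))" for m x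
	 by (rule softmax_C1(2)[OF S trig_C1[OF atrig] t])
	have e1: "(\<oint>x. pd k (%x. ?q m x t) x * phi x) =
		(\<oint>x. pd k (a t m) x * (?q m x t * phi x)) - (SUM s:S. \<integral>x. pd k (a s m) x * (?q m x t * ?q m x s * phi x) \<partial>M)" for m
	 unfolding pdq
	 by (rule expand[of "?q m" "%s. pd k (a s m)"])
		(erule qm, erule b1, intro L2D(5) trig_L2 trig_partial atrig)
	have e2: "(\<oint>x. ?g k x * phi x) =
		(\<oint>x. wp k (w t) x * (?p w x t * phi x)) - (SUM s:S. \<integral>x. wp k (w s) x * (?p w x t * ?p w x s * phi x) \<partial>M)"
	 by (rule expand[of "?p w" "%s. wp k (w s)"]) (erule pmM, erule b1, intro L2D(5) wL)
	show "(%m. \<integral>x. pd k (%x. ?q m x t) x * phi x \<partial>M) ----> (\<oint>x. ?g k x * phi x)"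
	 unfolding e1 e2 by (intro tendsto_diff tendsto_sum T1 T2)
 qed
 show "(%x. ?p w x t) : W" by (rule W_I(1)[OF pL[OF t] wpart])
 show "AE x in M. wp k (%x. ?p w x t) x = ?g k x" by (rule W_I(2)[OF pL[OF t] wpart])
qed

end

section \<open>The Cartan matrix\<close>

declare One_nat_def [simp del]

lemma sum_delta_mult:
 fixes f :: "nat => real"
 assumes "i : {1..N}"
 shows "(SUM l=1..N. (if i = l then 1 else 0) * f l) = f i"
	and "(SUM l=1..N. f l * (if l = i then 1 else 0)) = f i"
proof -
 have "(SUM l=1..N. (if i = l then 1 else 0) * f l) = (SUM l=1..N. if i = l then f l else 0)"
	by (intro sum.cong refl) simp
 thus "(SUM l=1..N. (if i = l then 1 else 0) * f l) = f i" using assms by simp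
 have "(SUM l=1..N. f l * (if l = i then 1 else 0)) = (SUM l=1..N. if l = i then f l else 0)"
	by (intro sum.cong refl) simp
 thus "(SUM l=1..N. f l * (if l = i then 1 else 0)) = f i" using assms by simp
qed

definition gram :: "nat => nat => nat => real" where
 "gram N i j = (if i : {1..N} & j : {1..N}
	then real (min i j) * (real N + 1 - real (max i j)) / (real N + 1) else 0)"

lemma cartan_sym: "cartan i j = cartan j i"
 by (auto simp: cartan_def)

lemma sum_cartan:
 fixes x :: "nat => real"
 assumes i: "i : {1..N}" and x: "x 0 = 0" "x (Suc N) = 0"
 shows "(SUM k=1..N. cartan i k * x k) = 2 * x i - x (i - 1) - x (Suc i)"
proof -
 have "{0..Suc N} = insert 0 (insert (Suc N) {1..N})" by auto
 hence "(SUM k=1..N. cartan i k * x k) = (SUM k:{0..Suc N}. cartan i k * x k)"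
	using x by simp
 also have "... = (SUM k:{i - 1, i, Suc i}. cartan i k * x k)"
	using i by (intro sum.mono_neutral_right) (auto simp: cartan_def)
 also have "... = 2 * x i - x (i - 1) - x (Suc i)"
 proof -
	obtain m where "i = Suc m" using i by (cases i) auto
	thus ?thesis by (simp add: cartan_def)
 qed
 finally show ?thesis .
qed

lemma gram_sym: "gram N i j = gram N j i"
 by (simp add: gram_def min.commute max.commute)

lemma cartan_gram:
 assumes i: "i : {1..N}" and j: "j : {1..N}"
 shows "(SUM k=1..N. cartan i k * gram N k j) = (if i = j then 1 else 0)"
proof -
 let ?h = "%k. real (min k j) * (real N + 1 - real (max k j)) / (real N + 1)"
 have "(SUM k=1..N. cartan i k * gram N k j) = (SUM k=1..N. cartan i k * ?h k)"
	using j by (intro sum.cong refl) (simp add: gram_def)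
 also have "... = 2 * ?h i - ?h (i - 1) - ?h (Suc i)"
	using i j by (intro sum_cartan) (simp_all add: max_def)
 also have "... = (if i = j then 1 else 0)"
 proof -
	define S where "S = real N + 1"
	have S: "S > 0" by (simp add: S_def)
	have h: "?h k = real k * (S - real j) / S" if "k <= j" for k
	 using that by (simp add: S_def min_def max_def)
	have h': "?h k = real j * (S - real k) / S" if "j <= k" for k
	 using that by (auto simp: S_def min_def max_def)
	have im: "real (i - 1) = real i - 1" using i by (simp add: of_nat_diff)
	consider "i < j" | "i = j" | "j < i" by linarith
	thus ?thesis
	proof cases
	 case 1
	 have "2 * ?h i - ?h (i - 1) - ?h (Suc i) = (2 * (real i * (S - real j)) - (real i - 1) * (S - real j) - (real i + 1) * (S - real j)) / S"
		using 1 h[of i] h[of "i - 1"] h[of "Suc i"] im by (simp add: diff_divide_distrib)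
	 also have "2 * (real i * (S - real j)) - (real i - 1) * (S - real j) - (real i + 1) * (S - real j) = 0" by algebra
	 finally show ?thesis using 1 by simp
	next
	 case 2
	 have "2 * ?h i - ?h (i - 1) - ?h (Suc i) = (2 * (real i * (S - real j)) - (real i - 1) * (S - real j) - real j * (S - (real i + 1))) / S"
		using 2 h[of i] h[of "i - 1"] h'[of "Suc i"] im by (simp add: diff_divide_distrib)
	 also have "2 * (real i * (S - real j)) - (real i - 1) * (S - real j) - real j * (S - (real i + 1)) = S"
		unfolding 2 by (simp add: algebra_simps)
	 finally show ?thesis using 2 S by simp
	next
	 case 3
	 have "2 * ?h i - ?h (i - 1) - ?h (Suc i) = (2 * (real j * (S - real i)) - real j * (S - (real i - 1)) - real j * (S - (real i + 1))) / S"
		using 3 h'[of i] h'[of "i - 1"] h'[of "Suc i"] im by (simp add: diff_divide_distrib)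
	 also have "2 * (real j * (S - real i)) - real j * (S - (real i - 1)) - real j * (S - (real i + 1)) = 0" by algebra
	 finally show ?thesis using 3 by simp
	qed
 qed
 finally show ?thesis .
qed

lemma gram_cartan:
 assumes i: "i : {1..N}" and j: "j : {1..N}"
 shows "(SUM k=1..N. gram N i k * cartan k j) = (if i = j then 1 else 0)"
 using cartan_gram[OF j i] by (simp add: gram_sym[of N i] cartan_sym[of _ j] mult.commute)

lemma A_mat_eq: "A_mat N = gram N"
proof -
 let ?P = "%B. (ALL i:{1..N}. ALL j:{1..N}. mat_mult N cartan B i j = diag (%_. 1) i j &
		mat_mult N B cartan i j = diag (%_. 1) i j) &
	(ALL i j. i ~: {1..N} \<or> j ~: {1..N} --> B i j = 0)"
 have ex: "?P (gram N)"
 proof (intro conjI ballI allI impI)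
	fix i j assume ij: "i : {1..N}" "j : {1..N}"
	show "mat_mult N cartan (gram N) i j = diag (%_. 1) i j"
	 using cartan_gram[OF ij] by (simp add: mat_mult_def diag_def)
	show "mat_mult N (gram N) cartan i j = diag (%_. 1) i j"
	 using gram_cartan[OF ij] by (simp add: mat_mult_def diag_def)
 next
	fix i j assume "i ~: {1..N} \<or> j ~: {1..N}"
	thus "gram N i j = 0" by (auto simp: gram_def)
 qed
 have "B = gram N" if B: "?P B" for B
 proof (intro ext)
	fix i j
	show "B i j = gram N i j"
	proof (cases "i : {1..N} & j : {1..N}")
	 case True
	 hence i: "i : {1..N}" and j: "j : {1..N}" by auto
	 have BK: "(SUM k=1..N. B i k * cartan k l) = (if i = l then 1 else 0)" if "l : {1..N}" for l
		using B i that by (simp add: mat_mult_def diag_def)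
	 have "B i j = (SUM k=1..N. B i k * (if k = j then 1 else 0))"
		by (rule sum_delta_mult(2)[OF j, symmetric])
	 also have "... = (SUM k=1..N. B i k * (SUM l=1..N. cartan k l * gram N l j))"
		by (intro sum.cong refl arg_cong[where f = "%x. B i _ * x"]) (rule cartan_gram[OF _ j, symmetric])
	 also have "... = (SUM k=1..N. SUM l=1..N. B i k * cartan k l * gram N l j)"
		by (simp add: sum_distrib_left mult.assoc)
	 also have "... = (SUM l=1..N. SUM k=1..N. B i k * cartan k l * gram N l j)"
		by (rule sum.swap)
	 also have "... = (SUM l=1..N. (SUM k=1..N. B i k * cartan k l) * gram N l j)"
		by (simp add: sum_distrib_right)
	 also have "... = (SUM l=1..N. (if i = l then 1 else 0) * gram N l j)"
		by (intro sum.cong refl) (simp only: BK)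
	 also have "... = gram N i j" by (rule sum_delta_mult(1)[OF i])
	 finally show ?thesis .
	next
	 case False
	 thus ?thesis using B by (auto simp: gram_def)
	qed
 qed
 thus ?thesis unfolding A_mat_def mat_inverse_def using ex by (intro the_equality)
qed

lemma A_sym: "A_mat N i j = A_mat N j i"
 by (simp add: A_mat_eq gram_sym)

lemma A_nonneg: "0 <= A_mat N i j"
 by (auto simp: A_mat_eq gram_def)

lemma A_pos: "i : {1..N} ==> j : {1..N} ==> 0 < A_mat N i j"
 by (auto simp: A_mat_eq gram_def)

lemma r_pos: "i : {1..N} ==> 0 < r_vec N i"
 unfolding r_vec_def by (intro sum_pos A_pos) auto

lemma K_A: "i : {1..N} ==> j : {1..N} ==> (SUM k=1..N. cartan i k * A_mat N k j) = (if i = j then 1 else 0)"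
 "i : {1..N} ==> j : {1..N} ==> (SUM k=1..N. A_mat N i k * cartan k j) = (if i = j then 1 else 0)"
 unfolding A_mat_eq using cartan_gram gram_cartan by auto

lemma K_r: "i : {1..N} ==> (SUM k=1..N. cartan i k * r_vec N k) = 1"
proof -
 assume i: "i : {1..N}"
 have "(SUM k=1..N. cartan i k * r_vec N k) = (SUM j=1..N. SUM k=1..N. cartan i k * A_mat N k j)"
	unfolding r_vec_def sum_distrib_left by (rule sum.swap)
 also have "... = (SUM j=1..N. if i = j then 1 else 0)" using i by (intro sum.cong refl K_A) auto
 also have "... = 1" using i by simp
 finally show ?thesis .
qed

lemma b_pos:
 assumes "!!i. i : {1..N} ==> n i >= 1" "i : {1..N}"
 shows "0 < b_vec N n i"
proof -
 have "0 < (SUM k=1..N. A_mat N i k * real (n k))"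
	using assms A_pos[OF assms(2)] by (intro sum_pos mult_pos_pos) (force intro: Suc_le_lessD)+
 thus ?thesis by (simp add: b_vec_def)
qed

lemma M_mat_eq:
 assumes "i : {1..N}" "j : {1..N}"
 shows "M_mat N i j = r_vec N i * cartan i j * r_vec N j"
proof -
 have "mat_mult N (diag (r_vec N)) cartan i k = r_vec N i * cartan i k" for k
	unfolding mat_mult_def diag_def using assms by (simp add: if_distrib[of "%x. x * _"] cong: if_cong)
 thus ?thesis
	unfolding M_mat_def mat_mult_def[of N "mat_mult N (diag (r_vec N)) cartan"] diag_def using assms
	by (simp add: if_distrib[of "%x. _ * x"] cong: if_cong)
qed

definition kform :: "nat => (nat => real) => real" where
 "kform N z = (SUM i=1..N. SUM k=1..N. z i * cartan i k * z k)"

lemma cartan_abs_sum: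
 fixes w :: "nat => real"
 assumes that: "!!i. 0 <= w i"
 shows "(SUM i=1..N. SUM k=1..N. abs (cartan i k) * w k) <= (SUM i=1..N. 4 * w i)"
proof -
 have "(SUM i=1..N. abs (cartan i k)) <= 4" if k: "k : {1..N}" for k
 proof -
	have "(SUM i=1..N. abs (cartan i k)) = (SUM i:{1..N} \<inter> {k - 1, k, Suc k}. abs (cartan i k))"
	 by (intro sum.mono_neutral_right) (auto simp: cartan_def)
	also have "... <= (SUM i:{k - 1, k, Suc k}. abs (cartan i k))" by (intro sum_mono2) auto
	also have "... <= 4"
	proof -
	 obtain m where "k = Suc m" using k by (cases k) auto
	 thus ?thesis by (simp add: cartan_def)
	qed
	finally show ?thesis .
 qed
 hence "(SUM k=1..N. (SUM i=1..N. abs (cartan i k)) * w k) <= (SUM k=1..N. 4 * w k)"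
	by (intro sum_mono mult_right_mono that)
 thus ?thesis by (subst sum.swap) (simp add: sum_distrib_right)
qed

text \<open>The positive vector \<open>r\<close> with \<open>K r = 1\<close> acts as a ground state.\<close>

lemma kform_lower:
 "(SUM i=1..N. (z i)^2 / r_vec N i) <= kform N z"
proof -
 let ?r = "r_vec N"
 have off: "z i * cartan i k * z k >= cartan i k * ((z i)^2 * ?r k / ?r i + (z k)^2 * ?r i / ?r k) / 2"
	if i: "i : {1..N}" and k: "k : {1..N}" for i k
 proof (cases "i = k")
	case True
	thus ?thesis using r_pos[OF i] by (simp add: power2_eq_square)
 next
	case False
	have ri: "?r i > 0" and rk: "?r k > 0" using r_pos i k by auto
	have "0 <= (z i * ?r k - z k * ?r i)^2 / (?r i * ?r k)" using ri rk by simp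
	also have "... = ((z i)^2 * ?r k / ?r i + (z k)^2 * ?r i / ?r k) - 2 * (z i * z k)"
	 using ri rk by (simp add: power2_eq_square field_simps)
	finally have "z i * z k <= ((z i)^2 * ?r k / ?r i + (z k)^2 * ?r i / ?r k) / 2" by simp
	hence "(- cartan i k) * (z i * z k) <= (- cartan i k) * (((z i)^2 * ?r k / ?r i + (z k)^2 * ?r i / ?r k) / 2)"
	 using False by (intro mult_left_mono) (simp_all add: cartan_def)
	thus ?thesis by (simp add: mult_ac)
 qed
 have half: "(SUM i=1..N. SUM k=1..N. cartan i k * ((z i)^2 * ?r k / ?r i)) = (SUM i=1..N. (z i)^2 / ?r i)"
 proof (rule sum.cong[OF refl])
	fix i assume i: "i : {1..N}"
	have "(SUM k=1..N. cartan i k * ((z i)^2 * ?r k / ?r i)) = (SUM k=1..N. cartan i k * ?r k) * ((z i)^2 / ?r i)"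
	 unfolding sum_distrib_right by (intro sum.cong refl) simp
	thus "(SUM k=1..N. cartan i k * ((z i)^2 * ?r k / ?r i)) = (z i)^2 / ?r i" unfolding K_r[OF i] by simp
 qed
 have half': "(SUM i=1..N. SUM k=1..N. cartan i k * ((z k)^2 * ?r i / ?r k)) = (SUM i=1..N. (z i)^2 / ?r i)"
	using half by (subst sum.swap) (simp add: cartan_sym)
 have "(SUM i=1..N. (z i)^2 / ?r i) = (SUM i=1..N. SUM k=1..N. cartan i k * ((z i)^2 * ?r k / ?r i + (z k)^2 * ?r i / ?r k) / 2)"
	unfolding distrib_left add_divide_distrib sum.distrib sum_divide_distrib[symmetric] half half' by simp
 also have "... <= kform N z" unfolding kform_def by (intro sum_mono off)
 finally show ?thesis .
qed

definition kappa :: "nat => real" where "kappa N = 1 / (SUM i=1..N. r_vec N i)"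

lemma kappa_pos: "N >= 1 ==> kappa N > 0"
 unfolding kappa_def by (intro divide_pos_pos sum_pos r_pos) auto

lemma kform_coercive: "kappa N * (SUM i=1..N. (z i)^2) <= kform N z"
proof -
 have "kappa N * (z i)^2 <= (z i)^2 / r_vec N i" if i: "i : {1..N}" for i
 proof -
	have "r_vec N i <= (SUM i=1..N. r_vec N i)"
	 using i r_pos[of _ N] by (intro member_le_sum) (simp_all add: less_imp_le)
	hence "kappa N <= 1 / r_vec N i" unfolding kappa_def using r_pos[OF i] by (intro divide_left_mono mult_pos_pos) auto
	hence "kappa N * (z i)^2 <= 1 / r_vec N i * (z i)^2" by (intro mult_right_mono) auto
	thus ?thesis by simp
 qed
 hence "(SUM i=1..N. kappa N * (z i)^2) <= (SUM i=1..N. (z i)^2 / r_vec N i)" by (intro sum_mono)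
 thus ?thesis using kform_lower[of z N] by (simp add: sum_distrib_left)
qed

lemma cartan_square_bound:
 "(SUM k=1..N. cartan i k * z k)^2 <= 4 * (SUM k=1..N. abs (cartan i k) * (z k)^2)"
proof -
 have b: "(SUM k=1..N. abs (cartan i k)) <= 4"
 proof -
	have "(SUM k=1..N. abs (cartan i k)) = (SUM k:{1..N} \<inter> {i - 1, i, Suc i}. abs (cartan i k))"
	 by (intro sum.mono_neutral_right) (auto simp: cartan_def)
	also have "... <= (SUM k:{i - 1, i, Suc i}. abs (cartan i k))" by (intro sum_mono2) auto
	also have "... <= 4" by (cases i) (auto simp: cartan_def)
	finally show ?thesis .
 qed
 have s1: "sqrt (abs c) * (sqrt (abs c) * (sgn c * y)) = c * y" for c y :: real
 proof -
	have "sqrt (abs c) * (sqrt (abs c) * (sgn c * y)) = (sqrt (abs c) * sqrt (abs c)) * sgn c * y" by (simp only: mult.assoc)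
	also have "... = c * y" by (simp only: real_sqrt_mult_self abs_abs abs_mult_sgn)
	finally show ?thesis .
 qed
 have s2: "(sqrt (abs c) * (sgn c * y))^2 = abs c * y^2" for c y :: real
	by (cases "c = 0") (simp_all add: power_mult_distrib sgn_if)
 have "(SUM k=1..N. sqrt (abs (cartan i k)) * (sqrt (abs (cartan i k)) * (sgn (cartan i k) * z k)))^2
	 <= (SUM k=1..N. (sqrt (abs (cartan i k)))^2) * (SUM k=1..N. (sqrt (abs (cartan i k)) * (sgn (cartan i k) * z k))^2)"
	by (rule Cauchy_Schwarz_ineq_sum)
 also have "... = (SUM k=1..N. abs (cartan i k)) * (SUM k=1..N. abs (cartan i k) * (z k)^2)"
	unfolding s2 by simp
 also have "... <= 4 * (SUM k=1..N. abs (cartan i k) * (z k)^2)"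
	using b by (intro mult_right_mono sum_nonneg) simp_all
 finally show ?thesis unfolding s1 .
qed

definition aform :: "nat => (nat => real) => (nat => real) => real" where
 "aform N x y = (SUM i=1..N. SUM j=1..N. x i * A_mat N i j * y j)"

lemma aform_sym: "aform N x y = aform N y x"
 unfolding aform_def by (subst sum.swap) (simp add: A_sym mult_ac)

lemma aform_cartan:
 "aform N x (%j. SUM k=1..N. cartan j k * y k) = (SUM i=1..N. x i * y i)"
proof -
 have "(SUM j=1..N. x i * A_mat N i j * (SUM k=1..N. cartan j k * y k)) = x i * y i" if i: "i : {1..N}" for i
 proof -
	have "(SUM j=1..N. x i * A_mat N i j * (SUM k=1..N. cartan j k * y k)) = (SUM j=1..N. SUM k=1..N. x i * (A_mat N i j * cartan j k) * y k)"
	 by (simp add: sum_distrib_left mult_ac)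
	also have "... = (SUM k=1..N. x i * (SUM j=1..N. A_mat N i j * cartan j k) * y k)"
	 by (subst sum.swap) (simp add: sum_distrib_left sum_distrib_right)
	also have "... = (SUM k=1..N. x i * (if i = k then 1 else 0) * y k)"
	 using i by (intro sum.cong refl) (simp only: K_A(2))
	also have "... = (SUM k=1..N. (if i = k then 1 else 0) * (x i * y k))" by (intro sum.cong refl) simp
	also have "... = x i * y i" by (rule sum_delta_mult(1)[OF i])
	finally show ?thesis .
 qed
 thus ?thesis unfolding aform_def by (intro sum.cong refl)
qed

lemma aform_coercive: "kappa N / 16 * (SUM i=1..N. (x i)^2) <= aform N x x" if N: "N >= 1"
proof -
 define y where "y i = (SUM k=1..N. A_mat N i k * x k)" for i
 have xy: "x i = (SUM k=1..N. cartan i k * y k)" if i: "i : {1..N}" for i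
 proof -
	have "(SUM k=1..N. cartan i k * y k) = (SUM k=1..N. SUM l=1..N. cartan i k * A_mat N k l * x l)"
	 unfolding y_def by (simp add: sum_distrib_left mult_ac)
	also have "... = (SUM l=1..N. (SUM k=1..N. cartan i k * A_mat N k l) * x l)"
	 by (subst sum.swap) (simp add: sum_distrib_right)
	also have "... = (SUM l=1..N. (if i = l then 1 else 0) * x l)"
	 using i by (intro sum.cong refl) (simp only: K_A(1))
	also have "... = x i" by (rule sum_delta_mult(1)[OF i])
	finally show ?thesis ..
 qed
 have "aform N x x = (SUM i=1..N. x i * y i)"
	unfolding aform_def y_def by (simp add: sum_distrib_left mult.assoc)
 also have "... = (SUM i=1..N. (SUM k=1..N. cartan i k * y k) * y i)" by (intro sum.cong refl) (simp add: xy)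
 also have "... = kform N y"
	unfolding kform_def by (intro sum.cong refl) (simp add: sum_distrib_left mult_ac)
 finally have "aform N x x = kform N y" .
 moreover have "(SUM i=1..N. (x i)^2) <= 16 * (SUM i=1..N. (y i)^2)"
 proof -
	have "(SUM i=1..N. (x i)^2) <= (SUM i=1..N. 4 * (SUM k=1..N. abs (cartan i k) * (y k)^2))"
	 by (intro sum_mono) (simp only: xy cartan_square_bound)
	also have "... = 4 * (SUM i=1..N. SUM k=1..N. abs (cartan i k) * (y k)^2)" by (simp add: sum_distrib_left)
	also have "... <= 4 * (SUM i=1..N. 4 * (y i)^2)" by (intro mult_left_mono cartan_abs_sum) simp_all
	finally show ?thesis by (simp add: sum_distrib_left)
 qed
 moreover have "kappa N * (SUM i=1..N. (y i)^2) <= kform N y" by (rule kform_coercive)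
 moreover have "kappa N / 16 * (SUM i=1..N. (x i)^2) <= kappa N / 16 * (16 * (SUM i=1..N. (y i)^2))"
	using kappa_pos[OF N] calculation(2) by (intro mult_left_mono) simp_all
 ultimately show ?thesis by simp
qed

section \<open>The functional and its derivative\<close>

lemma exp_minus_one_le: "exp h - 1 <= h * exp h" for h :: real
proof -
 have "exp h * (1 - h) <= exp h * exp (- h)"
	using exp_ge_add_one_self[of "- h"] by (intro mult_left_mono) simp_all
 hence "exp h - exp h * h <= 1" by (simp only: exp_minus_inverse right_diff_distrib mult_1_right)
 thus ?thesis unfolding mult.commute[of h] by linarith
qed

lemma exp_minus_one_bound: "abs (exp h - 1) <= abs h * exp (abs h)" for h :: real
proof (cases "0 <= h")
 case True
 have "abs (exp h - 1) = exp h - 1" "abs h = h" using True by simp_all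
 thus ?thesis using exp_minus_one_le[of h] by (simp only:)
next
 case False
 have "abs (exp h - 1) = 1 - exp h" "abs h = - h" using False by simp_all
 moreover have "abs h * 1 <= abs h * exp (abs h)" by (intro mult_left_mono) simp_all
 ultimately show ?thesis using exp_ge_add_one_self[of h] by linarith
qed

lemma exp_taylor_bound: "abs (exp h - 1 - h) <= h^2 * exp (abs h)" for h :: real
proof -
 have 0: "0 <= exp h - 1 - h" using exp_ge_add_one_self[of h] by linarith
 have "exp h - 1 - h <= h * (exp h - 1)" unfolding right_diff_distrib using exp_minus_one_le[of h] by linarith
 also have "... <= abs h * abs (exp h - 1)" unfolding abs_mult[symmetric] by (rule abs_ge_self)
 also have "... <= abs h * (abs h * exp (abs h))" by (intro mult_left_mono exp_minus_one_bound) simp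
 also have "... = h^2 * exp (abs h)" by (simp add: power2_eq_square mult.assoc[symmetric])
 finally show ?thesis using 0 by linarith
qed

lemma square_le_exp: "h^2 <= 2 * exp (abs h)" for h :: real
 using exp_lower_Taylor_quadratic[of "abs h"] by simp

lemma mult_le_avg_squares: "a * b <= (a^2 + b^2) / 2" for a b :: real
 using zero_le_power2[of "a - b"] by (simp add: power2_eq_square algebra_simps)

lemma kform_le: "kform N d <= 4 * (SUM i=1..N. (d i)^2)"
proof -
 have "kform N d <= (SUM i=1..N. SUM k=1..N. abs (cartan i k) * (d i)^2 / 2 + abs (cartan i k) * (d k)^2 / 2)"
	unfolding kform_def
 proof (intro sum_mono)
	fix i k
	have "d i * cartan i k * d k <= abs (cartan i k) * (abs (d i) * abs (d k))"
	 by (rule order_trans[OF abs_ge_self]) (simp add: abs_mult mult_ac)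
	also have "... <= abs (cartan i k) * ((abs (d i)^2 + abs (d k)^2) / 2)"
	 by (intro mult_left_mono mult_le_avg_squares) simp
	finally show "d i * cartan i k * d k <= abs (cartan i k) * (d i)^2 / 2 + abs (cartan i k) * (d k)^2 / 2"
	 by (simp add: distrib_left add_divide_distrib)
 qed
 also have "... = (SUM i=1..N. SUM k=1..N. abs (cartan i k) * (d i)^2) / 2 + (SUM i=1..N. SUM k=1..N. abs (cartan i k) * (d k)^2) / 2"
	by (simp add: sum.distrib sum_divide_distrib)
 also have "(SUM i=1..N. SUM k=1..N. abs (cartan i k) * (d i)^2) = (SUM i=1..N. SUM k=1..N. abs (cartan i k) * (d k)^2)"
	by (subst sum.swap) (simp add: cartan_sym)
 also have "(SUM i=1..N. SUM k=1..N. abs (cartan i k) * (d k)^2) / 2 + (SUM i=1..N. SUM k=1..N. abs (cartan i k) * (d k)^2) / 2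
	 <= (SUM i=1..N. 4 * (d i)^2)"
	using cartan_abs_sum[of "%i. (d i)^2" N] by simp
 finally show ?thesis by (simp add: sum_distrib_left)
qed

lemma kform_nonneg: "N >= 1 ==> 0 <= kform N d"
 using kform_coercive[of N d] kappa_pos[of N] by (smt (verit) mult_nonneg_nonneg sum_nonneg zero_le_power2)

lemma kform_add: "kform N (%i. y i + d i) = kform N y + 2 * (SUM i=1..N. d i * (SUM k=1..N. cartan i k * y k)) + kform N d"
proof -
 have e: "kform N (%i. y i + d i) = kform N y + (SUM i=1..N. SUM k=1..N. y i * cartan i k * d k)
	 + (SUM i=1..N. SUM k=1..N. d i * cartan i k * y k) + kform N d"
	unfolding kform_def sum.distrib[symmetric] by (intro sum.cong refl) (simp add: algebra_simps)
 have "(SUM i=1..N. SUM k=1..N. y i * cartan i k * d k) = (SUM i=1..N. SUM k=1..N. d i * cartan i k * y k)"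
	by (subst sum.swap) (simp add: cartan_sym mult_ac)
 with e show ?thesis by (simp add: sum_distrib_left mult_ac)
qed

lemma aform_lincomb: "aform N p (%i. a * x i + b * y i) = a * aform N p x + b * aform N p y"
 unfolding aform_def by (simp add: sum_distrib_left distrib_left sum.distrib[symmetric] mult_ac)

locale chern_simons = flat_torus +
 fixes N :: nat and l :: real and n :: "nat => nat" and u0 :: "nat => real^2 => real" and C0 :: real
 assumes N: "1 <= N" and l: "0 < l" and n: "!!i. i : {1..N} ==> n i >= 1"
	and u0_int: "!!i. i : {1..N} ==> Integ (u0 i)"
	and u0_le: "!!i. i : {1..N} ==> AE x in M. u0 i x <= C0"
begin

abbreviation V :: "(nat => real^2 => real) set" where "V \<equiv> W12_vec per1 per2 N"
abbreviation nrm :: "(nat => real^2 => real) => real" where "nrm \<equiv> W12_norm per1 per2 N"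
abbreviation E :: "(nat => real^2 => real) => real" where "E \<equiv> energy per1 per2 N l n u0"
abbreviation b :: "nat => real" where "b \<equiv> b_vec N n"
abbreviation r :: "nat => real" where "r \<equiv> r_vec N"

definition z :: "(nat => real^2 => real) => nat => real^2 => real" where
 "z v j x = r j * exp (u0 j x + v j x)"

text \<open>The potential part of the derivative, per component.\<close>

definition force :: "(nat => real^2 => real) => nat => real^2 => real" where
 "force v j x = z v j x * ((SUM k=1..N. cartan j k * z v k x) - 1)"

definition dform :: "(nat => real^2 => real) => (nat => real^2 => real) => real" where
 "dform v w = (SUM k:UNIV. \<integral>x. aform N (%i. wp k (v i) x) (%i. wp k (w i) x) \<partial>M)"

definition lin :: "(nat => real^2 => real) => (nat => real^2 => real) => real" where
 "lin v w = dform v w + l * (\<oint>x. (SUM j=1..N. force v j x * w j x))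
	+ 1 / area * (\<oint>x. (SUM j=1..N. b j * w j x))"

definition size :: "(nat => real^2 => real) => real^2 => real" where
 "size v x = (SUM j=1..N. abs (v j x))"

lemma V_W: "v : V ==> i : {1..N} ==> v i : W"
 by (simp add: W12_vec_def)

lemma V_I: "(!!i. i : {1..N} ==> v i : W) ==> v : V"
 by (simp add: W12_vec_def)

lemma V_L2: "v : V ==> i : {1..N} ==> v i : L2"
 "v : V ==> i : {1..N} ==> wp k (v i) : L2"
 by (rule W_L2[OF V_W], assumption+) (rule wp_L2[OF V_W], assumption+)

lemma V_lincomb: "v : V ==> w : V ==> (%i x. a * v i x + b' * w i x) : V"
 by ((rule V_I, rule W_lincomb(1)); rule V_W; assumption)

lemma V_add: "v : V ==> w : V ==> (%i x. v i x + w i x) : V"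
 by ((rule V_I, rule W_add(1)); rule V_W; assumption)

lemma V_diff: "v : V ==> w : V ==> (%i x. v i x - w i x) : V"
 by ((rule V_I, rule W_diff(1)); rule V_W; assumption)

lemma V_cmult: "w : V ==> (%i x. c * w i x) : V"
 by ((rule V_I, rule W_cmult(1)); rule V_W; assumption)

lemma nrm_eq: "v : V ==> nrm v = sqrt (SUM i=1..N. (\<oint>x. (v i x)^2) + dir (v i))"
proof -
 assume v: "v : V"
 have e: "(\<oint>x. (v i x)^2 + (SUM k:UNIV. (wp k (v i) x)^2)) = (\<oint>x. (v i x)^2) + dir (v i)"
	if i: "i : {1..N}" for i
 proof -
	have 1: "Integ (%x. (v i x)^2)" by (rule L2D(4)[OF V_L2(1)[OF v i]])
	have 2: "Integ (%x. (wp k (v i) x)^2)" for k by (rule L2D(4)[OF V_L2(2)[OF v i]])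
	have "(\<oint>x. (v i x)^2 + (SUM k:UNIV. (wp k (v i) x)^2)) = (\<oint>x. (v i x)^2) + (\<oint>x. (SUM k:UNIV. (wp k (v i) x)^2))"
	 by (intro add_integral sum_integrable 1 2)
	also have "(\<oint>x. (SUM k:UNIV. (wp k (v i) x)^2)) = dir (v i)"
	 unfolding dir_def by (intro sum_integral 2)
	finally show ?thesis .
 qed
 show ?thesis unfolding W12_norm_def cell_integral_M by (rule arg_cong[where f = sqrt], rule sum.cong[OF refl], rule e)
qed

lemma L2_mass_nonneg: "0 <= (\<oint>x. (f x)^2)" for f :: "real^2 => real"
 by (rule integral_nonneg_AE) simp

lemma nrm_nonneg: "v : V ==> 0 <= nrm v"
 unfolding nrm_eq by (intro real_sqrt_ge_zero sum_nonneg add_nonneg_nonneg L2_mass_nonneg dirichlet_nonneg)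

lemma nrm_sq: "v : V ==> (nrm v)^2 = (SUM i=1..N. (\<oint>x. (v i x)^2) + dir (v i))"
 unfolding nrm_eq by (intro real_sqrt_pow2 sum_nonneg add_nonneg_nonneg L2_mass_nonneg dirichlet_nonneg)

lemma component_bounds:
 assumes v: "v : V" and i: "i : {1..N}"
 shows "(\<oint>x. (v i x)^2) + dir (v i) <= (nrm v)^2" "(\<oint>x. (v i x)^2) <= (nrm v)^2"
	"dir (v i) <= (nrm v)^2" "(\<oint>x. (wp k (v i) x)^2) <= (nrm v)^2"
proof -
 show 1: "(\<oint>x. (v i x)^2) + dir (v i) <= (nrm v)^2"
	unfolding nrm_sq[OF v] using i
	by (intro member_le_sum[of i "{1..N}" "%i. (\<oint>x. (v i x)^2) + dir (v i)"] add_nonneg_nonneg L2_mass_nonneg dirichlet_nonneg) simp_all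
 show "(\<oint>x. (v i x)^2) <= (nrm v)^2" using 1 dirichlet_nonneg[of "v i"] by linarith
 show 2: "dir (v i) <= (nrm v)^2" using 1 L2_mass_nonneg[of "v i"] by linarith
 have "(\<oint>x. (wp k (v i) x)^2) <= dir (v i)"
	unfolding dir_def
	by (intro member_le_sum[of k UNIV "%k. \<integral>x. (wp k (v i) x)^2 \<partial>M"] L2_mass_nonneg) simp_all
 thus "(\<oint>x. (wp k (v i) x)^2) <= (nrm v)^2" using 2 by linarith
qed

lemma dirichlet_cmult: "u : W ==> dir (%x. c * u x) = c^2 * dir u"
proof -
 assume u: "u : W"
 have "(\<oint>x. (wp k (%x. c * u x) x)^2) = c^2 * (\<oint>x. (wp k u x)^2)" for k
 proof -
	have "(\<oint>x. (wp k (%x. c * u x) x)^2) = (\<oint>x. c^2 * (wp k u x)^2)"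
	proof (rule integral_cong_AE)
	 show "AE x in M. (wp k (%x. c * u x) x)^2 = c^2 * (wp k u x)^2"
		using W_cmult(2)[OF u, of k c] by eventually_elim (simp add: power_mult_distrib)
	qed (use L2D(3)[OF wp_L2[OF u]] L2D(3)[OF wp_L2[OF W_cmult(1)[OF u]]] in simp_all)
	thus ?thesis by simp
 qed
 thus ?thesis unfolding dir_def by (simp add: sum_distrib_left)
qed

lemma nrm_scale: "w : V ==> nrm (%i x. c * w i x) = abs c * nrm w"
proof -
 assume w: "w : V"
 have e: "(\<oint>x. (c * w i x)^2) + dir (%x. c * w i x) = c^2 * ((\<oint>x. (w i x)^2) + dir (w i))"
	if "i : {1..N}" for i
	using dirichlet_cmult[OF V_W[OF w that]] by (simp add: power_mult_distrib distrib_left)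
 have "nrm (%i x. c * w i x) = sqrt (c^2 * (SUM i=1..N. (\<oint>x. (w i x)^2) + dir (w i)))"
	unfolding nrm_eq[OF V_cmult[OF w]] sum_distrib_left by (rule arg_cong[where f = sqrt], rule sum.cong[OF refl], rule e)
 thus ?thesis unfolding nrm_eq[OF w] by (simp add: real_sqrt_mult)
qed

lemma L2_pairing_bound:
 assumes f: "f : L2" and g: "g : Meas" "Integ (%x. (g x)^2)"
	and b: "(\<oint>x. (f x)^2) <= a^2" "(\<oint>x. (g x)^2) <= c^2" "0 <= a" "0 <= c"
 shows "abs (\<integral>x. f x * g x \<partial>M) <= a * c"
proof -
 have "(\<oint>x. f x * g x)^2 <= (\<oint>x. (f x)^2) * (\<oint>x. (g x)^2)"
	by (rule cauchy_schwarz_M[OF L2D(3)[OF f] g(1) L2D(4)[OF f] g(2)])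
 also have "... <= a^2 * c^2" by (intro mult_mono b L2_mass_nonneg) simp
 finally have "abs (\<integral>x. f x * g x \<partial>M)^2 <= (a * c)^2" by (simp only: power_mult_distrib power2_abs)
 thus ?thesis by (rule power2_le_imp_le) (use b(3,4) in simp)
qed

lemma aform_integrable:
 assumes v: "v : V" and w: "w : V"
 shows "Integ (%x. aform N (%i. wp k (v i) x) (%i. wp k (w i) x))"
proof -
 have "Integ (%x. wp k (v i) x * A_mat N i j * wp k (w j) x)" if "i : {1..N}" "j : {1..N}" for i j
 proof -
	note L = V_L2(2)[OF v that(1), of k] V_L2(2)[OF w that(2), of k]
	have "Integ (%x. A_mat N i j * (wp k (v i) x * wp k (w j) x))"
	 by (intro integrable_mult_right L2_product_integrable L2D(3,4) L)
	thus ?thesis by (simp add: mult_ac)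
 qed
 thus ?thesis unfolding aform_def by (intro sum_integrable)
qed

lemma dirichlet_form_sym: "dform v w = dform w v"
 unfolding dform_def by (subst aform_sym) (rule refl)

lemma dirichlet_form_lincomb:
 assumes u: "u : V" and v: "v : V" and w: "w : V"
 shows "dform u (%i x. a * v i x + c * w i x) = a * dform u v + c * dform u w"
proof -
 have "(\<oint>x. aform N (%i. wp k (u i) x) (%i. wp k (%x. a * v i x + c * w i x) x)) =
	 a * (\<oint>x. aform N (%i. wp k (u i) x) (%i. wp k (v i) x)) + c * (\<oint>x. aform N (%i. wp k (u i) x) (%i. wp k (w i) x))" for k
 proof -
	have ae: "AE x in M. ALL i:{1..N}. wp k (%x. a * v i x + c * w i x) x = a * wp k (v i) x + c * wp k (w i) x"
	 by (rule AE_finite_allI) (simp, intro W_lincomb(2) V_W v w)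
	have "(\<oint>x. aform N (%i. wp k (u i) x) (%i. wp k (%x. a * v i x + c * w i x) x)) =
	 (\<oint>x. a * aform N (%i. wp k (u i) x) (%i. wp k (v i) x) + c * aform N (%i. wp k (u i) x) (%i. wp k (w i) x))"
	proof (rule integral_cong_AE)
	 show "AE x in M. aform N (%i. wp k (u i) x) (%i. wp k (%x. a * v i x + c * w i x) x) =
		a * aform N (%i. wp k (u i) x) (%i. wp k (v i) x) + c * aform N (%i. wp k (u i) x) (%i. wp k (w i) x)"
		using ae
	 proof eventually_elim
		fix x assume x: "ALL i:{1..N}. wp k (%x. a * v i x + c * w i x) x = a * wp k (v i) x + c * wp k (w i) x"
		have "aform N (%i. wp k (u i) x) (%i. wp k (%x. a * v i x + c * w i x) x) = aform N (%i. wp k (u i) x) (%i. a * wp k (v i) x + c * wp k (w i) x)"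
		unfolding aform_def by (intro sum.cong refl) (simp only: x[rule_format])
		thus "aform N (%i. wp k (u i) x) (%i. wp k (%x. a * v i x + c * w i x) x) =
		a * aform N (%i. wp k (u i) x) (%i. wp k (v i) x) + c * aform N (%i. wp k (u i) x) (%i. wp k (w i) x)"
		by (simp only: aform_lincomb)
	 qed
	 show "(%x. aform N (%i. wp k (u i) x) (%i. wp k (%x. a * v i x + c * w i x) x)) : Meas"
		by (rule borel_measurable_integrable[OF aform_integrable[OF u V_lincomb[OF v w]]])
	 show "(%x. a * aform N (%i. wp k (u i) x) (%i. wp k (v i) x) + c * aform N (%i. wp k (u i) x) (%i. wp k (w i) x)) : Meas"
		using aform_integrable[OF u v, of k] aform_integrable[OF u w, of k] by simp
	qed
	also have "... = a * (\<oint>x. aform N (%i. wp k (u i) x) (%i. wp k (v i) x)) + c * (\<oint>x. aform N (%i. wp k (u i) x) (%i. wp k (w i) x))"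
	 using aform_integrable[OF u v, of k] aform_integrable[OF u w, of k] by simp
	finally show ?thesis .
 qed
 thus ?thesis unfolding dform_def by (simp add: sum.distrib sum_distrib_left)
qed

lemma dirichlet_form_bound:
 "EX C>=0. ALL v:V. ALL w:V. abs (dform v w) <= C * nrm v * nrm w"
proof (intro exI conjI ballI)
 let ?C = "SUM k:(UNIV::2 set). SUM i=1..N. SUM j=1..N. A_mat N i j"
 show "0 <= ?C" by (intro sum_nonneg A_nonneg)
 fix v w assume v: "v : V" and w: "w : V"
 have "abs (\<integral>x. aform N (%i. wp k (v i) x) (%i. wp k (w i) x) \<partial>M) <= (SUM i=1..N. SUM j=1..N. A_mat N i j) * nrm v * nrm w" for k
 proof -
	have i: "Integ (%x. wp k (v i) x * wp k (w j) x)" if "i : {1..N}" "j : {1..N}" for i j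
	 by (intro L2_product_integrable L2D(3,4) V_L2(2) v w that)
	have "(\<oint>x. aform N (%i. wp k (v i) x) (%i. wp k (w i) x)) =
		(\<oint>x. (SUM i=1..N. SUM j=1..N. A_mat N i j * (wp k (v i) x * wp k (w j) x)))"
	 unfolding aform_def by (simp add: mult_ac)
	also have "... = (SUM i=1..N. SUM j=1..N. A_mat N i j * (\<oint>x. wp k (v i) x * wp k (w j) x))"
	 by (subst sum_integral, intro sum_integrable integrable_mult_right i, assumption+)
		(intro sum.cong refl, subst sum_integral, intro integrable_mult_right i, assumption+, simp)
	finally have eq: "(\<oint>x. aform N (%i. wp k (v i) x) (%i. wp k (w i) x)) = (SUM i=1..N. SUM j=1..N. A_mat N i j * (\<oint>x. wp k (v i) x * wp k (w j) x))" .
	have "abs (\<integral>x. aform N (%i. wp k (v i) x) (%i. wp k (w i) x) \<partial>M) <= (SUM i=1..N. SUM j=1..N. A_mat N i j * (nrm v * nrm w))"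
	 unfolding eq
	proof (rule order_trans[OF sum_abs], intro sum_mono, rule order_trans[OF sum_abs], intro sum_mono)
	 fix i j assume ij: "i : {1..N}" "j : {1..N}"
	 have "abs (\<integral>x. wp k (v i) x * wp k (w j) x \<partial>M) <= nrm v * nrm w"
		by (intro L2_pairing_bound L2D(3,4) V_L2(2) v w ij component_bounds nrm_nonneg)
	 thus "abs (A_mat N i j * (\<oint>x. wp k (v i) x * wp k (w j) x)) <= A_mat N i j * (nrm v * nrm w)"
		using A_nonneg[of N i j] by (simp add: abs_mult mult_left_mono)
	qed
	thus ?thesis by (simp add: sum_distrib_right mult.assoc)
 qed
 thus "abs (dform v w) <= ?C * nrm v * nrm w"
	unfolding dform_def sum_distrib_right by (intro order_trans[OF sum_abs] sum_mono)
qed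

lemma V_measurable: "v : V ==> i : {1..N} ==> v i : Meas"
 by (rule L2D(3)[OF V_L2(1)])

lemma size_measurable: "v : V ==> size v : Meas"
 unfolding size_def[abs_def] by (intro borel_measurable_sum borel_measurable_abs V_measurable)

lemma size_nonneg: "0 <= size v x"
 unfolding size_def by (rule sum_nonneg) simp

lemma component_le_size: "j : {1..N} ==> abs (v j x) <= size v x"
 unfolding size_def by (intro member_le_sum[of j "{1..N}" "%j. abs (v j x)"]) simp_all

lemma z_measurable: "v : V ==> j : {1..N} ==> z v j : Meas"
 unfolding z_def[abs_def] using V_measurable borel_measurable_integrable[OF u0_int] by simp

lemma z_pos: "j : {1..N} ==> 0 < z v j x"
 unfolding z_def using r_pos by simp

lemma force_measurable: "v : V ==> j : {1..N} ==> force v j : Meas"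
 unfolding force_def[abs_def] by (intro borel_measurable_times borel_measurable_diff borel_measurable_sum
	 borel_measurable_const z_measurable) assumption+

lemma exp_size_le: "0 <= s ==> exp (s * size v x) <= (SUM j=1..N. exp (s * real N * abs (v j x)))"
proof -
 assume s: "0 <= s"
 have "Max ((%j. abs (v j x)) ` {1..N}) : (%j. abs (v j x)) ` {1..N}" using N by (intro Max_in) simp_all
 then obtain m where m1: "Max ((%j. abs (v j x)) ` {1..N}) = abs (v m x)" "m : {1..N}" by (elim imageE)
 have m: "m : {1..N}" "!!j. j : {1..N} ==> abs (v j x) <= abs (v m x)"
	using m1(2) unfolding m1(1)[symmetric] by (simp_all add: Max_ge)
 have "size v x <= real N * abs (v m x)"
	unfolding size_def using sum_bounded_above[of "{1..N}" "%j. abs (v j x)" "abs (v m x)"] m(2) by simp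
 hence "exp (s * size v x) <= exp (s * real N * abs (v m x))" using s by (simp add: mult.assoc mult_left_mono)
 also have "... <= (SUM j=1..N. exp (s * real N * abs (v j x)))"
	using m(1) by (intro member_le_sum[of m "{1..N}" "%j. exp (s * real N * abs (v j x))"]) simp_all
 finally show ?thesis .
qed

lemma exp_size_bound:
 assumes s: "0 <= s"
 shows "EX c beta. 0 <= c & 0 <= beta & (ALL v:V. Integ (%x. exp (s * size v x)) &
	(ALL B. (ALL i:{1..N}. (\<oint>x. (v i x)^2) + dir (v i) <= B) --> (\<oint>x. exp (s * size v x)) <= c * exp (beta * B)))"
proof -
 have sN: "0 <= s * real N" using s by simp
 obtain c beta where c: "0 <= c" "0 <= beta" and cb: "ALL u:W. Integ (%x. exp (s * real N * abs (u x))) &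
	(\<oint>x. exp (s * real N * abs (u x))) <= c * exp (beta * ((\<oint>x. (u x)^2) + dir u))"
	using exp_bound_W12[OF sN] by (elim exE conjE)
 show ?thesis
 proof (rule exI[of _ "real N * c"], rule exI[of _ beta], intro conjI ballI allI impI)
	fix v assume v: "v : V"
	have i: "Integ (%x. exp (s * real N * abs (v j x)))" if "j : {1..N}" for j
	 by (rule cb[rule_format, OF V_W[OF v that], THEN conjunct1])
	have isum: "Integ (%x. SUM j=1..N. exp (s * real N * abs (v j x)))"
	 by (rule sum_integrable[OF i])
	show ie: "Integ (%x. exp (s * size v x))"
	proof (rule bound_integrable[OF isum])
	 show "(%x. exp (s * size v x)) : Meas" using size_measurable[OF v] by simp
	 show "AE x in M. norm (exp (s * size v x)) <= norm (SUM j=1..N. exp (s * real N * abs (v j x)))"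
		using order_trans[OF exp_size_le[OF s] abs_ge_self] by (intro AE_I2) simp
	qed
	fix B assume B: "ALL i:{1..N}. (\<oint>x. (v i x)^2) + dir (v i) <= B"
	have "(\<oint>x. exp (s * size v x)) <= (\<oint>x. (SUM j=1..N. exp (s * real N * abs (v j x))))"
	 by (rule integral_mono[OF ie isum exp_size_le[OF s]])
	also have "... = (SUM j=1..N. \<integral>x. exp (s * real N * abs (v j x)) \<partial>M)" by (rule sum_integral[OF i])
	also have "... <= (SUM j=1..N. c * exp (beta * B))"
	proof (rule sum_mono)
	 fix j assume j: "j : {1..N}"
	 have "(\<oint>x. exp (s * real N * abs (v j x))) <= c * exp (beta * ((\<oint>x. (v j x)^2) + dir (v j)))"
		by (rule cb[rule_format, OF V_W[OF v j], THEN conjunct2])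
	 also have "... <= c * exp (beta * B)" using c B j by (intro mult_left_mono) (simp_all add: mult_left_mono)
	 finally show "(\<oint>x. exp (s * real N * abs (v j x))) <= c * exp (beta * B)" .
	qed
	finally show "(\<oint>x. exp (s * size v x)) <= real N * c * exp (beta * B)" by simp
 qed (use c in simp_all)
qed

lemma exp_size_integrable:
 assumes v: "v : V" and s: "0 <= s"
 shows "Integ (%x. exp (s * size v x))"
proof -
 obtain c beta where "ALL v:V. Integ (%x. exp (s * size v x)) &
	(ALL B. (ALL i:{1..N}. (\<oint>x. (v i x)^2) + dir (v i) <= B) --> (\<oint>x. exp (s * size v x)) <= c * exp (beta * B))"
	using exp_size_bound[OF s] by (elim exE conjE)
 from this[rule_format, OF v, THEN conjunct1] show ?thesis .
qed

lemma growth_integrable: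
 assumes f: "f : Meas" and v: "v : V" and s: "0 <= s" and g: "AE x in M. abs (f x) <= c * exp (s * size v x)"
 shows "Integ f"
proof (rule bound_integrable[OF integrable_mult_right[OF exp_size_integrable[OF v s], of c] f])
 show "AE x in M. norm (f x) <= norm (c * exp (s * size v x))" using g by eventually_elim simp
qed

definition Z0 :: real where "Z0 = (SUM j=1..N. r j) * exp C0"

lemma Z0_nonneg: "0 <= Z0"
 unfolding Z0_def using r_pos[of _ N] by (intro mult_nonneg_nonneg sum_nonneg) (simp_all add: less_imp_le)

lemma u0_all: "AE x in M. ALL j:{1..N}. u0 j x <= C0"
 by (rule AE_finite_allI) (simp, rule u0_le)

lemma z_le_exp:
 assumes x: "ALL j:{1..N}. u0 j x <= C0" and j: "j : {1..N}"
 shows "z v j x <= Z0 * exp (v j x)"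
proof -
 have "r j <= (SUM j=1..N. r j)" using j r_pos[of _ N] by (intro member_le_sum[of j "{1..N}" r]) (simp_all add: less_imp_le)
 hence "r j * (exp (u0 j x) * exp (v j x)) <= (SUM j=1..N. r j) * (exp C0 * exp (v j x))"
	using x j r_pos[OF j] by (intro mult_mono) simp_all
 thus ?thesis unfolding z_def Z0_def by (simp add: exp_add mult_ac)
qed

lemma z_le_size:
 assumes x: "ALL j:{1..N}. u0 j x <= C0" and j: "j : {1..N}"
 shows "z v j x <= Z0 * exp (size v x)"
proof -
 have "exp (v j x) <= exp (size v x)" using component_le_size[OF j, of v x] by simp
 thus ?thesis using z_le_exp[OF x j, of v] mult_left_mono[OF _ Z0_nonneg] by (meson order_trans)
qed

lemma cartan_abs_le: "abs (cartan i k) <= 2" by (simp add: cartan_def)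

definition force_const :: real where "force_const = Z0 * (2 * real N * Z0 + 1)"

lemma force_const_nonneg: "0 <= force_const"
 unfolding force_const_def using Z0_nonneg by simp

lemma force_le:
 assumes x: "ALL j:{1..N}. u0 j x <= C0" and j: "j : {1..N}"
 shows "abs (force v j x) <= force_const * exp (2 * size v x)"
proof -
 let ?e = "exp (size v x)"
 have e1: "1 <= ?e" using size_nonneg[of v x] by simp
 have "abs (SUM k=1..N. cartan j k * z v k x) <= (SUM k=1..N. 2 * (Z0 * ?e))"
 proof (rule order_trans[OF sum_abs sum_mono])
	fix k assume k: "k : {1..N}"
	show "abs (cartan j k * z v k x) <= 2 * (Z0 * ?e)"
	 unfolding abs_mult using z_pos[OF k, of v x] z_le_size[OF x k, of v] by (intro mult_mono cartan_abs_le) simp_all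
 qed
 hence "abs ((SUM k=1..N. cartan j k * z v k x) - 1) <= 2 * real N * Z0 * ?e + 1" by simp
 also have "... <= (2 * real N * Z0 + 1) * ?e" using e1 by (simp add: distrib_right)
 finally have "abs (z v j x) * abs ((SUM k=1..N. cartan j k * z v k x) - 1) <= (Z0 * ?e) * ((2 * real N * Z0 + 1) * ?e)"
	using z_pos[OF j, of v x] z_le_size[OF x j, of v] Z0_nonneg by (intro mult_mono) simp_all
 moreover have "exp (2 * size v x) = ?e * ?e" by (simp add: exp_add[symmetric])
 ultimately show ?thesis unfolding force_def force_const_def abs_mult by (simp only: mult_ac)
qed

lemma force_L2:
 assumes v: "v : V" and j: "j : {1..N}"
 shows "Integ (%x. (force v j x)^2)"
proof (rule growth_integrable[OF _ v, of _ 4 "force_const^2"])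
 show "(%x. (force v j x)^2) : Meas" using force_measurable[OF v j] by simp
 show "AE x in M. abs ((force v j x)^2) <= force_const^2 * exp (4 * size v x)"
	using u0_all
 proof eventually_elim
	fix x assume "ALL j:{1..N}. u0 j x <= C0"
	from power_mono[OF force_le[OF this j, of v] abs_ge_zero, of 2]
	show "abs ((force v j x)^2) <= force_const^2 * exp (4 * size v x)"
	 by (simp add: power_mult_distrib exp_double[symmetric])
 qed
qed simp

lemma force_int:
 assumes v: "v : V" and w: "w : V"
 shows "j : {1..N} ==> Integ (%x. force v j x * w j x)"
	and "Integ (%x. SUM j=1..N. force v j x * w j x)"
	and "Integ (%x. SUM j=1..N. b j * w j x)"
proof -
 show i: "Integ (%x. force v j x * w j x)" if "j : {1..N}" for j
	using that by (intro L2_product_integrable force_L2 force_measurable v L2D(3,4) V_L2(1) w)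
 show "Integ (%x. SUM j=1..N. force v j x * w j x)" by (rule sum_integrable[OF i])
 show "Integ (%x. SUM j=1..N. b j * w j x)"
	by (intro sum_integrable integrable_mult_right L2D(5) V_L2(1) w)
qed

lemma lin_lincomb:
 assumes v: "v : V" and w: "w : V" "w' : V"
 shows "lin v (%i x. a * w i x + c * w' i x) = a * lin v w + c * lin v w'"
proof -
 have "(\<oint>x. (SUM j=1..N. f j x * (a * w j x + c * w' j x))) = a * (\<oint>x. (SUM j=1..N. f j x * w j x)) + c * (\<oint>x. (SUM j=1..N. f j x * w' j x))"
	if "Integ (%x. SUM j=1..N. f j x * w j x)" "Integ (%x. SUM j=1..N. f j x * w' j x)" for f :: "nat => real^2 => real"
 proof -
	have "(\<oint>x. (SUM j=1..N. f j x * (a * w j x + c * w' j x))) = (\<oint>x. a * (SUM j=1..N. f j x * w j x) + c * (SUM j=1..N. f j x * w' j x))"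
	 by (simp add: sum_distrib_left sum.distrib[symmetric] distrib_left mult_ac)
	thus ?thesis using that by simp
 qed
 note this[of "force v", OF force_int(2)[OF v w(1)] force_int(2)[OF v w(2)]]
	this[of "%j x. b j", OF force_int(3)[OF v w(1)] force_int(3)[OF v w(2)]]
 thus ?thesis unfolding lin_def dirichlet_form_lincomb[OF v w] by (simp add: algebra_simps)
qed

lemma lin_bounded:
 assumes v: "v : V"
 shows "EX C. ALL w:V. abs (lin v w) <= C * nrm w"
proof -
 obtain C1 where C1: "ALL v:V. ALL w:V. abs (dform v w) <= C1 * nrm v * nrm w"
	using dirichlet_form_bound by (elim exE conjE)
 define F where "F j = sqrt (\<oint>x. (force v j x)^2)" for j
 define B where "B j = sqrt (\<oint>x. (b j)^2)" for j
 have FB: "(\<oint>x. (force v j x)^2) <= (F j)^2" "0 <= F j" "(\<oint>x. (b j)^2) <= (B j)^2" "0 <= B j" for j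
	unfolding F_def B_def using L2_mass_nonneg[of "force v j"] L2_mass_nonneg[of "%x. b j"] by simp_all
 have "abs (lin v w) <= (C1 * nrm v + l * (SUM j=1..N. F j) + 1 / area * (SUM j=1..N. B j)) * nrm w" if w: "w : V" for w
 proof -
	have p: "abs (\<integral>x. (SUM j=1..N. f j x * w j x) \<partial>M) <= (SUM j=1..N. G j) * nrm w"
	 if f: "!!j. j : {1..N} ==> f j : Meas" "!!j. j : {1..N} ==> Integ (%x. (f j x)^2)"
		"!!j. (\<oint>x. (f j x)^2) <= (G j)^2" "!!j. 0 <= G j" for f G
	proof -
	 have "(\<oint>x. (SUM j=1..N. f j x * w j x)) = (SUM j=1..N. \<integral>x. f j x * w j x \<partial>M)"
		by (intro sum_integral L2_product_integrable f L2D(3,4) V_L2(1) w)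
	 also have "abs (...) <= (SUM j=1..N. G j * nrm w)"
	 proof (rule order_trans[OF sum_abs sum_mono])
		fix j assume j: "j : {1..N}"
		show "abs (\<integral>x. f j x * w j x \<partial>M) <= G j * nrm w"
		using L2_pairing_bound[OF V_L2(1)[OF w j] f(1)[OF j] f(2)[OF j] component_bounds(2)[OF w j] f(3) nrm_nonneg[OF w] f(4)]
		by (simp add: mult.commute)
	 qed
	 finally show ?thesis by (simp add: sum_distrib_right)
	qed
	have t1: "abs (\<integral>x. (SUM j=1..N. force v j x * w j x) \<partial>M) <= (SUM j=1..N. F j) * nrm w"
	 by (rule p[OF force_measurable[OF v] force_L2[OF v] FB(1,2)])
	have t2: "abs (\<integral>x. (SUM j=1..N. b j * w j x) \<partial>M) <= (SUM j=1..N. B j) * nrm w"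
	 by (rule p[of "%j x. b j", OF _ _ FB(3,4)]) simp_all
	have "abs (lin v w) <= abs (dform v w) + abs (l * (\<oint>x. (SUM j=1..N. force v j x * w j x))) + abs (1 / area * (\<oint>x. (SUM j=1..N. b j * w j x)))"
	 unfolding lin_def by linarith
	also have "... <= C1 * nrm v * nrm w + l * ((SUM j=1..N. F j) * nrm w) + 1 / area * ((SUM j=1..N. B j) * nrm w)"
	 unfolding abs_mult using C1 v w l area_pos by (intro add_mono mult_mono t1 t2) simp_all
	finally show ?thesis by (simp add: algebra_simps)
 qed
 thus ?thesis by blast
qed

lemma lin_dual: "v : V ==> lin v : W12_dual per1 per2 N"
 unfolding W12_dual_def
proof (intro CollectI conjI ballI allI)
 assume v: "v : V"
 show "lin v (%i x. w i x + w' i x) = lin v w + lin v w'" if "w : V" "w' : V" for w w'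
	using lin_lincomb[OF v that, of 1 1] by simp
 show "lin v (%i x. c * w i x) = c * lin v w" if "w : V" for c w
	using lin_lincomb[OF v that that, of c 0] by simp
 show "EX C. ALL w:V. abs (lin v w) <= C * nrm w" by (rule lin_bounded[OF v])
qed

lemma energy_eq:
 "E v = 1/2 * dform v v + l/2 * (\<oint>x. kform N (%j. z v j x - r j)) + 1 / area * (\<oint>x. (SUM j=1..N. b j * v j x))"
proof -
 have "(SUM i=1..N. SUM j=1..N. (exp (u0 i x + v i x) - 1) * M_mat N i j * (exp (u0 j x + v j x) - 1)) = kform N (%j. z v j x - r j)" for x
	unfolding kform_def by (intro sum.cong refl) (simp add: M_mat_eq z_def algebra_simps)
 thus ?thesis
	unfolding energy_def cell_integral_M dform_def aform_def cell_area_eq by simp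
qed

lemma kform_shift_integrable:
 assumes v: "v : V"
 shows "Integ (%x. kform N (%j. z v j x - r j))"
proof -
 have L: "Integ (%x. (z v j x - r j)^2)" if j: "j : {1..N}" for j
 proof (rule growth_integrable[OF _ v, of _ 2 "(Z0 + r j)^2"])
	show "(%x. (z v j x - r j)^2) : Meas" using z_measurable[OF v j] by simp
	show "AE x in M. abs ((z v j x - r j)^2) <= (Z0 + r j)^2 * exp (2 * size v x)" using u0_all
	proof eventually_elim
	 fix x assume x: "ALL j:{1..N}. u0 j x <= C0"
	 have "r j * 1 <= r j * exp (size v x)" using r_pos[OF j] size_nonneg[of v x] by (intro mult_left_mono) simp_all
	 hence "abs (z v j x - r j) <= (Z0 + r j) * exp (size v x)"
		using z_le_size[OF x j, of v] z_pos[OF j, of v x] r_pos[OF j] mult_nonneg_nonneg[OF Z0_nonneg exp_ge_zero[of "size v x"]]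
		unfolding distrib_right by linarith
	 from power_mono[OF this abs_ge_zero, of 2]
	 show "abs ((z v j x - r j)^2) <= (Z0 + r j)^2 * exp (2 * size v x)"
		by (simp add: power_mult_distrib exp_double[symmetric])
	qed
 qed simp
 have "Integ (%x. cartan i k * ((z v i x - r i) * (z v k x - r k)))" if "i : {1..N}" "k : {1..N}" for i k
	using that z_measurable[OF v] by (intro integrable_mult_right L2_product_integrable L) simp_all
 thus ?thesis unfolding kform_def by (intro sum_integrable) (simp add: mult_ac)
qed

definition remainder_const :: real where "remainder_const = 2 * force_const + 4 * Z0^2"

lemma potential_remainder:
 assumes x: "ALL j:{1..N}. u0 j x <= C0"
 shows "abs (kform N (%j. z (%i x. v i x + h i x) j x - r j) - kform N (%j. z v j x - r j) - 2 * (SUM j=1..N. force v j x * h j x))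
	<= remainder_const * exp (2 * size v x) * (SUM j=1..N. (h j x)^2 * exp (2 * abs (h j x)))"
proof -
 define d where "d j = z v j x * (exp (h j x) - 1)" for j
 let ?S = "SUM j=1..N. (h j x)^2 * exp (2 * abs (h j x))"
 let ?e = "exp (2 * size v x)"
 have zh: "z (%i x. v i x + h i x) j x - r j = (z v j x - r j) + d j" for j
	unfolding z_def d_def by (simp add: exp_add algebra_simps)
 have Ky: "(SUM k=1..N. cartan j k * (z v k x - r k)) = (SUM k=1..N. cartan j k * z v k x) - 1" if "j : {1..N}" for j
	using K_r[OF that] by (simp add: right_diff_distrib sum_subtractf)
 have s: "(SUM j=1..N. d j * (SUM k=1..N. cartan j k * (z v k x - r k))) = (SUM j=1..N. force v j x * (exp (h j x) - 1))"
	by (intro sum.cong refl, subst Ky, assumption) (simp add: d_def force_def mult_ac)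
 have eq: "kform N (%j. z (%i x. v i x + h i x) j x - r j) - kform N (%j. z v j x - r j) - 2 * (SUM j=1..N. force v j x * h j x)
	= 2 * (SUM j=1..N. force v j x * (exp (h j x) - 1 - h j x)) + kform N d"
	unfolding zh kform_add s by (simp add: right_diff_distrib sum_subtractf)
 have k0: "0 <= kform N d" by (rule kform_nonneg[OF N])
 have k1: "kform N d <= 4 * (Z0^2 * ?e * ?S)"
 proof -
	have "(d j)^2 <= Z0^2 * ?e * ((h j x)^2 * exp (2 * abs (h j x)))" if j: "j : {1..N}" for j
	proof -
	 have "abs (d j) <= (Z0 * exp (size v x)) * (abs (h j x) * exp (abs (h j x)))"
		unfolding d_def abs_mult using z_pos[OF j, of v x] z_le_size[OF x j, of v] Z0_nonneg
		by (intro mult_mono exp_minus_one_bound) simp_all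
	 from power_mono[OF this abs_ge_zero, of 2] show ?thesis
		by (simp add: power_mult_distrib exp_double[symmetric])
	qed
	hence "(SUM j=1..N. (d j)^2) <= (SUM j=1..N. Z0^2 * ?e * ((h j x)^2 * exp (2 * abs (h j x))))" by (rule sum_mono)
	hence "(SUM j=1..N. (d j)^2) <= Z0^2 * ?e * ?S" by (simp only: sum_distrib_left)
	thus ?thesis using kform_le[of N d] by linarith
 qed
 have f1: "abs (SUM j=1..N. force v j x * (exp (h j x) - 1 - h j x)) <= force_const * ?e * ?S"
	unfolding sum_distrib_left
 proof (rule order_trans[OF sum_abs sum_mono])
	fix j assume j: "j : {1..N}"
	have "abs (exp (h j x) - 1 - h j x) <= (h j x)^2 * exp (abs (h j x))" by (rule exp_taylor_bound)
	also have "... <= (h j x)^2 * exp (2 * abs (h j x))" by (intro mult_left_mono) simp_all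
	finally show "abs (force v j x * (exp (h j x) - 1 - h j x)) <= force_const * ?e * ((h j x)^2 * exp (2 * abs (h j x)))"
	 unfolding abs_mult using force_const_nonneg by (intro mult_mono force_le[OF x j]) simp_all
 qed
 have "abs (2 * (SUM j=1..N. force v j x * (exp (h j x) - 1 - h j x)) + kform N d) <= 2 * (force_const * ?e * ?S) + 4 * (Z0^2 * ?e * ?S)"
	using f1 k0 k1 by linarith
 thus ?thesis unfolding eq remainder_const_def by (simp add: distrib_right mult.assoc)
qed

text \<open>Rescale \<open>h\<close> to norm one before applying the exponential bound; the weight is then bounded independently of \<open>h\<close>.\<close>

lemma weighted_square_bound:
 assumes v: "v : V"
 shows "EX C>=0. ALL h:V. nrm h <= 1 --> (ALL j:{1..N}. Integ (%x. exp (2 * size v x) * ((h j x)^2 * exp (2 * abs (h j x)))) &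
	(\<oint>x. exp (2 * size v x) * ((h j x)^2 * exp (2 * abs (h j x)))) <= C * (nrm h)^2)"
proof -
 have 6: "(0::real) <= 6" by simp
 obtain c beta where c: "0 <= c" "0 <= beta" and cb: "ALL u:W. Integ (%x. exp (6 * abs (u x))) &
	(\<oint>x. exp (6 * abs (u x))) <= c * exp (beta * ((\<oint>x. (u x)^2) + dir u))"
	using exp_bound_W12[OF 6] by (elim exE conjE)
 define D where "D = (\<oint>x. exp (4 * size v x)) + c * exp beta"
 have i4: "Integ (%x. exp (4 * size v x))" by (rule exp_size_integrable[OF v]) simp
 have D: "0 <= D" unfolding D_def using c by (intro add_nonneg_nonneg integral_nonneg_AE) simp_all
 show ?thesis
 proof (intro exI[of _ D] conjI D ballI impI)
	fix h j assume h: "h : V" and h1: "nrm h <= 1" and j: "j : {1..N}"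
	let ?f = "%x. exp (2 * size v x) * ((h j x)^2 * exp (2 * abs (h j x)))"
	have fm: "?f : Meas" using size_measurable[OF v] V_measurable[OF h j] by simp
	have "Integ ?f & (\<oint>x. ?f x) <= D * (nrm h)^2"
	proof (cases "nrm h = 0")
	 case True
	 have "(\<oint>x. (h j x)^2) = 0" using component_bounds(2)[OF h j] L2_mass_nonneg[of "h j"] True by simp
	 hence "AE x in M. (h j x)^2 = 0"
		using L2D(4)[OF V_L2(1)[OF h j]] by (subst integral_nonneg_eq_0_iff_AE[symmetric]) simp_all
	 hence ae: "AE x in M. ?f x = 0" by eventually_elim simp
	 have "(\<oint>x. ?f x) = (\<oint>x. 0)" by (rule integral_cong_AE[OF fm _ ae]) simp
	 moreover have "Integ ?f \<longleftrightarrow> Integ (%x. 0 :: real)" by (rule integrable_cong_AE[OF fm _ ae]) simp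
	 ultimately show ?thesis using True by simp
	next
	 case False
	 define rho where "rho = nrm h"
	 have rho: "0 < rho" "rho <= 1" using False nrm_nonneg[OF h] h1 by (simp_all add: rho_def)
	 define g where "g x = 1 / rho * h j x" for x
	 have hg: "h j x = rho * g x" for x using rho by (simp add: g_def)
	 have gW: "g : W" unfolding g_def[abs_def] by (rule W_cmult(1)[OF V_W[OF h j]])
	 have "(\<oint>x. (g x)^2) + dir g = (1 / rho)^2 * ((\<oint>x. (h j x)^2) + dir (h j))"
		unfolding g_def[abs_def] dirichlet_cmult[OF V_W[OF h j]] by (simp add: power_mult_distrib distrib_left power_divide)
	 also have "... <= (1 / rho)^2 * rho^2"
		unfolding rho_def by (intro mult_left_mono component_bounds(1)[OF h j]) simp
	 also have "... = 1" using rho by (simp add: power_divide)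
	 finally have "exp (beta * ((\<oint>x. (g x)^2) + dir g)) <= exp beta" using c(2) by (simp add: mult_left_le)
	 hence g6: "(\<oint>x. exp (6 * abs (g x))) <= c * exp beta"
		by (rule order_trans[OF cb[rule_format, OF gW, THEN conjunct2] mult_left_mono[OF _ c(1)]])
	 have i6: "Integ (%x. exp (6 * abs (g x)))" by (rule cb[rule_format, OF gW, THEN conjunct1])
	 have pt: "?f x <= rho^2 * (exp (4 * size v x) + exp (6 * abs (g x)))" for x
	 proof -
		have "abs (h j x) <= abs (g x)" unfolding hg abs_mult using rho by (intro mult_left_le_one_le) simp_all
		hence "(h j x)^2 * exp (2 * abs (h j x)) <= rho^2 * (g x)^2 * exp (2 * abs (g x))"
		by (intro mult_mono) (simp_all add: hg power_mult_distrib)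
		also have "... <= rho^2 * (2 * exp (abs (g x))) * exp (2 * abs (g x))"
		by (intro mult_right_mono mult_left_mono square_le_exp) simp_all
		also have "... = rho^2 * (2 * exp (3 * abs (g x)))"
		by (simp add: mult.assoc exp_add[symmetric])
		finally have "?f x <= exp (2 * size v x) * (rho^2 * (2 * exp (3 * abs (g x))))" by (intro mult_left_mono) simp_all
		also have "... = rho^2 * (2 * (exp (2 * size v x) * exp (3 * abs (g x))))" by simp
		also have "... <= rho^2 * ((exp (2 * size v x))^2 + (exp (3 * abs (g x)))^2)"
		using mult_le_avg_squares[of "exp (2 * size v x)" "exp (3 * abs (g x))"] by (intro mult_left_mono) simp_all
		finally show ?thesis by (simp add: exp_double[symmetric])
	 qed
	 have ib: "Integ (%x. rho^2 * (exp (4 * size v x) + exp (6 * abs (g x))))"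
		by (intro integrable_mult_right add_integrable i4 i6)
	 have fi: "Integ ?f"
		using order_trans[OF pt abs_ge_self]
		by (intro bound_integrable[OF ib fm] AE_I2) (simp add: abs_mult)
	 have "(\<oint>x. ?f x) <= (\<oint>x. rho^2 * (exp (4 * size v x) + exp (6 * abs (g x))))"
		by (rule integral_mono[OF fi ib pt])
	 also have "... = rho^2 * ((\<oint>x. exp (4 * size v x)) + (\<oint>x. exp (6 * abs (g x))))" using i4 i6 by simp
	 also have "... <= rho^2 * D" unfolding D_def using g6 by (intro mult_left_mono) simp_all
	 finally show ?thesis using fi by (simp add: rho_def mult.commute)
	qed
	thus "Integ ?f" "(\<oint>x. ?f x) <= D * (nrm h)^2" by auto
 qed
qed

lemma energy_remainder:
 assumes v: "v : V"
 shows "EX C>=0. ALL h:V. nrm h <= 1 --> abs (E (%i x. v i x + h i x) - E v - lin v h) <= C * (nrm h)^2"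
proof -
 obtain C1 where C1: "0 <= C1" "ALL v:V. ALL w:V. abs (dform v w) <= C1 * nrm v * nrm w"
	using dirichlet_form_bound by (elim exE conjE)
 obtain C2 where C2: "0 <= C2" "ALL h:V. nrm h <= 1 --> (ALL j:{1..N}. Integ (%x. exp (2 * size v x) * ((h j x)^2 * exp (2 * abs (h j x)))) &
	(\<oint>x. exp (2 * size v x) * ((h j x)^2 * exp (2 * abs (h j x)))) <= C2 * (nrm h)^2)"
	using weighted_square_bound[OF v] by (elim exE conjE)
 have R0: "0 <= remainder_const" unfolding remainder_const_def using force_const_nonneg by simp
 define C where "C = C1 / 2 + l / 2 * (remainder_const * (real N * C2))"
 have C0: "0 <= C" unfolding C_def using C1 C2(1) R0 l by simp
 have "abs (E (%i x. v i x + h i x) - E v - lin v h) <= C * (nrm h)^2" if h: "h : V" "nrm h <= 1" for h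
 proof -
	let ?vh = "%i x. v i x + h i x"
	let ?g = "%j x. exp (2 * size v x) * ((h j x)^2 * exp (2 * abs (h j x)))"
	let ?R = "%x. kform N (%j. z ?vh j x - r j) - kform N (%j. z v j x - r j) - 2 * (SUM j=1..N. force v j x * h j x)"
	have vh: "?vh : V" by (rule V_add[OF v h(1)])
	have gi: "Integ (?g j)" "(\<oint>x. ?g j x) <= C2 * (nrm h)^2" if "j : {1..N}" for j
	 by (rule C2(2)[rule_format, OF h that, THEN conjunct1], rule C2(2)[rule_format, OF h that, THEN conjunct2])
	have Df: "dform ?vh ?vh = dform v v + 2 * dform v h + dform h h"
	proof -
	 have "dform ?vh ?vh = dform ?vh v + dform ?vh h"
		using dirichlet_form_lincomb[OF vh v h(1), of 1 1] by simp
	 moreover have "dform ?vh v = dform v v + dform v h"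
		using dirichlet_form_lincomb[OF v v h(1), of 1 1] by (simp add: dirichlet_form_sym[of ?vh v])
	 moreover have "dform ?vh h = dform v h + dform h h"
		using dirichlet_form_lincomb[OF h(1) v h(1), of 1 1] by (simp add: dirichlet_form_sym[of ?vh h] dirichlet_form_sym[of v h])
	 ultimately show ?thesis by linarith
	qed
	note ki = kform_shift_integrable[OF vh] kform_shift_integrable[OF v] and fi = force_int(2)[OF v h(1)]
	have Ri: "Integ ?R" using ki fi by simp
	have Re: "(\<oint>x. ?R x) = (\<oint>x. kform N (%j. z ?vh j x - r j)) - (\<oint>x. kform N (%j. z v j x - r j)) - 2 * (\<oint>x. (SUM j=1..N. force v j x * h j x))"
	 using ki fi by simp
	have bl: "(\<oint>x. (SUM j=1..N. b j * ?vh j x)) = (\<oint>x. (SUM j=1..N. b j * v j x)) + (\<oint>x. (SUM j=1..N. b j * h j x))"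
	 using force_int(3)[OF v v] force_int(3)[OF v h(1)]
	 by (simp add: distrib_left sum.distrib)
	have eq: "E ?vh - E v - lin v h = 1/2 * dform h h + l/2 * (\<oint>x. ?R x)"
	 unfolding energy_eq lin_def Df Re bl by (simp add: algebra_simps)
	have "abs (\<integral>x. ?R x \<partial>M) <= (\<oint>x. remainder_const * (SUM j=1..N. ?g j x))"
	proof (rule order_trans[OF integral_abs_bound], rule integral_mono_AE)
	 show "Integ (%x. abs (?R x))" by (rule integrable_abs[OF Ri])
	 show "Integ (%x. remainder_const * (SUM j=1..N. ?g j x))"
		by (intro integrable_mult_right sum_integrable gi)
	 show "AE x in M. abs (?R x) <= remainder_const * (SUM j=1..N. ?g j x)"
		using u0_all
	 proof eventually_elim
		fix x assume x: "ALL j:{1..N}. u0 j x <= C0"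
		have "remainder_const * (SUM j=1..N. ?g j x) = remainder_const * exp (2 * size v x) * (SUM j=1..N. (h j x)^2 * exp (2 * abs (h j x)))"
		by (simp only: sum_distrib_left[symmetric] mult.assoc)
		thus "abs (?R x) <= remainder_const * (SUM j=1..N. ?g j x)" using potential_remainder[OF x, of v h] by (simp only:)
	 qed
	qed
	also have "... = remainder_const * (SUM j=1..N. \<integral>x. ?g j x \<partial>M)"
	 unfolding integral_mult_right_zero by (subst sum_integral) (simp_all only: gi)
	also have "... <= remainder_const * (SUM j=1..N. C2 * (nrm h)^2)" by (intro mult_left_mono sum_mono gi R0)
	finally have R: "abs (\<integral>x. ?R x \<partial>M) <= remainder_const * (real N * (C2 * (nrm h)^2))" by simp
	have D: "abs (dform h h) <= C1 * (nrm h)^2" using C1(2) h(1) by (simp add: power2_eq_square mult.assoc)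
	have "abs (E ?vh - E v - lin v h) <= 1/2 * abs (dform h h) + l/2 * abs (\<integral>x. ?R x \<partial>M)"
	 unfolding eq using l by (intro order_trans[OF abs_triangle_ineq]) (simp add: abs_mult)
	also have "... <= 1/2 * (C1 * (nrm h)^2) + l/2 * (remainder_const * (real N * (C2 * (nrm h)^2)))"
	 using D R l by (intro add_mono mult_left_mono) simp_all
	finally show ?thesis unfolding C_def by (simp add: algebra_simps)
 qed
 thus ?thesis using C0 by (intro exI[of _ C] conjI ballI impI)
qed

lemma energy_has_derivative: "v : V ==> has_W12_derivative per1 per2 N E (lin v) v"
 unfolding has_W12_derivative_def
proof (intro conjI allI impI)
 assume v: "v : V"
 show "lin v : W12_dual per1 per2 N" by (rule lin_dual[OF v])
 fix eps :: real assume eps: "eps > 0"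
 obtain C where C: "0 <= C" "ALL h:V. nrm h <= 1 --> abs (E (%i x. v i x + h i x) - E v - lin v h) <= C * (nrm h)^2"
	using energy_remainder[OF v] by (elim exE conjE)
 show "EX del'>0. ALL h:V. nrm h < del' --> abs (E (%i x. v i x + h i x) - E v - lin v h) <= eps * nrm h"
 proof (intro exI[of _ "min 1 (eps / (C + 1))"] conjI ballI impI)
	show "0 < min 1 (eps / (C + 1))" using eps C(1) by simp
	fix h assume h: "h : V" "nrm h < min 1 (eps / (C + 1))"
	have "(C + 1) * nrm h <= eps" using h(2) C(1) by (simp add: pos_less_divide_eq mult.commute)
	hence "C * nrm h <= eps" using nrm_nonneg[OF h(1)] by (simp add: distrib_right)
	hence "C * nrm h * nrm h <= eps * nrm h" by (rule mult_right_mono[OF _ nrm_nonneg[OF h(1)]])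
	thus "abs (E (%i x. v i x + h i x) - E v - lin v h) <= eps * nrm h"
	 using C(2)[rule_format, OF h(1)] h(2) by (simp add: power2_eq_square mult.assoc)
 qed
qed

lemma derivative_unique:
 assumes L: "has_W12_derivative per1 per2 N F L v" and L': "has_W12_derivative per1 per2 N F L' v" and w: "w : V"
 shows "L w = L' w"
proof -
 have "abs (L w - L' w) <= e" if e: "e > 0" for e
 proof -
	define eps where "eps = e / (2 * (nrm w + 1))"
	have n1: "0 < nrm w + 1" using nrm_nonneg[OF w] by simp
	have eps: "eps > 0" unfolding eps_def using e n1 by simp
	obtain del' where del': "del' > 0" "ALL h:V. nrm h < del' --> abs (F (%i x. v i x + h i x) - F v - L h) <= eps * nrm h"
	 using L eps unfolding has_W12_derivative_def by blast
	obtain del'' where del'': "del'' > 0" "ALL h:V. nrm h < del'' --> abs (F (%i x. v i x + h i x) - F v - L' h) <= eps * nrm h"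
	 using L' eps unfolding has_W12_derivative_def by blast
	define t where "t = min del' del'' / (2 * (nrm w + 1))"
	have t: "t > 0" unfolding t_def using del' del'' n1 by simp
	let ?h = "%i x. t * w i x"
	have h: "?h : V" by (rule V_cmult[OF w])
	have nh: "nrm ?h = t * nrm w" using nrm_scale[OF w, of t] t by simp
	have "t * nrm w < t * (2 * (nrm w + 1))" using t nrm_nonneg[OF w] by (intro mult_strict_left_mono) simp_all
	also have "... = min del' del''" unfolding t_def using n1 by simp
	finally have "nrm ?h < del'" "nrm ?h < del''" unfolding nh by simp_all
	hence "abs (L ?h - L' ?h) <= 2 * (eps * (t * nrm w))"
	 using del'(2)[rule_format, OF h] del''(2)[rule_format, OF h] unfolding nh by linarith
	moreover have "L ?h = t * L w" "L' ?h = t * L' w"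
	 using L L' w unfolding has_W12_derivative_def W12_dual_def by simp_all
	ultimately have "t * abs (L w - L' w) <= t * (2 * eps * nrm w)"
	 using t by (simp add: right_diff_distrib[symmetric] abs_mult mult_ac)
	hence "abs (L w - L' w) <= 2 * eps * nrm w" using t by simp
	also have "... <= 2 * eps * (nrm w + 1)" using eps by simp
	also have "... = e"
	proof -
	 have "2 * (e / (2 * p)) * p = e" if "0 < p" for p using that by simp
	 thus ?thesis unfolding eps_def using n1 by (simp only:)
	qed
	finally show ?thesis .
 qed
 hence "abs (L w - L' w) <= 0" by (intro field_le_epsilon[of _ 0]) simp
 thus ?thesis by simp
qed

text \<open>The chosen derivative agrees with \<open>lin v\<close> on the whole space, and the dual norm is the supremum over a set that is bounded above.\<close>

theorem derivative_bound:
 assumes v: "v : V" and w: "w : V"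
 shows "abs (lin v w) <= dual_norm per1 per2 N (W12_derivative per1 per2 N E v) * nrm w"
	and "0 <= dual_norm per1 per2 N (W12_derivative per1 per2 N E v)"
proof -
 define L where "L = W12_derivative per1 per2 N E v"
 have hd: "has_W12_derivative per1 per2 N E L v"
	unfolding L_def W12_derivative_def by (rule someI[of "%L. has_W12_derivative per1 per2 N E L v", OF energy_has_derivative[OF v]])
 have Leq: "L w = lin v w" if "w : V" for w by (rule derivative_unique[OF hd energy_has_derivative[OF v] that])
 obtain C where C: "ALL w:V. abs (lin v w) <= C * nrm w" using lin_bounded[OF v] by (elim exE)
 let ?S = "{abs (L w) | w. w : V & nrm w <= 1}"
 have bdd: "bdd_above ?S"
 proof (rule bdd_aboveI[of _ "abs C"])
	fix y assume "y : ?S"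
	then obtain w where w: "y = abs (L w)" "w : V" "nrm w <= 1" by blast
	have "y <= C * nrm w" unfolding w(1) Leq[OF w(2)] by (rule C[rule_format, OF w(2)])
	also have "... <= abs C * 1" using nrm_nonneg[OF w(2)] w(3) by (intro mult_mono) simp_all
	finally show "y <= abs C" by simp
 qed
 have up: "abs (L w) <= dual_norm per1 per2 N L" if "w : V" "nrm w <= 1" for w
	unfolding dual_norm_def by (rule cSup_upper[OF _ bdd]) (use that in blast)
 have z0: "nrm (%i x. 0 * w i x) <= 1" unfolding nrm_scale[OF w] by simp
 show "0 <= dual_norm per1 per2 N (W12_derivative per1 per2 N E v)"
	using order_trans[OF abs_ge_zero up[OF V_cmult[OF w] z0]] unfolding L_def .
 have "abs (L w) <= dual_norm per1 per2 N L * nrm w"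
 proof (cases "nrm w = 0")
	case True
	have "abs (L w) <= C * nrm w" unfolding Leq[OF w] by (rule C[rule_format, OF w])
	thus ?thesis using True by simp
 next
	case False
	hence p: "0 < nrm w" using nrm_nonneg[OF w] by simp
	let ?w = "%i x. 1 / nrm w * w i x"
	have n1: "nrm ?w <= 1" unfolding nrm_scale[OF w] using p by simp
	have "L ?w = 1 / nrm w * L w" unfolding Leq[OF V_cmult[OF w]] Leq[OF w] using lin_lincomb[OF v w w, of "1 / nrm w" 0] by simp
	hence "abs (L w) / nrm w <= dual_norm per1 per2 N L" using up[OF V_cmult[OF w] n1] p by (simp add: abs_mult)
	thus ?thesis using p by (simp add: pos_divide_le_eq)
 qed
 thus "abs (lin v w) <= dual_norm per1 per2 N (W12_derivative per1 per2 N E v) * nrm w"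
	unfolding Leq[OF w] by (simp only: L_def)
qed


section \<open>First estimates for almost critical points\<close>

definition zsq :: "(nat => real^2 => real) => real^2 => real" where
 "zsq v x = (SUM j=1..N. (z v j x)^2)"

definition pos :: "(nat => real^2 => real) => real^2 => real" where
 "pos v x = (SUM j=1..N. max 0 (v j x))"

text \<open>Almost critical points, with the accuracy as a parameter.\<close>

definition crit :: "real => (nat => real^2 => real) => bool" where
 "crit eps v \<longleftrightarrow> v : V & 0 <= eps & eps <= 1 & (ALL w:V. abs (lin v w) <= eps * nrm w)"

lemma critD:
 assumes "crit eps v"
 shows "v : V" "0 <= eps" "eps <= 1" "w : V ==> abs (lin v w) <= eps * nrm w"
 using assms by (simp_all add: crit_def)

lemma z_sq_integrable:
 assumes v: "v : V" and j: "j : {1..N}"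
 shows "Integ (%x. (z v j x)^2)"
proof (rule growth_integrable[OF _ v, of _ 2 "Z0^2"])
 show "(%x. (z v j x)^2) : Meas" using z_measurable[OF v j] by simp
 show "AE x in M. abs ((z v j x)^2) <= Z0^2 * exp (2 * size v x)" using u0_all
 proof eventually_elim
	fix x assume x: "ALL j:{1..N}. u0 j x <= C0"
	from power_mono[OF z_le_size[OF x j, of v], of 2] show "abs ((z v j x)^2) <= Z0^2 * exp (2 * size v x)"
	 using z_pos[OF j, of v x] by (simp add: power_mult_distrib exp_double[symmetric])
 qed
qed simp

lemma zsq_integrable: "v : V ==> Integ (zsq v)"
 unfolding zsq_def[abs_def] by (intro sum_integrable z_sq_integrable)

lemma zsq_nonneg: "0 <= zsq v x"
 unfolding zsq_def by (rule sum_nonneg) simp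

lemma z_sq_le_zsq: "j : {1..N} ==> (z v j x)^2 <= zsq v x"
 unfolding zsq_def by (intro member_le_sum[of j "{1..N}" "%j. (z v j x)^2"]) simp_all

lemma pos_part_integrable: "v : V ==> Integ (pos v)"
 unfolding pos_def[abs_def]
 by (intro sum_integrable integrable_max) (simp_all add: L2D(5)[OF V_L2(1)])

lemma pos_part_nonneg: "0 <= pos v x"
 unfolding pos_def by (rule sum_nonneg) simp

lemma le_pos_part: "j : {1..N} ==> v j x <= pos v x" "j : {1..N} ==> max 0 (v j x) <= pos v x"
proof -
 show 1: "max 0 (v j x) <= pos v x" if "j : {1..N}"
	unfolding pos_def using that by (intro member_le_sum[of j "{1..N}" "%j. max 0 (v j x)"]) simp_all
 show "v j x <= pos v x" if "j : {1..N}" using 1[OF that] by linarith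
qed

lemma sum_force: "(SUM j=1..N. force v j x) = kform N (%j. z v j x) - (SUM j=1..N. z v j x)"
 unfolding force_def kform_def right_diff_distrib sum_subtractf by (simp add: sum_distrib_left mult.assoc)

lemma dirichlet_form_const: "v : V ==> dform v (%j x. c) = 0"
proof -
 assume v: "v : V"
 have c: "(%j x. c) : V" by (rule V_I[OF W_const(1)])
 have "(\<oint>x. aform N (%i. wp k (v i) x) (%i. wp k (%x. c) x)) = (\<oint>x. 0)" for k
 proof (rule integral_cong_AE)
	show "(%x. aform N (%i. wp k (v i) x) (%i. wp k (%x. c) x)) : Meas"
	 by (rule borel_measurable_integrable[OF aform_integrable[OF v c]])
	show "AE x in M. aform N (%i. wp k (v i) x) (%i. wp k (%x. c) x) = 0"
	 using W_const(2)[where c = c and k = k] by eventually_elim (simp add: aform_def)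
 qed simp
 thus ?thesis unfolding dform_def by simp
qed

lemma young: "0 < k ==> y <= k / 2 * y^2 + 1 / (2 * k)" for y k :: real
proof -
 assume k: "0 < k"
 have "0 <= (k * y - 1)^2 / (2 * k)" using k by simp
 also have "(k * y - 1)^2 / (2 * k) = k / 2 * y^2 + 1 / (2 * k) - y"
	using k by (simp add: field_simps power2_eq_square)
 finally show ?thesis by linarith
qed

lemma mass_bound: "EX C>=0. ALL eps v. crit eps v --> (\<oint>x. zsq v x) <= C"
proof -
 define one where "one = (%(j::nat) (x::real^2). 1::real)"
 have oV: "one : V" unfolding one_def by (rule V_I[OF W_const(1)])
 let ?k = "kappa N"
 have k: "0 < ?k" by (rule kappa_pos[OF N])
 define C where "C = 2 / ?k * (nrm one / l + area * (real N / (2 * ?k)))"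
 have C0: "0 <= C" unfolding C_def using k l area_pos nrm_nonneg[OF oV] by simp
 have "(\<oint>x. zsq v x) <= C" if cr: "crit eps v" for eps v
 proof -
	note v = critD(1)[OF cr]
	have bp: "0 <= (\<oint>x. (SUM j=1..N. b j * one j x))"
	 unfolding one_def using b_pos[OF n] by (intro integral_nonneg_AE AE_I2 sum_nonneg) (simp add: less_imp_le)
	have "lin v one <= nrm one"
	 using critD(4)[OF cr oV] mult_right_mono[OF critD(3)[OF cr] nrm_nonneg[OF oV]] by linarith
	moreover have "dform v one = 0" unfolding one_def by (rule dirichlet_form_const[OF v])
	moreover have "0 <= 1 / area * (\<oint>x. (SUM j=1..N. b j * one j x))" using bp area_pos by simp
	ultimately have "l * (\<oint>x. (SUM j=1..N. force v j x * one j x)) <= nrm one" unfolding lin_def by linarith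
	hence f1: "(\<oint>x. (SUM j=1..N. force v j x * one j x)) <= nrm one / l" using l by (simp add: field_simps)
	have pt: "?k / 2 * zsq v x - real N / (2 * ?k) <= (SUM j=1..N. force v j x * one j x)" for x
	proof -
	 have "(SUM j=1..N. z v j x) <= (SUM j=1..N. ?k / 2 * (z v j x)^2 + 1 / (2 * ?k))" by (intro sum_mono young k)
	 also have "... = ?k / 2 * zsq v x + real N / (2 * ?k)" unfolding zsq_def by (simp add: sum.distrib sum_distrib_left)
	 finally have "(SUM j=1..N. z v j x) <= ?k / 2 * zsq v x + real N / (2 * ?k)" .
	 moreover have "?k * zsq v x <= kform N (%j. z v j x)" unfolding zsq_def by (rule kform_coercive)
	 ultimately show ?thesis using sum_force[of v x] unfolding one_def by simp
	qed
	have "?k / 2 * (\<oint>x. zsq v x) - area * (real N / (2 * ?k)) = (\<oint>x. ?k / 2 * zsq v x - real N / (2 * ?k))"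
	 using zsq_integrable[OF v] by (simp add: area_def)
	also have "... <= (\<oint>x. (SUM j=1..N. force v j x * one j x))"
	 by (intro integral_mono pt force_int(2)[OF v oV] diff_integrable integrable_mult_right zsq_integrable[OF v]) simp
	finally have "?k / 2 * (\<oint>x. zsq v x) <= nrm one / l + area * (real N / (2 * ?k))" using f1 by linarith
	hence "2 / ?k * (?k / 2 * (\<oint>x. zsq v x)) <= C" unfolding C_def using k by (intro mult_left_mono) simp_all
	thus ?thesis using k by simp
 qed
 thus ?thesis using C0 by (intro exI[of _ C] conjI allI impI)
qed

lemma pos_part_bound: "EX C>=0. ALL eps v. crit eps v --> (\<oint>x. pos v x) <= C"
proof -
 obtain C1 where C1: "0 <= C1" "ALL eps v. crit eps v --> (\<oint>x. zsq v x) <= C1" using mass_bound by (elim exE conjE)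
 define C where "C = (SUM j=1..N. 1 / r j * (area + C1) + (\<oint>x. abs (u0 j x)))"
 have C0: "0 <= C" unfolding C_def using C1(1) area_pos r_pos
	by (intro sum_nonneg add_nonneg_nonneg mult_nonneg_nonneg integral_nonneg_AE) (simp_all add: less_imp_le)
 have "(\<oint>x. pos v x) <= C" if cr: "crit eps v" for eps v
 proof -
	note v = critD(1)[OF cr]
	let ?f = "%j x. 1 / r j * (1 + zsq v x) + abs (u0 j x)"
	have fi: "Integ (?f j)" if "j : {1..N}" for j
	 by (intro add_integrable integrable_mult_right integrable_abs zsq_integrable[OF v] u0_int that) simp
	have pt: "max 0 (v j x) <= ?f j x" if j: "j : {1..N}" for j x
	proof -
	 have "v j x <= exp (u0 j x + v j x) + abs (u0 j x)" using exp_ge_add_one_self[of "u0 j x + v j x"] by linarith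
	 moreover have "exp (u0 j x + v j x) = 1 / r j * z v j x" unfolding z_def using r_pos[OF j] by simp
	 moreover have "1 / r j * z v j x <= 1 / r j * (1 + zsq v x)"
	 proof (rule mult_left_mono)
		have "z v j x <= 1 + (z v j x)^2" using young[of 2 "z v j x"] by simp
		thus "z v j x <= 1 + zsq v x" using z_sq_le_zsq[OF j, of v x] by linarith
	 qed (use r_pos[OF j] in simp)
	 moreover have "0 <= 1 / r j * (1 + zsq v x)" using r_pos[OF j] zsq_nonneg[of v x] by simp
	 ultimately show ?thesis by linarith
	qed
	have "(\<oint>x. pos v x) <= (\<oint>x. (SUM j=1..N. ?f j x))"
	 by (rule integral_mono[OF pos_part_integrable[OF v] sum_integrable[OF fi]])
		(assumption, unfold pos_def, rule sum_mono, rule pt)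
	also have "... = (SUM j=1..N. \<integral>x. ?f j x \<partial>M)" by (rule sum_integral[OF fi])
	also have "... <= C" unfolding C_def
	proof (rule sum_mono)
	 fix j assume j: "j : {1..N}"
	 have "(\<oint>x. ?f j x) = 1 / r j * (area + (\<oint>x. zsq v x)) + (\<oint>x. abs (u0 j x))"
		using zsq_integrable[OF v] u0_int[OF j] by (simp add: area_def)
	 also have "... <= 1 / r j * (area + C1) + (\<oint>x. abs (u0 j x))"
		using C1(2)[rule_format, OF cr] r_pos[OF j] by (intro add_right_mono mult_left_mono) simp_all
	 finally show "(\<oint>x. ?f j x) <= 1 / r j * (area + C1) + (\<oint>x. abs (u0 j x))" .
	qed
	finally show ?thesis .
 qed
 thus ?thesis using C0 by (intro exI[of _ C] conjI allI impI)
qed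

lemma energy_balance: "EX C>=0. ALL eps v. crit eps v --> abs (E v) <= a -->
 abs (dform v v + 2 / area * (\<oint>x. (SUM j=1..N. b j * v j x))) <= C"
proof -
 obtain C1 where C1: "0 <= C1" "ALL eps v. crit eps v --> (\<oint>x. zsq v x) <= C1" using mass_bound by (elim exE conjE)
 let ?R = "SUM j=1..N. (r j)^2"
 define C where "C = abs (2 * a) + l * (8 * C1 + 8 * ?R * area)"
 have R0: "0 <= ?R" by (rule sum_nonneg) simp
 have C0: "0 <= C" unfolding C_def using C1 l area_pos R0 by simp
 have "abs (dform v v + 2 / area * (\<oint>x. (SUM j=1..N. b j * v j x))) <= C" if cr: "crit eps v" and e: "abs (E v) <= a" for eps v
 proof -
	note v = critD(1)[OF cr]
	let ?K = "\<integral>x. kform N (%j. z v j x - r j) \<partial>M"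
	have K0: "0 <= ?K" by (intro integral_nonneg_AE AE_I2 kform_nonneg N)
	have pt: "kform N (%j. z v j x - r j) <= 8 * zsq v x + 8 * ?R" for x
	proof -
	 have sq: "(y - s)^2 <= 2 * y^2 + 2 * s^2" for y s :: real
		using zero_le_power2[of "y + s"] by (simp add: power2_eq_square algebra_simps)
	 have "kform N (%j. z v j x - r j) <= 4 * (SUM j=1..N. (z v j x - r j)^2)" by (rule kform_le)
	 also have "... <= 4 * (SUM j=1..N. 2 * (z v j x)^2 + 2 * (r j)^2)" by (intro mult_left_mono sum_mono sq) simp
	 also have "... = 8 * zsq v x + 8 * ?R" unfolding zsq_def by (simp add: sum.distrib sum_distrib_left)
	 finally show ?thesis .
	qed
	have "?K <= (\<oint>x. 8 * zsq v x + 8 * ?R)"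
	 by (intro integral_mono pt kform_shift_integrable[OF v] add_integrable integrable_mult_right zsq_integrable[OF v]) simp
	also have "... = 8 * (\<oint>x. zsq v x) + 8 * ?R * area" using zsq_integrable[OF v] by (simp add: area_def)
	also have "... <= 8 * C1 + 8 * ?R * area" using C1(2)[rule_format, OF cr] by simp
	finally have K1: "l * ?K <= l * (8 * C1 + 8 * ?R * area)" using l by (intro mult_left_mono) simp_all
	have lK: "0 <= l * ?K" using l K0 by simp
	have "dform v v + 2 * (1 / area * (\<oint>x. (SUM j=1..N. b j * v j x))) = 2 * E v - l * ?K"
	 unfolding energy_eq distrib_left by simp
	thus ?thesis unfolding C_def using K1 lK e by simp
 qed
 thus ?thesis using C0 by (intro exI[of _ C] conjI allI impI)
qed

lemma dirichlet_form_coercive: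
 assumes v: "v : V"
 shows "kappa N / 16 * (SUM j=1..N. dir (v j)) <= dform v v" "0 <= dform v v"
	"j : {1..N} ==> dir (v j) <= 16 / kappa N * dform v v"
proof -
 let ?k = "kappa N"
 have k: "0 < ?k" by (rule kappa_pos[OF N])
 have i: "Integ (%x. (wp k (v j) x)^2)" if "j : {1..N}" for j k by (rule L2D(4)[OF V_L2(2)[OF v that]])
 have "(SUM j=1..N. dir (v j)) = (SUM k:UNIV. SUM j=1..N. \<integral>x. (wp k (v j) x)^2 \<partial>M)"
	unfolding dir_def by (rule sum.swap)
 hence "?k / 16 * (SUM j=1..N. dir (v j)) = (SUM k:UNIV. ?k / 16 * (SUM j=1..N. \<integral>x. (wp k (v j) x)^2 \<partial>M))"
	by (simp only: sum_distrib_left)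
 also have "... <= dform v v"
	unfolding dform_def
 proof (rule sum_mono)
	fix k
	have "?k / 16 * (SUM j=1..N. \<integral>x. (wp k (v j) x)^2 \<partial>M) = (\<oint>x. ?k / 16 * (SUM j=1..N. (wp k (v j) x)^2))"
	 unfolding integral_mult_right_zero by (subst sum_integral) (simp_all only: i)
	also have "... <= (\<oint>x. aform N (%i. wp k (v i) x) (%i. wp k (v i) x))"
	 by (intro integral_mono aform_coercive[OF N] aform_integrable v integrable_mult_right sum_integrable i)
	finally show "?k / 16 * (SUM j=1..N. \<integral>x. (wp k (v j) x)^2 \<partial>M) <= (\<oint>x. aform N (%i. wp k (v i) x) (%i. wp k (v i) x))" .
 qed
 finally show 1: "?k / 16 * (SUM j=1..N. dir (v j)) <= dform v v" .
 have "0 <= ?k / 16 * (SUM j=1..N. dir (v j))" using k by (intro mult_nonneg_nonneg sum_nonneg dirichlet_nonneg) simp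
 thus "0 <= dform v v" using 1 by linarith
 show "dir (v j) <= 16 / ?k * dform v v" if j: "j : {1..N}"
 proof -
	have "dir (v j) <= (SUM j=1..N. dir (v j))"
	 using j by (intro member_le_sum[of j "{1..N}" "%j. dir (v j)"] dirichlet_nonneg) simp_all
	hence "?k / 16 * dir (v j) <= dform v v" using 1 k by (intro order_trans[OF mult_left_mono 1]) simp_all
	hence "16 / ?k * (?k / 16 * dir (v j)) <= 16 / ?k * dform v v" using k by (intro mult_left_mono) simp_all
	thus ?thesis using k by simp
 qed
qed

text \<open>The negative part of \<open>b\<cdot>v\<close> is known from the balance of energies, since all \<open>b\<^sub>j\<close> are positive.\<close>

lemma L1_growth: "EX C>=0. ALL eps v. crit eps v --> abs (E v) <= a --> (ALL j:{1..N}. (\<oint>x. abs (v j x)) <= C * (1 + dform v v))"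
proof -
 obtain C1 where C1: "0 <= C1" "ALL eps v. crit eps v --> (\<oint>x. pos v x) <= C1" using pos_part_bound by (elim exE conjE)
 obtain C2 where C2: "0 <= C2" "ALL eps v. crit eps v --> abs (E v) <= a -->
	abs (dform v v + 2 / area * (\<oint>x. (SUM j=1..N. b j * v j x))) <= C2" using energy_balance[of a] by (elim exE conjE)
 have bp: "0 < b j" if "j : {1..N}" for j by (rule b_pos[OF n that])
 define B where "B = (SUM j=1..N. b j)"
 have bB: "b j <= B" if "j : {1..N}" for j
	unfolding B_def using that bp by (intro member_le_sum[of j "{1..N}" b]) (simp_all add: less_imp_le)
 have B0: "0 <= B" unfolding B_def using bp by (intro sum_nonneg) (simp add: less_imp_le)
 define I where "I = (SUM j=1..N. 1 / b j)"
 define H where "H = 2 * B * C1 + area / 2 * C2 + area / 2"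
 have H0: "0 <= H" unfolding H_def using B0 C1(1) C2(1) area_pos by simp
 have I0: "0 <= I" unfolding I_def using bp by (intro sum_nonneg) (simp add: less_imp_le)
 have "(\<oint>x. abs (v j x)) <= I * H * (1 + dform v v)" if cr: "crit eps v" and e: "abs (E v) <= a" and j: "j : {1..N}" for eps v j
 proof -
	note v = critD(1)[OF cr]
	let ?D = "dform v v"
	have D0: "0 <= ?D" by (rule dirichlet_form_coercive(2)[OF v])
	have vi: "Integ (v j)" if "j : {1..N}" for j by (rule L2D(5)[OF V_L2(1)[OF v that]])
	let ?L = "\<integral>x. (SUM j=1..N. b j * v j x) \<partial>M"
	note Li = force_int(3)[OF v v]
	have pt: "b j * abs (v j x) <= 2 * B * pos v x - (SUM j=1..N. b j * v j x)" for x
	proof -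
	 have "b j * abs (v j x) <= (SUM j=1..N. b j * abs (v j x))"
		using j bp by (intro member_le_sum[of j "{1..N}" "%j. b j * abs (v j x)"]) (simp_all add: less_imp_le)
	 also have "... <= (SUM j=1..N. 2 * B * max 0 (v j x) - b j * v j x)"
	 proof (rule sum_mono)
		fix i assume i: "i : {1..N}"
		have "b i * max 0 (v i x) <= B * max 0 (v i x)" by (rule mult_right_mono[OF bB[OF i]]) simp
		moreover have "b i * abs (v i x) = 2 * (b i * max 0 (v i x)) - b i * v i x" by (simp add: max_def)
		ultimately show "b i * abs (v i x) <= 2 * B * max 0 (v i x) - b i * v i x" by linarith
	 qed
	 finally show ?thesis unfolding pos_def sum_subtractf sum_distrib_left .
	qed
	have "b j * (\<oint>x. abs (v j x)) = (\<oint>x. b j * abs (v j x))" by simp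
	also have "... <= (\<oint>x. 2 * B * pos v x - (SUM j=1..N. b j * v j x))"
	 by (intro integral_mono pt integrable_mult_right integrable_abs vi j diff_integrable pos_part_integrable[OF v] Li)
	also have "... = 2 * B * (\<oint>x. pos v x) - ?L" using pos_part_integrable[OF v] Li by simp
	also have "... <= 2 * B * C1 + area / 2 * (?D + C2)"
	proof -
	 have "- (2 / area * ?L) <= ?D + C2" using C2(2)[rule_format, OF cr e] by linarith
	 hence "area / 2 * (- (2 / area * ?L)) <= area / 2 * (?D + C2)" using area_pos by (intro mult_left_mono) simp_all
	 hence "- ?L <= area / 2 * (?D + C2)" using area_pos by simp
	 moreover have "2 * B * (\<oint>x. pos v x) <= 2 * B * C1" using C1(2)[rule_format, OF cr] B0 by (intro mult_left_mono) simp_all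
	 ultimately show ?thesis by linarith
	qed
	also have "... <= H * (1 + ?D)"
	proof -
	 have "0 <= (2 * B * C1 + area / 2 * C2) * ?D" using B0 C1(1) C2(1) area_pos D0 by simp
	 moreover have "H * (1 + ?D) = H + (2 * B * C1 + area / 2 * C2) * ?D + area / 2 * ?D"
		by (simp add: H_def algebra_simps)
	 moreover have "area / 2 * (?D + C2) = area / 2 * ?D + area / 2 * C2" by (rule distrib_left)
	 ultimately show ?thesis using area_pos unfolding H_def by linarith
	qed
	finally have "1 / b j * (b j * (\<oint>x. abs (v j x))) <= 1 / b j * (H * (1 + ?D))"
	 using bp[OF j] by (intro mult_left_mono) simp_all
	also have "... <= I * (H * (1 + ?D))"
	proof (rule mult_right_mono)
	 show "1 / b j <= I" unfolding I_def using j bp by (intro member_le_sum[of j "{1..N}" "%j. 1 / b j"]) (simp_all add: less_imp_le)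
	qed (use H0 D0 in simp)
	finally show ?thesis using bp[OF j] by (simp add: mult.assoc)
 qed
 thus ?thesis using I0 H0 by (intro exI[of _ "I * H"] conjI allI impI ballI mult_nonneg_nonneg)
qed

lemma nrm_growth: "EX C>=0. ALL eps v. crit eps v --> abs (E v) <= a --> nrm v <= C * (1 + dform v v)"
proof -
 obtain C1 where C1: "0 <= C1" "ALL eps v. crit eps v --> abs (E v) <= a --> (ALL j:{1..N}. (\<oint>x. abs (v j x)) <= C1 * (1 + dform v v))"
	using L1_growth[of a] by (elim exE conjE)
 let ?k = "kappa N"
 have k: "0 < ?k" by (rule kappa_pos[OF N])
 have pc: "0 <= poincare_const" unfolding poincare_const_def by simp
 define c where "c = 2 * C1^2 / area + (2 * poincare_const + 1) * (16 / ?k)"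
 have c0: "0 <= c" unfolding c_def using area_pos pc k by simp
 have "nrm v <= sqrt (real N * c) * (1 + dform v v)" if cr: "crit eps v" and e: "abs (E v) <= a" for eps v
 proof -
	note v = critD(1)[OF cr]
	let ?D = "dform v v"
	have D0: "0 <= ?D" by (rule dirichlet_form_coercive(2)[OF v])
	have "(\<oint>x. (v j x)^2) + dir (v j) <= c * (1 + ?D)^2" if j: "j : {1..N}" for j
	proof -
	 have "abs (\<integral>x. v j x \<partial>M) <= (\<oint>x. abs (v j x))" by (rule integral_abs_bound)
	 also have "... <= C1 * (1 + ?D)" by (rule C1(2)[rule_format, OF cr e j])
	 finally have m: "abs (\<integral>x. v j x \<partial>M)^2 <= (C1 * (1 + ?D))^2" by (intro power_mono) simp_all
	 have "(\<oint>x. (v j x)^2) <= 2 * (\<oint>x. (mean (v j))^2) + 2 * (\<oint>x. (v j x - mean (v j))^2)"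
		by (rule integral_sq_le_double[OF V_L2(1)[OF v j] W_L2[OF W_const(1)]])
	 also have "... <= 2 * C1^2 / area * (1 + ?D)^2 + 2 * poincare_const * dir (v j)"
	 proof -
		have "(\<oint>x. (mean (v j))^2) = area * (mean (v j))^2" by (simp add: area_def)
		also have "... = abs (\<integral>x. v j x \<partial>M)^2 / area" unfolding mean_def using area_pos by (simp add: power_divide power2_eq_square)
		also have "... <= (C1 * (1 + ?D))^2 / area" using m area_pos by (intro divide_right_mono) simp_all
		finally have "2 * (\<oint>x. (mean (v j))^2) <= 2 * C1^2 / area * (1 + ?D)^2" by (simp add: power_mult_distrib)
		moreover have "(\<oint>x. (v j x - mean (v j))^2) <= poincare_const * dir (v j)" by (rule poincare[OF V_W[OF v j]])
		ultimately show ?thesis by linarith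
	 qed
	 finally have 1: "(\<oint>x. (v j x)^2) + dir (v j) <= 2 * C1^2 / area * (1 + ?D)^2 + (2 * poincare_const + 1) * dir (v j)"
		unfolding distrib_right by linarith
	 have "dir (v j) <= 16 / ?k * ?D" by (rule dirichlet_form_coercive(3)[OF v j])
	 also have "... <= 16 / ?k * (1 + ?D)^2"
	 proof (rule mult_left_mono)
		have "1 * ?D <= (1 + ?D) * (1 + ?D)" using D0 by (intro mult_mono) simp_all
		thus "?D <= (1 + ?D)^2" by (simp add: power2_eq_square)
	 qed (use k in simp)
	 finally have "(2 * poincare_const + 1) * dir (v j) <= (2 * poincare_const + 1) * (16 / ?k * (1 + ?D)^2)"
		using pc by (intro mult_left_mono) simp_all
	 thus ?thesis using 1 unfolding c_def distrib_right[of _ _ "(1 + ?D)^2"] unfolding mult.assoc by linarith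
	qed
	hence "(nrm v)^2 <= (SUM j=1..N. c * (1 + ?D)^2)" unfolding nrm_sq[OF v] by (rule sum_mono)
	also have "... = (sqrt (real N * c) * (1 + ?D))^2" using c0 by (simp add: power_mult_distrib)
	finally show ?thesis by (rule power2_le_imp_le) (use D0 c0 in simp)
 qed
 thus ?thesis using c0 by (intro exI[of _ "sqrt (real N * c)"] conjI allI impI) simp_all
qed

end

section \<open>Uniform integrability\<close>

text \<open>A variance for weights of total mass at most one: the missing mass sits at the value 0.\<close>

lemma weighted_variance:
 fixes p G :: "'i => real"
 assumes p: "!!t. t : S ==> 0 <= p t" "!!t. t : S ==> p t <= 1" and P: "(SUM t:S. p t) <= 1"
 shows "(SUM t:S. (p t * (G t - (SUM s:S. p s * G s)))^2) <= (SUM t:S. p t * (G t - (SUM s:S. p s * G s)) * G t)"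
proof -
 define m where "m = (SUM s:S. p s * G s)"
 have "(SUM t:S. (p t * (G t - m))^2) <= (SUM t:S. p t * (G t - m)^2)"
 proof (rule sum_mono)
	fix t assume t: "t : S"
	have "p t * p t * (G t - m)^2 <= p t * (G t - m)^2"
	 using p[OF t] by (intro mult_right_mono mult_left_le) simp_all
	thus "(p t * (G t - m))^2 <= p t * (G t - m)^2" by (simp only: power_mult_distrib power2_eq_square[of "p t"])
 qed
 also have "... <= (SUM t:S. p t * (G t - m)^2) + m^2 * (1 - (SUM t:S. p t))" using P by simp
 also have "... = (SUM t:S. p t * (G t - m)^2) + m * (SUM t:S. p t * (G t - m))"
 proof -
	have "(SUM t:S. p t * (G t - m)) = (SUM t:S. p t * G t) - (SUM t:S. p t) * m"
	 by (simp only: right_diff_distrib sum_subtractf sum_distrib_right)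
	hence e: "(SUM t:S. p t * (G t - m)) = m - (SUM t:S. p t) * m" by (simp only: m_def[symmetric])
	show ?thesis unfolding e by (simp add: power2_eq_square right_diff_distrib)
 qed
 also have "... = (SUM t:S. p t * (G t - m) * G t)"
	unfolding sum_distrib_left sum.distrib[symmetric]
	by (intro sum.cong refl) (simp add: power2_eq_square algebra_simps)
 finally show ?thesis unfolding m_def .
qed

lemma cartan_square_sum: "(SUM i=1..N. (SUM k=1..N. cartan i k * y k)^2) <= 16 * (SUM i=1..N. (y i)^2)"
proof -
 have "(SUM i=1..N. (SUM k=1..N. cartan i k * y k)^2) <= (SUM i=1..N. 4 * (SUM k=1..N. abs (cartan i k) * (y k)^2))"
	by (intro sum_mono cartan_square_bound)
 also have "... = 4 * (SUM i=1..N. SUM k=1..N. abs (cartan i k) * (y k)^2)" by (simp add: sum_distrib_left)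
 also have "... <= 4 * (SUM i=1..N. 4 * (y i)^2)" by (intro mult_left_mono cartan_abs_sum) simp_all
 finally show ?thesis by (simp add: sum_distrib_left)
qed

definition theta :: "nat => (nat => real) => nat => real" where
 "theta N t j = (SUM k=1..N. cartan j k * t k)"

text \<open>The lattice points \<open>t \<ge> 0\<close> of mesh \<open>1/q\<close> with \<open>K t \<le> 1\<close>; nonnegativity of the inverse matrix bounds them by \<open>r\<close>.\<close>

definition weights :: "nat => nat => (nat => real) set" where
 "weights N q = {t. (ALL i. i ~: {1..N} --> t i = 0) & (ALL i:{1..N}. EX m::nat. t i = real m / real q) & (ALL j:{1..N}. theta N t j <= 1)}"

lemma weightsD:
 assumes "t : weights N q"
 shows "i ~: {1..N} ==> t i = 0" "i : {1..N} ==> EX m::nat. t i = real m / real q" "j : {1..N} ==> theta N t j <= 1"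
	"i : {1..N} ==> 0 <= t i"
proof -
 show 2: "EX m::nat. t i = real m / real q" if "i : {1..N}" for i using assms that unfolding weights_def by simp
 show "i ~: {1..N} ==> t i = 0" "j : {1..N} ==> theta N t j <= 1" using assms unfolding weights_def by simp_all
 show "i : {1..N} ==> 0 <= t i" 
 proof -
	assume "i : {1..N}"
	from 2[OF this] obtain m :: nat where "t i = real m / real q" by (elim exE)
	thus "0 <= t i" by simp
 qed
qed

lemma weights_le_r:
 assumes t: "t : weights N q" and i: "i : {1..N}"
 shows "t i <= r_vec N i"
proof -
 have "(SUM j=1..N. A_mat N i j * theta N t j) = (SUM j=1..N. SUM k=1..N. A_mat N i j * cartan j k * t k)"
	unfolding theta_def by (simp add: sum_distrib_left mult.assoc)
 also have "... = (SUM k=1..N. (SUM j=1..N. A_mat N i j * cartan j k) * t k)"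
	by (subst sum.swap) (simp add: sum_distrib_right)
 also have "... = (SUM k=1..N. (if i = k then 1 else 0) * t k)" using i by (intro sum.cong refl) (simp only: K_A(2))
 also have "... = t i" by (rule sum_delta_mult(1)[OF i])
 finally have "t i = (SUM j=1..N. A_mat N i j * theta N t j)" ..
 also have "... <= (SUM j=1..N. A_mat N i j)" by (intro sum_mono mult_left_le weightsD(3)[OF t] A_nonneg)
 finally show ?thesis by (simp add: r_vec_def)
qed

lemma finite_weights: assumes q: "q >= 1" shows "finite (weights N q)"
proof -
 obtain m0 :: nat where m0: "real q * (SUM i=1..N. r_vec N i) <= real m0" using real_arch_simple[of "real q * (SUM i=1..N. r_vec N i)"] by (elim exE)
 have "weights N q \<subseteq> {f. ALL x. (x : {1..N} --> f x : (%m. real m / real q) ` {..m0}) & (x ~: {1..N} --> f x = 0)}"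
 proof (intro subsetI CollectI allI conjI impI)
	fix t i assume t: "t : weights N q"
	show "t i = 0" if "i ~: {1..N}" by (rule weightsD(1)[OF t that])
	assume i: "i : {1..N}"
	obtain m where m: "t i = real m / real q" using weightsD(2)[OF t i] by (elim exE)
	have "r_vec N i <= (SUM i=1..N. r_vec N i)" using i r_pos[of _ N] by (intro member_le_sum) (simp_all add: less_imp_le)
	hence "real q * t i <= real m0" using weights_le_r[OF t i] m0 q
	 by (intro order_trans[OF mult_left_mono m0]) simp_all
	hence "m <= m0" unfolding m using q by simp
	thus "t i : (%m. real m / real q) ` {..m0}" unfolding m by (intro imageI) simp
 qed
 thus ?thesis by (rule finite_subset) (intro finite_set_of_finite_funs finite_atLeastAtMost finite_imageI finite_atMost)
qed

definition step :: "nat => (nat => real) => nat => nat => real" where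
 "step q t j i = t i + (if i = j then 1 / real q else 0)"

lemma step_sum:
 assumes j: "j : {1..N}"
 shows "(SUM i=1..N. c i * step q t j i) = (SUM i=1..N. c i * t i) + c j / real q"
proof -
 have "(SUM i=1..N. c i * step q t j i) = (SUM i=1..N. c i * t i) + (SUM i=1..N. c i / real q * (if i = j then 1 else 0))"
	unfolding step_def distrib_left sum.distrib by (intro arg_cong2[where f = "(+)"] refl sum.cong) simp
 thus ?thesis unfolding sum_delta_mult(2)[OF j] .
qed

lemma step_weights:
 assumes q: "q >= 1" and t: "t : weights N q" and j: "j : {1..N}" and room: "theta N t j <= 1 - 2 / real q"
 shows "step q t j : weights N q"
 unfolding weights_def
proof (intro CollectI conjI allI ballI impI)
 show "step q t j i = 0" if "i ~: {1..N}" for i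
 proof -
	have "i ~= j" using that j by (intro notI) simp
	thus ?thesis using weightsD(1)[OF t that] by (simp add: step_def)
 qed
 show "EX m::nat. step q t j i = real m / real q" if i: "i : {1..N}" for i
 proof -
	obtain m :: nat where m: "t i = real m / real q" using weightsD(2)[OF t i] by (elim exE)
	show ?thesis by (rule exI[of _ "if i = j then Suc m else m"]) (simp add: step_def m add_divide_distrib)
 qed
 fix i assume i: "i : {1..N}"
 have th: "theta N (step q t j) i = theta N t i + cartan i j / real q"
	unfolding theta_def by (rule step_sum[OF j])
 show "theta N (step q t j) i <= 1"
 proof (cases "i = j")
	case True
	thus ?thesis unfolding th using room by (simp add: cartan_def)
 next
	case False
	hence "cartan i j / real q <= 0" using q by (simp add: cartan_def)
	thus ?thesis unfolding th using weightsD(3)[OF t i] by linarith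
 qed
qed

lemma zero_weights: "(%i. 0) : weights N q"
 unfolding weights_def theta_def by (auto intro: exI[of _ 0])

text \<open>The defect \<open>1 - \<theta>\<^sub>j\<close> is below \<open>2/q\<close> or the component counts as bad; for large \<open>q\<close> the former is absorbed by coercivity.\<close>

lemma theta_pairing_lower:
 assumes q: "36 / kappa N <= real q" "q >= 1" and N: "N >= 1" and T: "!!j. j : {1..N} ==> abs (th j) <= T" "!!j. j : {1..N} ==> abs (1 - th j) <= T"
	and le: "!!j. j : {1..N} ==> th j <= 1"
 shows "kappa N / 2 * (SUM j=1..N. (y j)^2) - real q * T^2 / 4 * ((SUM j=1..N. if th j <= 1 - 2 / real q then (y j)^2 else 0) + real N)
	<= (SUM j=1..N. y j * ((SUM k=1..N. cartan j k * y k) - 1) * th j)"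
proof -
 define Y where "Y j = (SUM k=1..N. cartan j k * y k)" for j
 define bad where "bad j = (if th j <= 1 - 2 / real q then (y j)^2 else 0)" for j
 let ?s = "SUM j=1..N. (y j)^2"
 let ?c = "real q * T^2 / 4"
 have q0: "0 < real q" using q(2) by simp
 have am: "u * v <= u^2 / real q + real q * v^2 / 4" for u v :: real
 proof -
	have "0 <= (2 * u - real q * v)^2 / (4 * real q)" using q0 by simp
	also have "... = u^2 / real q + real q * v^2 / 4 - u * v" using q0 by (simp add: field_simps power2_eq_square)
	finally show ?thesis by linarith
 qed
 have c0: "0 <= ?c" using q0 by simp
 have one: "(1 - th j) * y j * Y j <= (y j)^2 / real q + (Y j)^2 / real q + ?c * bad j" if j: "j : {1..N}" for j
 proof (cases "th j <= 1 - 2 / real q")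
	case True
	have "(1 - th j) * y j * Y j = Y j * ((1 - th j) * y j)" by simp
	also have "... <= (Y j)^2 / real q + real q * ((1 - th j) * y j)^2 / 4" by (rule am)
	also have "real q * ((1 - th j) * y j)^2 / 4 <= ?c * (y j)^2"
	proof -
	 have "(1 - th j)^2 <= T^2" using power_mono[OF T(2)[OF j] abs_ge_zero, of 2] by simp
	 hence "real q / 4 * (y j)^2 * (1 - th j)^2 <= real q / 4 * (y j)^2 * T^2" using q0 by (intro mult_left_mono) simp_all
	 thus ?thesis by (simp add: power_mult_distrib mult_ac)
	qed
	finally have "(1 - th j) * y j * Y j <= (Y j)^2 / real q + ?c * (y j)^2" by simp
	moreover have "0 <= (y j)^2 / real q" by simp
	ultimately show ?thesis unfolding bad_def if_P[OF True] by linarith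
 next
	case False
	have d: "0 <= 1 - th j" "1 - th j <= 2 / real q" using False le[OF j] by simp_all
	have "(1 - th j) * y j * Y j <= (1 - th j) * (((y j)^2 + (Y j)^2) / 2)"
	 unfolding mult.assoc by (intro mult_left_mono mult_le_avg_squares d)
	also have "... <= 2 / real q * (((y j)^2 + (Y j)^2) / 2)" by (intro mult_right_mono d) simp
	also have "... = (y j)^2 / real q + (Y j)^2 / real q" by (simp add: add_divide_distrib)
	finally show ?thesis unfolding bad_def using False by simp
 qed
 have two: "th j * y j <= (y j)^2 / real q + ?c" if j: "j : {1..N}" for j
 proof -
	have "th j * y j <= abs (y j) * T"
	 using mult_left_mono[OF T(1)[OF j] abs_ge_zero[of "y j"]] abs_ge_self[of "th j * y j"] by (simp add: abs_mult mult.commute)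
	also have "... <= abs (y j)^2 / real q + real q * T^2 / 4" by (rule am)
	finally show ?thesis by simp
 qed
 have "kform N y = (SUM j=1..N. y j * Y j)" unfolding kform_def Y_def by (simp add: sum_distrib_left mult.assoc)
 hence eq: "(SUM j=1..N. y j * (Y j - 1) * th j) = kform N y - (SUM j=1..N. (1 - th j) * y j * Y j) - (SUM j=1..N. th j * y j)"
	by (simp only: sum_subtractf[symmetric]) (intro sum.cong refl, simp add: algebra_simps)
 have s1: "(SUM j=1..N. (1 - th j) * y j * Y j) <= ?s / real q + (SUM j=1..N. (Y j)^2) / real q + ?c * (SUM j=1..N. bad j)"
	unfolding sum_divide_distrib sum_distrib_left sum.distrib[symmetric] by (rule sum_mono[OF one])
 have s2: "(SUM j=1..N. th j * y j) <= ?s / real q + ?c * real N"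
 proof -
	have "(SUM j=1..N. th j * y j) <= (SUM j=1..N. (y j)^2 / real q + ?c)" by (rule sum_mono[OF two])
	also have "... = ?s / real q + ?c * real N" by (simp add: sum.distrib sum_divide_distrib[symmetric])
	finally show ?thesis .
 qed
 have s3: "(SUM j=1..N. (Y j)^2) / real q <= 16 * ?s / real q"
	unfolding Y_def using cartan_square_sum[where N = N and y = y] q0 by (intro divide_right_mono) simp_all
 have s0: "0 <= ?s" by (rule sum_nonneg) simp
 have "18 / real q <= kappa N / 2"
	using q(1) q0 kappa_pos[OF N] by (simp add: field_simps)
 hence "18 / real q * ?s <= kappa N / 2 * ?s" by (rule mult_right_mono[OF _ s0])
 moreover have "18 / real q * ?s = ?s / real q + 16 * ?s / real q + ?s / real q" by simp
 moreover have "kappa N * ?s <= kform N y" by (rule kform_coercive)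
 ultimately have "kappa N / 2 * ?s - (?c * (SUM j=1..N. bad j) + ?c * real N) <= (SUM j=1..N. y j * (Y j - 1) * th j)"
	unfolding eq using s1 s2 s3 by linarith
 thus ?thesis unfolding bad_def Y_def by (simp only: distrib_left)
qed

context chern_simons
begin

definition expo :: "nat => (nat => real^2 => real) => real => (nat => real) => real^2 => real" where
 "expo q v L t x = (SUM i=1..N. (4 * real q * t i) * v i x) - L"

definition occ :: "nat => (nat => real^2 => real) => real => (nat => real) => real^2 => real" where
 "occ q v L t x = softmax (weights N q) (%s. expo q v L s x) t"

lemma expo_W:
 assumes v: "v : V"
 shows "expo q v L t : W" "AE x in M. wp k (expo q v L t) x = 4 * real q * (SUM i=1..N. t i * wp k (v i) x)"
proof -
 have fin: "finite {1..N}" by simp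
 have S: "(%x. SUM i=1..N. (4 * real q * t i) * v i x) : W &
	 (ALL k. AE x in M. wp k (%x. SUM i=1..N. (4 * real q * t i) * v i x) x = (SUM i=1..N. (4 * real q * t i) * wp k (v i) x))"
	by (rule W_sum[OF fin]) (rule V_W[OF v])
 note S1 = S[THEN conjunct1] and S2 = S[THEN conjunct2, THEN spec]
 show "expo q v L t : W" unfolding expo_def[abs_def] by (rule W_diff(1)[OF S1 W_const(1)])
 show "AE x in M. wp k (expo q v L t) x = 4 * real q * (SUM i=1..N. t i * wp k (v i) x)"
	unfolding expo_def[abs_def] using W_diff(2)[OF S1 W_const(1)[of L], of k] S2[of k] W_const(2)[where c = L and k = k]
	by eventually_elim (simp only: sum_distrib_left mult.assoc diff_zero)
qed

lemma expo_step:
 assumes q: "q >= 1" and j: "j : {1..N}"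
 shows "expo q v L (step q t j) x = expo q v L t x + 4 * v j x"
proof -
 have c: "(SUM i=1..N. (4 * real q * f i) * v i x) = (SUM i=1..N. (4 * real q * v i x) * f i)" for f by (simp add: mult_ac)
 have "(SUM i=1..N. (4 * real q * v i x) * step q t j i) = (SUM i=1..N. (4 * real q * v i x) * t i) + (4 * real q * v j x) / real q"
	by (rule step_sum[OF j])
 thus ?thesis unfolding expo_def c using q by simp
qed

lemma occ_bounds:
 assumes q: "q >= 1" and t: "t : weights N q"
 shows "0 < occ q v L t x" "occ q v L t x <= 1" "occ q v L t x <= exp (expo q v L t x)"
	"(SUM t:weights N q. occ q v L t x) <= 1"
 unfolding occ_def
 by (rule softmax_pos, rule softmax_le_1[OF finite_weights[OF q] t], rule softmax_le_exp[OF finite_weights[OF q]], rule softmax_sum)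

text \<open>The weight of the neighbour \<open>t + e\<^sub>j/q\<close> is also at most one.\<close>

lemma occ_step:
 assumes q: "q >= 1" and t: "t : weights N q" and j: "j : {1..N}" and room: "theta N t j <= 1 - 2 / real q"
 shows "occ q v L t x * exp (4 * v j x) <= 1"
proof -
 have "occ q v L t x * exp (4 * v j x) = occ q v L (step q t j) x"
	unfolding occ_def softmax_def expo_step[OF q j] exp_add by simp
 also have "... <= 1" by (rule occ_bounds(2)[OF q step_weights[OF q t j room]])
 finally show ?thesis .
qed

lemma occ_W:
 assumes v: "v : V" and q: "q >= 1" and t: "t : weights N q"
 shows "occ q v L t : W"
	and "AE x in M. wp k (occ q v L t) x = occ q v L t x * (wp k (expo q v L t) x - (SUM s:weights N q. occ q v L s x * wp k (expo q v L s) x))"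
 unfolding occ_def[abs_def]
 by (rule softmax_chain_rule(1)[OF finite_weights[OF q] expo_W(1)[OF v] t],
	 rule softmax_chain_rule(2)[OF finite_weights[OF q] expo_W(1)[OF v] t])

lemma occ_measurable: "v : V ==> q >= 1 ==> t : weights N q ==> occ q v L t : Meas"
 by (rule L2D(3)[OF W_L2[OF occ_W(1)]])

definition probe :: "nat => (nat => real^2 => real) => real => nat => real^2 => real" where
 "probe q v L j x = (SUM t:weights N q. theta N t j * occ q v L t x)"

lemma probe_W:
 assumes v: "v : V" and q: "q >= 1"
 shows "probe q v L j : W" "AE x in M. wp k (probe q v L j) x = (SUM t:weights N q. theta N t j * wp k (occ q v L t) x)"
proof -
 have S: "(%x. SUM t:weights N q. theta N t j * occ q v L t x) : W &
	 (ALL k. AE x in M. wp k (%x. SUM t:weights N q. theta N t j * occ q v L t x) x = (SUM t:weights N q. theta N t j * wp k (occ q v L t) x))"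
	by (rule W_sum[OF finite_weights[OF q]]) (rule occ_W(1)[OF v q])
 show "probe q v L j : W" unfolding probe_def[abs_def] by (rule S[THEN conjunct1])
 show "AE x in M. wp k (probe q v L j) x = (SUM t:weights N q. theta N t j * wp k (occ q v L t) x)"
	unfolding probe_def[abs_def] by (rule S[THEN conjunct2, THEN spec])
qed

lemma probe_V: "v : V ==> q >= 1 ==> probe q v L : V"
 by (rule V_I[OF probe_W(1)])

text \<open>The inverse matrix cancels the Cartan matrix in the test function, which leaves a variance.\<close>

lemma probe_dirichlet_form:
 assumes v: "v : V" and q: "q >= 1"
 shows "1 / (4 * real q) * (SUM t:weights N q. dir (occ q v L t)) <= dform v (probe q v L)"
proof -
 let ?S = "weights N q"
 have q0: "0 < real q" using q by simp
 note fS = finite_weights[OF q]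
 have i: "Integ (%x. (wp k (occ q v L t) x)^2)" if "t : ?S" for t k by (rule L2D(4)[OF wp_L2[OF occ_W(1)[OF v q that]]])
 have "1 / (4 * real q) * (SUM t:?S. dir (occ q v L t)) = (SUM k:UNIV. 1 / (4 * real q) * (SUM t:?S. \<integral>x. (wp k (occ q v L t) x)^2 \<partial>M))"
	unfolding dir_def by (subst sum.swap) (simp only: sum_distrib_left)
 also have "... <= dform v (probe q v L)"
	unfolding dform_def
 proof (rule sum_mono)
	fix k
	have ae1: "AE x in M. ALL j:{1..N}. wp k (probe q v L j) x = (SUM t:?S. theta N t j * wp k (occ q v L t) x)"
	 by (rule AE_finite_allI) (simp, rule probe_W(2)[OF v q])
	have ae2: "AE x in M. ALL t:?S. wp k (occ q v L t) x = occ q v L t x * (wp k (expo q v L t) x - (SUM s:?S. occ q v L s x * wp k (expo q v L s) x))"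
	 by (rule AE_finite_allI[OF fS occ_W(2)[OF v q]])
	have ae3: "AE x in M. ALL t:?S. wp k (expo q v L t) x = 4 * real q * (SUM i=1..N. t i * wp k (v i) x)"
	 by (rule AE_finite_allI[OF fS expo_W(2)[OF v]])
	have "1 / (4 * real q) * (SUM t:?S. \<integral>x. (wp k (occ q v L t) x)^2 \<partial>M) = (\<oint>x. 1 / (4 * real q) * (SUM t:?S. (wp k (occ q v L t) x)^2))"
	 unfolding integral_mult_right_zero by (subst sum_integral) (simp_all only: i)
	also have "... <= (\<oint>x. aform N (%i. wp k (v i) x) (%i. wp k (probe q v L i) x))"
	proof (rule integral_mono_AE)
	 show "Integ (%x. 1 / (4 * real q) * (SUM t:?S. (wp k (occ q v L t) x)^2))"
		by (intro integrable_mult_right sum_integrable i)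
	 show "Integ (%x. aform N (%i. wp k (v i) x) (%i. wp k (probe q v L i) x))"
		by (rule aform_integrable[OF v probe_V[OF v q]])
	 show "AE x in M. 1 / (4 * real q) * (SUM t:?S. (wp k (occ q v L t) x)^2) <= aform N (%i. wp k (v i) x) (%i. wp k (probe q v L i) x)"
		using ae1 ae2 ae3
	 proof eventually_elim
		fix x
		assume 1: "ALL j:{1..N}. wp k (probe q v L j) x = (SUM t:?S. theta N t j * wp k (occ q v L t) x)"
		and 2: "ALL t:?S. wp k (occ q v L t) x = occ q v L t x * (wp k (expo q v L t) x - (SUM s:?S. occ q v L s x * wp k (expo q v L s) x))"
		and 3: "ALL t:?S. wp k (expo q v L t) x = 4 * real q * (SUM i=1..N. t i * wp k (v i) x)"
		define y where "y i = (SUM t:?S. t i * wp k (occ q v L t) x)" for i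
		have "wp k (probe q v L j) x = (SUM m=1..N. cartan j m * y m)" if "j : {1..N}" for j
		unfolding 1[rule_format, OF that] theta_def y_def sum_distrib_left sum_distrib_right
		by (subst sum.swap) (simp add: mult_ac)
		hence "aform N (%i. wp k (v i) x) (%i. wp k (probe q v L i) x) = aform N (%i. wp k (v i) x) (%j. SUM m=1..N. cartan j m * y m)"
		unfolding aform_def by (intro sum.cong refl) (simp only:)
		also have "... = (SUM i=1..N. wp k (v i) x * y i)" by (rule aform_cartan)
		also have "... = (SUM t:?S. wp k (occ q v L t) x * (SUM i=1..N. t i * wp k (v i) x))"
		unfolding y_def sum_distrib_left by (subst sum.swap) (simp add: mult_ac)
		also have "... = (SUM t:?S. 1 / (4 * real q) * (wp k (occ q v L t) x * wp k (expo q v L t) x))"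
		using q0 by (intro sum.cong refl) (simp add: 3)
		also have "... = 1 / (4 * real q) * (SUM t:?S. wp k (occ q v L t) x * wp k (expo q v L t) x)" by (rule sum_distrib_left[symmetric])
		finally have eq: "aform N (%i. wp k (v i) x) (%i. wp k (probe q v L i) x) = 1 / (4 * real q) * (SUM t:?S. wp k (occ q v L t) x * wp k (expo q v L t) x)" .
		have "(SUM t:?S. (wp k (occ q v L t) x)^2) = (SUM t:?S. (occ q v L t x * (wp k (expo q v L t) x - (SUM s:?S. occ q v L s x * wp k (expo q v L s) x)))^2)"
		by (rule sum.cong[OF refl]) (simp only: 2[rule_format])
		also have "... <= (SUM t:?S. occ q v L t x * (wp k (expo q v L t) x - (SUM s:?S. occ q v L s x * wp k (expo q v L s) x)) * wp k (expo q v L t) x)"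
		using occ_bounds[OF q, of _ v L x] occ_bounds(4)[OF q zero_weights, of v L x] by (intro weighted_variance) (simp_all add: less_imp_le)
		also have "... = (SUM t:?S. wp k (occ q v L t) x * wp k (expo q v L t) x)"
		by (rule sum.cong[OF refl]) (simp only: 2[rule_format])
		finally show "1 / (4 * real q) * (SUM t:?S. (wp k (occ q v L t) x)^2) <= aform N (%i. wp k (v i) x) (%i. wp k (probe q v L i) x)"
		unfolding eq using q0 by (intro mult_left_mono) simp_all
	 qed
	qed
	finally show "1 / (4 * real q) * (SUM t:?S. \<integral>x. (wp k (occ q v L t) x)^2 \<partial>M) <= (\<oint>x. aform N (%i. wp k (v i) x) (%i. wp k (probe q v L i) x))" .
 qed
 finally show ?thesis .
qed

definition theta_bound :: "nat => real" where
 "theta_bound q = 1 + (SUM t:weights N q. SUM j=1..N. abs (theta N t j))"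

lemma theta_bound:
 assumes q: "q >= 1" and t: "t : weights N q" and j: "j : {1..N}"
 shows "abs (theta N t j) <= theta_bound q" "abs (1 - theta N t j) <= theta_bound q"
proof -
 have "abs (theta N t j) <= (SUM j=1..N. abs (theta N t j))" using j by (intro member_le_sum[of j "{1..N}" "%j. abs (theta N t j)"]) simp_all
 also have "... <= (SUM t:weights N q. SUM j=1..N. abs (theta N t j))"
	using t finite_weights[OF q] by (intro member_le_sum[of t "weights N q" "%t. SUM j=1..N. abs (theta N t j)"] sum_nonneg) simp_all
 finally show "abs (theta N t j) <= theta_bound q" "abs (1 - theta N t j) <= theta_bound q" unfolding theta_bound_def by linarith+
qed

lemma theta_bound_pos: "1 <= theta_bound q"
 unfolding theta_bound_def using sum_nonneg[of "weights N q" "%t. SUM j=1..N. abs (theta N t j)"] by (simp add: sum_nonneg)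

lemma probe_abs_le:
 assumes q: "q >= 1" and j: "j : {1..N}"
 shows "abs (probe q v L j x) <= theta_bound q * (SUM t:weights N q. occ q v L t x)" "abs (probe q v L j x) <= theta_bound q"
proof -
 show 1: "abs (probe q v L j x) <= theta_bound q * (SUM t:weights N q. occ q v L t x)"
	unfolding probe_def sum_distrib_left
 proof (rule order_trans[OF sum_abs sum_mono])
	fix t assume t: "t : weights N q"
	show "abs (theta N t j * occ q v L t x) <= theta_bound q * occ q v L t x"
	 unfolding abs_mult using occ_bounds(1)[OF q t, of v L x] theta_bound(1)[OF q t j] by (intro mult_mono) simp_all
 qed
 have "theta_bound q * (SUM t:weights N q. occ q v L t x) <= theta_bound q * 1"
	using theta_bound_pos[of q] by (intro mult_left_mono occ_bounds(4)[OF q zero_weights]) simp_all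
 thus "abs (probe q v L j x) <= theta_bound q" using 1 by linarith
qed

lemma probe_nrm:
 assumes v: "v : V" and q: "q >= 1"
 shows "nrm (probe q v L) <= (1 + real N * (theta_bound q)^2 * area + real N * (real (card (weights N q)) * (theta_bound q)^2)) *
	(1 + (SUM t:weights N q. dir (occ q v L t)))"
proof -
 let ?S = "weights N q" and ?T = "theta_bound q"
 let ?G = "SUM t:?S. dir (occ q v L t)"
 let ?c1 = "?T^2 * area" and ?c2 = "real (card ?S) * ?T^2"
 note pV = probe_V[OF v q, of L]
 have G0: "0 <= ?G" by (intro sum_nonneg dirichlet_nonneg)
 have i: "Integ (%x. (wp k (occ q v L t) x)^2)" if "t : ?S" for t k by (rule L2D(4)[OF wp_L2[OF occ_W(1)[OF v q that]]])
 have 1: "(\<oint>x. (probe q v L j x)^2) <= ?c1" if j: "j : {1..N}" for j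
 proof -
	have "(\<oint>x. (probe q v L j x)^2) <= (\<oint>x. ?T^2)"
	proof (rule integral_mono[OF L2D(4)[OF V_L2(1)[OF pV j]]])
	 show "(probe q v L j x)^2 <= ?T^2" for x using power_mono[OF probe_abs_le(2)[OF q j, of v L x] abs_ge_zero, of 2] by simp
	qed simp
	thus ?thesis by (simp add: area_def mult.commute)
 qed
 have 2: "dir (probe q v L j) <= ?c2 * ?G" if j: "j : {1..N}" for j
 proof -
	have "(\<oint>x. (wp k (probe q v L j) x)^2) <= ?c2 * (SUM t:?S. \<integral>x. (wp k (occ q v L t) x)^2 \<partial>M)" for k
	proof -
	 have "(\<oint>x. (wp k (probe q v L j) x)^2) <= (\<oint>x. ?c2 * (SUM t:?S. (wp k (occ q v L t) x)^2))"
	 proof (rule integral_mono_AE[OF L2D(4)[OF V_L2(2)[OF pV j]]])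
		show "Integ (%x. ?c2 * (SUM t:?S. (wp k (occ q v L t) x)^2))"
		by (intro integrable_mult_right sum_integrable i)
		show "AE x in M. (wp k (probe q v L j) x)^2 <= ?c2 * (SUM t:?S. (wp k (occ q v L t) x)^2)"
		using probe_W(2)[OF v q, of k L j]
		proof eventually_elim
		fix x assume x: "wp k (probe q v L j) x = (SUM t:?S. theta N t j * wp k (occ q v L t) x)"
		have "(wp k (probe q v L j) x)^2 <= (SUM t:?S. (theta N t j * wp k (occ q v L t) x)^2) * real (card ?S)"
		unfolding x by (rule sum_squared_le_sum_of_squares)
		also have "... <= (SUM t:?S. ?T^2 * (wp k (occ q v L t) x)^2) * real (card ?S)"
		proof (intro mult_right_mono sum_mono)
		fix t assume t: "t : ?S"
		have "(theta N t j)^2 <= ?T^2" using power_mono[OF theta_bound(1)[OF q t j] abs_ge_zero, of 2] by simp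
		thus "(theta N t j * wp k (occ q v L t) x)^2 <= ?T^2 * (wp k (occ q v L t) x)^2"
		unfolding power_mult_distrib by (rule mult_right_mono) simp
		qed simp
		also have "... = ?c2 * (SUM t:?S. (wp k (occ q v L t) x)^2)" by (simp only: sum_distrib_left[symmetric] mult_ac)
		finally show "(wp k (probe q v L j) x)^2 <= ?c2 * (SUM t:?S. (wp k (occ q v L t) x)^2)" .
		qed
	 qed
	 also have "... = ?c2 * (SUM t:?S. \<integral>x. (wp k (occ q v L t) x)^2 \<partial>M)"
		unfolding integral_mult_right_zero by (subst sum_integral) (simp_all only: i)
	 finally show ?thesis .
	qed
	hence "dir (probe q v L j) <= (SUM k:UNIV. ?c2 * (SUM t:?S. \<integral>x. (wp k (occ q v L t) x)^2 \<partial>M))"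
	 unfolding dir_def by (intro sum_mono)
	also have "... = ?c2 * ?G" unfolding dir_def sum_distrib_left[symmetric] by (subst sum.swap) (rule refl)
	finally show ?thesis .
 qed
 have "(nrm (probe q v L))^2 <= (SUM j=1..N. ?c1 + ?c2 * ?G)" unfolding nrm_sq[OF pV] by (intro sum_mono add_mono 1 2)
 hence sq: "(nrm (probe q v L))^2 <= real N * ?c1 + real N * ?c2 * ?G" by (simp add: distrib_left)
 have "nrm (probe q v L) <= 1 + (nrm (probe q v L))^2" using young[of 2 "nrm (probe q v L)"] by simp
 also have "... <= 1 + real N * ?c1 + real N * ?c2 * ?G" using sq by simp
 also have "... <= (1 + real N * ?c1 + real N * ?c2) * (1 + ?G)"
 proof -
	have "0 <= (1 + real N * ?c1) * ?G" "0 <= real N * ?c2" using G0 area_pos by simp_all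
	moreover have "(1 + real N * ?c1 + real N * ?c2) * (1 + ?G) = 1 + real N * ?c1 + real N * ?c2 + (1 + real N * ?c1) * ?G + real N * ?c2 * ?G"
	 by (simp only: distrib_left distrib_right mult_1_left mult_1_right add_ac)
	ultimately show ?thesis by linarith
 qed
 finally show ?thesis by (simp only: mult.assoc)
qed


lemma occ_sqrt:
 assumes q: "q >= 1" and t: "t : weights N q"
 shows "occ q v L t x <= sqrt (occ q v L t x)" "sqrt (occ q v L t x) <= 1"
	"j : {1..N} ==> theta N t j <= 1 - 2 / real q ==> occ q v L t x * exp (2 * v j x) <= sqrt (occ q v L t x)"
proof -
 let ?p = "occ q v L t x"
 note b = occ_bounds[OF q t, of v L x]
 have "?p * ?p <= 1 * ?p" using b by (intro mult_right_mono) simp_all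
 thus "?p <= sqrt ?p" using b(1) by (intro real_le_rsqrt) (simp add: power2_eq_square)
 show "sqrt ?p <= 1" using b(2) by simp
 assume j: "j : {1..N}" "theta N t j <= 1 - 2 / real q"
 have "?p * (?p * exp (4 * v j x)) <= ?p * 1" using b(1) by (intro mult_left_mono occ_step[OF q t j]) simp
 moreover have "(?p * exp (2 * v j x))^2 = ?p * (?p * exp (4 * v j x))"
	unfolding power_mult_distrib exp_double[symmetric] by (simp add: power2_eq_square)
 ultimately show "?p * exp (2 * v j x) <= sqrt ?p" by (intro real_le_rsqrt) simp
qed

lemma occ_sqrt_decay:
 assumes q: "q >= 1" and t: "t : weights N q" and L: "0 < L"
 shows "sqrt (occ q v L t x) <= (4 + 8 * real q * (SUM j=1..N. r j) * pos v x) / L"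
proof -
 let ?R = "SUM j=1..N. r j" and ?p = "occ q v L t x"
 define X where "X = 4 * real q * ?R * pos v x"
 have rR: "r i <= ?R" if "i : {1..N}" for i using that r_pos[of _ N] by (intro member_le_sum[of i "{1..N}" r]) (simp_all add: less_imp_le)
 have R0: "0 <= ?R" using r_pos[of _ N] by (intro sum_nonneg) (simp add: less_imp_le)
 have X0: "0 <= X" unfolding X_def using R0 pos_part_nonneg[of v x] by simp
 have "(SUM i=1..N. (4 * real q * t i) * v i x) <= (SUM i=1..N. (4 * real q * ?R) * max 0 (v i x))"
 proof (rule sum_mono)
	fix i assume i: "i : {1..N}"
	have "t i * v i x <= t i * max 0 (v i x)" using weightsD(4)[OF t i] by (intro mult_left_mono) simp_all
	also have "... <= ?R * max 0 (v i x)" using order_trans[OF weights_le_r[OF t i] rR[OF i]] by (intro mult_right_mono) simp_all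
	finally have "4 * real q * (t i * v i x) <= 4 * real q * (?R * max 0 (v i x))" by (intro mult_left_mono) simp_all
	thus "(4 * real q * t i) * v i x <= (4 * real q * ?R) * max 0 (v i x)" by (simp only: mult.assoc)
 qed
 also have "... = X" unfolding X_def pos_def by (rule sum_distrib_left[symmetric])
 finally have ex: "expo q v L t x <= X - L" unfolding expo_def by linarith
 have X8: "8 * real q * ?R * pos v x = 2 * X" unfolding X_def by simp
 have "sqrt ?p * L <= 4 + 2 * X"
 proof (cases "L / 2 <= X")
	case True
	have "sqrt ?p * L <= 1 * L" using occ_sqrt(2)[OF q t] L by (intro mult_right_mono) simp_all
	thus ?thesis using True by linarith
 next
	case False
	have "?p <= exp (- (L / 2))" using occ_bounds(3)[OF q t, of v L x] ex False
	 by (intro order_trans[OF occ_bounds(3)[OF q t]]) simp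
	also have "... = (exp (- (L / 4)))^2" unfolding exp_double[symmetric] by simp
	finally have "sqrt ?p <= exp (- (L / 4))" using occ_bounds(1)[OF q t, of v L x] by (intro real_le_lsqrt) simp_all
	hence "sqrt ?p * L <= exp (- (L / 4)) * L" using L by (intro mult_right_mono) simp_all
	also have "... <= exp (- (L / 4)) * (4 * exp (L / 4))"
	proof (rule mult_left_mono)
	 show "L <= 4 * exp (L / 4)" using exp_ge_add_one_self[of "L / 4"] by linarith
	qed simp
	also have "... = 4" by (simp add: exp_minus)
	finally show ?thesis using X0 by linarith
 qed
 thus ?thesis unfolding X8 using L by (simp add: pos_le_divide_eq)
qed

lemma occ_large:
 assumes q: "q >= 2" and j: "j : {1..N}" and big: "L / 4 <= v j x"
 shows "1/2 <= (SUM t:weights N q. occ q v L t x)"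
proof -
 have q1: "q >= 1" using q by simp
 have room: "theta N (%i. 0) j <= 1 - 2 / real q" unfolding theta_def using q by simp
 define s where "s = step q (%i. 0) j"
 have s: "s : weights N q" unfolding s_def by (rule step_weights[OF q1 zero_weights j room])
 have "expo q v L s x = expo q v L (%i. 0) x + 4 * v j x" unfolding s_def by (rule expo_step[OF q1 j])
 hence e: "0 <= expo q v L s x" using big by (simp add: expo_def)
 let ?Z = "SUM t:weights N q. exp (expo q v L t x)"
 have "1 <= exp (expo q v L s x)" using e by simp
 also have "... <= ?Z" using s finite_weights[OF q1] by (intro member_le_sum[of s "weights N q" "%t. exp (expo q v L t x)"]) simp_all
 finally have Z: "1 <= ?Z" .
 have "(SUM t:weights N q. occ q v L t x) = ?Z / (1 + ?Z)" unfolding occ_def softmax_def sum_divide_distrib ..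
 moreover have "1/2 <= ?Z / (1 + ?Z)"
	using Z by (subst pos_le_divide_eq) simp_all
 ultimately show ?thesis by (simp only:)
qed

lemma uniform_integrability:
 "EX C eps1. 0 <= C & 0 < eps1 & (ALL eps v L. crit eps v --> eps <= eps1 --> 0 < L -->
	(EX P. P : Meas & (ALL x. 0 <= P x & P x <= 1) &
		(ALL x. (EX j:{1..N}. L / 4 <= v j x) --> 1/2 <= P x) & (\<oint>x. P x * zsq v x) <= C * (1 / L + eps)))"
proof -
 let ?k = "kappa N"
 have k: "0 < ?k" by (rule kappa_pos[OF N])
 obtain q0 :: nat where q0: "36 / ?k <= real q0" using real_arch_simple[of "36 / ?k"] by (elim exE)
 define q where "q = max q0 2"
 have q: "36 / ?k <= real q" "q >= 2" "q >= 1" using q0 unfolding q_def by simp_all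
 obtain Cp where Cp: "0 <= Cp" "ALL eps v. crit eps v --> (\<oint>x. pos v x) <= Cp" using pos_part_bound by (elim exE conjE)
 let ?S = "weights N q" and ?T = "theta_bound q" and ?R = "SUM j=1..N. r j"
 define c where "c = real q * ?T^2 / 4"
 define C1 where "C1 = c * (real N * Z0^2 + real N)"
 define B where "B = (SUM j=1..N. b j)"
 define c5 where "c5 = 1 + real N * ?T^2 * area + real N * (real (card ?S) * ?T^2)"
 define C2 where "C2 = real (card ?S) * (4 * area + 8 * real q * ?R * Cp)"
 define Q where "Q = B * ?T / area + l * C1"
 define C where "C = 2 / (l * ?k) * (c5 + Q * C2)"
 have bp: "0 < b j" if "j : {1..N}" for j by (rule b_pos[OF n that])
 have T1: "1 <= ?T" by (rule theta_bound_pos)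
 have c0: "0 <= c" unfolding c_def by simp
 have C10: "0 <= C1" unfolding C1_def using c0 by simp
 have B0: "0 <= B" unfolding B_def using bp by (intro sum_nonneg) (simp add: less_imp_le)
 have R0: "0 <= ?R" using r_pos[of _ N] by (intro sum_nonneg) (simp add: less_imp_le)
 have c51: "1 <= c5" unfolding c5_def using area_pos by simp
 have C20: "0 <= C2" unfolding C2_def using area_pos R0 Cp(1) by simp
 have Q0: "0 <= Q" unfolding Q_def using B0 T1 area_pos l C10 by simp
 have C0: "0 <= C" unfolding C_def using l k c51 Q0 C20 by simp
 define eps1 where "eps1 = 1 / (4 * real q * c5)"
 have e1: "0 < eps1" unfolding eps1_def using q(3) c51 by simp
 have main: "EX P. P : Meas & (ALL x. 0 <= P x & P x <= 1) &
		(ALL x. (EX j:{1..N}. L / 4 <= v j x) --> 1/2 <= P x) & (\<oint>x. P x * zsq v x) <= C * (1 / L + eps)"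
	if cr: "crit eps v" and eps: "eps <= eps1" and L: "0 < L" for eps v L
 proof -
	note v = critD(1)[OF cr]
	define P where "P x = (SUM t:?S. occ q v L t x)" for x
	define Y where "Y x = (SUM t:?S. sqrt (occ q v L t x))" for x
	define G where "G = (SUM t:?S. dir (occ q v L t))"
	have G0: "0 <= G" unfolding G_def by (intro sum_nonneg dirichlet_nonneg)
	have Pm: "P : Meas" unfolding P_def[abs_def] by (intro borel_measurable_sum occ_measurable v q)
	have P01: "0 <= P x" "P x <= 1" for x
	 unfolding P_def using occ_bounds(1)[OF q(3), of _ v L x] occ_bounds(4)[OF q(3) zero_weights, of v L x]
	 by (auto intro!: sum_nonneg simp: less_imp_le)
	have PY: "P x <= Y x" for x unfolding P_def Y_def by (intro sum_mono occ_sqrt(1)[OF q(3)])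
	have si: "Integ (%x. sqrt (occ q v L t x))" if t: "t : ?S" for t
	proof (rule integrable_M_bounded[where B = 1])
	 show "(%x. sqrt (occ q v L t x)) : Meas" using occ_measurable[OF v q(3) t] by simp
	 show "abs (sqrt (occ q v L t x)) <= 1" for x using occ_sqrt(2)[OF q(3) t, of v L x] occ_bounds(1)[OF q(3) t, of v L x] by simp
	qed
	have Yi: "Integ Y" unfolding Y_def[abs_def] by (rule sum_integrable[OF si])
	have Pz: "Integ (%x. P x * zsq v x)"
	 using integrable_M_mult_bounded[OF zsq_integrable[OF v] Pm, of 1] P01 by (simp add: mult.commute)
	have YL: "(\<oint>x. Y x) <= C2 / L"
	proof -
	 let ?g = "%x. (4 + 8 * real q * ?R * pos v x) / L"
	 have gi: "Integ ?g" using pos_part_integrable[OF v] by simp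
	 have "(\<oint>x. Y x) <= (\<oint>x. real (card ?S) * ?g x)"
	 proof (rule integral_mono[OF Yi integrable_mult_right[OF gi]])
		show "Y x <= real (card ?S) * ?g x" for x unfolding Y_def by (rule sum_bounded_above) (rule occ_sqrt_decay[OF q(3) _ L])
	 qed
	 also have "... = real (card ?S) * ((4 * area + 8 * real q * ?R * (\<oint>x. pos v x)) / L)"
		using pos_part_integrable[OF v] by (simp add: area_def)
	 also have "... <= real (card ?S) * ((4 * area + 8 * real q * ?R * Cp) / L)"
		using Cp(2)[rule_format, OF cr] R0 L by (intro mult_left_mono divide_right_mono add_left_mono) simp_all
	 finally show ?thesis unfolding C2_def by simp
	qed
	have pV: "probe q v L : V" by (rule probe_V[OF v q(3)])
	let ?F = "\<integral>x. (SUM j=1..N. force v j x * probe q v L j x) \<partial>M" and ?B = "\<integral>x. (SUM j=1..N. b j * probe q v L j x) \<partial>M"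
	note Fi = force_int(2)[OF v pV] and Bi = force_int(3)[OF v pV]
	have Bl: "- (B * ?T * (\<oint>x. Y x)) <= ?B"
	proof -
	 have "(\<oint>x. - (B * ?T) * Y x) <= ?B"
	 proof (rule integral_mono[OF integrable_mult_right[OF Yi] Bi])
		fix x
		have "abs (SUM j=1..N. b j * probe q v L j x) <= (SUM j=1..N. b j * (?T * P x))"
		proof (rule order_trans[OF sum_abs sum_mono])
		fix j assume j: "j : {1..N}"
		show "abs (b j * probe q v L j x) <= b j * (?T * P x)"
		using mult_left_mono[OF probe_abs_le(1)[OF q(3) j, of v L x], of "b j"] bp[OF j] by (simp add: abs_mult P_def)
		qed
		also have "... = B * (?T * P x)" unfolding B_def by (rule sum_distrib_right[symmetric])
		also have "... <= B * (?T * Y x)" using B0 T1 by (intro mult_left_mono PY) simp_all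
		finally show "- (B * ?T) * Y x <= (SUM j=1..N. b j * probe q v L j x)" by simp
	 qed
	 thus ?thesis by simp
	qed
	have Fl: "?k / 2 * (\<oint>x. P x * zsq v x) - C1 * (\<oint>x. Y x) <= ?F"
	proof -
	 have "(\<oint>x. ?k / 2 * (P x * zsq v x) - C1 * Y x) <= ?F"
	 proof (rule integral_mono_AE)
		show "Integ (%x. ?k / 2 * (P x * zsq v x) - C1 * Y x)"
		by (intro diff_integrable integrable_mult_right Pz Yi)
		show "Integ (%x. SUM j=1..N. force v j x * probe q v L j x)" by (rule Fi)
		show "AE x in M. ?k / 2 * (P x * zsq v x) - C1 * Y x <= (SUM j=1..N. force v j x * probe q v L j x)"
		using u0_all
		proof eventually_elim
		fix x assume x: "ALL j:{1..N}. u0 j x <= C0"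
		have "(SUM j=1..N. force v j x * probe q v L j x) = (SUM t:?S. occ q v L t x * (SUM j=1..N. force v j x * theta N t j))"
		unfolding probe_def sum_distrib_left by (subst sum.swap) (simp add: mult_ac)
		moreover have "(SUM t:?S. ?k / 2 * (occ q v L t x * zsq v x) - C1 * sqrt (occ q v L t x))
		<= (SUM t:?S. occ q v L t x * (SUM j=1..N. force v j x * theta N t j))"
		proof (rule sum_mono)
		fix t assume t: "t : ?S"
		let ?p = "occ q v L t x"
		let ?bad = "%j. if theta N t j <= 1 - 2 / real q then (z v j x)^2 else 0"
		note p = occ_bounds[OF q(3) t, of v L x] and sp = occ_sqrt[OF q(3) t, where v = v and L = L and x = x]
		have low: "?k / 2 * zsq v x - c * ((SUM j=1..N. ?bad j) + real N) <= (SUM j=1..N. force v j x * theta N t j)"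
		unfolding zsq_def c_def force_def
		by (rule theta_pairing_lower[OF q(1,3) N]) (erule theta_bound[OF q(3) t] weightsD(3)[OF t])+
		have "?p * ?bad j <= Z0^2 * sqrt ?p" if j: "j : {1..N}" for j
		proof (cases "theta N t j <= 1 - 2 / real q")
		case True
		have "(z v j x)^2 <= Z0^2 * exp (2 * v j x)"
		using power_mono[OF z_le_exp[OF x j, of v], of 2] z_pos[OF j, of v x] by (simp add: power_mult_distrib exp_double[symmetric])
		hence "?p * (z v j x)^2 <= ?p * (Z0^2 * exp (2 * v j x))" using p(1) by (intro mult_left_mono) simp_all
		also have "... = Z0^2 * (?p * exp (2 * v j x))" by simp
		also have "... <= Z0^2 * sqrt ?p" by (intro mult_left_mono sp(3)[OF j True]) simp
		finally show ?thesis using True by simp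
		next
		case False
		thus ?thesis using p(1) by simp
		qed
		hence "(SUM j=1..N. ?p * ?bad j) <= (SUM j=1..N. Z0^2 * sqrt ?p)" by (rule sum_mono)
		hence b1: "?p * (SUM j=1..N. ?bad j) <= real N * Z0^2 * sqrt ?p" by (simp add: sum_distrib_left)
		have b2: "?p * real N <= real N * sqrt ?p" using mult_left_mono[OF sp(1), of "real N"] by (simp add: mult.commute)
		have "c * (?p * (SUM j=1..N. ?bad j) + ?p * real N) <= c * (real N * Z0^2 * sqrt ?p + real N * sqrt ?p)"
		by (intro mult_left_mono add_mono b1 b2 c0)
		also have "... = C1 * sqrt ?p" unfolding C1_def by (simp add: algebra_simps)
		finally have b3: "c * (?p * (SUM j=1..N. ?bad j) + ?p * real N) <= C1 * sqrt ?p" .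
		have "?p * (?k / 2 * zsq v x - c * ((SUM j=1..N. ?bad j) + real N)) <= ?p * (SUM j=1..N. force v j x * theta N t j)"
		using p(1) by (intro mult_left_mono low) simp
		moreover have "?p * (?k / 2 * zsq v x - c * ((SUM j=1..N. ?bad j) + real N)) =
		?k / 2 * (?p * zsq v x) - c * (?p * (SUM j=1..N. ?bad j) + ?p * real N)"
		by (simp only: right_diff_distrib distrib_left mult_ac)
		ultimately show "?k / 2 * (?p * zsq v x) - C1 * sqrt ?p <= ?p * (SUM j=1..N. force v j x * theta N t j)"
		using b3 by linarith
		qed
		moreover have "(SUM t:?S. ?k / 2 * (occ q v L t x * zsq v x) - C1 * sqrt (occ q v L t x)) = ?k / 2 * (P x * zsq v x) - C1 * Y x"
		unfolding P_def Y_def sum_subtractf sum_distrib_left sum_distrib_right ..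
		ultimately show "?k / 2 * (P x * zsq v x) - C1 * Y x <= (SUM j=1..N. force v j x * probe q v L j x)" by linarith
		qed
	 qed
	 thus ?thesis using Pz Yi by simp
	qed
	have "lin v (probe q v L) <= eps * (c5 * (1 + G))"
	proof -
	 have "eps * nrm (probe q v L) <= eps * (c5 * (1 + G))"
		unfolding c5_def G_def by (intro mult_left_mono probe_nrm[OF v q(3)] critD(2)[OF cr])
	 thus ?thesis using critD(4)[OF cr pV] by linarith
	qed
	also have "... <= eps * c5 + 1 / (4 * real q) * G"
	proof -
	 have "eps * c5 * G <= eps1 * c5 * G" using eps c51 G0 by (intro mult_right_mono) simp_all
	 also have "... = 1 / (4 * real q) * G" unfolding eps1_def using c51 by simp
	 finally show ?thesis by (simp add: distrib_left mult.assoc)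
	qed
	finally have up: "lin v (probe q v L) <= eps * c5 + 1 / (4 * real q) * G" .
	have "1 / area * (- (B * ?T * (\<oint>x. Y x))) <= 1 / area * ?B" using Bl area_pos by (intro mult_left_mono) simp_all
	moreover have "1 / (4 * real q) * G <= dform v (probe q v L)" unfolding G_def by (rule probe_dirichlet_form[OF v q(3)])
	ultimately have "l * ?F <= eps * c5 + B * ?T / area * (\<oint>x. Y x)" using up unfolding lin_def by simp
	moreover have "l * (?k / 2 * (\<oint>x. P x * zsq v x) - C1 * (\<oint>x. Y x)) <= l * ?F" using l by (intro mult_left_mono Fl) simp
	moreover have "l * (?k / 2 * (\<oint>x. P x * zsq v x) - C1 * (\<oint>x. Y x)) = l * ?k / 2 * (\<oint>x. P x * zsq v x) - l * C1 * (\<oint>x. Y x)"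
	 by (simp add: right_diff_distrib)
	moreover have "Q * (\<oint>x. Y x) = B * ?T / area * (\<oint>x. Y x) + l * C1 * (\<oint>x. Y x)"
	 unfolding Q_def by (rule distrib_right)
	ultimately have "l * ?k / 2 * (\<oint>x. P x * zsq v x) <= eps * c5 + Q * (\<oint>x. Y x)"
	 by linarith
	also have "... <= eps * c5 + Q * (C2 / L)" by (intro add_left_mono mult_left_mono YL Q0)
	also have "... <= (c5 + Q * C2) * (1 / L + eps)"
	proof -
	 have "0 <= c5 * (1 / L)" "0 <= Q * C2 * eps" using c51 L Q0 C20 critD(2)[OF cr] by simp_all
	 moreover have "(c5 + Q * C2) * (1 / L + eps) = c5 * (1 / L) + eps * c5 + Q * (C2 / L) + Q * C2 * eps"
		by (simp add: algebra_simps)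
	 ultimately show ?thesis by linarith
	qed
	finally have "2 / (l * ?k) * (l * ?k / 2 * (\<oint>x. P x * zsq v x)) <= 2 / (l * ?k) * ((c5 + Q * C2) * (1 / L + eps))"
	 using l k by (intro mult_left_mono) simp_all
	hence fin: "(\<oint>x. P x * zsq v x) <= C * (1 / L + eps)" unfolding C_def mult.assoc[of "2 / (l * ?k)"] using l k by simp
	have big: "1/2 <= P x" if "EX j:{1..N}. L / 4 <= v j x" for x
	 unfolding P_def using that by (elim bexE) (rule occ_large[OF q(2)])
	show ?thesis by (intro exI[of _ P] conjI allI impI Pm P01 fin big)
 qed
 show ?thesis by (rule exI[of _ C], rule exI[of _ eps1], intro conjI allI impI C0 e1) (rule main)
qed

lemma dirichlet_shift: "u : W ==> dir (%x. u x - c) = dir u"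
proof -
 assume u: "u : W"
 have "(\<oint>x. (wp k (%x. u x - c) x)^2) = (\<oint>x. (wp k u x)^2)" for k
 proof (rule integral_cong_AE)
	show "AE x in M. (wp k (%x. u x - c) x)^2 = (wp k u x)^2"
	 using W_diff(2)[OF u W_const(1)[of c], of k] W_const(2)[where c = c and k = k] by eventually_elim simp
 qed (use L2D(3)[OF wp_L2[OF u]] L2D(3)[OF wp_L2[OF W_diff(1)[OF u W_const(1)]]] in simp_all)
 thus ?thesis unfolding dir_def by simp
qed

lemma force_pairing_bound:
 assumes x: "ALL j:{1..N}. u0 j x <= C0" and j: "j : {1..N}"
 shows "abs (force v j x * v j x) <= (1 + 10 * zsq v x) * pos v x + Z0 * (2 + 16 * zsq v x)"
proof -
 let ?K = "SUM k=1..N. cartan j k * z v k x" and ?s = "zsq v x"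
 have s0: "0 <= ?s" by (rule zsq_nonneg)
 have K2: "?K^2 <= 16 * ?s"
 proof -
	have "?K^2 <= (SUM j=1..N. (SUM k=1..N. cartan j k * z v k x)^2)"
	 using j by (intro member_le_sum[of j "{1..N}" "%j. (SUM k=1..N. cartan j k * z v k x)^2"]) simp_all
	thus ?thesis using cartan_square_sum[where N = N and y = "%k. z v k x"] unfolding zsq_def by linarith
 qed
 note zj = z_pos[OF j, of v x] z_sq_le_zsq[OF j, of v x]
 have z1: "z v j x <= 1 + (z v j x)^2" using young[of 2 "z v j x"] by simp
 have f1: "abs (force v j x) <= 1 + 10 * ?s"
 proof -
	have ar: "p <= 9 * s" if "p <= (c + d) / 2" "c <= s" "d <= 16 * s" "0 <= s" for p c d s :: real
	proof -
	 have "p * 2 <= c + d" using that(1) by simp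
	 thus ?thesis using that(2-) by linarith
	qed
	have "z v j x * abs ?K <= ((z v j x)^2 + abs ?K^2) / 2" by (rule mult_le_avg_squares)
	hence "z v j x * abs ?K <= 9 * ?s" unfolding power2_abs by (rule ar[OF _ zj(2) K2 s0])
	moreover have "abs (force v j x) <= z v j x * abs ?K + z v j x"
	proof -
	 have "z v j x * abs (?K - 1) <= z v j x * (abs ?K + 1)" using zj(1) by (intro mult_left_mono) simp_all
	 thus ?thesis unfolding force_def abs_mult using zj(1) by (simp add: distrib_left)
	qed
	ultimately show ?thesis using z1 zj(2) by linarith
 qed
 have p0: "0 <= (1 + 10 * ?s) * pos v x" "0 <= Z0 * (2 + 16 * ?s)" using s0 pos_part_nonneg[of v x] Z0_nonneg by simp_all
 show ?thesis
 proof (cases "0 <= v j x")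
	case True
	have "abs (force v j x) * abs (v j x) <= (1 + 10 * ?s) * pos v x"
	 using True le_pos_part(1)[OF j, of v x] s0 by (intro mult_mono f1) simp_all
	thus ?thesis using p0(2) unfolding abs_mult by linarith
 next
	case False
	have "abs (v j x) <= exp (- v j x)" using False exp_ge_add_one_self[of "- v j x"] by linarith
	hence "z v j x * abs (v j x) <= (Z0 * exp (v j x)) * exp (- v j x)"
	 using zj(1) Z0_nonneg by (intro mult_mono z_le_exp[OF x j]) simp_all
	hence zv: "z v j x * abs (v j x) <= Z0" by (simp add: mult.assoc exp_minus_inverse)
	have "abs ?K <= 1 + ?K^2" using young[of 2 "abs ?K"] by simp
	hence K1: "abs (?K - 1) <= 2 + 16 * ?s" using K2 by linarith
	have "abs (force v j x * v j x) = (z v j x * abs (v j x)) * abs (?K - 1)" unfolding force_def abs_mult using zj(1) by simp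
	also have "... <= Z0 * (2 + 16 * ?s)" using Z0_nonneg zj(1) by (intro mult_mono zv K1) simp_all
	finally show ?thesis using p0(1) by linarith
 qed
qed


section \<open>Completeness\<close>

lemma L2_complete:
 fixes u :: "nat => real^2 => real"
 assumes u: "!!n. u n : L2"
	and cauchy: "!!e. 0 < e ==> EX n0. ALL i>=n0. ALL k>=n0. (\<oint>x. (u i x - u k x)^2) <= e"
 shows "EX w. w : L2 & (ALL e>0. EX n0. ALL i>=n0. (\<oint>x. (u i x - w x)^2) <= e)"
proof -
 have d: "(%x. u i x - u k x) : L2" for i k by (rule L2_diff[OF u u])
 have L1: "EX n0. ALL i>=n0. ALL k>=n0. (\<oint>x. norm (u i x - u k x)) < e" if e: "0 < e" for e
 proof -
	have "0 < e^2 / (4 * area)" using e area_pos by simp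
	from cauchy[OF this] obtain n0 where n0: "ALL i>=n0. ALL k>=n0. (\<oint>x. (u i x - u k x)^2) <= e^2 / (4 * area)" by (elim exE)
	show ?thesis
	proof (intro exI[of _ n0] allI impI)
	 fix i k assume ik: "i >= n0" "k >= n0"
	 have "(\<oint>x. abs (u i x - u k x))^2 <= area * (\<oint>x. (u i x - u k x)^2)"
		by (rule L1_norm_le_L2[OF L2D(3,4)[OF d]])
	 also have "... <= area * (e^2 / (4 * area))" using n0 ik area_pos by (intro mult_left_mono) simp_all
	 also have "... = (e / 2)^2" using area_pos by (simp add: power_divide)
	 finally have "(\<oint>x. abs (u i x - u k x)) <= e / 2" by (rule power2_le_imp_le) (use e in simp)
	 thus "(\<oint>x. norm (u i x - u k x)) < e" using e by simp
	qed
 qed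
 obtain s :: "nat => nat" where s: "strict_mono s" "AE x in M. Cauchy (%i. u (s i) x)"
	by (rule cauchy_L1_AE_cauchy_subseq[OF L2D(5)[OF u] L1], assumption, rule that)
 define w where "w x = lim (%i. u (s i) x)" for x
 have wm: "w : LMeas" unfolding w_def[abs_def] by (rule borel_measurable_lim_metric) (rule L2D(2)[OF u])
 have wM: "w : Meas" by (rule measurable_lebesgue_M[OF wm])
 have wp: "periodic w" unfolding periodic_def w_def by (simp add: periodicD[OF L2D(1)[OF u]])
 have wl: "AE x in M. (%i. u (s i) x) ----> w x" using s(2)
	by eventually_elim (simp add: w_def Cauchy_convergent convergent_LIMSEQ_iff[symmetric])
 have um: "u i : Meas" for i by (rule L2D(3)[OF u])
 have est: "EX n0. ALL i>=n0. Integ (%x. (u i x - w x)^2) & (\<oint>x. (u i x - w x)^2) <= e" if e: "0 < e" for e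
 proof -
	obtain n0 where n0: "ALL i>=n0. ALL k>=n0. (\<oint>x. (u i x - u k x)^2) <= e" using cauchy[OF e] by (elim exE)
	show ?thesis
	proof (intro exI[of _ n0] allI impI)
	 fix i assume i: "i >= n0"
	 have "(\<oint>+x. ennreal (abs (u i x - w x) ^ 2)) = (\<oint>+x. liminf (%k. ennreal (abs (u i x - u (s k) x) ^ 2)))"
	 proof (rule nn_integral_cong_AE, use wl in eventually_elim)
		fix x assume "(%k. u (s k) x) ----> w x"
		hence "(%k. ennreal (abs (u i x - u (s k) x) ^ 2)) ----> ennreal (abs (u i x - w x) ^ 2)"
		by (intro tendsto_ennrealI tendsto_power tendsto_rabs tendsto_diff tendsto_const)
		thus "ennreal (abs (u i x - w x) ^ 2) = liminf (%k. ennreal (abs (u i x - u (s k) x) ^ 2))"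
		by (intro lim_imp_Liminf[symmetric]) simp_all
	 qed
	 also have "... <= liminf (%k. \<integral>\<^sup>+x. ennreal (abs (u i x - u (s k) x) ^ 2) \<partial>M)"
		by (rule nn_integral_liminf) (use um in measurable)
	 also have "... <= limsup (%k. \<integral>\<^sup>+x. ennreal (abs (u i x - u (s k) x) ^ 2) \<partial>M)" by (rule Liminf_le_Limsup) simp
	 also have "... <= ennreal e"
	 proof (rule Limsup_bounded, rule eventually_sequentiallyI[of n0])
		fix k assume "n0 <= k"
		hence "n0 <= s k" using seq_suble[OF s(1), of k] by linarith
		hence "(\<oint>x. (u i x - u (s k) x)^2) <= e" using n0 i by simp
		thus "(\<oint>+x. ennreal (abs (u i x - u (s k) x) ^ 2)) <= ennreal e"
		unfolding nn_integral_abs_power2[OF L2D(4)[OF d]] by (rule ennreal_leI)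
	 qed
	 finally have fin: "(\<oint>+x. ennreal (abs (u i x - w x) ^ 2)) <= ennreal e" .
	 have dm: "(%x. u i x - w x) : Meas" using um wM by simp
	 show "Integ (%x. (u i x - w x)^2) & (\<oint>x. (u i x - w x)^2) <= e"
		using nn_square_bound[OF dm fin] e by simp
	qed
 qed
 have wL: "w : L2"
 proof -
	obtain n0 where n0: "ALL i>=n0. Integ (%x. (u i x - w x)^2) & (\<oint>x. (u i x - w x)^2) <= 1"
	 using est[OF zero_less_one] by (elim exE)
	have "(%x. u n0 x - w x) : L2"
	 unfolding L2_iff
	proof (intro conjI)
	 show "periodic (%x. u n0 x - w x)" unfolding periodic_def by (simp add: periodicD[OF wp] periodicD[OF L2D(1)[OF u]])
	 show "(%x. u n0 x - w x) : LMeas" by (rule borel_measurable_diff[OF L2D(2)[OF u] wm])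
	qed (use n0 in simp)
	from L2_diff[OF u[of n0] this] show ?thesis by simp
 qed
 show ?thesis
 proof (intro exI[of _ w] conjI wL allI impI)
	fix e :: real assume "e > 0"
	from est[OF this] obtain n0 where "ALL i>=n0. Integ (%x. (u i x - w x)^2) & (\<oint>x. (u i x - w x)^2) <= e" by (elim exE)
	thus "EX n0. ALL i>=n0. (\<oint>x. (u i x - w x)^2) <= e" by (intro exI[of _ n0]) simp
 qed
qed

lemma dirichlet_diff:
 assumes u: "u : W" and v: "v : W"
 shows "(\<oint>x. (wp k (%x. u x - v x) x)^2) = (\<oint>x. (wp k u x - wp k v x)^2)"
proof (rule integral_cong_AE)
 show "AE x in M. (wp k (%x. u x - v x) x)^2 = (wp k u x - wp k v x)^2"
	using W_diff(2)[OF u v, of k] by eventually_elim simp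
qed (use L2D(3)[OF wp_L2[OF u]] L2D(3)[OF wp_L2[OF v]] L2D(3)[OF wp_L2[OF W_diff(1)[OF u v]]] in simp_all)

lemma eventually_small_tendsto:
 fixes f :: "nat => real"
 assumes "!!e. 0 < e ==> EX n0. ALL i>=n0. f i <= e" "!!i. 0 <= f i"
 shows "f ----> 0"
proof (rule LIMSEQ_I)
 fix e :: real assume e: "0 < e"
 then obtain n0 where n0: "ALL i>=n0. f i <= e / 2" using assms(1)[of "e / 2"] by auto
 show "EX n0. ALL i>=n0. norm (f i - 0) < e"
 proof (intro exI[of _ n0] allI impI)
	fix i assume "n0 <= i"
	hence "f i <= e / 2" using n0 by simp
	thus "norm (f i - 0) < e" using assms(2)[of i] e by simp
 qed
qed

theorem W_complete:
 fixes u :: "nat => real^2 => real"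
 assumes u: "!!n. u n : W"
	and cauchy: "!!e. 0 < e ==> EX n0. ALL i>=n0. ALL k>=n0. (\<oint>x. (u i x - u k x)^2) <= e & dir (%x. u i x - u k x) <= e"
 shows "EX w:W. (%i. (\<oint>x. (u i x - w x)^2) + dir (%x. u i x - w x)) ----> 0"
proof -
 have c0: "EX n0. ALL i>=n0. ALL k>=n0. (\<oint>x. (u i x - u k x)^2) <= e" if e: "0 < e" for e
 proof -
	obtain n0 where n0: "ALL i>=n0. ALL k>=n0. (\<oint>x. (u i x - u k x)^2) <= e & dir (%x. u i x - u k x) <= e"
	 using cauchy[OF e] by (elim exE)
	show ?thesis by (intro exI[of _ n0] allI impI) (rule n0[rule_format, THEN conjunct1])
 qed
 have c1: "EX n0. ALL i>=n0. ALL j>=n0. (\<oint>x. (wp k (u i) x - wp k (u j) x)^2) <= e" if e: "0 < e" for e k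
 proof -
	obtain n0 where n0: "ALL i>=n0. ALL k>=n0. (\<oint>x. (u i x - u k x)^2) <= e & dir (%x. u i x - u k x) <= e"
	 using cauchy[OF e] by (elim exE)
	show ?thesis
	proof (intro exI[of _ n0] allI impI)
	 fix i j assume "i >= n0" "j >= n0"
	 hence d: "dir (%x. u i x - u j x) <= e" by (rule n0[rule_format, THEN conjunct2])
	 have "(\<oint>x. (wp k (%x. u i x - u j x) x)^2) <= dir (%x. u i x - u j x)"
		unfolding dir_def
		by (intro member_le_sum[of k UNIV "%k. \<integral>x. (wp k (%x. u i x - u j x) x)^2 \<partial>M"] integral_nonneg_AE) simp_all
	 thus "(\<oint>x. (wp k (u i) x - wp k (u j) x)^2) <= e" unfolding dirichlet_diff[OF u u] using d by linarith
	qed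
 qed
 have "EX w. w : L2 & (ALL e>0. EX n0. ALL i>=n0. (\<oint>x. (u i x - w x)^2) <= e)"
	by (rule L2_complete[OF W_L2[OF u] c0])
 then obtain w where w: "w : L2" "ALL e>0. EX n0. ALL i>=n0. (\<oint>x. (u i x - w x)^2) <= e"
	by (elim exE conjE)
 have "EX g. g : L2 & (ALL e>0. EX n0. ALL i>=n0. (\<oint>x. (wp k (u i) x - g x)^2) <= e)" for k
	by (rule L2_complete[of "%i. wp k (u i)", OF wp_L2[OF u] c1])
 hence "EX g. ALL k. g k : L2 & (ALL e>0. EX n0. ALL i>=n0. (\<oint>x. (wp k (u i) x - g k x)^2) <= e)"
	by (intro choice allI)
 then obtain g where g: "!!k. g k : L2" "!!k. ALL e>0. EX n0. ALL i>=n0. (\<oint>x. (wp k (u i) x - g k x)^2) <= e" by auto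
 have ul: "(%i. \<integral>x. (u i x - w x)^2 \<partial>M) ----> 0"
	by (rule eventually_small_tendsto) (rule w(2)[rule_format], assumption, rule integral_nonneg_AE, simp)
 have gl: "(%i. \<integral>x. (wp k (u i) x - g k x)^2 \<partial>M) ----> 0" for k
	by (rule eventually_small_tendsto) (rule g(2)[rule_format], assumption, rule integral_nonneg_AE, simp)
 have weak: "wkp k w (g k)" for k
 proof (rule weak_partial_limit[OF weak_partial_spec[OF u] g(1)])
	fix phi assume phi: "phi : Test"
	obtain B where B: "!!x. abs (phi x) <= B" "!!x. abs (pd k phi x) <= B"
	 "phi : Meas" "pd k phi : Meas"
	 by (rule test_bounded[OF phi, of k], rule that)
	note d1 = L2_diff[OF W_L2[OF u] w(1)] and d2 = L2_diff[OF wp_L2[OF u] g(1)]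
	show "(%m. \<integral>x. u m x * pd k phi x \<partial>M) ----> (\<oint>x. w x * pd k phi x)"
	 by (rule bounded_L1_pairing[OF B(4,4,2) _ L2D(5)[OF W_L2[OF u]] L2D(5)[OF w(1)] L1_limit_of_L2[OF L2D(3)[OF d1] L2D(4)[OF d1] ul]]) simp
	show "(%m. \<integral>x. wp k (u m) x * phi x \<partial>M) ----> (\<oint>x. g k x * phi x)"
	 by (rule bounded_L1_pairing[OF B(3,3,1) _ L2D(5)[OF wp_L2[OF u]] L2D(5)[OF g(1)] L1_limit_of_L2[OF L2D(3)[OF d2] L2D(4)[OF d2] gl]]) simp
 qed
 note wW = W_I(1)[OF w(1) weak] and wg = W_I(2)[OF w(1) weak]
 have "(\<oint>x. (wp k (%x. u i x - w x) x)^2) = (\<oint>x. (wp k (u i) x - g k x)^2)" for i k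
	unfolding dirichlet_diff[OF u wW]
 proof (rule integral_cong_AE)
	show "AE x in M. (wp k (u i) x - wp k w x)^2 = (wp k (u i) x - g k x)^2" using wg[of k] by eventually_elim simp
 qed (use L2D(3)[OF wp_L2[OF u]] L2D(3)[OF wp_L2[OF wW]] L2D(3)[OF g(1)] in simp_all)
 hence e: "dir (%x. u i x - w x) = (SUM k:UNIV. \<integral>x. (wp k (u i) x - g k x)^2 \<partial>M)" for i
	unfolding dir_def by (intro sum.cong refl)
 have "(%i. (\<oint>x. (u i x - w x)^2) + dir (%x. u i x - w x)) ----> 0 + (SUM k:(UNIV::2 set). 0)"
	unfolding e by (intro tendsto_add tendsto_sum ul gl)
 thus ?thesis using wW by (intro bexI[of _ w]) simp_all
qed


lemma zsq_le_exp:
 assumes x: "ALL j:{1..N}. u0 j x <= C0"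
 shows "zsq v x <= real N * Z0^2 * exp (2 * pos v x)"
proof -
 have "(z v j x)^2 <= Z0^2 * exp (2 * pos v x)" if j: "j : {1..N}" for j
 proof -
	have "Z0 * exp (v j x) <= Z0 * exp (pos v x)" using le_pos_part(1)[OF j, of v x] Z0_nonneg by (intro mult_left_mono) simp_all
	hence "z v j x <= Z0 * exp (pos v x)" using z_le_exp[OF x j, of v] by linarith
	from power_mono[OF this, of 2] show ?thesis using z_pos[OF j, of v x] by (simp add: power_mult_distrib exp_double[symmetric])
 qed
 hence "zsq v x <= (SUM j=1..N. Z0^2 * exp (2 * pos v x))" unfolding zsq_def by (rule sum_mono)
 thus ?thesis by simp
qed

lemma pos_part_le_size: "pos v x <= size v x"
 unfolding pos_def size_def by (intro sum_mono) simp

lemma zsq_pos_integrable: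
 assumes v: "v : V"
 shows "Integ (%x. zsq v x * pos v x)"
proof (rule growth_integrable[OF _ v, of _ 3 "real N * Z0^2"])
 show "(%x. zsq v x * pos v x) : Meas"
	using zsq_integrable[OF v] pos_part_integrable[OF v] by simp
 show "AE x in M. abs (zsq v x * pos v x) <= real N * Z0^2 * exp (3 * size v x)" using u0_all
 proof eventually_elim
	fix x assume x: "ALL j:{1..N}. u0 j x <= C0"
	have ps: "pos v x <= size v x" by (rule pos_part_le_size)
	have "zsq v x <= real N * Z0^2 * exp (2 * size v x)"
	 using ps by (intro order_trans[OF zsq_le_exp[OF x] mult_left_mono]) simp_all
	moreover have "pos v x <= exp (size v x)" using ps exp_ge_add_one_self[of "size v x"] by linarith
	ultimately have "zsq v x * pos v x <= (real N * Z0^2 * exp (2 * size v x)) * exp (size v x)"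
	 using pos_part_nonneg[of v x] by (intro mult_mono) simp_all
	also have "... = real N * Z0^2 * (exp (2 * size v x) * exp (size v x))" by (rule mult.assoc)
	also have "exp (2 * size v x) * exp (size v x) = exp (3 * size v x)" unfolding exp_add[symmetric] by simp
	finally show "abs (zsq v x * pos v x) <= real N * Z0^2 * exp (3 * size v x)"
	 using zsq_nonneg[of v x] pos_part_nonneg[of v x] by simp
 qed
qed simp

lemma exp_pos_part_bound:
 "EX C beta. 0 <= C & 0 <= beta & (ALL eps v. crit eps v --> Integ (%x. exp (3 * pos v x)) &
	(\<oint>x. exp (3 * pos v x)) <= C * exp (beta * dform v v))"
proof -
 obtain C2 where C2: "0 <= C2" "ALL eps v. crit eps v --> (\<oint>x. pos v x) <= C2" using pos_part_bound by (elim exE conjE)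
 have 3: "(0::real) <= 3" by simp
 obtain c beta where c: "0 <= c" "0 <= beta" and cb: "ALL v:V. Integ (%x. exp (3 * size v x)) &
	(ALL B. (ALL i:{1..N}. (\<oint>x. (v i x)^2) + dir (v i) <= B) --> (\<oint>x. exp (3 * size v x)) <= c * exp (beta * B))"
	using exp_size_bound[OF 3] by (elim exE conjE)
 define a where "a = exp (3 * (real N * (C2 / area)))"
 define g where "g = (poincare_const + 1) * (16 / kappa N)"
 have pc: "0 <= poincare_const" unfolding poincare_const_def by simp
 have g0: "0 <= g" unfolding g_def using pc kappa_pos[OF N] by simp
 have "Integ (%x. exp (3 * pos v x)) & (\<oint>x. exp (3 * pos v x)) <= a * c * exp (beta * g * dform v v)"
	if cr: "crit eps v" for eps v
 proof -
	note v = critD(1)[OF cr]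
	define w where "w j x = v j x - mean (v j)" for j x
	have wV: "w : V"
	proof (rule V_I)
	 fix i assume i: "i : {1..N}"
	 show "w i : W" unfolding w_def[abs_def] by (rule W_diff(1)[OF V_W[OF v i] W_const(1)])
	qed
	have wB: "ALL i:{1..N}. (\<oint>x. (w i x)^2) + dir (w i) <= g * dform v v"
	proof
	 fix i assume i: "i : {1..N}"
	 have "dir (w i) = dir (v i)" unfolding w_def[abs_def] by (rule dirichlet_shift[OF V_W[OF v i]])
	 moreover have "(\<oint>x. (w i x)^2) <= poincare_const * dir (v i)" unfolding w_def by (rule poincare[OF V_W[OF v i]])
	 moreover have "(poincare_const + 1) * dir (v i) <= (poincare_const + 1) * (16 / kappa N * dform v v)"
		using pc by (intro mult_left_mono dirichlet_form_coercive(3)[OF v i]) simp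
	 ultimately show "(\<oint>x. (w i x)^2) + dir (w i) <= g * dform v v"
		unfolding g_def mult.assoc distrib_right by simp
	qed
	have iw: "Integ (%x. exp (3 * size w x))" by (rule cb[rule_format, OF wV, THEN conjunct1])
	have bw: "(\<oint>x. exp (3 * size w x)) <= c * exp (beta * (g * dform v v))"
	 by (rule cb[rule_format, OF wV, THEN conjunct2, rule_format]) (rule wB[rule_format])
	have mj: "mean (v j) <= C2 / area" if j: "j : {1..N}" for j
	proof -
	 have "(\<oint>x. v j x) <= (\<oint>x. pos v x)"
		by (rule integral_mono[OF L2D(5)[OF V_L2(1)[OF v j]] pos_part_integrable[OF v] le_pos_part(1)[OF j]])
	 thus ?thesis unfolding mean_def using C2(2)[rule_format, OF cr] area_pos by (intro divide_right_mono) simp_all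
	qed
	have pt: "exp (3 * pos v x) <= a * exp (3 * size w x)" for x
	proof -
	 have "pos v x <= (SUM j=1..N. C2 / area + abs (w j x))"
		unfolding pos_def
	 proof (rule sum_mono)
		fix j assume j: "j : {1..N}"
		have "0 <= C2 / area" using C2(1) area_pos by simp
		thus "max 0 (v j x) <= C2 / area + abs (w j x)" using mj[OF j] unfolding w_def by linarith
	 qed
	 also have "... = real N * (C2 / area) + size w x" unfolding size_def by (simp add: sum.distrib)
	 finally have "3 * pos v x <= 3 * (real N * (C2 / area)) + 3 * size w x" by linarith
	 thus ?thesis unfolding a_def exp_add[symmetric] by (simp only: exp_le_cancel_iff)
	qed
	have i: "Integ (%x. exp (3 * pos v x))"
	proof (rule bound_integrable[OF integrable_mult_right[OF iw, of a]])
	 show "(%x. exp (3 * pos v x)) : Meas" using pos_part_integrable[OF v] by simp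
	 show "AE x in M. norm (exp (3 * pos v x)) <= norm (a * exp (3 * size w x))"
		using order_trans[OF pt abs_ge_self] by (intro AE_I2) simp
	qed
	have "(\<oint>x. exp (3 * pos v x)) <= (\<oint>x. a * exp (3 * size w x))"
	 by (rule integral_mono[OF i integrable_mult_right[OF iw] pt])
	also have "... = a * (\<oint>x. exp (3 * size w x))" by simp
	also have "... <= a * (c * exp (beta * (g * dform v v)))" unfolding a_def by (intro mult_left_mono bw) simp
	finally show ?thesis using i by (simp add: mult.assoc)
 qed
 moreover have "0 <= a * c" unfolding a_def using c(1) by simp
 ultimately show ?thesis using c(2) g0 by (intro exI[of _ "a * c"] exI[of _ "beta * g"] conjI allI impI) simp_all
qed


section \<open>Boundedness and compactness\<close>

text \<open>Where \<open>v\<close> is large, \<open>v\<^sup>+ \<le> K + e\<^bsup>v\<^sup>+ - K\<^esup>\<close> trades \<open>v\<^sup>+\<close> for a constant and an exponential tail.\<close>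

lemma zsq_pos_split:
 assumes x: "ALL j:{1..N}. u0 j x <= C0" and P: "0 <= p" "p <= 1" and big: "(EX j:{1..N}. L / 4 <= v j x) ==> 1/2 <= p"
	and L: "0 < L" and K: "0 <= K"
 shows "zsq v x * pos v x <= real N * L / 4 * zsq v x + 2 * (K * (p * zsq v x) + real N * Z0^2 * exp (- K) * exp (3 * pos v x))"
proof -
 let ?s = "zsq v x" and ?m = "pos v x"
 have s0: "0 <= ?s" and m0: "0 <= ?m" by (rule zsq_nonneg, rule pos_part_nonneg)
 have e0: "0 <= real N * Z0^2 * exp (- K) * exp (3 * ?m)" by simp
 have k0: "0 <= K * (p * ?s)" using K P s0 by simp
 have l0: "0 <= real N * L / 4 * ?s" using L s0 by simp
 show ?thesis
 proof (cases "EX j:{1..N}. L / 4 <= v j x")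
	case True
	have m: "?m <= K + exp (?m - K)" using exp_ge_add_one_self[of "?m - K"] by linarith
	have "?s * ?m <= 2 * (p * ?s * ?m)"
	proof -
	 have "1/2 * (?s * ?m) <= p * (?s * ?m)" using big[OF True] s0 m0 by (intro mult_right_mono) simp_all
	 thus ?thesis by (simp add: mult.assoc)
	qed
	also have "p * ?s * ?m <= p * ?s * (K + exp (?m - K))" using P s0 by (intro mult_left_mono m) simp
	also have "p * ?s * (K + exp (?m - K)) = K * (p * ?s) + p * (?s * exp (?m - K))" by (simp add: algebra_simps)
	also have "p * (?s * exp (?m - K)) <= real N * Z0^2 * exp (- K) * exp (3 * ?m)"
	proof -
	 have "p * (?s * exp (?m - K)) <= ?s * exp (?m - K)" using P s0 by (intro mult_left_le_one_le) simp_all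
	 also have "... <= (real N * Z0^2 * exp (2 * ?m)) * exp (?m - K)" by (intro mult_right_mono zsq_le_exp[OF x]) simp
	 also have "... = real N * Z0^2 * (exp (2 * ?m) * exp (?m - K))" by (rule mult.assoc)
	 also have "exp (2 * ?m) * exp (?m - K) = exp (- K) * exp (3 * ?m)" unfolding exp_add[symmetric] by simp
	 finally show ?thesis by (simp only: mult.assoc)
	qed
	finally show ?thesis using l0 by simp
 next
	case False
	have "?m <= (SUM j=1..N. L / 4)" unfolding pos_def
	proof (rule sum_mono)
	 fix j assume "j : {1..N}"
	 hence "v j x < L / 4" using False by (meson not_le)
	 thus "max 0 (v j x) <= L / 4" using L by simp
	qed
	hence "?m <= real N * L / 4" by simp
	hence "?s * ?m <= ?s * (real N * L / 4)" by (rule mult_left_mono[OF _ s0])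
	hence "?s * ?m <= real N * L / 4 * ?s" by (simp only: mult.commute[of ?s "real N * L / 4"])
	thus ?thesis unfolding distrib_left using e0 k0 by linarith
 qed
qed

text \<open>The tail is integrable for \<open>K\<close> proportional to the Dirichlet energy, and uniform integrability makes the factor of that energy small.\<close>

lemma nrm_bounded:
 "EX C eps2. 0 <= C & 0 < eps2 & (ALL eps v. crit eps v --> abs (E v) <= a --> eps <= eps2 --> nrm v <= C)"
proof -
 obtain C1 where C1: "0 <= C1" "ALL eps v. crit eps v --> (\<oint>x. zsq v x) <= C1" using mass_bound by (elim exE conjE)
 obtain C2 where C2: "0 <= C2" "ALL eps v. crit eps v --> (\<oint>x. pos v x) <= C2" using pos_part_bound by (elim exE conjE)
 obtain C3 where C3: "0 <= C3" "ALL eps v. crit eps v --> abs (E v) <= a -->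
	abs (dform v v + 2 / area * (\<oint>x. (SUM j=1..N. b j * v j x))) <= C3" using energy_balance[of a] by (elim exE conjE)
 obtain C5 where C5: "0 <= C5" "ALL eps v. crit eps v --> abs (E v) <= a --> nrm v <= C5 * (1 + dform v v)"
	using nrm_growth[of a] by (elim exE conjE)
 obtain CU eps1 where CU: "0 <= CU" "0 < eps1" "ALL eps v L. crit eps v --> eps <= eps1 --> 0 < L -->
	(EX P. P : Meas & (ALL x. 0 <= P x & P x <= 1) &
		(ALL x. (EX j:{1..N}. L / 4 <= v j x) --> 1/2 <= P x) & (\<oint>x. P x * zsq v x) <= CU * (1 / L + eps))"
	using uniform_integrability by (elim exE conjE)
 obtain C6 beta where C6: "0 <= C6" "0 <= beta" "ALL eps v. crit eps v --> Integ (%x. exp (3 * pos v x)) &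
	(\<oint>x. exp (3 * pos v x)) <= C6 * exp (beta * dform v v)"
	using exp_pos_part_bound by (elim exE conjE)
 define n' where "n' = real N"
 have n0: "0 <= n'" by (simp add: n'_def)
 define Y where "Y = 20 * l * n' * beta * CU"
 have Y0: "0 <= Y" unfolding Y_def using l n0 C6(2) CU(1) by simp
 define L where "L = 16 * (Y + 1)"
 have L0: "0 < L" unfolding L_def using Y0 by simp
 define eps2 where "eps2 = min eps1 (1 / (16 * (C5 + Y + 1)))"
 have e20: "0 < eps2" unfolding eps2_def using CU(2) C5(1) Y0 by simp
 define q where "q = Z0 * (2 * area + 16 * C1)"
 define S where "S = n' * L / 4 * C1 + 2 * (n' * Z0^2 * C6)"
 define A where "A = C3 / 2 + C5 + l * n' * (C2 + q) + 10 * l * n' * S"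
 have q0: "0 <= q" unfolding q_def using Z0_nonneg area_pos C1(1) by simp
 have S0: "0 <= S" unfolding S_def using n0 L0 C1(1) C6(1) by simp
 have A0: "0 <= A" unfolding A_def using C3(1) C5(1) l n0 C2(1) q0 S0 by simp
 have "nrm v <= C5 * (1 + 4 * A)" if cr: "crit eps v" and e: "abs (E v) <= a" and eps: "eps <= eps2" for eps v
 proof -
	note v = critD(1)[OF cr] and ep0 = critD(2)[OF cr] and ep1 = critD(3)[OF cr]
	define D where "D = dform v v"
	have D0: "0 <= D" unfolding D_def by (rule dirichlet_form_coercive(2)[OF v])
	have K0: "0 <= beta * D" using C6(2) D0 by simp
	have eps1: "eps <= eps1" using eps unfolding eps2_def by simp
	obtain P where P: "P : Meas" "ALL x. 0 <= P x & P x <= 1"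
	 "ALL x. (EX j:{1..N}. L / 4 <= v j x) --> 1/2 <= P x" "(\<oint>x. P x * zsq v x) <= CU * (1 / L + eps)"
	 using CU(3)[rule_format, OF cr eps1 L0] by (elim exE conjE)
	have P01: "0 <= P x" "P x <= 1" for x using P(2) by simp_all
	have Pz: "Integ (%x. P x * zsq v x)"
	 using integrable_M_mult_bounded[OF zsq_integrable[OF v] P(1), of 1] P01 by (simp add: mult.commute)
	note ei = C6(3)[rule_format, OF cr, THEN conjunct1] and eb = C6(3)[rule_format, OF cr, THEN conjunct2]
	note zi = zsq_integrable[OF v] and mi = pos_part_integrable[OF v] and zmi = zsq_pos_integrable[OF v]
	define J where "J = (\<oint>x. zsq v x * pos v x)"
	have J: "J <= S + 2 * (beta * D * (CU * (1 / L + eps)))"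
	proof -
	 have "J <= (\<oint>x. n' * L / 4 * zsq v x + 2 * (beta * D * (P x * zsq v x) + n' * Z0^2 * exp (- (beta * D)) * exp (3 * pos v x)))"
		unfolding J_def
	 proof (rule integral_mono_AE[OF zmi])
		show "Integ (%x. n' * L / 4 * zsq v x + 2 * (beta * D * (P x * zsq v x) + n' * Z0^2 * exp (- (beta * D)) * exp (3 * pos v x)))"
		by (intro add_integrable integrable_mult_right zi Pz ei)
		show "AE x in M. zsq v x * pos v x <= n' * L / 4 * zsq v x + 2 * (beta * D * (P x * zsq v x) + n' * Z0^2 * exp (- (beta * D)) * exp (3 * pos v x))"
		using u0_all unfolding n'_def
		by eventually_elim (rule zsq_pos_split[OF _ P01 _ L0 K0], assumption, rule P(3)[rule_format], assumption)
	 qed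
	 also have "... = n' * L / 4 * (\<oint>x. zsq v x) + 2 * (beta * D * (\<oint>x. P x * zsq v x) + n' * Z0^2 * exp (- (beta * D)) * (\<oint>x. exp (3 * pos v x)))"
		using zi Pz ei by simp
	 also have "... <= n' * L / 4 * C1 + 2 * (beta * D * (CU * (1 / L + eps)) + n' * Z0^2 * exp (- (beta * D)) * (C6 * exp (beta * D)))"
		using C1(2)[rule_format, OF cr] P(4) eb n0 L0 K0 unfolding D_def by (intro add_mono mult_left_mono) simp_all
	 also have "n' * Z0^2 * exp (- (beta * D)) * (C6 * exp (beta * D)) = n' * Z0^2 * C6" by (simp add: exp_minus)
	 finally show ?thesis unfolding S_def distrib_left by linarith
	qed
	define F where "F = (\<oint>x. (SUM j=1..N. force v j x * v j x))"
	note Fi = force_int(2)[OF v v]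
	have F: "- F <= n' * (C2 + 10 * J + q)"
	proof -
	 let ?g = "%x. n' * (pos v x + 10 * (zsq v x * pos v x) + Z0 * (2 + 16 * zsq v x))"
	 have gi: "Integ ?g" using zi mi zmi by simp
	 have "- F = (\<oint>x. - (SUM j=1..N. force v j x * v j x))" unfolding F_def by simp
	 also have "... <= (\<oint>x. ?g x)"
	 proof (rule integral_mono_AE[OF _ gi])
		show "Integ (%x. - (SUM j=1..N. force v j x * v j x))" using Fi by simp
		show "AE x in M. - (SUM j=1..N. force v j x * v j x) <= ?g x" using u0_all
		proof eventually_elim
		fix x assume x: "ALL j:{1..N}. u0 j x <= C0"
		have "- (SUM j=1..N. force v j x * v j x) <= (SUM j=1..N. abs (force v j x * v j x))"
		using sum_abs[of "%j. force v j x * v j x" "{1..N}"] by linarith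
		also have "... <= (SUM j=1..N. (1 + 10 * zsq v x) * pos v x + Z0 * (2 + 16 * zsq v x))"
		by (intro sum_mono force_pairing_bound[OF x])
		also have "... = ?g x" unfolding n'_def by (simp add: algebra_simps)
		finally show "- (SUM j=1..N. force v j x * v j x) <= ?g x" .
		qed
	 qed
	 also have "... = n' * ((\<oint>x. pos v x) + 10 * J + Z0 * (2 * area + 16 * (\<oint>x. zsq v x)))"
		unfolding J_def using zi mi zmi by (simp add: area_def)
	 also have "... <= n' * (C2 + 10 * J + q)"
		unfolding q_def using C2(2)[rule_format, OF cr] C1(2)[rule_format, OF cr] n0 Z0_nonneg
		by (intro mult_left_mono add_mono) simp_all
	 finally show ?thesis .
	qed
	define B where "B = (\<oint>x. (SUM j=1..N. b j * v j x))"
	have lin: "D + l * F + 1 / area * B <= eps * (C5 * (1 + D))"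
	proof -
	 have "lin v v <= eps * nrm v" using critD(4)[OF cr v] by linarith
	 also have "... <= eps * (C5 * (1 + D))" using C5(2)[rule_format, OF cr e] ep0 unfolding D_def by (intro mult_left_mono)
	 finally show ?thesis unfolding lin_def D_def F_def B_def .
	qed
	have bal: "- C3 <= D + 2 * (1 / area * B)" using C3(2)[rule_format, OF cr e] unfolding D_def B_def by simp
	have lF: "- (l * F) <= l * n' * (C2 + q) + 10 * l * n' * J"
	proof -
	 have "l * (- F) <= l * (n' * (C2 + 10 * J + q))" using l by (intro mult_left_mono F) simp
	 thus ?thesis by (simp add: algebra_simps)
	qed
	have lJ: "10 * l * n' * J <= 10 * l * n' * S + Y * D * (1 / L + eps)"
	proof -
	 have "10 * l * n' * J <= 10 * l * n' * (S + 2 * (beta * D * (CU * (1 / L + eps))))" using l n0 by (intro mult_left_mono J) simp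
	 thus ?thesis unfolding Y_def by (simp add: algebra_simps)
	qed
	have small: "Y * D * (1 / L + eps) + eps * C5 * D <= D / 8"
	proof -
	 have "Y / L <= 1 / 16" unfolding L_def using Y0 by (simp add: divide_simps)
	 moreover have "eps * (C5 + Y) <= 1 / 16"
	 proof -
		have p: "0 < C5 + Y + 1" using C5(1) Y0 by simp
		have "eps * (C5 + Y) <= eps * (C5 + Y + 1)" using ep0 by (intro mult_left_mono) simp_all
		also have "... <= 1 / (16 * (C5 + Y + 1)) * (C5 + Y + 1)" using eps p unfolding eps2_def by (intro mult_right_mono) simp_all
		also have "... = 1 / 16" using p by simp
		finally show ?thesis .
	 qed
	 ultimately have "Y / L + eps * (C5 + Y) <= 1 / 8" by linarith
	 hence "(Y / L + eps * (C5 + Y)) * D <= 1 / 8 * D" by (rule mult_right_mono[OF _ D0])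
	 thus ?thesis by (simp add: algebra_simps)
	qed
	have eC: "eps * C5 <= C5" using ep0 ep1 C5(1) by (simp add: mult_left_le_one_le)
	have lin': "D + l * F + 1 / area * B <= eps * C5 + eps * C5 * D" using lin by (simp add: algebra_simps)
	have "D / 2 <= A + D / 8" unfolding A_def using lin' bal lF lJ small eC by linarith
	hence "D <= 4 * A" using A0 by linarith
	hence "C5 * (1 + D) <= C5 * (1 + 4 * A)" using C5(1) by (intro mult_left_mono) simp_all
	thus ?thesis using C5(2)[rule_format, OF cr e] unfolding D_def by linarith
 qed
 thus ?thesis using C5(1) A0 e20 by (intro exI[of _ "C5 * (1 + 4 * A)"] exI[of _ eps2] conjI allI impI) simp_all
qed

lemma rellich_vec:
 assumes u: "!!m. u m : V" and b: "!!m. nrm (u m) <= C"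
 shows "EX s. strict_mono (s :: nat => nat) & (ALL j:{1..N}. ALL e>0. EX n0. ALL i>=n0. ALL k>=n0. (\<oint>x. (u (s i) j x - u (s k) j x)^2) <= e)"
proof -
 have nB: "(nrm (u m))^2 <= C^2" for m using power_mono[OF b nrm_nonneg[OF u]] .
 have "finite J ==> J \<subseteq> {1..N} ==> EX s. strict_mono (s :: nat => nat) &
	(ALL j:J. ALL e>0. EX n0. ALL i>=n0. ALL k>=n0. (\<oint>x. (u (s i) j x - u (s k) j x)^2) <= e)" for J
 proof (induction J rule: finite_induct)
	case empty
	show ?case by (rule exI[of _ "%i. i"]) (simp add: strict_mono_def)
 next
	case (insert j J)
	hence j: "j : {1..N}" and J: "J \<subseteq> {1..N}" by simp_all
	obtain s where s: "strict_mono (s :: nat => nat)"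
	 "ALL j:J. ALL e>0. EX n0. ALL i>=n0. ALL k>=n0. (\<oint>x. (u (s i) j x - u (s k) j x)^2) <= e"
	 using insert.IH[OF J] by (elim exE conjE)
	obtain t where t: "strict_mono (t :: nat => nat)"
	 "ALL e>0. EX n0. ALL i>=n0. ALL k>=n0. (\<oint>x. (u (s (t i)) j x - u (s (t k)) j x)^2) <= e"
	 using rellich[of "%m. u (s m) j" "C^2", OF V_W[OF u j] order_trans[OF component_bounds(2)[OF u j] nB] order_trans[OF component_bounds(3)[OF u j] nB]]
	 by (elim exE conjE)
	show ?case
	proof (intro exI[of _ "s \<circ> t"] conjI ballI allI impI)
	 show "strict_mono (s \<circ> t)" by (rule strict_mono_o[OF s(1) t(1)])
	 fix i e assume i: "i : insert j J" and e: "(0::real) < e"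
	 show "EX n0. ALL k>=n0. ALL m>=n0. (\<oint>x. (u ((s \<circ> t) k) i x - u ((s \<circ> t) m) i x)^2) <= e"
	 proof (cases "i = j")
		case True
		thus ?thesis using t(2)[rule_format, OF e] by simp
	 next
		case False
		hence "i : J" using i by simp
		then obtain n0 where n0: "ALL k>=n0. ALL m>=n0. (\<oint>x. (u (s k) i x - u (s m) i x)^2) <= e"
		using s(2)[rule_format, OF _ e] by (elim exE[OF s(2)[rule_format, OF _ e]])
		have "n0 <= t k" if "n0 <= k" for k using seq_suble[OF t(1), of k] that by linarith
		thus ?thesis using n0 by (intro exI[of _ n0] allI impI) simp
	 qed
	qed
 qed
 from this[of "{1..N}"] show ?thesis by simp
qed

lemma force_L2_bound: "EX F>=0. ALL v:V. nrm v <= C --> (ALL j:{1..N}. (\<oint>x. (force v j x)^2) <= F^2)"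
proof -
 have 4: "(0::real) <= 4" by simp
 obtain c beta where c: "0 <= c" "0 <= beta" and cb: "ALL v:V. Integ (%x. exp (4 * size v x)) &
	(ALL B. (ALL i:{1..N}. (\<oint>x. (v i x)^2) + dir (v i) <= B) --> (\<oint>x. exp (4 * size v x)) <= c * exp (beta * B))"
	using exp_size_bound[OF 4] by (elim exE conjE)
 define F where "F = sqrt (force_const^2 * (c * exp (beta * C^2)))"
 have "(\<oint>x. (force v j x)^2) <= F^2" if v: "v : V" and C: "nrm v <= C" and j: "j : {1..N}" for v j
 proof -
	have nB: "(nrm v)^2 <= C^2" using power_mono[OF C nrm_nonneg[OF v]] .
	have ie: "Integ (%x. exp (4 * size v x))" by (rule cb[rule_format, OF v, THEN conjunct1])
	have be: "(\<oint>x. exp (4 * size v x)) <= c * exp (beta * C^2)"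
	 by (rule cb[rule_format, OF v, THEN conjunct2, rule_format]) (rule order_trans[OF component_bounds(1)[OF v] nB])
	have "(\<oint>x. (force v j x)^2) <= (\<oint>x. force_const^2 * exp (4 * size v x))"
	proof (rule integral_mono_AE[OF force_L2[OF v j] integrable_mult_right[OF ie]])
	 show "AE x in M. (force v j x)^2 <= force_const^2 * exp (4 * size v x)" using u0_all
	 proof eventually_elim
		fix x assume "ALL j:{1..N}. u0 j x <= C0"
		from power_mono[OF force_le[OF this j, of v] abs_ge_zero, of 2]
		show "(force v j x)^2 <= force_const^2 * exp (4 * size v x)" by (simp add: power_mult_distrib exp_double[symmetric])
	 qed
	qed
	also have "... <= force_const^2 * (c * exp (beta * C^2))" using be by (simp add: mult_left_mono)
	also have "... = F^2" unfolding F_def using c(1) by simp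
	finally show ?thesis .
 qed
 moreover have "0 <= F" unfolding F_def using c(1) by simp
 ultimately show ?thesis by (intro exI[of _ F] conjI ballI impI)
qed

lemma dirichlet_difference:
 assumes u: "u : V" "v : V" and F: "!!j. j : {1..N} ==> (\<oint>x. (force u j x)^2) <= F^2" "!!j. j : {1..N} ==> (\<oint>x. (force v j x)^2) <= F^2" "0 <= F"
	and lu: "!!w. w : V ==> abs (lin u w) <= eps * nrm w" "!!w. w : V ==> abs (lin v w) <= eps * nrm w" "0 <= eps"
	and C: "nrm u <= C" "nrm v <= C" and d: "!!j. j : {1..N} ==> (\<oint>x. (u j x - v j x)^2) <= del'^2" "0 <= del'"
 shows "dform (%i x. u i x - v i x) (%i x. u i x - v i x) <= 4 * eps * C + 2 * l * real N * F * del'"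
proof -
 let ?w = "%i x. u i x - v i x"
 have wV: "?w : V" by (rule V_diff[OF u])
 have Df: "dform ?w ?w = dform u ?w - dform v ?w"
	using dirichlet_form_lincomb[OF wV u, of 1 "-1"] by (simp add: dirichlet_form_sym[of ?w u] dirichlet_form_sym[of ?w v])
 have lw: "abs (lin t ?w) <= 2 * eps * C" if t: "t : V" "!!w. w : V ==> abs (lin t w) <= eps * nrm w" for t
 proof -
	have "lin t ?w = lin t u - lin t v" using lin_lincomb[OF t(1) u, of 1 "-1"] by simp
	moreover have "eps * nrm u <= eps * C" "eps * nrm v <= eps * C" using C lu(3) by (simp_all add: mult_left_mono)
	ultimately show ?thesis using t(2)[OF u(1)] t(2)[OF u(2)] by linarith
 qed
 have fw: "abs (\<integral>x. (SUM j=1..N. force t j x * ?w j x) \<partial>M) <= real N * (F * del')"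
	if t: "t : V" "!!j. j : {1..N} ==> (\<oint>x. (force t j x)^2) <= F^2" for t
 proof -
	have "(\<oint>x. (SUM j=1..N. force t j x * ?w j x)) = (SUM j=1..N. \<integral>x. force t j x * ?w j x \<partial>M)"
	 by (rule sum_integral[OF force_int(1)[OF t(1) wV]])
	also have "abs (...) <= (SUM j=1..N. F * del')"
	proof (rule order_trans[OF sum_abs sum_mono])
	 fix j assume j: "j : {1..N}"
	 have "abs (\<integral>x. ?w j x * force t j x \<partial>M) <= del' * F"
		by (rule L2_pairing_bound[OF V_L2(1)[OF wV j] force_measurable[OF t(1) j] force_L2[OF t(1) j] d(1)[OF j] t(2)[OF j] d(2) F(3)])
	 thus "abs (\<integral>x. force t j x * ?w j x \<partial>M) <= F * del'" by (simp only: mult.commute)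
	qed
	finally show ?thesis by simp
 qed
 let ?Fu = "\<integral>x. (SUM j=1..N. force u j x * ?w j x) \<partial>M" and ?Fv = "\<integral>x. (SUM j=1..N. force v j x * ?w j x) \<partial>M"
 have "dform ?w ?w = lin u ?w - lin v ?w + l * (?Fv - ?Fu)"
	unfolding Df lin_def by (simp add: right_diff_distrib)
 moreover have "l * (?Fv - ?Fu) <= l * (2 * (real N * (F * del')))"
	using fw[OF u(1) F(1)] fw[OF u(2) F(2)] l by (intro mult_left_mono) simp_all
 ultimately have "dform ?w ?w <= 4 * eps * C + l * (2 * (real N * (F * del')))"
	using lw[OF u(1) lu(1)] lw[OF u(2) lu(2)] by linarith
 thus ?thesis by (simp only: mult_ac)
qed


theorem palais_smale:
 assumes v: "!!m. v m : V" and en: "(%m. E (v m)) ----> a0"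
	and dn: "(%m. dual_norm per1 per2 N (W12_derivative per1 per2 N E (v m))) ----> 0"
 shows "EX s :: nat => nat. strict_mono s & (EX w:V. (%m. nrm (%i x. v (s m) i x - w i x)) ----> 0)"
proof -
 define d where "d m = dual_norm per1 per2 N (W12_derivative per1 per2 N E (v m))" for m
 have dl: "abs (lin (v m) w) <= d m * nrm w" if "w : V" for m w unfolding d_def by (rule derivative_bound(1)[OF v that])
 have d0: "0 <= d m" for m unfolding d_def by (rule derivative_bound(2)[OF v v])
 have dsmall: "EX m0. ALL m>=m0. d m <= e" if e: "0 < e" for e
 proof -
	have "\<forall>\<^sub>F m in sequentially. d m < e" using order_tendstoD(2)[OF dn e] unfolding d_def .
	then obtain m0 where "ALL m>=m0. d m < e" unfolding eventually_sequentially by (elim exE)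
	thus ?thesis by (intro exI[of _ m0]) (simp add: less_imp_le)
 qed
 obtain a where a: "!!m. norm (E (v m)) <= a"
	using convergent_imp_Bseq[OF convergentI[OF en]] by (elim BseqE) auto
 obtain C eps2 where C: "0 <= C" "0 < eps2" "ALL eps v. crit eps v --> abs (E v) <= a --> eps <= eps2 --> nrm v <= C"
	using nrm_bounded[of a] by (elim exE conjE)
 have "0 < min eps2 1" using C(2) by simp
 from dsmall[OF this] obtain m0 where m0: "ALL m>=m0. d m <= min eps2 1" by (elim exE)
 define u where "u m = v (m + m0)" for m
 have uV: "u m : V" for m unfolding u_def by (rule v)
 have ub: "nrm (u m) <= C" for m
 proof (rule C(3)[rule_format])
	have "d (m + m0) <= min eps2 1" using m0 by simp
	thus "crit (d (m + m0)) (u m)" "d (m + m0) <= eps2" unfolding crit_def u_def using v d0 dl by simp_all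
	show "abs (E (u m)) <= a" unfolding u_def using a[of "m + m0"] by simp
 qed
 obtain F where F: "0 <= F" "ALL v:V. nrm v <= C --> (ALL j:{1..N}. (\<oint>x. (force v j x)^2) <= F^2)"
	using force_L2_bound[of C] by (elim exE conjE)
 obtain s where s: "strict_mono (s :: nat => nat)"
	"ALL j:{1..N}. ALL e>0. EX n0. ALL i>=n0. ALL k>=n0. (\<oint>x. (u (s i) j x - u (s k) j x)^2) <= e"
	using rellich_vec[of u, OF uV ub] by (elim exE conjE)
 have common: "EX n0. ALL j:{1..N}. ALL i>=n0. ALL k>=n0. (\<oint>x. (u (s i) j x - u (s k) j x)^2) <= e" if e: "0 < e" for e
 proof -
	have "ALL j:{1..N}. EX n0. ALL i>=n0. ALL k>=n0. (\<oint>x. (u (s i) j x - u (s k) j x)^2) <= e"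
	 using s(2) e by simp
	then obtain f where f: "ALL j:{1..N}. ALL i>=f j. ALL k>=f j. (\<oint>x. (u (s i) j x - u (s k) j x)^2) <= e"
	 by (elim exE[OF bchoice])
	have "f j <= (SUM j=1..N. f j)" if "j : {1..N}" for j using that by (intro member_le_sum) simp_all
	thus ?thesis using f by (intro exI[of _ "SUM j=1..N. f j"] ballI allI impI) (meson order_trans)
 qed
 have k: "0 < kappa N" by (rule kappa_pos[OF N])
 have cauchy: "EX n0. ALL i>=n0. ALL k>=n0. (\<oint>x. (u (s i) j x - u (s k) j x)^2) <= e & dir (%x. u (s i) j x - u (s k) j x) <= e"
	if j: "j : {1..N}" and e: "0 < e" for j e
 proof -
	define eps where "eps = e * kappa N / (128 * (C + 1))"
	define q where "q = l * real N * F"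
	define del' where "del' = e * kappa N / (64 * (q + 1))"
	have q0: "0 <= q" unfolding q_def using l F(1) by simp
	have eps: "0 < eps" unfolding eps_def using e k C(1) by simp
	have del': "0 < del'" unfolding del'_def using e k q0 by simp
	have cancel: "e * kappa N / (a * p) * p = e * kappa N / a" if "0 < p" for a p :: real using that by simp
	have bound: "16 / kappa N * (4 * eps * C + 2 * l * real N * F * del') <= e"
	proof -
	 have "eps * C <= eps * (C + 1)" using eps by simp
	 also have "... = e * kappa N / 128" unfolding eps_def by (rule cancel) (use C(1) in simp)
	 finally have 1: "4 * eps * C <= e * kappa N / 32" by linarith
	 have "q * del' <= (q + 1) * del'" using del' by simp
	 also have "... = e * kappa N / 64" unfolding del'_def mult.commute[of "q + 1"] by (rule cancel) (use q0 in simp)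
	 finally have 2: "2 * l * real N * F * del' <= e * kappa N / 32" unfolding q_def by linarith
	 have "16 / kappa N * (4 * eps * C + 2 * l * real N * F * del') <= 16 / kappa N * (e * kappa N / 32 + e * kappa N / 32)"
		using k by (intro mult_left_mono add_mono 1 2) simp_all
	 also have "... = e" using k by simp
	 finally show ?thesis .
	qed
	have "0 < min e (del'^2)" using e del' by simp
	from common[OF this] obtain n1 where n1: "ALL j:{1..N}. ALL i>=n1. ALL k>=n1. (\<oint>x. (u (s i) j x - u (s k) j x)^2) <= min e (del'^2)"
	 by (elim exE)
	obtain n2 where n2: "ALL m>=n2. d m <= eps" using dsmall[OF eps] by (elim exE)
	show ?thesis
	proof (intro exI[of _ "max n1 n2"] allI impI conjI)
	 fix i k' assume i: "max n1 n2 <= i" and k': "max n1 n2 <= k'"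
	 have di: "(\<oint>x. (u (s i) j x - u (s k') j x)^2) <= min e (del'^2)" if "j : {1..N}" for j
		using n1[rule_format, OF that] i k' by simp
	 show "(\<oint>x. (u (s i) j x - u (s k') j x)^2) <= e" using di[OF j] by simp
	 have small: "abs (lin (u (s t)) w) <= eps * nrm w" if t: "max n1 n2 <= t" and w: "w : V" for t w
	 proof -
		have "n2 <= s t + m0" using t seq_suble[OF s(1), of t] by simp
		hence "d (s t + m0) * nrm w <= eps * nrm w" using n2 by (intro mult_right_mono nrm_nonneg[OF w]) simp
		thus ?thesis using dl[OF w, of "s t + m0"] unfolding u_def by linarith
	 qed
	 let ?w = "%j x. u (s i) j x - u (s k') j x"
	 have "dform ?w ?w <= 4 * eps * C + 2 * l * real N * F * del'"
	 proof (rule dirichlet_difference[OF uV uV])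
		show "(\<oint>x. (u (s i) j x - u (s k') j x)^2) <= del'^2" if "j : {1..N}" for j using di[OF that] by simp
		show "(\<oint>x. (force (u (s i)) j x)^2) <= F^2" "(\<oint>x. (force (u (s k')) j x)^2) <= F^2" if "j : {1..N}" for j
		by (rule F(2)[rule_format, OF uV ub that])+
		show "abs (lin (u (s i)) w) <= eps * nrm w" "abs (lin (u (s k')) w) <= eps * nrm w" if "w : V" for w
		by (rule small[OF i that], rule small[OF k' that])
	 qed (use F(1) eps del' ub in simp_all)
	 hence "16 / kappa N * dform ?w ?w <= 16 / kappa N * (4 * eps * C + 2 * l * real N * F * del')"
		using k by (intro mult_left_mono) simp_all
	 thus "dir (%x. u (s i) j x - u (s k') j x) <= e"
		using dirichlet_form_coercive(3)[OF V_diff[OF uV uV] j, of "s i" "s k'"] bound by linarith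
	qed
 qed
 have "ALL j:{1..N}. EX w. w : W & (%i. (\<oint>x. (u (s i) j x - w x)^2) + dir (%x. u (s i) j x - w x)) ----> 0"
 proof
	fix j assume j: "j : {1..N}"
	have "EX w:W. (%i. (\<oint>x. (u (s i) j x - w x)^2) + dir (%x. u (s i) j x - w x)) ----> 0"
	 by (rule W_complete[of "%i. u (s i) j", OF V_W[OF uV j]]) (rule cauchy[OF j])
	thus "EX w. w : W & (%i. (\<oint>x. (u (s i) j x - w x)^2) + dir (%x. u (s i) j x - w x)) ----> 0"
	 unfolding Bex_def .
 qed
 then obtain w where w: "ALL j:{1..N}. w j : W & (%i. (\<oint>x. (u (s i) j x - w j x)^2) + dir (%x. u (s i) j x - w j x)) ----> 0"
	by (elim exE[OF bchoice])
 have wV: "w : V" by (rule V_I) (rule w[rule_format, THEN conjunct1])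
 have "(%m. sqrt (SUM j=1..N. (\<oint>x. (u (s m) j x - w j x)^2) + dir (%x. u (s m) j x - w j x))) ----> sqrt (SUM j=1..N. 0)"
	by (intro tendsto_real_sqrt tendsto_sum) (rule w[rule_format, THEN conjunct2])
 hence "(%m. nrm (%i x. u (s m) i x - w i x)) ----> 0"
	unfolding nrm_eq[OF V_diff[OF uV wV]] by simp
 moreover have "strict_mono (%m. s m + m0)" using s(1) by (simp add: strict_mono_def)
 ultimately show ?thesis unfolding u_def using wV by (intro exI[of _ "%m. s m + m0"] conjI bexI[of _ w])
qed

end

theorem proposition2:
  fixes \<omega>1 \<omega>2 :: "real^2" and N :: nat and l a0 :: real
    and n :: "nat \<Rightarrow> nat" and p :: "nat \<Rightarrow> nat \<Rightarrow> real^2"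
    and u0 :: "nat \<Rightarrow> real^2 \<Rightarrow> real" and v :: "nat \<Rightarrow> nat \<Rightarrow> real^2 \<Rightarrow> real"
  assumes periods: "\<omega>1 \<noteq> \<omega>2" "independent {\<omega>1, \<omega>2}"
    and N: "3 \<le> N" "N \<le> 5"
    and l: "l > 0"
    and n: "\<And>i. i \<in> {1..N} \<Longrightarrow> n i \<ge> 1"
    and p: "\<And>i s. i \<in> {1..N} \<Longrightarrow> s \<in> {1..n i} \<Longrightarrow> p i s \<in> period_cell \<omega>1 \<omega>2"
    and u0: "\<And>i. i \<in> {1..N} \<Longrightarrow> is_background \<omega>1 \<omega>2 (n i) (p i) (u0 i)"
    and v: "\<And>m. v m \<in> W12_vec \<omega>1 \<omega>2 N"
    and energy: "(\<lambda>m. energy \<omega>1 \<omega>2 N l n u0 (v m)) \<longlonglongrightarrow> a0"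
    and deriv: "(\<lambda>m. dual_norm \<omega>1 \<omega>2 N
                   (W12_derivative \<omega>1 \<omega>2 N (energy \<omega>1 \<omega>2 N l n u0) (v m))) \<longlonglongrightarrow> 0"
  shows "\<exists>r :: nat \<Rightarrow> nat. strict_mono r \<and>
           (\<exists>w \<in> W12_vec \<omega>1 \<omega>2 N.
              (\<lambda>m. W12_norm \<omega>1 \<omega>2 N (\<lambda>i x. v (r m) i x - w i x)) \<longlonglongrightarrow> 0)"
proof -
 interpret flat_torus \<omega>1 \<omega>2 by (unfold_locales) (rule periods)+
 have "ALL i:{1..N}. EX C. AE x in M. u0 i x <= C"
	by (intro ballI) (rule background_bounded_above[OF u0])
 then obtain c where c: "ALL i:{1..N}. AE x in M. u0 i x <= c i" by (elim exE[OF bchoice])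
 have "chern_simons_axioms \<omega>1 \<omega>2 N l n u0 (SUM i=1..N. abs (c i))"
 proof (unfold_locales)
	show "1 <= N" using N(1) by simp
	show "0 < l" by (rule l)
	fix i assume i: "i : {1..N}"
	show "1 <= n i" by (rule n[OF i])
	show "Integ (u0 i)" using u0[OF i] unfolding is_background_def L1_iff by simp
	have le: "c i <= (SUM i=1..N. abs (c i))"
	 using i by (intro order_trans[OF abs_ge_self member_le_sum[of i "{1..N}" "%i. abs (c i)"]]) simp_all
	show "AE x in M. u0 i x <= (SUM i=1..N. abs (c i))" using c[rule_format, OF i] by eventually_elim (rule order_trans[OF _ le])
 qed
 then interpret chern_simons \<omega>1 \<omega>2 N l n u0 "SUM i=1..N. abs (c i)" by (intro chern_simons.intro flat_torus_axioms)
 show ?thesis by (rule palais_smale[OF v energy deriv])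
qed

end
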